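(* Suppose that $\eta_0=\sum_{k\ge1}a_{2k}\tilde e_{2k}^{(o)}\in\mathcal{H}_{DW}$. Then there exists an absolute constant $\varepsilon>0$ such that if $\|\eta_0\|_{\mathcal{H}_{DW}}\le\varepsilon$, the problem $$\partial_t\eta+L\eta=\partial_\theta v\,\eta-v\,\partial_\theta\eta,\qquad \partial_\theta v=H\eta,\qquad \eta(0,\theta)=\eta_0(\theta),\qquad v(t,0)=0$$ is globally well-posed. Moreover, it holds that $$\|\eta(t)\|_{\mathcal{H}_{DW}}\lesssim e^{-\frac38t}\,\|\eta_0\|_{\mathcal{H}_{DW}}\qquad\text{for all }t\ge0.$$
   Context: $\mathbb{T}=[-\pi,\pi]$ is the torus (functions are $2\pi$-periodic). $H$ is the periodic Hilbert transform, $Hf(\theta)=\frac{1}{2\pi}\,\mathrm{P.V.}\int_{-\pi}^{\pi}\cot\frac{\theta-\phi}{2}f(\phi)\,d\phi$, so $H\sin k\theta=-\cos k\theta$ and $H\cos k\theta=\sin k\theta$ for $k\ge1$. The unknown is $\eta=\eta(t,\theta)$; the function $v$ is determined by $\eta$ through $\partial_\theta v=H\eta$ and $v(t,0)=0$, and $$L\eta=\tfrac12\sin2\theta\,\partial_\theta\eta-\cos2\theta\,\eta+\sin2\theta\,H\eta-2\cos2\theta\,v.$$ This is the equation for the perturbation $\eta=\omega+\sin2\theta$ of the steady state $-\sin 2\theta$ of the De Gregorio model $\partial_t\omega+u\,\partial_\theta\omega=\omega\,\partial_\theta u$, $\partial_\theta u=H\omega$, with $u=\frac12\sin2\theta+v$.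 For $k\ge1$, $\tilde e_k^{(o)}=\frac{\sin(k+2)\theta}{k+2}-\frac{\sin k\theta}{k}$. With $\rho=\frac{1}{4\pi\sin^2\theta}$, the space $\mathcal{H}_{DW}=\{\eta\in H^1(\mathbb{T}):\eta\text{ odd},\ \int_{\mathbb{T}}\frac{|\partial_\theta\eta|^2}{|\sin\theta|^2}\,d\theta<\infty\}$ is a Hilbert space with inner product $\langle\xi,\eta\rangle_\rho=\int_{-\pi}^{\pi}\rho\,\partial_\theta\xi\,\partial_\theta\eta\,d\theta$ and norm $\|\eta\|_{\mathcal{H}_{DW}}=\langle\eta,\eta\rangle_\rho^{1/2}$. The family $\{\tilde e_k^{(o)}\}_{k\ge1}$ is a complete orthonormal basis of $\mathcal{H}_{DW}$. The notation $A\lesssim B$ means $A\le CB$ for some positive constant $C$. *)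

theory Defs
  imports "HOL-Analysis.Analysis"
begin

text \<open>
  Functions on the torus are \<open>2\<pi>\<close>-periodic functions \<open>real \<Rightarrow> real\<close>, integrated over \<open>[-\<pi>, \<pi>]\<close>.
\<close>

definition periodic :: "(real \<Rightarrow> real) \<Rightarrow> bool" where
  "periodic f \<longleftrightarrow> (\<forall>x. f (x + 2 * pi) = f x)"

definition L2 :: "(real \<Rightarrow> real) set" where
  "L2 = {f. periodic f \<and> f \<in> borel_measurable borel \<and>
            set_integrable lborel {-pi..pi} (\<lambda>x. (f x)\<^sup>2)}"

definition L2_norm :: "(real \<Rightarrow> real) \<Rightarrow> real" where
  "L2_norm f = sqrt (LBINT x:{-pi..pi}. (f x)\<^sup>2)"

text \<open>
  The principal value removes a symmetric neighbourhood of the singularity. The period of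
  integration is centred at \<open>\<theta>\<close>, so that \<open>\<phi> = \<theta>\<close> is the only singularity also when
  \<open>\<theta>\<close> is an end point of \<open>[-\<pi>, \<pi>]\<close>; for periodic \<open>f\<close> the choice of the period is immaterial.
\<close>

definition hilbert :: "(real \<Rightarrow> real) \<Rightarrow> real \<Rightarrow> real" where
  "hilbert f \<theta> = 1 / (2 * pi) *
     Lim (at_right 0) (\<lambda>\<epsilon>. LBINT \<phi>:{\<phi> \<in> {\<theta> - pi..\<theta> + pi}. \<epsilon> \<le> \<bar>\<theta> - \<phi>\<bar>}. cot ((\<theta> - \<phi>) / 2) * f \<phi>)"

definition has_weak_deriv :: "(real \<Rightarrow> real) \<Rightarrow> (real \<Rightarrow> real) \<Rightarrow> bool" where
  "has_weak_deriv f g \<longleftrightarrow>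
     (\<forall>\<phi> \<phi>'. periodic \<phi> \<and> (\<forall>x. (\<phi> has_real_derivative \<phi>' x) (at x)) \<and> continuous_on UNIV \<phi>' \<longrightarrow>
        (LBINT x:{-pi..pi}. f x * \<phi>' x) = - (LBINT x:{-pi..pi}. g x * \<phi> x))"

text \<open>Elements of \<open>H\<^sup>1\<close> are represented by their continuous representative.\<close>

definition H1 :: "(real \<Rightarrow> real) set" where
  "H1 = {f. periodic f \<and> continuous_on UNIV f \<and> (\<exists>g\<in>L2. has_weak_deriv f g)}"

text \<open>A choice of \<open>\<partial>\<^sub>\<theta> f\<close> for \<open>f\<close> in \<open>H\<^sup>1\<close>, unique up to null sets.\<close>

definition wderiv :: "(real \<Rightarrow> real) \<Rightarrow> real \<Rightarrow> real" where
  "wderiv f = (SOME g. g \<in> L2 \<and> has_weak_deriv f g)"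

definition rho :: "real \<Rightarrow> real" where
  "rho \<theta> = 1 / (4 * pi * (sin \<theta>)\<^sup>2)"

definition HDW :: "(real \<Rightarrow> real) set" where
  "HDW = {f \<in> H1. (\<forall>x. f (- x) = - f x) \<and>
            set_integrable lborel {-pi..pi} (\<lambda>\<theta>. \<bar>wderiv f \<theta>\<bar>\<^sup>2 / \<bar>sin \<theta>\<bar>\<^sup>2)}"

definition HDW_inner :: "(real \<Rightarrow> real) \<Rightarrow> (real \<Rightarrow> real) \<Rightarrow> real" where
  "HDW_inner f g = (LBINT \<theta>:{-pi..pi}. rho \<theta> * wderiv f \<theta> * wderiv g \<theta>)"

definition HDW_norm :: "(real \<Rightarrow> real) \<Rightarrow> real" where
  "HDW_norm f = sqrt (HDW_inner f f)"

definition basis_o :: "nat \<Rightarrow> real \<Rightarrow> real" where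
  "basis_o k \<theta> = sin (real (k + 2) * \<theta>) / real (k + 2) - sin (real k * \<theta>) / real k"

text \<open>The sums \<open>\<Sum>k\<ge>1. a\<^sub>2\<^sub>k e\<^sub>2\<^sub>k\<close> that converge in the norm of \<open>HDW\<close>.\<close>

definition even_mode_data :: "(real \<Rightarrow> real) set" where
  "even_mode_data = {f \<in> HDW. \<exists>a :: nat \<Rightarrow> real.
     (\<lambda>n. HDW_norm (\<lambda>\<theta>. f \<theta> - (\<Sum>k=1..n. a (2 * k) * basis_o (2 * k) \<theta>))) \<longlonglongrightarrow> 0}"

definition vel :: "(real \<Rightarrow> real) \<Rightarrow> real \<Rightarrow> real" where
  "vel f = (THE v. v 0 = 0 \<and> (\<forall>\<theta>. (v has_real_derivative hilbert f \<theta>) (at \<theta>)))"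

definition lin_op :: "(real \<Rightarrow> real) \<Rightarrow> real \<Rightarrow> real" where
  "lin_op f \<theta> = 1 / 2 * sin (2 * \<theta>) * wderiv f \<theta> - cos (2 * \<theta>) * f \<theta>
     + sin (2 * \<theta>) * hilbert f \<theta> - 2 * cos (2 * \<theta>) * vel f \<theta>"

text \<open>
  \<open>D\<close> is the derivative at time \<open>t\<close> of the curve \<open>\<eta>\<close> with values in \<open>L2\<close>
  (one-sided at an end point of the time interval \<open>J\<close>).
\<close>

definition has_L2_time_deriv ::
    "(real \<Rightarrow> real \<Rightarrow> real) \<Rightarrow> (real \<Rightarrow> real) \<Rightarrow> real \<Rightarrow> real set \<Rightarrow> bool" where
  "has_L2_time_deriv \<eta> D t J \<longleftrightarrow> D \<in> L2 \<and>
     ((\<lambda>s. L2_norm (\<lambda>\<theta>. (\<eta> s \<theta> - \<eta> t \<theta>) / (s - t) - D \<theta>)) \<longlongrightarrow> 0) (at t within J)"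

text \<open>
  Solutions are continuous in time with values in \<open>HDW\<close> and differentiable in time with values
  in \<open>L2\<close>, where all terms of the equation lie; the equation holds at every time, as an identity
  in \<open>L2\<close>.
\<close>

definition solution_on :: "real set \<Rightarrow> (real \<Rightarrow> real) \<Rightarrow> (real \<Rightarrow> real \<Rightarrow> real) \<Rightarrow> bool" where
  "solution_on J \<eta>0 \<eta> \<longleftrightarrow>
     (\<forall>t\<in>J. \<eta> t \<in> HDW) \<and>
     (\<forall>t\<in>J. ((\<lambda>s. HDW_norm (\<lambda>\<theta>. \<eta> s \<theta> - \<eta> t \<theta>)) \<longlongrightarrow> 0) (at t within J)) \<and>
     \<eta> 0 = \<eta>0 \<and>
     (\<forall>t\<in>J. \<exists>D. has_L2_time_deriv \<eta> D t J \<and>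
        (AE \<theta> in lborel. D \<theta> + lin_op (\<eta> t) \<theta> =
           hilbert (\<eta> t) \<theta> * \<eta> t \<theta> - vel (\<eta> t) \<theta> * wderiv (\<eta> t) \<theta>))"

abbreviation global_solution :: "(real \<Rightarrow> real) \<Rightarrow> (real \<Rightarrow> real \<Rightarrow> real) \<Rightarrow> bool" where
  "global_solution \<equiv> solution_on {0..}"

text \<open>
  Global well-posedness, in the sense of Hadamard, for initial data in \<open>X\<close>: existence of a global
  solution, uniqueness (on every time interval), and continuous dependence on the data, uniformly
  on bounded time intervals.
\<close>

definition globally_well_posed :: "(real \<Rightarrow> real) set \<Rightarrow> bool" where
  "globally_well_posed X \<longleftrightarrow>
     (\<forall>\<eta>0\<in>X. \<exists>\<eta>. global_solution \<eta>0 \<eta>) \<and>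
     (\<forall>\<eta>0\<in>X. \<forall>T>0. \<forall>\<eta> \<eta>'. solution_on {0..T} \<eta>0 \<eta> \<and> solution_on {0..T} \<eta>0 \<eta>' \<longrightarrow>
        (\<forall>t\<in>{0..T}. \<eta> t = \<eta>' t)) \<and>
     (\<forall>\<eta>0\<in>X. \<forall>\<eta>. global_solution \<eta>0 \<eta> \<longrightarrow>
        (\<forall>T>0. \<forall>\<delta>>0. \<exists>r>0. \<forall>\<xi>0\<in>X. \<forall>\<xi>.
           global_solution \<xi>0 \<xi> \<and> HDW_norm (\<lambda>\<theta>. \<xi>0 \<theta> - \<eta>0 \<theta>) < r \<longrightarrow>
             (\<forall>t\<in>{0..T}. HDW_norm (\<lambda>\<theta>. \<xi> t \<theta> - \<eta> t \<theta>) < \<delta>)))"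

end

theory Submission
  imports Defs "HOL-Complex_Analysis.Great_Picard"
begin

text \<open>
  In the coordinates \<open>\<eta> = \<Sum>p. 2 a\<^sub>p e\<^sub>2\<^sub>p\<close> the norm of \<open>\<eta>\<close> in \<open>HDW\<close> is twice the \<open>\<ell>\<^sup>2\<close> norm of
  \<open>a\<close>, the linear part satisfies \<open>\<langle>a, L a\<rangle> \<ge> 3/8 \<bar>a\<bar>\<^sup>2\<close>, and the quadratic part \<open>N\<close> satisfies
  \<open>\<bar>\<Sum>p. w\<^sub>p a\<^sub>p N\<^sub>p\<bar> \<le> C \<bar>a\<bar> (\<Sum>p. w\<^sub>p a\<^sub>p\<^sup>2)\<close> with the same \<open>C\<close> for all slowly varying weights
  \<open>w\<close>. With \<open>w = 1\<close>, small Galerkin solutions are global and decay like \<open>exp (- 3/8 t)\<close>. With weights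
  that are small on low modes, their tails are controlled by the tail of the initial datum, uniformly in
  the truncation; hence a weak limit along a subsequence is a strong one, and it solves the equation
  continuously in time. Uniqueness and stability in \<open>L2\<close> come from an energy estimate without loss of
  derivatives, and the control of the tails upgrades stability to the norm of \<open>HDW\<close>.
\<close>

section \<open>The space of square integrable periodic functions\<close>

text \<open>The difference of two solutions satisfies an equation in which the velocity difference
  multiplies the derivative of one solution. In the norm of \<open>HDW\<close>, which already holds
  one derivative, this term costs a second one, so no Lipschitz estimate closes there. Compactness
  takes its place, and continuity in the strong norm is recovered by splitting: finitely many low
  modes are continuous functionals on L2, and the rest is bounded by tails inherited from the data.
  A sharp cutoff cannot measure these tails, because its commutator with transport is unbounded;
  hence weights that rise gradually. They are square roots of truncated linear functions: the root
  keeps the loss in the trilinear estimate below square-root growth, so that the smoothing of the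
  velocity still absorbs it. The gap 3/8 is read off a diagonal, because in these coordinates the
  off-diagonal entries of the linear operator are skew-symmetric. Transport is skew-symmetric too,
  up to a remainder of the size of the frequency of the velocity.\<close>

definition L2_inner :: "(real \<Rightarrow> real) \<Rightarrow> (real \<Rightarrow> real) \<Rightarrow> real" where
  "L2_inner f g = (LBINT x:{-pi..pi}. f x * g x)"

lemma L2_norm_eq: "L2_norm f = sqrt (L2_inner f f)"
  by (simp add: L2_norm_def L2_inner_def power2_eq_square)

lemma L2_inner_commute: "L2_inner f g = L2_inner g f"
  by (simp add: L2_inner_def mult.commute)

lemma L2_inner_self_nonneg: "L2_inner f f \<ge> 0"
  unfolding L2_inner_def set_lebesgue_integral_def
  by (rule integral_nonneg_AE) (auto simp: indicator_def)

lemma L2_norm_nonneg [simp]: "L2_norm f \<ge> 0"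
  by (simp add: L2_norm_eq L2_inner_self_nonneg)

lemma L2_norm_sq: "(L2_norm f)\<^sup>2 = L2_inner f f"
  by (simp add: L2_norm_eq L2_inner_self_nonneg)

lemma L2_measurable: "f \<in> L2 \<Longrightarrow> f \<in> borel_measurable borel"
  by (simp add: L2_def)

lemma L2_periodic: "f \<in> L2 \<Longrightarrow> f (x + 2 * pi) = f x"
  by (simp add: L2_def periodic_def)

lemma L2_mult_integrable:
  assumes "f \<in> L2" "g \<in> L2"
  shows "set_integrable lborel {-pi..pi} (\<lambda>x. f x * g x)"
proof -
  note [measurable] = L2_measurable[OF assms(1)] L2_measurable[OF assms(2)]
  have "set_integrable lborel {-pi..pi} (\<lambda>x. (f x)\<^sup>2 + (g x)\<^sup>2)"
    using assms by (auto simp: L2_def)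
  then show ?thesis
    unfolding set_integrable_def
  proof (rule Bochner_Integration.integrable_bound)
    show "AE x in lborel. norm (indicator {-pi..pi} x *\<^sub>R (f x * g x))
            \<le> norm (indicator {-pi..pi} x *\<^sub>R ((f x)\<^sup>2 + (g x)\<^sup>2))"
    proof (rule AE_I2)
      fix x
      have "2 * (\<bar>f x\<bar> * \<bar>g x\<bar>) \<le> (f x)\<^sup>2 + (g x)\<^sup>2"
        using zero_le_power2[of "\<bar>f x\<bar> - \<bar>g x\<bar>"] by (simp add: power2_diff)
      moreover have "0 \<le> \<bar>f x\<bar> * \<bar>g x\<bar>" by simp
      ultimately have "\<bar>f x * g x\<bar> \<le> (f x)\<^sup>2 + (g x)\<^sup>2"
        unfolding abs_mult by linarith
      then show "norm (indicator {-pi..pi} x *\<^sub>R (f x * g x))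
            \<le> norm (indicator {-pi..pi} x *\<^sub>R ((f x)\<^sup>2 + (g x)\<^sup>2))"
        by (auto simp: indicator_def)
    qed
  qed measurable
qed

lemma L2_continuous:
  assumes "continuous_on UNIV f" "\<And>x. f (x + 2 * pi) = f x"
  shows "f \<in> L2"
proof -
  have "continuous_on {-pi..pi} (\<lambda>x. (f x)\<^sup>2)"
    using assms(1) by (intro continuous_on_power) (rule continuous_on_subset, auto)
  then have "set_integrable lborel {-pi..pi} (\<lambda>x. (f x)\<^sup>2)"
    by (rule borel_integrable_atLeastAtMost')
  with assms show ?thesis
    by (auto simp: L2_def periodic_def borel_measurable_continuous_onI)
qed

lemma L2_zero [simp]: "(\<lambda>x. 0) \<in> L2"
  by (rule L2_continuous) auto

lemma L2_const [simp]: "(\<lambda>x. c) \<in> L2"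
  by (rule L2_continuous) auto

lemma L2_integrable: "f \<in> L2 \<Longrightarrow> set_integrable lborel {-pi..pi} f"
  using L2_mult_integrable[of f "\<lambda>x. 1"] by simp

lemma L2_scale [intro]:
  assumes "f \<in> L2" shows "(\<lambda>x. c * f x) \<in> L2"
  using assms by (auto simp: L2_def periodic_def power_mult_distrib)

lemma L2_uminus [intro]: "f \<in> L2 \<Longrightarrow> (\<lambda>x. - f x) \<in> L2"
  using L2_scale[of f "-1"] by simp

lemma L2_add [intro]:
  assumes "f \<in> L2" "g \<in> L2" shows "(\<lambda>x. f x + g x) \<in> L2"
proof -
  have "set_integrable lborel {-pi..pi} (\<lambda>x. ((f x)\<^sup>2 + (g x)\<^sup>2) + 2 * (f x * g x))"
    using assms L2_mult_integrable[OF assms] by (intro set_integral_add) (auto simp: L2_def)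
  then have "set_integrable lborel {-pi..pi} (\<lambda>x. (f x + g x)\<^sup>2)"
    by (simp add: power2_sum algebra_simps)
  with assms show ?thesis by (auto simp: L2_def periodic_def)
qed

lemma L2_diff [intro]: "f \<in> L2 \<Longrightarrow> g \<in> L2 \<Longrightarrow> (\<lambda>x. f x - g x) \<in> L2"
  using L2_add[OF _ L2_uminus, of f g] by simp

lemma L2_sum [intro]: "(\<And>i. i \<in> I \<Longrightarrow> u i \<in> L2) \<Longrightarrow> (\<lambda>x. \<Sum>i\<in>I. u i x) \<in> L2"
  by (induction I rule: infinite_finite_induct) auto

lemma L2_mult_bounded:
  assumes "f \<in> L2" "p \<in> borel_measurable borel" "\<And>x. p (x + 2 * pi) = p x" "\<And>x. \<bar>p x\<bar> \<le> B"
  shows "(\<lambda>x. p x * f x) \<in> L2"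
proof -
  note [measurable] = L2_measurable[OF assms(1)] assms(2)
  have "set_integrable lborel {-pi..pi} (\<lambda>x. B\<^sup>2 * (f x)\<^sup>2)"
    using assms(1) by (auto simp: L2_def)
  then have "set_integrable lborel {-pi..pi} (\<lambda>x. (p x * f x)\<^sup>2)"
    unfolding set_integrable_def
  proof (rule Bochner_Integration.integrable_bound)
    have "(p x)\<^sup>2 \<le> B\<^sup>2" for x
      using assms(4)[of x] by (simp add: abs_le_square_iff[symmetric])
    then show "AE x in lborel. norm (indicator {-pi..pi} x *\<^sub>R (p x * f x)\<^sup>2)
            \<le> norm (indicator {-pi..pi} x *\<^sub>R (B\<^sup>2 * (f x)\<^sup>2))"
      by (intro AE_I2) (auto simp: indicator_def power_mult_distrib mult_right_mono)
  qed measurable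
  then show ?thesis using assms by (auto simp: L2_def periodic_def)
qed

lemma L2_inner_add_left:
  "f \<in> L2 \<Longrightarrow> g \<in> L2 \<Longrightarrow> h \<in> L2 \<Longrightarrow> L2_inner (\<lambda>x. f x + g x) h = L2_inner f h + L2_inner g h"
  unfolding L2_inner_def by (simp add: distrib_right L2_mult_integrable)

lemma L2_inner_scale_left: "L2_inner (\<lambda>x. c * f x) h = c * L2_inner f h"
  unfolding L2_inner_def by (simp add: mult.assoc)

lemma L2_inner_diff_left:
  "f \<in> L2 \<Longrightarrow> g \<in> L2 \<Longrightarrow> h \<in> L2 \<Longrightarrow> L2_inner (\<lambda>x. f x - g x) h = L2_inner f h - L2_inner g h"
  unfolding L2_inner_def by (simp add: left_diff_distrib L2_mult_integrable)

lemma L2_inner_add_right: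
  "f \<in> L2 \<Longrightarrow> g \<in> L2 \<Longrightarrow> h \<in> L2 \<Longrightarrow> L2_inner h (\<lambda>x. f x + g x) = L2_inner h f + L2_inner h g"
  using L2_inner_add_left by (metis L2_inner_commute)

lemma L2_inner_scale_right: "L2_inner h (\<lambda>x. c * f x) = c * L2_inner h f"
  by (metis L2_inner_commute L2_inner_scale_left)

lemma L2_inner_diff_right:
  "f \<in> L2 \<Longrightarrow> g \<in> L2 \<Longrightarrow> h \<in> L2 \<Longrightarrow> L2_inner h (\<lambda>x. f x - g x) = L2_inner h f - L2_inner h g"
  using L2_inner_diff_left by (metis L2_inner_commute)

lemma L2_inner_zero_left [simp]: "L2_inner (\<lambda>x. 0) h = 0"
  by (simp add: L2_inner_def)

lemma L2_inner_sum_left: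
  assumes "\<And>i. i \<in> I \<Longrightarrow> u i \<in> L2" "h \<in> L2"
  shows "L2_inner (\<lambda>x. \<Sum>i\<in>I. u i x) h = (\<Sum>i\<in>I. L2_inner (u i) h)"
  using assms by (induction I rule: infinite_finite_induct) (simp_all add: L2_inner_add_left L2_sum)

lemma L2_inner_sum_right:
  assumes "\<And>i. i \<in> I \<Longrightarrow> u i \<in> L2" "h \<in> L2"
  shows "L2_inner h (\<lambda>x. \<Sum>i\<in>I. u i x) = (\<Sum>i\<in>I. L2_inner h (u i))"
  using L2_inner_sum_left[of I u h] assms by (simp add: L2_inner_commute)

lemma L2_cauchy_schwarz:
  assumes "f \<in> L2" "g \<in> L2"
  shows "\<bar>L2_inner f g\<bar> \<le> L2_norm f * L2_norm g"
proof -
  define a b c where "a = L2_inner f f" and "b = L2_inner f g" and "c = L2_inner g g"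
  have ac: "a \<ge> 0" "c \<ge> 0" by (simp_all add: a_def c_def L2_inner_self_nonneg)
  have q: "a + 2 * t * b + t\<^sup>2 * c \<ge> 0" for t
  proof -
    have "0 \<le> L2_inner (\<lambda>x. f x + t * g x) (\<lambda>x. f x + t * g x)"
      by (rule L2_inner_self_nonneg)
    also have "\<dots> = a + 2 * t * b + t\<^sup>2 * c"
      using assms by (simp add: L2_inner_add_left L2_inner_add_right L2_inner_scale_left
        L2_inner_scale_right L2_scale L2_add a_def b_def c_def L2_inner_commute[of g f]
        algebra_simps power2_eq_square)
    finally show ?thesis .
  qed
  have "b\<^sup>2 \<le> a * c"
  proof (cases "c = 0")
    case True
    \<comment> \<open>The equation \<open>c = 0\<close> makes \<open>g\<close> vanish only almost
      everywhere. The form is then affine in \<open>t\<close>, and the \<open>t\<close> chosen below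
      would give it the value -1.\<close>
    have "b = 0"
    proof (rule ccontr)
      assume "b \<noteq> 0"
      then show False using q[of "- (a + 1) / (2 * b)"] True by (simp add: field_simps)
    qed
    then show ?thesis using True by simp
  next
    case False
    then have "c > 0" using ac by simp
    then show ?thesis
      using q[of "- b / c"] by (simp add: power2_eq_square field_simps)
  qed
  then have "\<bar>b\<bar> \<le> sqrt (a * c)"
    using real_le_rsqrt by (metis power2_abs)
  then show ?thesis by (simp add: L2_norm_eq a_def b_def c_def real_sqrt_mult)
qed

lemma L2_norm_triangle:
  assumes "f \<in> L2" "g \<in> L2"
  shows "L2_norm (\<lambda>x. f x + g x) \<le> L2_norm f + L2_norm g"
proof (rule power2_le_imp_le)
  have "(L2_norm (\<lambda>x. f x + g x))\<^sup>2 = (L2_norm f)\<^sup>2 + 2 * L2_inner f g + (L2_norm g)\<^sup>2"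
    using assms by (simp add: L2_norm_sq L2_inner_add_left L2_inner_add_right L2_add
        L2_inner_commute[of g f])
  also have "\<dots> \<le> (L2_norm f + L2_norm g)\<^sup>2"
    using L2_cauchy_schwarz[OF assms] by (simp add: power2_sum)
  finally show "(L2_norm (\<lambda>x. f x + g x))\<^sup>2 \<le> (L2_norm f + L2_norm g)\<^sup>2" .
qed simp

lemma L2_norm_scale: "L2_norm (\<lambda>x. c * f x) = \<bar>c\<bar> * L2_norm f"
  by (simp add: L2_norm_eq L2_inner_scale_left L2_inner_scale_right real_sqrt_mult
      mult.assoc[symmetric])

lemma L2_norm_uminus [simp]: "L2_norm (\<lambda>x. - f x) = L2_norm f"
  using L2_norm_scale[of "-1" f] by simp

lemma L2_norm_minus_commute: "L2_norm (\<lambda>x. f x - g x) = L2_norm (\<lambda>x. g x - f x)"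
  using L2_norm_uminus[of "\<lambda>x. f x - g x"] by simp

lemma L2_norm_diff_triangle:
  assumes "f \<in> L2" "g \<in> L2"
  shows "L2_norm (\<lambda>x. f x - g x) \<le> L2_norm f + L2_norm g"
  using L2_norm_triangle[OF assms(1) L2_uminus[OF assms(2)]] by simp

lemma L2_norm_triangle3:
  assumes "f \<in> L2" "g \<in> L2" "h \<in> L2"
  shows "L2_norm (\<lambda>x. f x - h x) \<le> L2_norm (\<lambda>x. f x - g x) + L2_norm (\<lambda>x. g x - h x)"
  using L2_norm_triangle[of "\<lambda>x. f x - g x" "\<lambda>x. g x - h x"] assms by (simp add: L2_diff)

lemma L2_norm_reverse_triangle:
  assumes "f \<in> L2" "g \<in> L2"
  shows "\<bar>L2_norm f - L2_norm g\<bar> \<le> L2_norm (\<lambda>x. f x - g x)"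
  using L2_norm_triangle3[of f g "\<lambda>x. 0"] L2_norm_triangle3[of g f "\<lambda>x. 0"] assms
    L2_norm_minus_commute[of f g] by (simp add: abs_le_iff)

lemma L2_norm_AE_cong:
  assumes "AE x in lborel. x \<in> {-pi..pi} \<longrightarrow> f x = g x" "f \<in> L2" "g \<in> L2"
  shows "L2_norm f = L2_norm g"
proof -
  note [measurable] = L2_measurable[OF assms(2)] L2_measurable[OF assms(3)]
  show ?thesis unfolding L2_norm_def set_lebesgue_integral_def
    using assms(1) by (intro arg_cong[where f = sqrt] integral_cong_AE) (auto simp: indicator_def)
qed

lemma L2_inner_AE_cong:
  assumes "AE x in lborel. x \<in> {-pi..pi} \<longrightarrow> f x = g x" "f \<in> L2" "g \<in> L2" "h \<in> L2"
  shows "L2_inner f h = L2_inner g h"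
proof -
  note [measurable] = L2_measurable[OF assms(2)] L2_measurable[OF assms(3)] L2_measurable[OF assms(4)]
  show ?thesis unfolding L2_inner_def set_lebesgue_integral_def
    using assms(1) by (intro integral_cong_AE) (auto simp: indicator_def)
qed

lemma L2_norm_zero_AE:
  assumes "f \<in> L2" "L2_norm f = 0"
  shows "AE x in lborel. x \<in> {-pi..pi} \<longrightarrow> f x = 0"
proof -
  have "L2_inner f f = 0" using assms(2) by (metis L2_norm_sq power_zero_numeral)
  then have "integral\<^sup>L lborel (\<lambda>x. indicator {-pi..pi} x *\<^sub>R (f x * f x)) = 0"
    by (simp add: L2_inner_def set_lebesgue_integral_def)
  moreover have "integrable lborel (\<lambda>x. indicator {-pi..pi} x *\<^sub>R (f x * f x))"
    using L2_mult_integrable[OF assms(1) assms(1)] by (simp add: set_integrable_def)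
  ultimately have "AE x in lborel. indicator {-pi..pi} x *\<^sub>R (f x * f x) = 0"
    by (subst (asm) integral_nonneg_eq_0_iff_AE) (auto simp: indicator_def)
  then show ?thesis by eventually_elim (auto simp: indicator_def split: if_splits)
qed

lemma L2_norm_mult_bounded:
  assumes "f \<in> L2" "p \<in> borel_measurable borel" "\<And>x. p (x + 2 * pi) = p x" "\<And>x. \<bar>p x\<bar> \<le> B"
  shows "L2_norm (\<lambda>x. p x * f x) \<le> B * L2_norm f"
proof (rule power2_le_imp_le)
  have B: "B \<ge> 0" using assms(4)[of 0] by simp
  have pf: "(\<lambda>x. p x * f x) \<in> L2" by (rule L2_mult_bounded[OF assms])
  have "(p x * f x)\<^sup>2 \<le> B\<^sup>2 * (f x)\<^sup>2" for x
    using assms(4)[of x] by (simp add: power_mult_distrib mult_right_mono abs_le_square_iff[symmetric])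
  then have "L2_inner (\<lambda>x. p x * f x) (\<lambda>x. p x * f x) \<le> (LBINT x:{-pi..pi}. B\<^sup>2 * (f x)\<^sup>2)"
    unfolding L2_inner_def
    using L2_mult_integrable[OF pf pf] L2_mult_integrable[OF assms(1) assms(1)]
    by (intro set_integral_mono) (auto simp: power2_eq_square)
  also have "\<dots> = (B * L2_norm f)\<^sup>2"
    by (simp add: power_mult_distrib L2_norm_sq) (simp add: L2_inner_def power2_eq_square)
  finally show "(L2_norm (\<lambda>x. p x * f x))\<^sup>2 \<le> (B * L2_norm f)\<^sup>2"
    by (simp add: L2_norm_sq)
  show "0 \<le> B * L2_norm f" using B by simp
qed

lemma L2_norm_bounded:
  assumes "f \<in> L2" "\<And>x. \<bar>f x\<bar> \<le> B"
  shows "L2_norm f \<le> sqrt (2 * pi) * B"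
proof -
  have "L2_norm (\<lambda>x. f x * 1) \<le> B * L2_norm (\<lambda>x. 1)"
    using assms L2_periodic[OF assms(1)] L2_measurable[OF assms(1)]
    by (intro L2_norm_mult_bounded) auto
  moreover have "L2_norm (\<lambda>x. 1) = sqrt (2 * pi)"
    by (simp add: L2_norm_def set_lebesgue_integral_def)
  ultimately show ?thesis by (simp add: mult.commute)
qed

lemma L1_le_L2:
  assumes "f \<in> L2"
  shows "(LBINT x:{-pi..pi}. \<bar>f x\<bar>) \<le> sqrt (2 * pi) * L2_norm f"
proof -
  have 1: "(\<lambda>x. \<bar>f x\<bar>) \<in> L2" using assms by (auto simp: L2_def periodic_def)
  have "\<bar>L2_inner (\<lambda>x. \<bar>f x\<bar>) (\<lambda>x. 1)\<bar> \<le> L2_norm (\<lambda>x. \<bar>f x\<bar>) * L2_norm (\<lambda>x. 1)"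
    by (rule L2_cauchy_schwarz[OF 1]) simp
  moreover have "L2_norm (\<lambda>x. \<bar>f x\<bar>) = L2_norm f" by (simp add: L2_norm_def)
  moreover have "L2_norm (\<lambda>x. 1) = sqrt (2 * pi)"
    by (simp add: L2_norm_def set_lebesgue_integral_def)
  ultimately show ?thesis by (simp add: L2_inner_def mult.commute)
qed

section \<open>Completeness of the trigonometric system\<close>

lemma integral_cos_int:
  assumes "k \<in> \<int>"
  shows "(LBINT x:{-pi..pi}. cos (k * x)) = (if k = 0 then 2 * pi else 0)"
proof (cases "k = 0")
  case True
  then show ?thesis by (simp add: set_lebesgue_integral_def)
next
  case False
  have "sin (k * pi) = 0" using assms by (simp add: sin_times_pi_eq_0)
  moreover have "(LBINT x:{-pi..pi}. cos (k * x)) = sin (k * pi) / k - sin (k * (- pi)) / k"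
    unfolding set_lebesgue_integral_def using False
    by (intro integral_FTC_atLeastAtMost)
       (auto intro!: derivative_eq_intros continuous_intros
             simp: has_real_derivative_iff_has_vector_derivative[symmetric])
  ultimately show ?thesis using False by simp
qed

lemma sin_periodic_int: "k \<in> \<int> \<Longrightarrow> sin (k * (x + 2 * pi)) = sin (k * x)"
  using sin_integer_2pi[of k] cos_integer_2pi[of k] by (simp add: distrib_left sin_add mult.commute)

lemma cos_periodic_int: "k \<in> \<int> \<Longrightarrow> cos (k * (x + 2 * pi)) = cos (k * x)"
  using sin_integer_2pi[of k] cos_integer_2pi[of k] by (simp add: distrib_left cos_add mult.commute)

lemma sin_in_L2 [simp]: "k \<in> \<int> \<Longrightarrow> (\<lambda>x. sin (k * x)) \<in> L2"
  by (intro L2_continuous continuous_intros sin_periodic_int)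

lemma cos_in_L2 [simp]: "k \<in> \<int> \<Longrightarrow> (\<lambda>x. cos (k * x)) \<in> L2"
  by (intro L2_continuous continuous_intros cos_periodic_int)

lemma set_integrable_sin_cos [simp]:
  "set_integrable lborel {-pi..pi} (\<lambda>x. sin (k * x))"
  "set_integrable lborel {-pi..pi} (\<lambda>x. cos (k * x))"
  by (intro borel_integrable_atLeastAtMost' continuous_intros)+

lemma L2_inner_sin_sin:
  "L2_inner (\<lambda>x. sin (real m * x)) (\<lambda>x. sin (real n * x)) = (if m = n \<and> m > 0 then pi else 0)"
proof -
  have "L2_inner (\<lambda>x. sin (real m * x)) (\<lambda>x. sin (real n * x))
      = (LBINT x:{-pi..pi}. (1/2) * cos ((real m - real n) * x) - (1/2) * cos ((real m + real n) * x))"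
    by (simp add: L2_inner_def sin_times_sin left_diff_distrib distrib_right diff_divide_distrib)
  also have "\<dots> = (1/2) * (LBINT x:{-pi..pi}. cos ((real m - real n) * x))
      - (1/2) * (LBINT x:{-pi..pi}. cos ((real m + real n) * x))"
    by (subst set_integral_diff) auto
  finally show ?thesis by (auto simp: integral_cos_int)
qed

lemma L2_inner_cos_cos:
  "L2_inner (\<lambda>x. cos (real m * x)) (\<lambda>x. cos (real n * x)) =
     (if m = n then if m = 0 then 2 * pi else pi else 0)"
proof -
  have "L2_inner (\<lambda>x. cos (real m * x)) (\<lambda>x. cos (real n * x))
      = (LBINT x:{-pi..pi}. (1/2) * cos ((real m - real n) * x) + (1/2) * cos ((real m + real n) * x))"
    by (simp add: L2_inner_def cos_times_cos left_diff_distrib distrib_right add_divide_distrib)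
  also have "\<dots> = (1/2) * (LBINT x:{-pi..pi}. cos ((real m - real n) * x))
      + (1/2) * (LBINT x:{-pi..pi}. cos ((real m + real n) * x))"
    by (subst set_integral_add) auto
  finally show ?thesis by (auto simp: integral_cos_int)
qed

text \<open>Integer frequencies, instead of natural ones, spare the product formulas a case
  distinction on the sign of \<open>k - l\<close>.\<close>

inductive trig_poly :: "(real \<Rightarrow> real) \<Rightarrow> bool" where
  cos: "k \<in> \<int> \<Longrightarrow> trig_poly (\<lambda>x. cos (k * x))"
| sin: "k \<in> \<int> \<Longrightarrow> trig_poly (\<lambda>x. sin (k * x))"
| scale: "trig_poly f \<Longrightarrow> trig_poly (\<lambda>x. c * f x)"
| add: "trig_poly f \<Longrightarrow> trig_poly g \<Longrightarrow> trig_poly (\<lambda>x. f x + g x)"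

lemma trig_poly_mult_cos:
  assumes "trig_poly f" "k \<in> \<int>"
  shows "trig_poly (\<lambda>x. cos (k * x) * f x)"
  using assms(1)
proof induction
  case (cos l)
  have "trig_poly (\<lambda>x. (1/2) * cos ((k - l) * x) + (1/2) * cos ((k + l) * x))"
    using cos assms(2) by (intro trig_poly.intros) auto
  then show ?case by (simp add: cos_times_cos left_diff_distrib distrib_right add_divide_distrib)
next
  case (sin l)
  have "trig_poly (\<lambda>x. (1/2) * sin ((k + l) * x) + (- 1/2) * sin ((k - l) * x))"
    using sin assms(2) by (intro trig_poly.intros) auto
  then show ?case by (simp add: cos_times_sin left_diff_distrib distrib_right diff_divide_distrib)
next
  case (scale f c)
  then have "trig_poly (\<lambda>x. c * (cos (k * x) * f x))" by (intro trig_poly.scale)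
  then show ?case by (simp add: mult.left_commute)
next
  case (add f g)
  then have "trig_poly (\<lambda>x. cos (k * x) * f x + cos (k * x) * g x)" by (intro trig_poly.add)
  then show ?case by (simp add: distrib_left)
qed

lemma trig_poly_mult_sin:
  assumes "trig_poly f" "k \<in> \<int>"
  shows "trig_poly (\<lambda>x. sin (k * x) * f x)"
  using assms(1)
proof induction
  case (cos l)
  have "trig_poly (\<lambda>x. (1/2) * sin ((k + l) * x) + (1/2) * sin ((k - l) * x))"
    using cos assms(2) by (intro trig_poly.intros) auto
  then show ?case by (simp add: sin_times_cos left_diff_distrib distrib_right add_divide_distrib)
next
  case (sin l)
  have "trig_poly (\<lambda>x. (1/2) * cos ((k - l) * x) + (- 1/2) * cos ((k + l) * x))"
    using sin assms(2) by (intro trig_poly.intros) auto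
  then show ?case by (simp add: sin_times_sin left_diff_distrib distrib_right diff_divide_distrib)
next
  case (scale f c)
  then have "trig_poly (\<lambda>x. c * (sin (k * x) * f x))" by (intro trig_poly.scale)
  then show ?case by (simp add: mult.left_commute)
next
  case (add f g)
  then have "trig_poly (\<lambda>x. sin (k * x) * f x + sin (k * x) * g x)" by (intro trig_poly.add)
  then show ?case by (simp add: distrib_left)
qed

lemma trig_poly_mult:
  assumes "trig_poly g" "trig_poly f"
  shows "trig_poly (\<lambda>x. g x * f x)"
  using assms(1)
proof induction
  case (scale g c)
  then have "trig_poly (\<lambda>x. c * (g x * f x))" by (intro trig_poly.scale)
  then show ?case by (simp add: mult.assoc)
next
  case (add g h)
  then have "trig_poly (\<lambda>x. g x * f x + h x * f x)" by (intro trig_poly.add)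
  then show ?case by (simp add: distrib_right)
qed (use assms(2) trig_poly_mult_cos trig_poly_mult_sin in auto)

lemma trig_poly_polynomial_cis:
  assumes "real_polynomial_function g"
  shows "trig_poly (\<lambda>x. g (cis x))"
  using assms
proof induction
  case (linear f)
  then interpret bounded_linear f .
  have "f (cis x) = f 1 * cos (1 * x) + f \<i> * sin (1 * x)" for x
  proof -
    have "cis x = cos x *\<^sub>R 1 + sin x *\<^sub>R \<i>" by (simp add: complex_eq_iff)
    then show ?thesis by (simp add: add scale mult.commute)
  qed
  then show ?case
    by (simp only:) (intro trig_poly.intros Ints_1)
next
  case (const c)
  have "trig_poly (\<lambda>x. c * cos (0 * x))" by (intro trig_poly.intros Ints_0)
  then show ?case by simp
qed (auto intro: trig_poly.add trig_poly_mult)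

lemma trig_poly_L2: "trig_poly p \<Longrightarrow> p \<in> L2"
  by (induction rule: trig_poly.induct) (auto intro: sin_in_L2 cos_in_L2)

lemma trig_poly_orthogonal:
  assumes "trig_poly p" "h \<in> L2"
    and "\<And>m::nat. L2_inner h (\<lambda>x. cos (real m * x)) = 0"
    and "\<And>m::nat. L2_inner h (\<lambda>x. sin (real m * x)) = 0"
  shows "L2_inner h p = 0"
  using assms(1)
proof induction
  case (cos k)
  then obtain n :: int where n: "k = of_int n" by (auto elim: Ints_cases)
  have "(\<lambda>x. cos (k * x)) = (\<lambda>x. cos (real (nat \<bar>n\<bar>) * x))"
    using n by (auto simp: abs_if)
  then show ?case using assms(3)[of "nat \<bar>n\<bar>"] by simp
next
  case (sin k)
  then obtain n :: int where n: "k = of_int n" by (auto elim: Ints_cases)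
  have "(\<lambda>x. sin (k * x)) = (\<lambda>x. (if n < 0 then -1 else 1) * sin (real (nat \<bar>n\<bar>) * x))"
    using n by (auto simp: abs_if)
  then show ?case using assms(4)[of "nat \<bar>n\<bar>"] by (simp only: L2_inner_scale_right)
qed (use assms(2) in \<open>simp_all add: L2_inner_scale_right L2_inner_add_right trig_poly_L2\<close>)

lemma abs_le_mult_eps_zero:
  fixes x c :: real
  assumes "\<And>e. e > 0 \<Longrightarrow> \<bar>x\<bar> \<le> e * c" "c \<ge> 0"
  shows "x = 0"
proof (rule ccontr)
  assume "x \<noteq> 0"
  then have "\<bar>x\<bar> \<le> \<bar>x\<bar> / (2 * (c + 1)) * c" using assms by (intro assms(1)) auto
  then have "\<bar>x\<bar> * (c + 2) \<le> 0" using assms(2) by (simp add: field_simps)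
  moreover have "\<bar>x\<bar> * (c + 2) > 0" using \<open>x \<noteq> 0\<close> assms(2) by (intro mult_pos_pos) auto
  ultimately show False by simp
qed

text \<open>On the unit circle \<open>F\<close> is a uniform limit of real polynomials
  (Stone-Weierstrass), which restrict to trigonometric polynomials. Uniform approximation over one
  period is enough to pass to the limit against \<open>h\<close>.\<close>

lemma circle_function_orthogonal:
  fixes F :: "complex \<Rightarrow> real"
  assumes h: "h \<in> L2" "\<And>m::nat. L2_inner h (\<lambda>x. cos (real m * x)) = 0"
     "\<And>m::nat. L2_inner h (\<lambda>x. sin (real m * x)) = 0"
    and F: "continuous_on UNIV F"
  shows "L2_inner h (\<lambda>x. F (cis x)) = 0"
proof -
  have FL: "(\<lambda>x. F (cis x)) \<in> L2"
    by (intro L2_continuous continuous_on_compose2[OF F] continuous_intros)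
       (auto simp: cis_mult[symmetric])
  have "\<bar>L2_inner h (\<lambda>x. F (cis x))\<bar> \<le> e * (L2_norm h * sqrt (2 * pi))" if e: "e > 0" for e
  proof -
    obtain g where g: "real_polynomial_function g" "\<And>z. z \<in> sphere 0 1 \<Longrightarrow> \<bar>F z - g z\<bar> < e"
      using Stone_Weierstrass_real_polynomial_function[of "sphere (0::complex) 1" F e] e
        continuous_on_subset[OF F] by (metis compact_sphere subset_UNIV)
    have p: "trig_poly (\<lambda>x. g (cis x))" using g(1) by (rule trig_poly_polynomial_cis)
    have d: "(\<lambda>x. F (cis x) - g (cis x)) \<in> L2" using FL trig_poly_L2[OF p] by auto
    have "L2_inner h (\<lambda>x. F (cis x)) = L2_inner h (\<lambda>x. F (cis x) - g (cis x))"
      using trig_poly_orthogonal[OF p h] FL trig_poly_L2[OF p] h(1) by (simp add: L2_inner_diff_right)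
    also have "\<bar>\<dots>\<bar> \<le> L2_norm h * L2_norm (\<lambda>x. F (cis x) - g (cis x))"
      by (rule L2_cauchy_schwarz[OF h(1) d])
    also have "\<dots> \<le> L2_norm h * (sqrt (2 * pi) * e)"
      using g(2)[of "cis _"] by (intro mult_left_mono L2_norm_bounded[OF d]) (auto intro: less_imp_le)
    finally show ?thesis by (simp add: mult_ac)
  qed
  then show ?thesis by (rule abs_le_mult_eps_zero) (auto intro!: mult_nonneg_nonneg)
qed

text \<open>The set is moved to the circle, where the indicator of a closed set is the pointwise
  limit of continuous functions of the distance. Being functions of \<open>cis x\<close>, these are
  automatically periodic, and dominated convergence applies with \<open>h\<close> as
  majorant.\<close>

lemma trig_complete_closed:
  assumes h: "h \<in> L2" "\<And>m::nat. L2_inner h (\<lambda>x. cos (real m * x)) = 0"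
     "\<And>m::nat. L2_inner h (\<lambda>x. sin (real m * x)) = 0"
    and A: "closed A"
  shows "(LBINT x:{-pi..pi}. h x * indicator A x) = 0"
proof -
  note [measurable] = L2_measurable[OF h(1)]
  define K where "K = cis ` (A \<inter> {-pi..pi})"
  have K: "closed K" unfolding K_def
    by (intro compact_imp_closed compact_continuous_image continuous_intros closed_Int_compact A)
       auto
  \<comment> \<open>Only the open interval: \<open>cis\<close> identifies the two end points of the
    period. They form a null set.\<close>
  have inK: "cis x \<in> K \<longleftrightarrow> x \<in> A" if "x \<in> {-pi<..<pi}" for x
  proof
    assume "cis x \<in> K"
    then obtain y where y: "y \<in> A" "y \<in> {-pi..pi}" "cis x = cis y" by (auto simp: K_def)
    have "y \<noteq> -pi \<and> y \<noteq> pi"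
    proof (rule ccontr)
      assume "\<not> (y \<noteq> -pi \<and> y \<noteq> pi)"
      then have "cis x = cis pi" using y(3) by (auto simp: complex_eq_iff)
      then have "x = pi" using that Arg_cis[of x] Arg_cis[of pi] by simp
      then show False using that by simp
    qed
    then have "Arg (cis y) = y" using y(2) by (intro Arg_cis) auto
    moreover have "Arg (cis x) = x" using that by (intro Arg_cis) auto
    ultimately have "x = y" using y(3) by metis
    then show "x \<in> A" using y(1) by simp
  qed (use that in \<open>auto simp: K_def\<close>)
  show ?thesis
  \<comment> \<open>The distance to the empty set is 0 by convention, so the functions
    \<open>F n\<close> below would converge to 1 instead of 0 for empty \<open>K\<close>.\<close>
  proof (cases "K = {}")
    case True
    have "AE x in lborel. x \<noteq> -pi \<and> x \<noteq> pi"
      using AE_lborel_singleton[of "-pi"] AE_lborel_singleton[of pi] by eventually_elim auto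
    then have "AE x in lborel. indicator {-pi..pi} x *\<^sub>R (h x * indicator A x) = 0"
      by eventually_elim (use inK True in \<open>auto simp: indicator_def\<close>)
    then show ?thesis unfolding set_lebesgue_integral_def by (rule integral_eq_zero_AE)
  next
    case False
    define F where "F = (\<lambda>n z. max 0 (1 - real n * infdist z K))"
    have F01: "\<bar>F n z\<bar> \<le> 1" for n z by (auto simp: F_def intro!: mult_nonneg_nonneg infdist_nonneg)
    have 0: "L2_inner h (\<lambda>x. F n (cis x)) = 0" for n
      by (rule circle_function_orthogonal[OF h]) (auto simp: F_def intro!: continuous_intros)
    have "(\<lambda>n. integral\<^sup>L lborel (\<lambda>x. indicator {-pi..pi} x *\<^sub>R (h x * F n (cis x))))
       \<longlonglongrightarrow> integral\<^sup>L lborel (\<lambda>x. indicator {-pi..pi} x *\<^sub>R (h x * indicator K (cis x)))"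
    proof (rule integral_dominated_convergence)
      show "integrable lborel (\<lambda>x. norm (indicator {-pi..pi} x *\<^sub>R h x))"
        using L2_integrable[OF h(1)] by (intro integrable_norm) (simp add: set_integrable_def)
      have "(\<lambda>n. F n z) \<longlonglongrightarrow> indicator K z" for z
      proof (cases "z \<in> K")
        case True
        then show ?thesis by (simp add: F_def)
      next
        case F: False
        then have "infdist z K > 0"
          using in_closed_iff_infdist_zero[OF K False, of z] infdist_nonneg[of z K] by linarith
        then obtain N where N: "1 < real N * infdist z K" using reals_Archimedean3 by blast
        have "eventually (\<lambda>n. F n z = 0) sequentially"
          using eventually_ge_at_top[of N]
        proof eventually_elim
          case (elim n)
          have "real N * infdist z K \<le> real n * infdist z K"
            using elim by (intro mult_right_mono infdist_nonneg) auto
          then show ?case using N by (simp add: F_def)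
        qed
        then show ?thesis using F by (simp add: tendsto_eventually)
      qed
      then show "AE x in lborel. (\<lambda>n. indicator {-pi..pi} x *\<^sub>R (h x * F n (cis x)))
         \<longlonglongrightarrow> indicator {-pi..pi} x *\<^sub>R (h x * indicator K (cis x))"
        by (intro AE_I2 tendsto_intros)
      show "AE x in lborel. norm (indicator {-pi..pi} x *\<^sub>R (h x * F n (cis x)))
          \<le> norm (indicator {-pi..pi} x *\<^sub>R h x)" for n
        using F01[of n] by (intro AE_I2) (auto simp: indicator_def abs_mult mult_left_le)
      have "(\<lambda>x. F n (cis x)) \<in> borel_measurable borel" for n
        unfolding F_def by (intro borel_measurable_continuous_onI continuous_intros)
      then show "(\<lambda>x. indicator {-pi..pi} x *\<^sub>R (h x * F n (cis x))) \<in> borel_measurable lborel" for n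
        by measurable
      have [measurable]: "cis \<in> borel_measurable borel"
        by (intro borel_measurable_continuous_onI continuous_intros)
      have [measurable]: "K \<in> sets borel" using K by simp
      show "(\<lambda>x. indicator {-pi..pi} x *\<^sub>R (h x * indicator K (cis x))) \<in> borel_measurable lborel"
        by measurable
    qed
    then have "(\<lambda>n::nat. 0) \<longlonglongrightarrow> integral\<^sup>L lborel (\<lambda>x. indicator {-pi..pi} x *\<^sub>R (h x * indicator K (cis x)))"
      using 0 by (simp add: L2_inner_def set_lebesgue_integral_def)
    then have z: "integral\<^sup>L lborel (\<lambda>x. indicator {-pi..pi} x *\<^sub>R (h x * indicator K (cis x))) = 0"
      using LIMSEQ_unique tendsto_const by blast
    have "AE x in lborel. x \<noteq> -pi \<and> x \<noteq> pi"
      using AE_lborel_singleton[of "-pi"] AE_lborel_singleton[of pi] by eventually_elim auto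
    then have "AE x in lborel. indicator {-pi..pi} x *\<^sub>R (h x * indicator A x)
       = indicator {-pi..pi} x *\<^sub>R (h x * indicator K (cis x))"
      by eventually_elim (use inK in \<open>auto simp: indicator_def\<close>)
    moreover have [measurable]: "cis \<in> borel_measurable borel"
      by (intro borel_measurable_continuous_onI continuous_intros)
    moreover have [measurable]: "K \<in> sets borel" "A \<in> sets borel" using K A by auto
    have "(\<lambda>x. indicator {-pi..pi} x *\<^sub>R (h x * indicator K (cis x))) \<in> borel_measurable lborel"
      by measurable
    moreover have "(\<lambda>x. indicator {-pi..pi} x *\<^sub>R (h x * indicator A x)) \<in> borel_measurable lborel"
      by measurable
    ultimately show ?thesis unfolding set_lebesgue_integral_def z[symmetric]
      by (intro integral_cong_AE)
  qed
qed

text \<open>Closed sets are stable under intersection and generate the Borel sets, so vanishing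
  integrals extend from them to all Borel sets by complements and disjoint unions. An integrable
  function with this property is zero almost everywhere.\<close>

lemma trig_complete:
  assumes h: "h \<in> L2" "\<And>m::nat. L2_inner h (\<lambda>x. cos (real m * x)) = 0"
     "\<And>m::nat. L2_inner h (\<lambda>x. sin (real m * x)) = 0"
  shows "AE x in lborel. x \<in> {-pi..pi} \<longrightarrow> h x = 0"
proof -
  note [measurable] = L2_measurable[OF h(1)]
  define f where "f = (\<lambda>x. indicator {-pi..pi} x *\<^sub>R h x)"
  have f: "integrable lborel f"
    using L2_integrable[OF h(1)] by (simp add: set_integrable_def f_def)
  have eq: "(LBINT x:A. f x) = (LBINT x:{-pi..pi}. h x * indicator A x)" for A
    unfolding set_lebesgue_integral_def f_def
    by (intro Bochner_Integration.integral_cong) (auto simp: indicator_def)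
  have [simp]: "set_integrable lborel A f" if "A \<in> sets borel" for A
    using integrable_mult_indicator[OF _ f, of A] that by (simp add: set_integrable_def)
  have "(LBINT x:A. f x) = 0" if "A \<in> sets borel" for A
  proof -
    have "Int_stable (Collect (closed :: real set \<Rightarrow> bool))" by (auto simp: Int_stable_def)
    moreover have "Collect (closed :: real set \<Rightarrow> bool) \<subseteq> Pow UNIV" by auto
    moreover have "A \<in> sigma_sets UNIV (Collect closed)"
      using that unfolding borel_eq_closed by simp
    ultimately show ?thesis
    proof (induction rule: sigma_sets_induct_disjoint)
      case (basic A)
      then show ?case using trig_complete_closed[OF h] by (simp add: eq)
    next
      case empty
      then show ?case by (simp add: set_lebesgue_integral_def)
    next
      case (compl A)
      then have A: "A \<in> sets borel" unfolding borel_eq_closed by simp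
      have "(LBINT x:A \<union> (UNIV - A). f x) = (LBINT x:A. f x) + (LBINT x:UNIV - A. f x)"
      proof (rule set_integral_Un)
        have "UNIV - A \<in> sets borel" using A by (simp add: Compl_eq_Diff_UNIV[symmetric])
        then show "set_integrable lborel (UNIV - A) f" by simp
        show "set_integrable lborel A f" using A by simp
      qed simp
      moreover have "(LBINT x:A \<union> (UNIV - A). f x) = 0"
        using trig_complete_closed[OF h, of UNIV] by (simp add: eq)
      ultimately show ?case using compl by simp
    next
      case (union A)
      then have A: "A i \<in> sets borel" for i unfolding borel_eq_closed by auto
      have "(LBINT x:(\<Union>i. A i). f x) = (\<Sum>i. (LBINT x:A i. f x))"
      proof (rule lebesgue_integral_countable_add)
        show "A i \<in> sets lborel" for i using A by simp
        show "A i \<inter> A j = {}" if "i \<noteq> j" for i j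
          using union(1) that unfolding disjoint_family_on_def by simp
        have "(\<Union>i. A i) \<in> sets borel" using A by blast
        then show "set_integrable lborel (\<Union>i. A i) f" by simp
      qed
      then show ?case using union by simp
    qed
  qed
  then have "AE x in lborel. f x = 0"
    using density_unique_real[OF f, of "\<lambda>x. 0"] by (simp add: set_lebesgue_integral_def)
  then show ?thesis by eventually_elim (auto simp: f_def)
qed

text \<open>Riesz-Fischer. On a bounded interval a Cauchy sequence in L2 is Cauchy in L1, so a
  subsequence converges almost everywhere. Fatou's lemma turns the Cauchy bound for the whole
  sequence into a bound on the distance to that pointwise limit.\<close>

lemma L2_complete:
  assumes u: "\<And>n::nat. u n \<in> L2"
    and cau: "\<And>e. e > 0 \<Longrightarrow> \<exists>N. \<forall>i\<ge>N. \<forall>j\<ge>N. L2_norm (\<lambda>x. u i x - u j x) < e"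
  shows "\<exists>G\<in>L2. (\<lambda>n. L2_norm (\<lambda>x. u n x - G x)) \<longlonglongrightarrow> 0"
proof -
  note [measurable] = L2_measurable[OF u]
  define s where "s = (\<lambda>n x. indicator {-pi..pi} x *\<^sub>R u n x)"
  have [measurable]: "s n \<in> borel_measurable borel" for n unfolding s_def by measurable
  have int: "integrable lborel (s n)" for n
    using L2_integrable[OF u] by (simp add: set_integrable_def s_def)
  have L1: "(LINT x|lborel. norm (s i x - s j x)) \<le> sqrt (2 * pi) * L2_norm (\<lambda>x. u i x - u j x)" for i j
  proof -
    have "(LINT x|lborel. norm (s i x - s j x)) = (LBINT x:{-pi..pi}. \<bar>u i x - u j x\<bar>)"
      unfolding set_lebesgue_integral_def s_def
      by (intro Bochner_Integration.integral_cong) (auto simp: indicator_def)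
    then show ?thesis using L1_le_L2[OF L2_diff[OF u u, of i j]] by simp
  qed
  obtain r where r: "strict_mono r" "AE x in lborel. Cauchy (\<lambda>i. s (r i) x)"
  proof (rule cauchy_L1_AE_cauchy_subseq[where s = s and M = lborel])
    show "integrable lborel (s n)" for n by (rule int)
  next
    fix e :: real assume "e > 0"
    then obtain N where N: "\<forall>i\<ge>N. \<forall>j\<ge>N. L2_norm (\<lambda>x. u i x - u j x) < e / sqrt (2 * pi)"
      using cau[of "e / sqrt (2 * pi)"] by auto
    have "(LINT x|lborel. norm (s i x - s j x)) < e" if "i \<ge> N" "j \<ge> N" for i j
    proof -
      have "sqrt (2 * pi) * L2_norm (\<lambda>x. u i x - u j x) < sqrt (2 * pi) * (e / sqrt (2 * pi))"
        using N that by (intro mult_strict_left_mono) auto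
      also have "\<dots> = e" by simp
      finally show ?thesis using L1[of i j] by linarith
    qed
    then show "\<exists>N. \<forall>i\<ge>N. \<forall>j\<ge>N. (LINT x|lborel. norm (s i x - s j x)) < e" by blast
  qed
  \<comment> \<open>Since \<open>lim\<close> is total, \<open>G\<close> is measurable and exactly
    periodic, also on the null set where the subsequence diverges.\<close>
  define G where "G = (\<lambda>x. lim (\<lambda>i. u (r i) x))"
  have Gm [measurable]: "G \<in> borel_measurable borel" unfolding G_def by measurable
  have Gp: "periodic G" using L2_periodic[OF u] by (simp add: periodic_def G_def)
  have conv: "AE x in lborel. x \<in> {-pi..pi} \<longrightarrow> (\<lambda>i. u (r i) x) \<longlonglongrightarrow> G x"
    using r(2)
  proof eventually_elim
    case (elim x)
    show ?case
    proof
      assume x: "x \<in> {-pi..pi}"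
      then have "Cauchy (\<lambda>i. u (r i) x)" using elim by (simp add: s_def)
      then show "(\<lambda>i. u (r i) x) \<longlonglongrightarrow> G x"
        unfolding G_def using Cauchy_convergent_iff convergent_LIMSEQ_iff by blast
    qed
  qed
  have key: "(\<integral>\<^sup>+x. ennreal (indicator {-pi..pi} x *\<^sub>R (u n x - G x)\<^sup>2) \<partial>lborel) \<le> ennreal (e\<^sup>2)"
    if e: "e > 0" and N: "\<forall>i\<ge>N. \<forall>j\<ge>N. L2_norm (\<lambda>x. u i x - u j x) < e" and n: "n \<ge> N" for e N n
  proof -
    have "(\<integral>\<^sup>+x. ennreal (indicator {-pi..pi} x *\<^sub>R (u n x - G x)\<^sup>2) \<partial>lborel)
       = (\<integral>\<^sup>+x. liminf (\<lambda>i. ennreal (indicator {-pi..pi} x *\<^sub>R (u n x - u (r i) x)\<^sup>2)) \<partial>lborel)"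
    proof (rule nn_integral_cong_AE)
      show "AE x in lborel. ennreal (indicator {-pi..pi} x *\<^sub>R (u n x - G x)\<^sup>2)
         = liminf (\<lambda>i. ennreal (indicator {-pi..pi} x *\<^sub>R (u n x - u (r i) x)\<^sup>2))"
        using conv
      proof eventually_elim
        case (elim x)
        then have "(\<lambda>i. ennreal (indicator {-pi..pi} x *\<^sub>R (u n x - u (r i) x)\<^sup>2))
          \<longlonglongrightarrow> ennreal (indicator {-pi..pi} x *\<^sub>R (u n x - G x)\<^sup>2)"
          by (intro tendsto_ennrealI) (auto simp: indicator_def intro!: tendsto_intros)
        then show ?case by (intro lim_imp_Liminf[symmetric]) auto
      qed
    qed
    also have "\<dots> \<le> liminf (\<lambda>i. \<integral>\<^sup>+x. ennreal (indicator {-pi..pi} x *\<^sub>R (u n x - u (r i) x)\<^sup>2) \<partial>lborel)"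
      by (rule nn_integral_liminf) measurable
    also have "\<dots> \<le> limsup (\<lambda>i. \<integral>\<^sup>+x. ennreal (indicator {-pi..pi} x *\<^sub>R (u n x - u (r i) x)\<^sup>2) \<partial>lborel)"
      by (rule Liminf_le_Limsup) simp
    also have "\<dots> \<le> ennreal (e\<^sup>2)"
    proof (rule Limsup_bounded)
      show "eventually (\<lambda>i. (\<integral>\<^sup>+x. ennreal (indicator {-pi..pi} x *\<^sub>R (u n x - u (r i) x)\<^sup>2) \<partial>lborel) \<le> ennreal (e\<^sup>2)) sequentially"
        using eventually_ge_at_top[of N]
      proof eventually_elim
        case (elim i)
        then have ri: "r i \<ge> N" using strict_mono_imp_increasing[OF r(1), of i] by linarith
        have d: "(\<lambda>x. u n x - u (r i) x) \<in> L2" by (intro L2_diff u)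
        have "integrable lborel (\<lambda>x. indicator {-pi..pi} x *\<^sub>R (u n x - u (r i) x)\<^sup>2)"
          using d by (simp add: L2_def set_integrable_def)
        from nn_integral_eq_integral[OF this]
        have "(\<integral>\<^sup>+x. ennreal (indicator {-pi..pi} x *\<^sub>R (u n x - u (r i) x)\<^sup>2) \<partial>lborel)
          = ennreal (L2_inner (\<lambda>x. u n x - u (r i) x) (\<lambda>x. u n x - u (r i) x))"
          by (simp add: L2_inner_def set_lebesgue_integral_def power2_eq_square)
        also have "\<dots> \<le> ennreal (e\<^sup>2)"
          unfolding L2_norm_sq[symmetric] using N ri n
          by (intro ennreal_leI power_mono) (auto intro: less_imp_le)
        finally show ?case .
      qed
    qed
    finally show ?thesis .
  qed
  have diffL2: "(\<lambda>x. u n x - G x) \<in> L2 \<and> L2_norm (\<lambda>x. u n x - G x) \<le> e"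
    if e: "e > 0" and N: "\<forall>i\<ge>N. \<forall>j\<ge>N. L2_norm (\<lambda>x. u i x - u j x) < e" and n: "n \<ge> N" for e N n
  proof
    have fin: "integrable lborel (\<lambda>x. indicator {-pi..pi} x *\<^sub>R (u n x - G x)\<^sup>2)"
    proof (rule integrableI_nonneg)
      show "(\<integral>\<^sup>+x. ennreal (indicator {-pi..pi} x *\<^sub>R (u n x - G x)\<^sup>2) \<partial>lborel) < \<infinity>"
        using le_less_trans[OF key[OF that]] by simp
    qed auto
    moreover have "periodic (\<lambda>x. u n x - G x)"
      using L2_periodic[OF u, of n] Gp by (simp add: periodic_def)
    ultimately show "(\<lambda>x. u n x - G x) \<in> L2"
      by (simp add: L2_def set_integrable_def)
    have "ennreal (LBINT x:{-pi..pi}. (u n x - G x)\<^sup>2) \<le> ennreal (e\<^sup>2)"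
      using key[OF that] nn_integral_eq_integral[OF fin] unfolding set_lebesgue_integral_def
      by simp
    then have "(LBINT x:{-pi..pi}. (u n x - G x)\<^sup>2) \<le> e\<^sup>2" by (simp add: ennreal_le_iff)
    then show "L2_norm (\<lambda>x. u n x - G x) \<le> e" using e unfolding L2_norm_def
      by (intro real_le_lsqrt) auto
  qed
  have "G \<in> L2"
  proof -
    obtain N where N: "\<forall>i\<ge>N. \<forall>j\<ge>N. L2_norm (\<lambda>x. u i x - u j x) < 1" using cau[of 1] by auto
    have "(\<lambda>x. u N x - G x) \<in> L2"
      using diffL2[OF _ N, of N] by simp
    from L2_diff[OF u this, of N] show ?thesis by simp
  qed
  moreover have "(\<lambda>n. L2_norm (\<lambda>x. u n x - G x)) \<longlonglongrightarrow> 0"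
  proof (rule LIMSEQ_I)
    fix e :: real assume e: "e > 0"
    obtain N where N: "\<forall>i\<ge>N. \<forall>j\<ge>N. L2_norm (\<lambda>x. u i x - u j x) < e / 2" using cau[of "e/2"] e by auto
    have "norm (L2_norm (\<lambda>x. u n x - G x) - 0) < e" if "n \<ge> N" for n
    proof -
      have "L2_norm (\<lambda>x. u n x - G x) \<le> e / 2" using diffL2[OF _ N that] e by simp
      then show ?thesis using e by simp
    qed
    then show "\<exists>N. \<forall>n\<ge>N. norm (L2_norm (\<lambda>x. u n x - G x) - 0) < e" by blast
  qed
  ultimately show ?thesis by blast
qed

section \<open>Weak derivatives\<close>

lemma C1_continuous_on: "(\<And>x. (u has_real_derivative u' x) (at x)) \<Longrightarrow> continuous_on UNIV u"
  by (rule DERIV_continuous_on) auto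

section \<open>Limits in L2, orthogonal series and Bessel's inequality\<close>

lemma L2_inner_tendsto:
  assumes "\<And>N::nat. u N \<in> L2" "G \<in> L2" "h \<in> L2" "(\<lambda>N. L2_norm (\<lambda>x. u N x - G x)) \<longlonglongrightarrow> 0"
  shows "(\<lambda>N. L2_inner (u N) h) \<longlonglongrightarrow> L2_inner G h"
proof (rule LIM_zero_cancel, rule tendsto_0_le[where K = "L2_norm h"])
  show "(\<lambda>N. L2_norm (\<lambda>x. u N x - G x)) \<longlonglongrightarrow> 0" by fact
  show "\<forall>\<^sub>F N in sequentially. norm (L2_inner (u N) h - L2_inner G h)
     \<le> norm (L2_norm (\<lambda>x. u N x - G x)) * L2_norm h"
    using L2_cauchy_schwarz[OF L2_diff[OF assms(1,2)] assms(3)] assms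
    by (intro always_eventually allI) (simp add: L2_inner_diff_left)
qed

lemma L2_norm_tendsto:
  assumes "\<And>N::nat. u N \<in> L2" "G \<in> L2" "(\<lambda>N. L2_norm (\<lambda>x. u N x - G x)) \<longlonglongrightarrow> 0"
  shows "(\<lambda>N. L2_norm (u N)) \<longlonglongrightarrow> L2_norm G"
  using assms L2_norm_reverse_triangle[OF assms(1,2)]
  by (intro LIM_zero_cancel[OF tendsto_0_le[OF assms(3), of _ 1]] always_eventually allI) simp

lemma orthogonal_sum_norm:
  assumes e: "\<And>m::nat. e m \<in> L2" "\<And>m n. L2_inner (e m) (e n) = (if m = n then \<kappa> m else 0)"
    and "finite A"
  shows "L2_inner (\<lambda>x. \<Sum>m\<in>A. c m * e m x) (\<lambda>x. \<Sum>m\<in>A. c m * e m x) = (\<Sum>m\<in>A. \<kappa> m * (c m)\<^sup>2)"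
proof -
  have "L2_inner (\<lambda>x. \<Sum>m\<in>A. c m * e m x) (\<lambda>x. \<Sum>m\<in>A. c m * e m x)
     = (\<Sum>m\<in>A. \<Sum>n\<in>A. c n * (c m * (if m = n then \<kappa> m else 0)))"
    using e by (simp add: L2_inner_sum_left L2_inner_sum_right L2_inner_scale_left
        L2_inner_scale_right L2_scale L2_sum sum_distrib_left mult.left_commute)
  also have "\<dots> = (\<Sum>m\<in>A. \<kappa> m * (c m)\<^sup>2)"
  proof (rule sum.cong[OF refl])
    fix m assume "m \<in> A"
    have "(\<Sum>n\<in>A. c n * (c m * (if m = n then \<kappa> m else 0))) = (\<Sum>n\<in>A. if m = n then c n * c m * \<kappa> m else 0)"
      by (rule sum.cong) auto
    then show "(\<Sum>n\<in>A. c n * (c m * (if m = n then \<kappa> m else 0))) = \<kappa> m * (c m)\<^sup>2"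
      using \<open>m \<in> A\<close> assms(3) by (simp add: power2_eq_square)
  qed
  finally show ?thesis .
qed

text \<open>Stated with arbitrary squared norms \<kappa> because it serves the cosines (where the
  constant has another norm), the sines (where index 0 gives the zero function) and the
  odd-frequency sines.\<close>

lemma orthogonal_series_converges:
  assumes e: "\<And>m::nat. e m \<in> L2" "\<And>m n. L2_inner (e m) (e n) = (if m = n then \<kappa> m else 0)"
    and c: "summable (\<lambda>m. \<kappa> m * (c m)\<^sup>2)"
  shows "\<exists>G\<in>L2. (\<lambda>N. L2_norm (\<lambda>x. (\<Sum>m<N. c m * e m x) - G x)) \<longlonglongrightarrow> 0 \<and>
     (\<forall>m. L2_inner G (e m) = \<kappa> m * c m) \<and> (L2_norm G)\<^sup>2 = (\<Sum>m. \<kappa> m * (c m)\<^sup>2)"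
proof -
  define u where "u = (\<lambda>N x. \<Sum>m<N. c m * e m x)"
  have \<kappa>: "\<kappa> m \<ge> 0" for m using e(2)[of m m] L2_inner_self_nonneg[of "e m"] by simp
  have u: "u N \<in> L2" for N unfolding u_def by (intro L2_sum L2_scale e)
  have d: "(L2_norm (\<lambda>x. u i x - u j x))\<^sup>2 = (\<Sum>m\<in>{j..<i}. \<kappa> m * (c m)\<^sup>2)" if "j \<le> i" for i j
  proof -
    have "(\<lambda>x. u i x - u j x) = (\<lambda>x. \<Sum>m\<in>{j..<i}. c m * e m x)"
    proof (rule ext)
      fix x show "u i x - u j x = (\<Sum>m\<in>{j..<i}. c m * e m x)"
        unfolding u_def using that sum_diff_nat_ivl[of 0 j i "\<lambda>m. c m * e m x"]
        by (simp add: lessThan_atLeast0)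
    qed
    then show ?thesis using orthogonal_sum_norm[OF e, where A = "{j..<i}" and c = c] by (simp add: L2_norm_sq)
  qed
  have "\<exists>N. \<forall>i\<ge>N. \<forall>j\<ge>N. L2_norm (\<lambda>x. u i x - u j x) < \<epsilon>" if "\<epsilon> > 0" for \<epsilon>
  proof -
    obtain N where N: "\<And>m n. m \<ge> N \<Longrightarrow> norm (\<Sum>k\<in>{m..<n}. \<kappa> k * (c k)\<^sup>2) < \<epsilon>\<^sup>2"
      using c[unfolded summable_Cauchy, rule_format, of "\<epsilon>\<^sup>2"] \<open>\<epsilon> > 0\<close> by auto
    have *: "L2_norm (\<lambda>x. u i x - u j x) < \<epsilon>" if "j \<ge> N" "j \<le> i" for i j
    proof -
      have "(L2_norm (\<lambda>x. u i x - u j x))\<^sup>2 < \<epsilon>\<^sup>2" using d[OF that(2)] N[OF that(1), of i] by simp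
      then show ?thesis using \<open>\<epsilon> > 0\<close> by (simp add: power2_less_imp_less)
    qed
    have "L2_norm (\<lambda>x. u i x - u j x) < \<epsilon>" if "j \<ge> N" "i \<ge> N" for i j
    proof (cases "j \<le> i")
      case False
      then show ?thesis using that by (subst L2_norm_minus_commute) (intro *, auto)
    qed (use * that in blast)
    then show ?thesis by blast
  qed
  from L2_complete[of u, OF u this] obtain G where G: "G \<in> L2" "(\<lambda>N. L2_norm (\<lambda>x. u N x - G x)) \<longlonglongrightarrow> 0"
    by blast
  have "L2_inner G (e m) = \<kappa> m * c m" for m
  proof -
    have "L2_inner (u N) (e m) = \<kappa> m * c m" if "N > m" for N
    proof -
      have "L2_inner (u N) (e m) = (\<Sum>n<N. c n * (if n = m then \<kappa> n else 0))"
        unfolding u_def using e by (simp add: L2_inner_sum_left L2_inner_scale_left L2_scale)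
      also have "\<dots> = (\<Sum>n<N. if n = m then c n * \<kappa> n else 0)" by (rule sum.cong) auto
      finally show ?thesis using that by simp
    qed
    then have "(\<lambda>N. L2_inner (u N) (e m)) \<longlonglongrightarrow> \<kappa> m * c m"
      by (intro tendsto_eventually eventually_sequentiallyI[of "Suc m"]) auto
    with L2_inner_tendsto[OF u G(1) e(1) G(2)] show ?thesis using LIMSEQ_unique by blast
  qed
  moreover have "(L2_norm G)\<^sup>2 = (\<Sum>m. \<kappa> m * (c m)\<^sup>2)"
  proof -
    have "(L2_norm (u N))\<^sup>2 = (\<Sum>m<N. \<kappa> m * (c m)\<^sup>2)" for N
      unfolding L2_norm_sq u_def by (rule orthogonal_sum_norm[OF e]) auto
    then have "(\<lambda>N. (\<Sum>m<N. \<kappa> m * (c m)\<^sup>2)) \<longlonglongrightarrow> (L2_norm G)\<^sup>2"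
      using tendsto_power[OF L2_norm_tendsto[OF u G], of 2] by simp
    then show ?thesis using summable_LIMSEQ[OF c] LIMSEQ_unique by blast
  qed
  ultimately show ?thesis using G by (intro bexI[of _ G] conjI) (simp_all add: u_def)
qed

lemma bessel:
  assumes e: "\<And>m::nat. e m \<in> L2" "\<And>m n. L2_inner (e m) (e n) = (if m = n then \<kappa> m else 0)"
    and f: "f \<in> L2" and c: "\<And>m. L2_inner f (e m) = \<kappa> m * c m"
  shows "summable (\<lambda>m. \<kappa> m * (c m)\<^sup>2)" "(\<Sum>m<N. \<kappa> m * (c m)\<^sup>2) \<le> (L2_norm f)\<^sup>2"
proof -
  have \<kappa>: "\<kappa> m \<ge> 0" for m using e(2)[of m m] L2_inner_self_nonneg[of "e m"] by simp
  have *: "(\<Sum>m<N. \<kappa> m * (c m)\<^sup>2) \<le> (L2_norm f)\<^sup>2" for N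
  proof -
    let ?u = "\<lambda>x. \<Sum>m<N. c m * e m x"
    have u: "?u \<in> L2" by (intro L2_sum L2_scale e)
    have "0 \<le> L2_inner (\<lambda>x. f x - ?u x) (\<lambda>x. f x - ?u x)" by (rule L2_inner_self_nonneg)
    also have "\<dots> = L2_inner f f - 2 * L2_inner f ?u + L2_inner ?u ?u"
      using f u by (simp add: L2_inner_diff_left L2_inner_diff_right L2_diff L2_inner_commute[of ?u f])
    also have "L2_inner f ?u = (\<Sum>m<N. \<kappa> m * (c m)\<^sup>2)"
      using e f c by (simp add: L2_inner_sum_right L2_inner_scale_right L2_scale power2_eq_square mult.left_commute)
    also have "L2_inner ?u ?u = (\<Sum>m<N. \<kappa> m * (c m)\<^sup>2)" by (rule orthogonal_sum_norm[OF e]) auto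
    finally show ?thesis by (simp add: L2_norm_sq)
  qed
  show "(\<Sum>m<N. \<kappa> m * (c m)\<^sup>2) \<le> (L2_norm f)\<^sup>2" by (rule *)
  show "summable (\<lambda>m. \<kappa> m * (c m)\<^sup>2)"
    by (rule bounded_imp_summable[where B = "(L2_norm f)\<^sup>2"])
       (use \<kappa> *[of "Suc _"] in \<open>auto simp: lessThan_Suc_atMost\<close>)
qed

text \<open>A nonzero value in the interior of the period would persist on a ball, which has
  positive measure. One end point follows by one-sided continuity, every other point by
  periodicity.\<close>

lemma continuous_AE_zero:
  assumes "continuous_on UNIV h" "\<And>x. h (x + 2 * pi) = h x" "AE x in lborel. x \<in> {-pi..pi} \<longrightarrow> h x = (0::real)"
  shows "h x = 0"
proof -
  have per: "h (x + 2 * pi * of_int k) = h x" for x k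
  proof (induction k rule: int_induct[where k = 0])
    case (step1 i)
    then show ?case using assms(2)[of "x + 2 * pi * of_int i"] by (simp add: algebra_simps)
  next
    case (step2 i)
    then show ?case using assms(2)[of "x + 2 * pi * of_int (i - 1)"] by (simp add: algebra_simps)
  qed simp
  have in0: "h x = 0" if x: "x \<in> {-pi<..<pi}" for x
  proof (rule ccontr)
    assume "h x \<noteq> 0"
    define U where "U = {-pi<..<pi} \<inter> (h -` (- {0}))"
    have "open U" unfolding U_def using assms(1)
      by (intro open_Int open_vimage) auto
    have "x \<in> U" using x \<open>h x \<noteq> 0\<close> by (auto simp: U_def)
    obtain e where e: "e > 0" "ball x e \<subseteq> U" 
      using \<open>open U\<close> \<open>x \<in> U\<close> by (rule openE)
    have "U \<notin> null_sets lborel"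
    proof
      assume U0: "U \<in> null_sets lborel"
      have "ball x e \<in> null_sets lborel" by (rule null_sets_subset[OF U0 _ e(2)]) simp
      then have "emeasure lborel {x - e<..<x + e} = 0" by (simp add: ball_eq_greaterThanLessThan null_sets_def)
      then show False using e(1) by simp
    qed
    have "AE x in lborel. x \<notin> U"
      using assms(3) by eventually_elim (auto simp: U_def)
    then have "U \<in> null_sets lborel" using \<open>open U\<close> AE_iff_null_sets[of U lborel] by simp
    with \<open>U \<notin> null_sets lborel\<close> show False by simp
  qed
  have pi0: "h (-pi) = 0"
  proof -
    have "(h \<longlongrightarrow> h (-pi)) (at_right (-pi))"
      using assms(1) by (simp add: continuous_on_eq_continuous_at isCont_def filterlim_at_split)
    moreover have "eventually (\<lambda>x. h x = 0) (at_right (-pi))"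
      using eventually_at_right_real[of "-pi" pi] in0 by (auto elim: eventually_mono)
    ultimately show ?thesis
      by (metis tendsto_eventually tendsto_unique trivial_limit_at_right_real)
  qed
  define k where "k = \<lfloor>(x + pi) / (2 * pi)\<rfloor>"
  have "of_int k \<le> (x + pi) / (2 * pi)" "(x + pi) / (2 * pi) < of_int k + 1" by (auto simp: k_def)
  then have "of_int k * (2 * pi) \<le> x + pi" "x + pi < (of_int k + 1) * (2 * pi)"
    by (simp_all add: pos_le_divide_eq pos_divide_less_eq)
  then have "x - 2 * pi * of_int k \<in> {-pi..<pi}" by (auto simp: algebra_simps)
  then have "h (x - 2 * pi * of_int k) = 0" using in0 pi0
    by (metis atLeastLessThan_iff greaterThanLessThan_iff less_eq_real_def)
  then show ?thesis using per[of "x - 2 * pi * of_int k" k] by simp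
qed

section \<open>Integration by parts and weak derivatives of periodic functions\<close>

lemma periodic_derivative:
  assumes "\<And>x. \<phi> (x + 2 * pi) = \<phi> x" "\<And>x. (\<phi> has_real_derivative \<phi>' x) (at x)"
  shows "\<phi>' (x + 2 * pi) = \<phi>' x"
proof -
  have "((\<lambda>y. \<phi> (y + 2 * pi)) has_real_derivative \<phi>' (x + 2 * pi)) (at x)"
    using assms(2)[of "x + 2 * pi"] by (simp add: DERIV_shift)
  then show ?thesis using assms DERIV_unique by simp blast
qed

lemma L2_inner_by_parts:
  assumes u: "\<And>x. u (x + 2 * pi) = u x" "\<And>x. (u has_real_derivative u' x) (at x)" "continuous_on UNIV u'"
    and v: "\<And>x. v (x + 2 * pi) = v x" "\<And>x. (v has_real_derivative v' x) (at x)" "continuous_on UNIV v'"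
  shows "L2_inner u v' = - L2_inner u' v"
proof -
  have c: "continuous_on UNIV u" "continuous_on UNIV v"
    using C1_continuous_on[OF u(2)] C1_continuous_on[OF v(2)] by auto
  have L: "u \<in> L2" "v \<in> L2" "u' \<in> L2" "v' \<in> L2"
    using c u v periodic_derivative[OF u(1,2)] periodic_derivative[OF v(1,2)] by (auto intro: L2_continuous)
  have "L2_inner u v' + L2_inner u' v = (LBINT x:{-pi..pi}. u x * v' x + u' x * v x)"
    unfolding L2_inner_def
    by (rule set_integral_add(2)[symmetric]) (intro L2_mult_integrable L)+
  also have "\<dots> = u pi * v pi - u (-pi) * v (-pi)"
    unfolding set_lebesgue_integral_def
  proof (rule integral_FTC_atLeastAtMost)
    fix x
    have "((\<lambda>x. u x * v x) has_real_derivative (u x * v' x + u' x * v x)) (at x within {-pi..pi})"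
      using DERIV_mult'[OF u(2)[of x] v(2)[of x]] by (rule has_field_derivative_at_within)
    then show "((\<lambda>x. u x * v x) has_vector_derivative (u x * v' x + u' x * v x)) (at x within {-pi..pi})"
      by (simp add: has_real_derivative_iff_has_vector_derivative)
  next
    have "continuous_on UNIV (\<lambda>x. u x * v' x + u' x * v x)"
      by (intro continuous_intros c u(3) v(3))
    then show "continuous_on {-pi..pi} (\<lambda>x. u x * v' x + u' x * v x)"
      by (rule continuous_on_subset) simp
  qed simp
  also have "\<dots> = 0"
  proof -
    have "u pi = u (-pi)" "v pi = v (-pi)" using u(1)[of "-pi"] v(1)[of "-pi"] by simp_all
    then show ?thesis by simp
  qed
  finally show ?thesis by simp
qed

lemma weak_derivD:
  assumes "has_weak_deriv f g" "\<And>x. \<phi> (x + 2 * pi) = \<phi> x" "\<And>x. (\<phi> has_real_derivative \<phi>' x) (at x)"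
    "continuous_on UNIV \<phi>'"
  shows "L2_inner f \<phi>' = - L2_inner g \<phi>"
  using assms unfolding has_weak_deriv_def periodic_def L2_inner_def by blast

text \<open>For a fixed test function both sides of the defining identity are continuous in L2, so
  the graph of the weak derivative is closed. Derivatives of series are obtained in this way from
  their partial sums.\<close>

lemma weak_deriv_limit:
  assumes u: "\<And>N::nat. u N \<in> L2" "\<And>N. u' N \<in> L2" "\<And>N. has_weak_deriv (u N) (u' N)"
    and f: "f \<in> L2" "g \<in> L2" "(\<lambda>N. L2_norm (\<lambda>x. u N x - f x)) \<longlonglongrightarrow> 0"
      "(\<lambda>N. L2_norm (\<lambda>x. u' N x - g x)) \<longlonglongrightarrow> 0"
  shows "has_weak_deriv f g"
  unfolding has_weak_deriv_def
proof (intro allI impI, elim conjE)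
  fix \<phi> \<phi>' :: "real \<Rightarrow> real"
  assume \<phi>: "periodic \<phi>" "\<forall>x. (\<phi> has_real_derivative \<phi>' x) (at x)" "continuous_on UNIV \<phi>'"
  have p: "\<phi> (x + 2 * pi) = \<phi> x" for x using \<phi>(1) by (simp add: periodic_def)
  have L: "\<phi> \<in> L2" "\<phi>' \<in> L2"
    using p \<phi> periodic_derivative[of \<phi> \<phi>'] C1_continuous_on[of \<phi> \<phi>']
    by (auto intro!: L2_continuous)
  have "(\<lambda>N. L2_inner (u N) \<phi>') \<longlonglongrightarrow> L2_inner f \<phi>'" by (rule L2_inner_tendsto) (use u f L in auto)
  moreover have "(\<lambda>N. - L2_inner (u' N) \<phi>) \<longlonglongrightarrow> - L2_inner g \<phi>"
    by (intro tendsto_minus L2_inner_tendsto) (use u f L in auto)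
  moreover have "L2_inner (u N) \<phi>' = - L2_inner (u' N) \<phi>" for N
    by (rule weak_derivD[OF u(3)]) (use \<phi> p in auto)
  ultimately have "L2_inner f \<phi>' = - L2_inner g \<phi>" by (simp add: LIMSEQ_unique)
  then show "(LBINT x:{-pi..pi}. f x * \<phi>' x) = - (LBINT x:{-pi..pi}. g x * \<phi> x)"
    by (simp add: L2_inner_def)
qed

lemma weak_deriv_C1:
  assumes "\<And>x. u (x + 2 * pi) = u x" "\<And>x. (u has_real_derivative u' x) (at x)" "continuous_on UNIV u'"
  shows "has_weak_deriv u u'"
  using L2_inner_by_parts[OF assms] unfolding has_weak_deriv_def periodic_def L2_inner_def by blast

lemma weak_deriv_linear:
  assumes "f \<in> L2" "g \<in> L2" "h \<in> L2" "k \<in> L2" "has_weak_deriv f g" "has_weak_deriv h k"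
  shows "has_weak_deriv (\<lambda>x. a * f x + b * h x) (\<lambda>x. a * g x + b * k x)"
  unfolding has_weak_deriv_def
proof (intro allI impI, elim conjE)
  fix \<phi> \<phi>' :: "real \<Rightarrow> real"
  assume \<phi>: "periodic \<phi>" "\<forall>x. (\<phi> has_real_derivative \<phi>' x) (at x)" "continuous_on UNIV \<phi>'"
  have p: "\<phi> (x + 2 * pi) = \<phi> x" for x using \<phi>(1) by (simp add: periodic_def)
  have L: "\<phi> \<in> L2" "\<phi>' \<in> L2"
    using p \<phi> periodic_derivative[of \<phi> \<phi>'] C1_continuous_on[of \<phi> \<phi>']
    by (auto intro!: L2_continuous)
  have "L2_inner f \<phi>' = - L2_inner g \<phi>" "L2_inner h \<phi>' = - L2_inner k \<phi>"
    using weak_derivD[OF assms(5)] weak_derivD[OF assms(6)] \<phi> p by auto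
  then have "L2_inner (\<lambda>x. a * f x + b * h x) \<phi>' = - L2_inner (\<lambda>x. a * g x + b * k x) \<phi>"
    using assms L by (simp add: L2_inner_add_left L2_inner_scale_left L2_scale)
  then show "(LBINT x:{-pi..pi}. (a * f x + b * h x) * \<phi>' x) = - (LBINT x:{-pi..pi}. (a * g x + b * k x) * \<phi> x)"
    by (simp add: L2_inner_def)
qed

lemma weak_deriv_sin:
  assumes "has_weak_deriv f g"
  shows "L2_inner g (\<lambda>x. sin (real m * x)) = - real m * L2_inner f (\<lambda>x. cos (real m * x))"
proof -
  have "L2_inner f (\<lambda>x. real m * cos (real m * x)) = - L2_inner g (\<lambda>x. sin (real m * x))"
    by (rule weak_derivD[OF assms])
       (auto intro!: derivative_eq_intros continuous_intros sin_periodic_int)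
  then show ?thesis by (simp add: L2_inner_scale_right)
qed

lemma weak_deriv_cos:
  assumes "has_weak_deriv f g"
  shows "L2_inner g (\<lambda>x. cos (real m * x)) = real m * L2_inner f (\<lambda>x. sin (real m * x))"
proof -
  have "L2_inner f (\<lambda>x. (- real m) * sin (real m * x)) = - L2_inner g (\<lambda>x. cos (real m * x))"
    by (rule weak_derivD[OF assms])
       (auto intro!: derivative_eq_intros continuous_intros cos_periodic_int)
  then show ?thesis unfolding L2_inner_scale_right by simp
qed

text \<open>Sines and cosines are admissible test functions, so \<open>f\<close> determines all
  Fourier coefficients of its weak derivative; completeness of the system does the rest.\<close>

lemma weak_deriv_unique:
  assumes "g \<in> L2" "h \<in> L2" "has_weak_deriv f g" "has_weak_deriv f h"
  shows "AE x in lborel. x \<in> {-pi..pi} \<longrightarrow> g x = h x"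
proof -
  have "AE x in lborel. x \<in> {-pi..pi} \<longrightarrow> g x - h x = 0"
    by (rule trig_complete)
       (use assms in \<open>auto simp: L2_inner_diff_left weak_deriv_sin weak_deriv_cos\<close>)
  then show ?thesis by simp
qed

lemma H1_wderiv:
  assumes "f \<in> H1"
  shows "wderiv f \<in> L2" "has_weak_deriv f (wderiv f)"
proof -
  have "\<exists>g. g \<in> L2 \<and> has_weak_deriv f g" using assms by (auto simp: H1_def)
  then have "wderiv f \<in> L2 \<and> has_weak_deriv f (wderiv f)" unfolding wderiv_def by (rule someI_ex)
  then show "wderiv f \<in> L2" "has_weak_deriv f (wderiv f)" by auto
qed

lemma H1_L2: "f \<in> H1 \<Longrightarrow> f \<in> L2"
  by (auto simp: H1_def periodic_def intro: L2_continuous)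

text \<open>\<open>wderiv\<close> is an arbitrary choice. This is the way to replace it by an
  explicit derivative, at the price of an exceptional null set.\<close>

lemma H1_I:
  assumes "continuous_on UNIV f" "\<And>x. f (x + 2 * pi) = f x" "g \<in> L2" "has_weak_deriv f g"
  shows "f \<in> H1" "AE x in lborel. x \<in> {-pi..pi} \<longrightarrow> wderiv f x = g x"
proof -
  show f: "f \<in> H1" using assms unfolding H1_def periodic_def by blast
  show "AE x in lborel. x \<in> {-pi..pi} \<longrightarrow> wderiv f x = g x"
    by (rule weak_deriv_unique[OF H1_wderiv(1)[OF f] assms(3) H1_wderiv(2)[OF f] assms(4)])
qed

lemma H1_linear:
  assumes "f \<in> H1" "h \<in> H1"
  shows "(\<lambda>x. a * f x + b * h x) \<in> H1"
    "AE x in lborel. x \<in> {-pi..pi} \<longrightarrow> wderiv (\<lambda>x. a * f x + b * h x) x = a * wderiv f x + b * wderiv h x"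
proof -
  have c: "continuous_on UNIV (\<lambda>x. a * f x + b * h x)" using assms by (auto simp: H1_def intro!: continuous_intros)
  have p: "a * f (x + 2 * pi) + b * h (x + 2 * pi) = a * f x + b * h x" for x using assms by (simp add: H1_def periodic_def)
  have l: "(\<lambda>x. a * wderiv f x + b * wderiv h x) \<in> L2"
    using assms by (intro L2_add L2_scale H1_wderiv)
  have w: "has_weak_deriv (\<lambda>x. a * f x + b * h x) (\<lambda>x. a * wderiv f x + b * wderiv h x)"
    using assms H1_wderiv H1_L2 by (intro weak_deriv_linear) auto
  show "(\<lambda>x. a * f x + b * h x) \<in> H1" by (rule H1_I(1)[OF c p l w])
  show "AE x in lborel. x \<in> {-pi..pi} \<longrightarrow> wderiv (\<lambda>x. a * f x + b * h x) x = a * wderiv f x + b * wderiv h x"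
    by (rule H1_I(2)[OF c p l w])
qed

section \<open>Odd functions and sine series\<close>

text \<open>The setting for sine series, the Hilbert transform and the velocity. The weight of
  \<open>HDW\<close> enters later, through the inclusion of \<open>HDW\<close> in this
  space.\<close>

definition odd_H1 :: "(real \<Rightarrow> real) set" where
  "odd_H1 = {f \<in> H1. \<forall>x. f (- x) = - f x}"

definition sine_coeff :: "(real \<Rightarrow> real) \<Rightarrow> nat \<Rightarrow> real" where
  "sine_coeff f m = L2_inner f (\<lambda>x. sin (real m * x)) / pi"

definition sine_series :: "(nat \<Rightarrow> real) \<Rightarrow> real \<Rightarrow> real" where
  "sine_series c x = (\<Sum>m. c m * sin (real m * x))"

definition cosine_series :: "(nat \<Rightarrow> real) \<Rightarrow> real \<Rightarrow> real" where
  "cosine_series c x = (\<Sum>m. c m * cos (real m * x))"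

lemma integral_odd_zero:
  assumes "\<And>x. f (- x) = - f x"
  shows "(LBINT x:{-pi..pi}. f x) = (0::real)"
proof -
  have "(LBINT x:{-pi..pi}. f x) = (LBINT x:{x. - x \<in> {-pi..pi}}. f (- x))"
    by (rule set_integral_reflect)
  also have "{x. - x \<in> {-pi..pi}} = {-pi..pi}" by auto
  also have "(LBINT x:{-pi..pi}. f (- x)) = - (LBINT x:{-pi..pi}. f x)"
    unfolding assms set_lebesgue_integral_def by simp
  finally show ?thesis by simp
qed

lemma odd_inner_cos: "(\<And>x. f (- x) = - f x) \<Longrightarrow> L2_inner f (\<lambda>x. cos (k * x)) = 0"
  unfolding L2_inner_def by (rule integral_odd_zero) simp

lemma sin_orthogonal:
  "L2_inner (\<lambda>x. sin (real m * x)) (\<lambda>x. sin (real n * x)) = (if m = n then if m = 0 then 0 else pi else 0)"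
  by (auto simp: L2_inner_sin_sin)

text \<open>The additional power of \<open>m\<close> pays for the growth of the truncated principal
  values in \<open>m\<close>. It is affordable because \<open>m * c m\<close> is square summable and
  the remaining factor \<open>m powr (-3/4)\<close> is as well.\<close>

lemma summable_sine_coeffs:
  assumes "summable (\<lambda>m. (real m * c m)\<^sup>2)"
  shows "summable (\<lambda>m. \<bar>c m\<bar> * real m powr (1/4))"
proof (rule summable_comparison_test_ev)
  show "summable (\<lambda>m. (1/2) * ((real m * c m)\<^sup>2 + real m powr (-3/2)))"
    using assms by (intro summable_mult summable_add) (auto simp: summable_real_powr_iff)
  show "\<forall>\<^sub>F m in sequentially. norm (\<bar>c m\<bar> * real m powr (1/4)) \<le> (1/2) * ((real m * c m)\<^sup>2 + real m powr (-3/2))"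
    using eventually_gt_at_top[of 0]
  proof eventually_elim
    case (elim m)
    have m1: "real m powr (1/4) = real m powr 1 * real m powr (-3/4)"
      unfolding powr_add[symmetric] by simp
    have m2: "(real m powr (-3/4))\<^sup>2 = real m powr (-3/2)"
      unfolding power2_eq_square powr_add[symmetric] by simp
    have "2 * (\<bar>real m * c m\<bar> * real m powr (-3/4)) \<le> (real m * c m)\<^sup>2 + (real m powr (-3/4))\<^sup>2"
      using sum_squares_bound[of "\<bar>real m * c m\<bar>" "real m powr (-3/4)"] by simp
    then show ?case unfolding m2 using m1 elim by (simp add: abs_mult mult_ac)
  qed
qed

lemma summable_abs_sine_coeffs:
  assumes "summable (\<lambda>m. (real m * c m)\<^sup>2)"
  shows "summable (\<lambda>m. \<bar>c m\<bar>)"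
proof (rule summable_comparison_test_ev[OF _ summable_sine_coeffs[OF assms]])
  show "\<forall>\<^sub>F m in sequentially. norm \<bar>c m\<bar> \<le> \<bar>c m\<bar> * real m powr (1/4)"
    using eventually_gt_at_top[of 0]
  proof eventually_elim
    case (elim m)
    have "\<bar>c m\<bar> * 1 \<le> \<bar>c m\<bar> * real m powr (1/4)"
      using elim by (intro mult_left_mono ge_one_powr_ge_zero) auto
    then show ?case by simp
  qed
qed

text \<open>The value is pi^2 / 6, the term at 0 being 0 by the convention for division.\<close>

definition zeta2 :: real where "zeta2 = (\<Sum>m. 1 / (real m)\<^sup>2)"

lemma summable_inverse_squares: "summable (\<lambda>m. 1 / (real m)\<^sup>2)"
  using inverse_power_summable[of 2, where 'a = real] by (simp add: inverse_eq_divide)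

lemma suminf_abs_sine_coeffs:
  assumes "summable (\<lambda>m. (real m * c m)\<^sup>2)" "c 0 = 0"
  shows "(\<Sum>m. \<bar>c m\<bar>) \<le> sqrt zeta2 * sqrt (\<Sum>m. (real m * c m)\<^sup>2)"
proof (rule suminf_le_const[OF summable_abs_sine_coeffs[OF assms(1)]])
  fix n
  have "(\<Sum>m<n. (1 / real m) * \<bar>real m * c m\<bar>) = (\<Sum>m<n. \<bar>c m\<bar>)"
    by (rule sum.cong) (use assms(2) in \<open>auto simp: abs_mult\<close>)
  moreover have "(\<Sum>m<n. (1 / real m) * \<bar>real m * c m\<bar>)\<^sup>2
      \<le> (\<Sum>m<n. (1 / real m)\<^sup>2) * (\<Sum>m<n. \<bar>real m * c m\<bar>\<^sup>2)"
    by (rule Cauchy_Schwarz_ineq_sum)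
  moreover have "(\<Sum>m<n. (1 / real m)\<^sup>2) * (\<Sum>m<n. \<bar>real m * c m\<bar>\<^sup>2) \<le> zeta2 * (\<Sum>m. (real m * c m)\<^sup>2)"
  proof (rule mult_mono)
    show "(\<Sum>m<n. (1 / real m)\<^sup>2) \<le> zeta2"
      unfolding zeta2_def power_one_over[symmetric]
      using sum_le_suminf[OF summable_inverse_squares, of "{..<n}"] by (simp add: power_divide)
    show "(\<Sum>m<n. \<bar>real m * c m\<bar>\<^sup>2) \<le> (\<Sum>m. (real m * c m)\<^sup>2)"
      using sum_le_suminf[OF assms(1), of "{..<n}"] by simp
    show "0 \<le> zeta2" unfolding zeta2_def by (intro suminf_nonneg summable_inverse_squares) simp
  qed (simp add: sum_nonneg)
  ultimately have "(\<Sum>m<n. \<bar>c m\<bar>)\<^sup>2 \<le> zeta2 * (\<Sum>m. (real m * c m)\<^sup>2)" by simp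
  then show "(\<Sum>m<n. \<bar>c m\<bar>) \<le> sqrt zeta2 * sqrt (\<Sum>m. (real m * c m)\<^sup>2)"
    unfolding real_sqrt_mult[symmetric] by (rule real_le_rsqrt)
qed

lemma trig_series_uniform:
  fixes t :: "real \<Rightarrow> real"
  assumes "summable (\<lambda>m. \<bar>c m\<bar>)" "\<And>x. \<bar>t x\<bar> \<le> 1"
  shows "uniform_limit UNIV (\<lambda>N x. \<Sum>m<N. c m * t (real m * x)) (\<lambda>x. \<Sum>m. c m * t (real m * x)) sequentially"
    "summable (\<lambda>m. c m * t (real m * x))" "\<bar>\<Sum>m. c m * t (real m * x)\<bar> \<le> (\<Sum>m. \<bar>c m\<bar>)"
proof -
  have b: "norm (c m * t (real m * x)) \<le> \<bar>c m\<bar>" for m x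
    using assms(2) by (simp add: abs_mult mult_left_le)
  show "uniform_limit UNIV (\<lambda>N x. \<Sum>m<N. c m * t (real m * x)) (\<lambda>x. \<Sum>m. c m * t (real m * x)) sequentially"
    by (rule Weierstrass_m_test[OF _ assms(1)]) (use b in auto)
  have "summable (\<lambda>m. norm (c m * t (real m * x)))"
    by (rule summable_comparison_test'[OF assms(1)]) (use b in auto)
  then show "summable (\<lambda>m. c m * t (real m * x))" by (rule summable_norm_cancel)
  have "norm (\<Sum>m. c m * t (real m * x)) \<le> (\<Sum>m. norm (c m * t (real m * x)))"
    by (rule summable_norm) fact
  also have "\<dots> \<le> (\<Sum>m. \<bar>c m\<bar>)"
    by (rule suminf_le) (use b \<open>summable (\<lambda>m. norm (c m * t (real m * x)))\<close> assms(1) in auto)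
  finally show "\<bar>\<Sum>m. c m * t (real m * x)\<bar> \<le> (\<Sum>m. \<bar>c m\<bar>)" by simp
qed

lemma trig_series_continuous:
  fixes t :: "real \<Rightarrow> real"
  assumes "summable (\<lambda>m. \<bar>c m\<bar>)" "\<And>x. \<bar>t x\<bar> \<le> 1" "continuous_on UNIV t"
  shows "continuous_on UNIV (\<lambda>x. \<Sum>m. c m * t (real m * x))"
proof (rule uniform_limit_theorem[OF _ trig_series_uniform(1)[OF assms(1,2)]])
  show "\<forall>\<^sub>F N in sequentially. continuous_on UNIV (\<lambda>x. \<Sum>m<N. c m * t (real m * x))"
    by (intro always_eventually allI continuous_intros continuous_on_compose2[OF assms(3)]) auto
qed simp

lemma uniform_limit_L2:
  assumes "\<And>N::nat. u N \<in> L2" "f \<in> L2" "uniform_limit UNIV u f sequentially"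
  shows "(\<lambda>N. L2_norm (\<lambda>x. u N x - f x)) \<longlonglongrightarrow> 0"
proof (rule LIMSEQ_I)
  fix e :: real assume "e > 0"
  define d where "d = e / (2 * sqrt (2 * pi))"
  have d: "d > 0" using \<open>e > 0\<close> by (simp add: d_def)
  obtain N where N: "\<And>n x. n \<ge> N \<Longrightarrow> \<bar>u n x - f x\<bar> < d"
    using assms(3) d unfolding uniform_limit_sequentially_iff dist_real_def by blast
  have "norm (L2_norm (\<lambda>x. u n x - f x) - 0) < e" if "n \<ge> N" for n
  proof -
    have "L2_norm (\<lambda>x. u n x - f x) \<le> sqrt (2 * pi) * d"
      using N[OF that] by (intro L2_norm_bounded L2_diff assms) (auto intro: less_imp_le)
    also have "\<dots> < e" using \<open>e > 0\<close> by (simp add: d_def field_simps)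
    finally show ?thesis by simp
  qed
  then show "\<exists>N. \<forall>n\<ge>N. norm (L2_norm (\<lambda>x. u n x - f x) - 0) < e" by blast
qed

lemma sine_series_uniform: "summable (\<lambda>m. \<bar>c m\<bar>) \<Longrightarrow>
    uniform_limit UNIV (\<lambda>N x. \<Sum>m<N. c m * sin (real m * x)) (sine_series c) sequentially"
  using trig_series_uniform(1)[of c sin] unfolding sine_series_def by simp

lemma cosine_series_uniform: "summable (\<lambda>m. \<bar>c m\<bar>) \<Longrightarrow>
    uniform_limit UNIV (\<lambda>N x. \<Sum>m<N. c m * cos (real m * x)) (cosine_series c) sequentially"
  using trig_series_uniform(1)[of c cos] unfolding cosine_series_def by simp

lemma sine_series_bound: "summable (\<lambda>m. \<bar>c m\<bar>) \<Longrightarrow> \<bar>sine_series c x\<bar> \<le> (\<Sum>m. \<bar>c m\<bar>)"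
  using trig_series_uniform(3)[of c sin] unfolding sine_series_def by simp

lemma cosine_series_bound: "summable (\<lambda>m. \<bar>c m\<bar>) \<Longrightarrow> \<bar>cosine_series c x\<bar> \<le> (\<Sum>m. \<bar>c m\<bar>)"
  using trig_series_uniform(3)[of c cos] unfolding cosine_series_def by simp

lemma sine_series_continuous: "summable (\<lambda>m. \<bar>c m\<bar>) \<Longrightarrow> continuous_on UNIV (sine_series c)"
  unfolding sine_series_def[abs_def]
  by (rule trig_series_continuous) (auto intro: continuous_on_sin continuous_on_id)

lemma cosine_series_continuous: "summable (\<lambda>m. \<bar>c m\<bar>) \<Longrightarrow> continuous_on UNIV (cosine_series c)"
  unfolding cosine_series_def[abs_def]
  by (rule trig_series_continuous) (auto intro: continuous_on_cos continuous_on_id)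

lemma sine_series_periodic: "sine_series c (x + 2 * pi) = sine_series c x"
  unfolding sine_series_def by (simp add: sin_periodic_int)

lemma cosine_series_periodic: "cosine_series c (x + 2 * pi) = cosine_series c x"
  unfolding cosine_series_def by (simp add: cos_periodic_int)

lemma sine_series_odd:
  assumes "summable (\<lambda>m. \<bar>c m\<bar>)"
  shows "sine_series c (- x) = - sine_series c x"
  using suminf_minus[OF trig_series_uniform(2)[OF assms, of sin x]]
  by (simp add: sine_series_def)

lemma sine_series_L2: "summable (\<lambda>m. \<bar>c m\<bar>) \<Longrightarrow> sine_series c \<in> L2"
  by (intro L2_continuous sine_series_continuous sine_series_periodic)

lemma cosine_series_L2: "summable (\<lambda>m. \<bar>c m\<bar>) \<Longrightarrow> cosine_series c \<in> L2"
  by (intro L2_continuous cosine_series_continuous cosine_series_periodic)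

lemma sine_sum_L2: "(\<lambda>x. \<Sum>m\<in>A. c m * sin (real m * x)) \<in> L2"
  by (intro L2_sum L2_scale sin_in_L2) simp

lemma cosine_sum_L2: "(\<lambda>x. \<Sum>m\<in>A. c m * cos (real m * x)) \<in> L2"
  by (intro L2_sum L2_scale cos_in_L2) simp

lemma sine_series_L2_tendsto:
  assumes "summable (\<lambda>m. \<bar>c m\<bar>)"
  shows "(\<lambda>N. L2_norm (\<lambda>x. (\<Sum>m<N. c m * sin (real m * x)) - sine_series c x)) \<longlonglongrightarrow> 0"
  by (rule uniform_limit_L2[OF sine_sum_L2 sine_series_L2[OF assms] sine_series_uniform[OF assms]])

lemma cosine_series_L2_tendsto:
  assumes "summable (\<lambda>m. \<bar>c m\<bar>)"
  shows "(\<lambda>N. L2_norm (\<lambda>x. (\<Sum>m<N. c m * cos (real m * x)) - cosine_series c x)) \<longlonglongrightarrow> 0"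
  by (rule uniform_limit_L2[OF cosine_sum_L2 cosine_series_L2[OF assms] cosine_series_uniform[OF assms]])

lemma sine_sum_inner:
  "L2_inner (\<lambda>x. \<Sum>m<N. c m * sin (real m * x)) (\<lambda>x. sin (real n * x)) = (if 0 < n \<and> n < N then pi * c n else 0)"
proof -
  have "L2_inner (\<lambda>x. \<Sum>m<N. c m * sin (real m * x)) (\<lambda>x. sin (real n * x))
     = (\<Sum>m<N. c m * L2_inner (\<lambda>x. sin (real m * x)) (\<lambda>x. sin (real n * x)))"
    by (simp add: L2_inner_sum_left L2_scale L2_inner_scale_left)
  also have "\<dots> = (\<Sum>m<N. if m = n then (if 0 < n then pi * c n else 0) else 0)"
    by (rule sum.cong) (auto simp: L2_inner_sin_sin)
  finally show ?thesis by simp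
qed

lemma sine_sum_norm:
  assumes "c 0 = 0"
  shows "(L2_norm (\<lambda>x. \<Sum>m<N. c m * sin (real m * x)))\<^sup>2 = pi * (\<Sum>m<N. (c m)\<^sup>2)"
proof -
  have "(L2_norm (\<lambda>x. \<Sum>m<N. c m * sin (real m * x)))\<^sup>2 = (\<Sum>m<N. (if m = 0 then 0 else pi) * (c m)\<^sup>2)"
    unfolding L2_norm_sq by (rule orthogonal_sum_norm) (auto simp: sin_orthogonal)
  also have "\<dots> = (\<Sum>m<N. pi * (c m)\<^sup>2)" by (rule sum.cong) (use assms in auto)
  finally show ?thesis by (simp add: sum_distrib_left)
qed

lemma cosine_sum_norm:
  assumes "c 0 = 0"
  shows "(L2_norm (\<lambda>x. \<Sum>m<N. c m * cos (real m * x)))\<^sup>2 = pi * (\<Sum>m<N. (c m)\<^sup>2)"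
proof -
  have "(L2_norm (\<lambda>x. \<Sum>m<N. c m * cos (real m * x)))\<^sup>2 = (\<Sum>m<N. (if m = 0 then 2 * pi else pi) * (c m)\<^sup>2)"
    unfolding L2_norm_sq by (rule orthogonal_sum_norm) (auto simp: L2_inner_cos_cos)
  also have "\<dots> = (\<Sum>m<N. pi * (c m)\<^sup>2)" by (rule sum.cong) (use assms in auto)
  finally show ?thesis by (simp add: sum_distrib_left)
qed

lemma sine_coeff_sine_series:
  assumes "summable (\<lambda>m. \<bar>c m\<bar>)" "c 0 = 0"
  shows "sine_coeff (sine_series c) n = c n"
proof -
  have "(\<lambda>N. L2_inner (\<lambda>x. \<Sum>m<N. c m * sin (real m * x)) (\<lambda>x. sin (real n * x)))
      \<longlonglongrightarrow> L2_inner (sine_series c) (\<lambda>x. sin (real n * x))"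
    by (rule L2_inner_tendsto[OF sine_sum_L2 sine_series_L2[OF assms(1)] _ sine_series_L2_tendsto[OF assms(1)]]) simp
  moreover have "(\<lambda>N. L2_inner (\<lambda>x. \<Sum>m<N. c m * sin (real m * x)) (\<lambda>x. sin (real n * x))) \<longlonglongrightarrow> pi * c n"
    using assms(2) by (intro tendsto_eventually eventually_sequentiallyI[of "Suc n"])
      (auto simp: sine_sum_inner not_less)
  ultimately have "L2_inner (sine_series c) (\<lambda>x. sin (real n * x)) = pi * c n" by (rule LIMSEQ_unique)
  then show ?thesis by (simp add: sine_coeff_def)
qed

lemma sine_series_norm:
  assumes "summable (\<lambda>m. \<bar>c m\<bar>)" "c 0 = 0"
  shows "summable (\<lambda>m. (c m)\<^sup>2)" "(L2_norm (sine_series c))\<^sup>2 = pi * (\<Sum>m. (c m)\<^sup>2)"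
proof -
  have "(\<lambda>N. (1/pi) * (L2_norm (\<lambda>x. \<Sum>m<N. c m * sin (real m * x)))\<^sup>2) \<longlonglongrightarrow> (1/pi) * (L2_norm (sine_series c))\<^sup>2"
    by (intro tendsto_intros L2_norm_tendsto[OF sine_sum_L2 sine_series_L2[OF assms(1)] sine_series_L2_tendsto[OF assms(1)]])
  then have "(\<lambda>m. (c m)\<^sup>2) sums ((1/pi) * (L2_norm (sine_series c))\<^sup>2)"
    unfolding sums_def sine_sum_norm[where c = c, OF assms(2)] by simp
  then show "summable (\<lambda>m. (c m)\<^sup>2)" "(L2_norm (sine_series c))\<^sup>2 = pi * (\<Sum>m. (c m)\<^sup>2)"
    using sums_summable[of "\<lambda>m. (c m)\<^sup>2"] sums_unique[of "\<lambda>m. (c m)\<^sup>2"] by (auto simp: field_simps)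
qed

lemma cosine_series_norm:
  assumes "summable (\<lambda>m. \<bar>c m\<bar>)" "c 0 = 0"
  shows "(L2_norm (cosine_series c))\<^sup>2 = pi * (\<Sum>m. (c m)\<^sup>2)"
proof -
  have "(\<lambda>N. (1/pi) * (L2_norm (\<lambda>x. \<Sum>m<N. c m * cos (real m * x)))\<^sup>2) \<longlonglongrightarrow> (1/pi) * (L2_norm (cosine_series c))\<^sup>2"
    by (intro tendsto_intros L2_norm_tendsto[OF cosine_sum_L2 cosine_series_L2[OF assms(1)] cosine_series_L2_tendsto[OF assms(1)]])
  then have "(\<lambda>m. (c m)\<^sup>2) sums ((1/pi) * (L2_norm (cosine_series c))\<^sup>2)"
    unfolding sums_def cosine_sum_norm[where c = c, OF assms(2)] by simp
  from sums_unique[OF this] show ?thesis by (simp add: field_simps)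
qed

lemma sine_sum_weak_deriv:
  "has_weak_deriv (\<lambda>x. \<Sum>m<N. c m * sin (real m * x)) (\<lambda>x. \<Sum>m<N. (real m * c m) * cos (real m * x))"
proof (rule weak_deriv_C1)
  fix x
  show "(\<Sum>m<N. c m * sin (real m * (x + 2 * pi))) = (\<Sum>m<N. c m * sin (real m * x))"
    by (simp add: sin_periodic_int)
  show "((\<lambda>x. \<Sum>m<N. c m * sin (real m * x)) has_real_derivative (\<Sum>m<N. (real m * c m) * cos (real m * x))) (at x)"
    by (auto intro!: derivative_eq_intros sum.cong)
qed (intro continuous_intros)

lemma sine_coeff_0 [simp]: "sine_coeff f 0 = 0"
  by (simp add: sine_coeff_def L2_inner_commute[of f])

text \<open>The differentiated series converges in L2 by orthogonality of the cosines, and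
  closedness of the weak derivative identifies its sum with the derivative. The second claim gives
  convergence of the differentiated partial sums, which is what arguments by approximation
  use.\<close>

lemma sine_series_odd_H1:
  assumes "summable (\<lambda>m. (real m * c m)\<^sup>2)"
  shows "sine_series c \<in> odd_H1"
    "(\<lambda>N. L2_norm (\<lambda>x. (\<Sum>m<N. (real m * c m) * cos (real m * x)) - wderiv (sine_series c) x)) \<longlonglongrightarrow> 0"
proof -
  note s = summable_abs_sine_coeffs[OF assms]
  have "summable (\<lambda>m. (if m = 0 then 2 * pi else pi) * (real m * c m)\<^sup>2)"
  proof (rule summable_cong[THEN iffD2, OF always_eventually])
    show "\<forall>m. (if m = 0 then 2 * pi else pi) * (real m * c m)\<^sup>2 = pi * (real m * c m)\<^sup>2" by auto
    show "summable (\<lambda>m. pi * (real m * c m)\<^sup>2)" by (rule summable_mult[OF assms])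
  qed
  from orthogonal_series_converges[where e = "\<lambda>m x. cos (real m * x)", OF _ L2_inner_cos_cos this]
  obtain G where G: "G \<in> L2" "(\<lambda>N. L2_norm (\<lambda>x. (\<Sum>m<N. (real m * c m) * cos (real m * x)) - G x)) \<longlonglongrightarrow> 0"
    by auto
  have w: "has_weak_deriv (sine_series c) G"
    by (rule weak_deriv_limit[OF sine_sum_L2 cosine_sum_L2 sine_sum_weak_deriv sine_series_L2[OF s] G(1)
         sine_series_L2_tendsto[OF s] G(2)])
  note H = H1_I[OF sine_series_continuous[OF s] sine_series_periodic G(1) w]
  show "sine_series c \<in> odd_H1" using H(1) sine_series_odd[OF s] by (simp add: odd_H1_def)
  have "L2_norm (\<lambda>x. (\<Sum>m<N. (real m * c m) * cos (real m * x)) - wderiv (sine_series c) x)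
     = L2_norm (\<lambda>x. (\<Sum>m<N. (real m * c m) * cos (real m * x)) - G x)" for N
  proof (rule L2_norm_AE_cong)
    show "AE x in lborel. x \<in> {-pi..pi} \<longrightarrow>
      (\<Sum>m<N. (real m * c m) * cos (real m * x)) - wderiv (sine_series c) x
      = (\<Sum>m<N. (real m * c m) * cos (real m * x)) - G x"
      using H(2) by eventually_elim simp
  qed (intro L2_diff cosine_sum_L2 G(1) H1_wderiv(1)[OF H(1)])+
  then show "(\<lambda>N. L2_norm (\<lambda>x. (\<Sum>m<N. (real m * c m) * cos (real m * x)) - wderiv (sine_series c) x)) \<longlonglongrightarrow> 0"
    using G(2) by simp
qed

text \<open>Bessel's inequality for the weak derivative, whose cosine coefficients are
  \<open>m\<close> times the sine coefficients of \<open>f\<close>.\<close>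

lemma odd_H1_summable:
  assumes "f \<in> odd_H1"
  shows "summable (\<lambda>m. (real m * sine_coeff f m)\<^sup>2)"
proof -
  have f: "f \<in> H1" using assms by (simp add: odd_H1_def)
  have "summable (\<lambda>m. (if m = 0 then 2 * pi else pi) * (real m * sine_coeff f m)\<^sup>2)"
    by (rule bessel(1)[where e = "\<lambda>m x. cos (real m * x)", OF _ L2_inner_cos_cos H1_wderiv(1)[OF f]])
       (auto simp: weak_deriv_cos[OF H1_wderiv(2)[OF f]] sine_coeff_def)
  then have "summable (\<lambda>m. (1/pi) * ((if m = 0 then 2 * pi else pi) * (real m * sine_coeff f m)\<^sup>2))"
    by (rule summable_mult)
  moreover have "(\<lambda>m. (1/pi) * ((if m = 0 then 2 * pi else pi) * (real m * sine_coeff f m)\<^sup>2))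
      = (\<lambda>m. (real m * sine_coeff f m)\<^sup>2)" by auto
  ultimately show ?thesis by (simp only:)
qed

text \<open>Both sides have the same Fourier coefficients, and both are continuous, so the identity
  holds at every point.\<close>

lemma odd_H1_series:
  assumes "f \<in> odd_H1"
  shows "f = sine_series (sine_coeff f)"
proof -
  have f: "f \<in> H1" using assms by (simp add: odd_H1_def)
  note s = summable_abs_sine_coeffs[OF odd_H1_summable[OF assms]]
  let ?h = "\<lambda>x. f x - sine_series (sine_coeff f) x"
  have "AE x in lborel. x \<in> {-pi..pi} \<longrightarrow> ?h x = 0"
  proof (rule trig_complete)
    show "?h \<in> L2" by (intro L2_diff H1_L2[OF f] sine_series_L2[OF s])
    show "L2_inner ?h (\<lambda>x. cos (real m * x)) = 0" for m
      by (rule odd_inner_cos) (use assms sine_series_odd[OF s] in \<open>simp add: odd_H1_def\<close>)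
    have "L2_inner (sine_series (sine_coeff f)) (\<lambda>x. sin (real m * x)) = L2_inner f (\<lambda>x. sin (real m * x))" for m
      using sine_coeff_sine_series[OF s sine_coeff_0, of m]
      unfolding sine_coeff_def[of "sine_series (sine_coeff f)" m] sine_coeff_def[of f m] by simp
    then show "L2_inner ?h (\<lambda>x. sin (real m * x)) = 0" for m
      by (simp add: L2_inner_diff_left H1_L2[OF f] sine_series_L2[OF s])
  qed
  then have "?h x = 0" for x
  proof (rule continuous_AE_zero[rotated 2])
    have "continuous_on UNIV f" using f by (simp add: H1_def)
    then show "continuous_on UNIV ?h" by (intro continuous_intros sine_series_continuous[OF s])
    show "f (x + 2 * pi) - sine_series (sine_coeff f) (x + 2 * pi) = ?h x" for x
      using L2_periodic[OF H1_L2[OF f]] by (simp add: sine_series_periodic)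
  qed
  then show ?thesis by (simp add: fun_eq_iff)
qed

lemma odd_H1_wderiv_tendsto:
  assumes "f \<in> odd_H1"
  shows "(\<lambda>N. L2_norm (\<lambda>x. (\<Sum>m<N. (real m * sine_coeff f m) * cos (real m * x)) - wderiv f x)) \<longlonglongrightarrow> 0"
  using sine_series_odd_H1(2)[OF odd_H1_summable[OF assms]] odd_H1_series[OF assms] by simp

lemma odd_H1_wderiv_norm:
  assumes "f \<in> odd_H1"
  shows "(L2_norm (wderiv f))\<^sup>2 = pi * (\<Sum>m. (real m * sine_coeff f m)\<^sup>2)"
proof -
  have f: "f \<in> H1" using assms by (simp add: odd_H1_def)
  have "(\<lambda>N. (L2_norm (\<lambda>x. \<Sum>m<N. (real m * sine_coeff f m) * cos (real m * x)))\<^sup>2) \<longlonglongrightarrow> (L2_norm (wderiv f))\<^sup>2"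
    by (intro tendsto_intros L2_norm_tendsto[OF cosine_sum_L2 H1_wderiv(1)[OF f] odd_H1_wderiv_tendsto[OF assms]])
  moreover have "(L2_norm (\<lambda>x. \<Sum>m<N. (real m * sine_coeff f m) * cos (real m * x)))\<^sup>2
     = pi * (\<Sum>m<N. (real m * sine_coeff f m)\<^sup>2)" for N
    by (rule cosine_sum_norm) simp
  moreover have "(\<lambda>N. pi * (\<Sum>m<N. (real m * sine_coeff f m)\<^sup>2)) \<longlonglongrightarrow> pi * (\<Sum>m. (real m * sine_coeff f m)\<^sup>2)"
    by (intro tendsto_intros summable_LIMSEQ odd_H1_summable[OF assms])
  ultimately show ?thesis by (simp add: LIMSEQ_unique)
qed

lemma odd_H1_linear:
  assumes "f \<in> odd_H1" "h \<in> odd_H1"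
  shows "(\<lambda>x. a * f x + b * h x) \<in> odd_H1"
    "AE x in lborel. x \<in> {-pi..pi} \<longrightarrow> wderiv (\<lambda>x. a * f x + b * h x) x = a * wderiv f x + b * wderiv h x"
    "sine_coeff (\<lambda>x. a * f x + b * h x) m = a * sine_coeff f m + b * sine_coeff h m"
proof -
  have H: "f \<in> H1" "h \<in> H1" using assms by (auto simp: odd_H1_def)
  show "(\<lambda>x. a * f x + b * h x) \<in> odd_H1"
    using assms H1_linear(1)[OF H] by (simp add: odd_H1_def)
  show "AE x in lborel. x \<in> {-pi..pi} \<longrightarrow> wderiv (\<lambda>x. a * f x + b * h x) x = a * wderiv f x + b * wderiv h x"
    by (rule H1_linear(2)[OF H])
  show "sine_coeff (\<lambda>x. a * f x + b * h x) m = a * sine_coeff f m + b * sine_coeff h m"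
    using H1_L2[OF H(1)] H1_L2[OF H(2)]
    by (simp add: sine_coeff_def L2_inner_add_left L2_inner_scale_left L2_scale add_divide_distrib)
qed

lemma odd_H1_L2: "f \<in> odd_H1 \<Longrightarrow> f \<in> L2"
  by (simp add: odd_H1_def H1_L2)

lemma odd_H1_wderiv_L2: "f \<in> odd_H1 \<Longrightarrow> wderiv f \<in> L2"
  by (simp add: odd_H1_def H1_wderiv)

lemma odd_H1_coeffs_bound:
  assumes "f \<in> odd_H1"
  shows "(\<Sum>m. \<bar>sine_coeff f m\<bar>) \<le> sqrt (zeta2 / pi) * L2_norm (wderiv f)"
proof -
  have "(\<Sum>m. (real m * sine_coeff f m)\<^sup>2) = (L2_norm (wderiv f))\<^sup>2 / pi"
    using odd_H1_wderiv_norm[OF assms] by simp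
  then show ?thesis
    using suminf_abs_sine_coeffs[OF odd_H1_summable[OF assms]]
    by (simp add: real_sqrt_divide)
qed

section \<open>The Hilbert transform and the velocity\<close>

text \<open>\<open>pv_coeff m \<epsilon>\<close> is \<open>\<integral>\<^sub>\<epsilon>\<^sup>\<pi> cot (s / 2) sin (m s) ds\<close>, by the recursion
  \<open>cot (s / 2) (sin ((m + 1) s) - sin (m s)) = cos ((m + 1) s) + cos (m s)\<close>.\<close>

fun pv_coeff :: "nat \<Rightarrow> real \<Rightarrow> real" where
  "pv_coeff 0 \<epsilon> = 0"
| "pv_coeff (Suc m) \<epsilon> = pv_coeff m \<epsilon> - sin (real (Suc m) * \<epsilon>) / real (Suc m)
     + (if m = 0 then pi - \<epsilon> else - sin (real m * \<epsilon>) / real m)"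

lemma pv_coeff_0: "m > 0 \<Longrightarrow> pv_coeff m 0 = pi"
proof (induction m)
  case (Suc m)
  then show ?case by (cases "m = 0") auto
qed simp

lemma continuous_on_pv_coeff: "continuous_on S (pv_coeff m)"
proof (induction m)
  case (Suc m)
  show ?case
  proof (cases "m = 0")
    case True
    then show ?thesis by (simp add: continuous_intros)
  next
    case False
    then have "pv_coeff (Suc m) = (\<lambda>\<epsilon>. pv_coeff m \<epsilon> - sin (real (Suc m) * \<epsilon>) / real (Suc m) + (- sin (real m * \<epsilon>) / real m))"
      by (simp add: fun_eq_iff)
    moreover have "continuous_on S (\<lambda>\<epsilon>. pv_coeff m \<epsilon> - sin (real (Suc m) * \<epsilon>) / real (Suc m) + (- sin (real m * \<epsilon>) / real m))"
      using Suc False by (intro continuous_intros) auto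
    ultimately show ?thesis by simp
  qed
qed (simp add: pv_coeff.simps(1)[abs_def])

text \<open>From the second step on, the recursion adds two terms of sizes \<open>1 / Suc m\<close>
  and \<open>1 / m\<close>. This crude logarithmic bound suffices because it is uniform in
  \<epsilon>.\<close>

lemma pv_coeff_bound:
  assumes "0 \<le> \<epsilon>" "\<epsilon> \<le> pi"
  shows "\<bar>pv_coeff m \<epsilon>\<bar> \<le> pi + harm m + harm (m - 1)"
proof (induction m)
  case (Suc m)
  have *: "\<bar>sin x / real k\<bar> \<le> 1 / real k" for x k
    by (simp add: divide_right_mono)
  show ?case
  proof (cases "m = 0")
    case True
    have "\<bar>pi - \<epsilon> - sin \<epsilon>\<bar> \<le> pi + 1"
      using assms sin_le_one[of \<epsilon>] sin_ge_minus_one[of \<epsilon>] pi_ge_two by linarith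
    then show ?thesis using True by (simp add: harm_def algebra_simps)
  next
    case False
    then obtain k where k: "m = Suc k" by (cases m) auto
    have "harm (Suc m) = harm m + 1 / real (Suc m)" "harm m = harm (m - 1) + 1 / real m"
      using k by (simp_all add: harm_Suc inverse_eq_divide)
    moreover define A B where "A = sin (real (Suc m) * \<epsilon>) / real (Suc m)" and "B = sin (real m * \<epsilon>) / real m"
    moreover have "\<bar>A\<bar> \<le> 1 / real (Suc m)" "\<bar>B\<bar> \<le> 1 / real m"
      unfolding A_def B_def by (rule *)+
    moreover have "pv_coeff (Suc m) \<epsilon> = pv_coeff m \<epsilon> - A - B" using False by (simp add: A_def B_def)
    ultimately show ?thesis using Suc by (simp only: diff_Suc_1) linarith
  qed
qed (simp add: harm_def)

text \<open>The constant 10 is 2 * (4 + 1): there are two harmonic sums, each at most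
  \<open>ln m + 1\<close>, and \<open>ln m\<close> is at most
  \<open>4 * m powr (1/4)\<close>.\<close>

lemma pv_coeff_bound_powr:
  assumes "0 \<le> \<epsilon>" "\<epsilon> \<le> pi" "m > 0"
  shows "\<bar>pv_coeff m \<epsilon>\<bar> \<le> (pi + 10) * real m powr (1/4)"
proof -
  have "harm (m - 1) \<le> (harm m :: real)" by (rule harm_mono) simp
  moreover have "harm m \<le> ln (real m) + 1"
    using decseqD[OF decseq_harm_diff_ln, of 0 "m - 1"] assms(3) by (simp add: harm_def)
  moreover have "ln (real m) \<le> 4 * real m powr (1/4)"
    using ln_powr_bound[of "real m" "1/4"] assms(3) by simp
  moreover have "1 \<le> real m powr (1/4)" using assms(3) by (intro ge_one_powr_ge_zero) auto
  moreover have "pi \<le> pi * real m powr (1/4)" using mult_left_mono[OF calculation(4), of pi] by simp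
  ultimately show ?thesis using pv_coeff_bound[OF assms(1,2), of m]
    unfolding distrib_right by linarith
qed

lemma integral_cos_tail:
  assumes "0 \<le> \<epsilon>" "\<epsilon> \<le> pi"
  shows "(LBINT s:{\<epsilon>..pi}. cos (real m * s)) = (if m = 0 then pi - \<epsilon> else - sin (real m * \<epsilon>) / real m)"
proof (cases "m = 0")
  case True
  then show ?thesis using assms by (simp add: set_lebesgue_integral_def)
next
  case False
  have "(LBINT s:{\<epsilon>..pi}. cos (real m * s)) = sin (real m * pi) / real m - sin (real m * \<epsilon>) / real m"
    unfolding set_lebesgue_integral_def using False assms
    by (intro integral_FTC_atLeastAtMost)
       (auto intro!: derivative_eq_intros continuous_intros
             simp: has_real_derivative_iff_has_vector_derivative[symmetric])
  then show ?thesis using False by simp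
qed

lemma continuous_on_cot_half: "0 < \<epsilon> \<Longrightarrow> continuous_on {\<epsilon>..pi} (\<lambda>s::real. cot (s / 2))"
  unfolding cot_def
proof (intro continuous_intros ballI)
  fix s assume "0 < \<epsilon>" "s \<in> {\<epsilon>..pi}"
  then have "sin (s / 2) > 0" by (intro sin_gt_zero) auto
  then show "sin (s / 2) \<noteq> 0" by simp
qed auto

lemma integral_cot_sin:
  assumes "0 < \<epsilon>" "\<epsilon> \<le> pi"
  shows "(LBINT s:{\<epsilon>..pi}. cot (s / 2) * sin (real m * s)) = pv_coeff m \<epsilon>"
proof (induction m)
  case (Suc m)
  have eq: "cot (s / 2) * sin (real (Suc m) * s) = cot (s / 2) * sin (real m * s)
      + (cos (real (Suc m) * s) + cos (real m * s))" if "s \<in> {\<epsilon>..pi}" for s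
  proof -
    have "sin (s / 2) > 0" using assms that by (intro sin_gt_zero) auto
    moreover have "sin (real (Suc m) * s) - sin (real m * s) = 2 * sin (s / 2) * cos ((real m + 1/2) * s)"
      by (subst sin_diff_sin) (simp add: algebra_simps add_divide_distrib)
    moreover have "cos (real (Suc m) * s) + cos (real m * s) = 2 * cos ((real m + 1/2) * s) * cos (s / 2)"
      by (subst cos_plus_cos) (simp add: algebra_simps add_divide_distrib)
    ultimately have "cot (s / 2) * (sin (real (Suc m) * s) - sin (real m * s)) = cos (real (Suc m) * s) + cos (real m * s)"
      by (simp add: cot_def)
    then show ?thesis by (simp only: right_diff_distrib)
  qed
  have i1: "set_integrable lborel {\<epsilon>..pi} (\<lambda>s. cot (s / 2) * sin (real m * s))"
    by (intro borel_integrable_atLeastAtMost' continuous_intros continuous_on_cot_half assms)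
  have i2: "set_integrable lborel {\<epsilon>..pi} (\<lambda>s. cos (real k * s))" for k
    by (intro borel_integrable_atLeastAtMost' continuous_intros)
  have "(LBINT s:{\<epsilon>..pi}. cot (s / 2) * sin (real (Suc m) * s))
     = (LBINT s:{\<epsilon>..pi}. cot (s / 2) * sin (real m * s) + (cos (real (Suc m) * s) + cos (real m * s)))"
    by (rule set_lebesgue_integral_cong) (use eq in auto)
  also have "\<dots> = (LBINT s:{\<epsilon>..pi}. cot (s / 2) * sin (real m * s))
     + ((LBINT s:{\<epsilon>..pi}. cos (real (Suc m) * s)) + (LBINT s:{\<epsilon>..pi}. cos (real m * s)))"
    by (simp only: set_integral_add(2)[OF i1 set_integral_add(1)[OF i2 i2]] set_integral_add(2)[OF i2 i2])
  finally show ?case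
    using assms Suc integral_cos_tail[of \<epsilon> "Suc m"] integral_cos_tail[of \<epsilon> m] by simp
qed (simp add: set_lebesgue_integral_def)

text \<open>The reflection of the half period beyond \<theta> uses that \<open>cot\<close> is odd,
  and turns the principal value into an integral of symmetric differences.\<close>

lemma pv_integral_split:
  assumes h: "continuous_on UNIV h" and \<epsilon>: "0 < \<epsilon>" "\<epsilon> \<le> pi"
  shows "(LBINT \<phi>:{\<phi> \<in> {\<theta> - pi..\<theta> + pi}. \<epsilon> \<le> \<bar>\<theta> - \<phi>\<bar>}. cot ((\<theta> - \<phi>) / 2) * h \<phi>)
     = (LBINT s:{\<epsilon>..pi}. cot (s / 2) * (h (\<theta> - s) - h (\<theta> + s)))"
proof -
  let ?S = "{\<phi> \<in> {\<theta> - pi..\<theta> + pi}. \<epsilon> \<le> \<bar>\<theta> - \<phi>\<bar>}"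
  have i: "set_integrable lborel {\<epsilon>..pi} (\<lambda>s. cot (s / 2) * h (\<theta> + c * s))" for c
    by (intro borel_integrable_atLeastAtMost' continuous_intros continuous_on_cot_half \<epsilon>
        continuous_on_compose2[OF h]) auto
  have i1: "integrable lborel (\<lambda>s. indicator {\<epsilon>..pi} s *\<^sub>R (cot (s / 2) * h (\<theta> - s)))"
    using i[of "-1"] by (simp add: set_integrable_def)
  have i2: "integrable lborel (\<lambda>s. indicator {\<epsilon>..pi} s *\<^sub>R (cot (s / 2) * h (\<theta> + s)))"
    using i[of 1] by (simp add: set_integrable_def)
  have i3: "integrable lborel (\<lambda>s. indicator {\<epsilon>..pi} (- s) *\<^sub>R (cot (- s / 2) * h (\<theta> - s)))"
    using lborel_integrable_real_affine[OF i2, of "-1" 0] by simp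
  have "(LBINT \<phi>:?S. cot ((\<theta> - \<phi>) / 2) * h \<phi>)
     = (\<integral>s. indicator ?S (\<theta> + (-1) * s) *\<^sub>R (cot ((\<theta> - (\<theta> + (-1) * s)) / 2) * h (\<theta> + (-1) * s)) \<partial>lborel)"
    unfolding set_lebesgue_integral_def
    by (subst lborel_integral_real_affine[where c = "-1" and t = \<theta>]) auto
  also have "\<dots> = (\<integral>s. indicator {\<epsilon>..pi} s *\<^sub>R (cot (s / 2) * h (\<theta> - s))
      - indicator {\<epsilon>..pi} (- s) *\<^sub>R (cot (- s / 2) * h (\<theta> - s)) \<partial>lborel)"
    by (rule Bochner_Integration.integral_cong) (use \<epsilon> in \<open>auto simp: indicator_def cot_minus\<close>)
  also have "\<dots> = (\<integral>s. indicator {\<epsilon>..pi} s *\<^sub>R (cot (s / 2) * h (\<theta> - s)) \<partial>lborel)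
      - (\<integral>s. indicator {\<epsilon>..pi} (- s) *\<^sub>R (cot (- s / 2) * h (\<theta> - s)) \<partial>lborel)"
    by (rule Bochner_Integration.integral_diff[OF i1 i3])
  also have "(\<integral>s. indicator {\<epsilon>..pi} (- s) *\<^sub>R (cot (- s / 2) * h (\<theta> - s)) \<partial>lborel)
     = (\<integral>s. indicator {\<epsilon>..pi} s *\<^sub>R (cot (s / 2) * h (\<theta> + s)) \<partial>lborel)"
    by (subst lborel_integral_real_affine[where c = "-1" and t = 0]) auto
  also have "(\<integral>s. indicator {\<epsilon>..pi} s *\<^sub>R (cot (s / 2) * h (\<theta> - s)) \<partial>lborel)
      - (\<integral>s. indicator {\<epsilon>..pi} s *\<^sub>R (cot (s / 2) * h (\<theta> + s)) \<partial>lborel)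
     = (\<integral>s. indicator {\<epsilon>..pi} s *\<^sub>R (cot (s / 2) * h (\<theta> - s)) - indicator {\<epsilon>..pi} s *\<^sub>R (cot (s / 2) * h (\<theta> + s)) \<partial>lborel)"
    by (rule Bochner_Integration.integral_diff[OF i1 i2, symmetric])
  also have "\<dots> = (LBINT s:{\<epsilon>..pi}. cot (s / 2) * (h (\<theta> - s) - h (\<theta> + s)))"
    unfolding set_lebesgue_integral_def
    by (rule Bochner_Integration.integral_cong) (auto simp: algebra_simps)
  finally show ?thesis .
qed

text \<open>Away from the singularity the kernel is bounded, so the series may be integrated term by
  term. The symmetric difference of \<open>sin (m * x)\<close> about \<theta> is
  \<open>- 2 * cos (m * \<theta>) * sin (m * s)\<close>.\<close>

lemma pv_integral_sine_series:
  assumes c: "summable (\<lambda>m. \<bar>c m\<bar>)" and \<epsilon>: "0 < \<epsilon>" "\<epsilon> \<le> pi"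
  shows "(LBINT \<phi>:{\<phi> \<in> {\<theta> - pi..\<theta> + pi}. \<epsilon> \<le> \<bar>\<theta> - \<phi>\<bar>}. cot ((\<theta> - \<phi>) / 2) * sine_series c \<phi>)
     = (\<Sum>m. (- 2 * c m * cos (real m * \<theta>)) * pv_coeff m \<epsilon>)"
proof -
  define F where "F = (\<lambda>m s. cot (s / 2) * (- 2 * c m * cos (real m * \<theta>) * sin (real m * s)))"
  obtain B where B: "\<And>s. s \<in> {\<epsilon>..pi} \<Longrightarrow> norm (cot (s / 2)) \<le> B" "B \<ge> 0"
  proof -
    have "bounded ((\<lambda>s. cot (s / 2)) ` {\<epsilon>..pi})"
      by (intro compact_imp_bounded compact_continuous_image continuous_on_cot_half \<epsilon> compact_Icc)
    then obtain B where "\<And>s. s \<in> {\<epsilon>..pi} \<Longrightarrow> norm (cot (s / 2)) \<le> B" unfolding bounded_iff by blast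
    then show ?thesis by (intro that[of "\<bar>B\<bar>"]) force+
  qed
  have Fb: "norm (F m s) \<le> 2 * B * \<bar>c m\<bar>" if "s \<in> {\<epsilon>..pi}" for m s
  proof -
    have "norm (F m s) = \<bar>cot (s / 2)\<bar> * (2 * \<bar>c m\<bar> * (\<bar>cos (real m * \<theta>)\<bar> * \<bar>sin (real m * s)\<bar>))"
      by (simp add: F_def abs_mult)
    also have "\<dots> \<le> B * (2 * \<bar>c m\<bar> * (1 * 1))"
      using B that by (intro mult_mono mult_left_mono) auto
    finally show ?thesis by (simp add: mult_ac)
  qed
  have Fi: "set_integrable lborel {\<epsilon>..pi} (F m)" for m
    unfolding F_def by (intro borel_integrable_atLeastAtMost' continuous_intros continuous_on_cot_half \<epsilon>)
  have Fint: "(LBINT s:{\<epsilon>..pi}. F m s) = (- 2 * c m * cos (real m * \<theta>)) * pv_coeff m \<epsilon>" for m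
  proof -
    have "(LBINT s:{\<epsilon>..pi}. F m s) = (LBINT s:{\<epsilon>..pi}. (- 2 * c m * cos (real m * \<theta>)) * (cot (s / 2) * sin (real m * s)))"
      by (rule set_lebesgue_integral_cong) (auto simp: F_def)
    then show ?thesis using integral_cot_sin[OF \<epsilon>, of m] by (simp only: set_integral_mult_right)
  qed
  have ser: "(\<lambda>m. F m s) sums (cot (s / 2) * (sine_series c (\<theta> - s) - sine_series c (\<theta> + s)))" for s
  proof -
    have s: "(\<lambda>m. c m * sin (real m * x)) sums sine_series c x" for x
      unfolding sine_series_def using trig_series_uniform(2)[OF c, of sin] by (simp add: summable_sums)
    have "(\<lambda>m. cot (s / 2) * (c m * sin (real m * (\<theta> - s)) - c m * sin (real m * (\<theta> + s))))
       sums (cot (s / 2) * (sine_series c (\<theta> - s) - sine_series c (\<theta> + s)))"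
      by (intro sums_mult sums_diff s)
    moreover have "cot (s / 2) * (c m * sin (real m * (\<theta> - s)) - c m * sin (real m * (\<theta> + s))) = F m s" for m
      by (simp add: F_def right_diff_distrib distrib_left sin_diff sin_add algebra_simps)
    ultimately show ?thesis by simp
  qed
  have "(\<lambda>m. \<integral>s. indicator {\<epsilon>..pi} s *\<^sub>R F m s \<partial>lborel) sums
      (\<integral>s. (\<Sum>m. indicator {\<epsilon>..pi} s *\<^sub>R F m s) \<partial>lborel)"
  proof (rule sums_integral)
    show "integrable lborel (\<lambda>s. indicator {\<epsilon>..pi} s *\<^sub>R F m s)" for m
      using Fi by (simp add: set_integrable_def)
    show "AE s in lborel. summable (\<lambda>m. norm (indicator {\<epsilon>..pi} s *\<^sub>R F m s))"
    proof (rule AE_I2)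
      fix s show "summable (\<lambda>m. norm (indicator {\<epsilon>..pi} s *\<^sub>R F m s))"
        by (rule summable_comparison_test'[OF summable_mult[OF c, of "2 * B"]])
           (use Fb B in \<open>auto simp: indicator_def\<close>)
    qed
    show "summable (\<lambda>m. \<integral>s. norm (indicator {\<epsilon>..pi} s *\<^sub>R F m s) \<partial>lborel)"
    proof (rule summable_comparison_test'[OF summable_mult[OF c, of "2 * B * pi"]])
      fix m
      have "(\<integral>s. norm (indicator {\<epsilon>..pi} s *\<^sub>R F m s) \<partial>lborel) \<le> (\<integral>s. indicator {\<epsilon>..pi} s *\<^sub>R (2 * B * \<bar>c m\<bar>) \<partial>lborel)"
      proof (rule integral_mono)
        show "integrable lborel (\<lambda>s. norm (indicator {\<epsilon>..pi} s *\<^sub>R F m s))"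
          using Fi[of m] unfolding set_integrable_def by (rule integrable_norm)
        show "integrable lborel (\<lambda>s. indicator {\<epsilon>..pi} s *\<^sub>R (2 * B * \<bar>c m\<bar>))"
          using borel_integrable_atLeastAtMost'[of \<epsilon> pi "\<lambda>_. 2 * B * \<bar>c m\<bar>"] by (simp add: set_integrable_def)
      qed (use Fb in \<open>auto simp: indicator_def\<close>)
      also have "\<dots> = (pi - \<epsilon>) * (2 * B * \<bar>c m\<bar>)" using \<epsilon> by simp
      also have "\<dots> \<le> pi * (2 * B * \<bar>c m\<bar>)" using \<epsilon> B by (intro mult_right_mono) auto
      finally show "norm (\<integral>s. norm (indicator {\<epsilon>..pi} s *\<^sub>R F m s) \<partial>lborel) \<le> 2 * B * pi * \<bar>c m\<bar>"
        by (simp add: mult_ac)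
    qed
  qed
  moreover have "(\<Sum>m. indicator {\<epsilon>..pi} s *\<^sub>R F m s)
      = indicator {\<epsilon>..pi} s *\<^sub>R (cot (s / 2) * (sine_series c (\<theta> - s) - sine_series c (\<theta> + s)))" for s
    using sums_unique[OF sums_mult[OF ser, of "indicator {\<epsilon>..pi} s"]] by simp
  ultimately have "(\<lambda>m. (- 2 * c m * cos (real m * \<theta>)) * pv_coeff m \<epsilon>) sums
     (LBINT s:{\<epsilon>..pi}. cot (s / 2) * (sine_series c (\<theta> - s) - sine_series c (\<theta> + s)))"
    using Fint unfolding set_lebesgue_integral_def by simp
  then show ?thesis
    using pv_integral_split[OF sine_series_continuous[OF c] \<epsilon>] by (simp add: sums_iff)
qed

text \<open>As functions of the truncation \<epsilon> the integrals form a uniformly convergent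
  series of continuous functions up to \<epsilon> = 0. The principal value is therefore the value of
  the series at 0, where every \<open>pv_coeff\<close> with positive index equals pi.\<close>

lemma hilbert_sine_series:
  assumes c: "summable (\<lambda>m. (real m * c m)\<^sup>2)" "c 0 = 0"
  shows "hilbert (sine_series c) \<theta> = - cosine_series c \<theta>"
proof -
  note s = summable_abs_sine_coeffs[OF c(1)]
  define T where "T = (\<lambda>\<epsilon>. \<Sum>m. (- 2 * c m * cos (real m * \<theta>)) * pv_coeff m \<epsilon>)"
  have bd: "norm ((- 2 * c m * cos (real m * \<theta>)) * pv_coeff m \<epsilon>) \<le> 2 * (pi + 10) * (\<bar>c m\<bar> * real m powr (1/4))"
    if "\<epsilon> \<in> {0..pi}" for m \<epsilon>
  proof (cases "m = 0")
    case False
    have "norm ((- 2 * c m * cos (real m * \<theta>)) * pv_coeff m \<epsilon>) = (2 * \<bar>c m\<bar> * \<bar>cos (real m * \<theta>)\<bar>) * \<bar>pv_coeff m \<epsilon>\<bar>"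
      by (simp add: abs_mult)
    also have "\<dots> \<le> (2 * \<bar>c m\<bar> * 1) * ((pi + 10) * real m powr (1/4))"
      using that False by (intro mult_mono mult_left_mono pv_coeff_bound_powr) auto
    finally show ?thesis by (simp only: mult_ac)
  qed (simp add: c(2))
  have unif: "uniform_limit {0..pi} (\<lambda>N \<epsilon>. \<Sum>m<N. (- 2 * c m * cos (real m * \<theta>)) * pv_coeff m \<epsilon>) T sequentially"
    unfolding T_def by (rule Weierstrass_m_test[OF bd summable_mult[OF summable_sine_coeffs[OF c(1)]]])
  have cont: "continuous_on {0..pi} T"
    by (rule uniform_limit_theorem[OF _ unif])
       (auto intro!: always_eventually continuous_intros continuous_on_pv_coeff)
  have "(T \<longlongrightarrow> T 0) (at 0 within {0..pi})"
    using cont pi_ge_zero unfolding continuous_on_def by auto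
  then have "(T \<longlongrightarrow> T 0) (at_right 0)"
    by (simp add: at_within_Icc_at_right)
  moreover have "eventually (\<lambda>\<epsilon>. (LBINT \<phi>:{\<phi> \<in> {\<theta> - pi..\<theta> + pi}. \<epsilon> \<le> \<bar>\<theta> - \<phi>\<bar>}. cot ((\<theta> - \<phi>) / 2) * sine_series c \<phi>) = T \<epsilon>) (at_right 0)"
    using eventually_at_right_real[OF pi_gt_zero]
  proof eventually_elim
    case (elim \<epsilon>)
    then show ?case unfolding T_def by (intro pv_integral_sine_series[OF s]) auto
  qed
  ultimately have "((\<lambda>\<epsilon>. LBINT \<phi>:{\<phi> \<in> {\<theta> - pi..\<theta> + pi}. \<epsilon> \<le> \<bar>\<theta> - \<phi>\<bar>}. cot ((\<theta> - \<phi>) / 2) * sine_series c \<phi>) \<longlongrightarrow> T 0) (at_right 0)"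
    by (simp add: tendsto_cong)
  then have "hilbert (sine_series c) \<theta> = 1 / (2 * pi) * T 0"
    unfolding hilbert_def by (simp add: tendsto_Lim)
  moreover have "T 0 = (\<Sum>m. (- 2 * pi) * (c m * cos (real m * \<theta>)))"
    unfolding T_def by (rule suminf_cong) (use pv_coeff_0 c(2) in \<open>case_tac "n = 0"; simp\<close>)
  moreover have "\<dots> = (- 2 * pi) * cosine_series c \<theta>"
    unfolding cosine_series_def using trig_series_uniform(2)[OF s, of cos] by (intro suminf_mult) simp
  ultimately show ?thesis by simp
qed

lemma sine_series_has_derivative:
  assumes "summable (\<lambda>m. \<bar>c m\<bar>)" "c 0 = 0"
  shows "(sine_series (\<lambda>m. c m / real m) has_real_derivative cosine_series c x) (at x)"
proof -
  have "\<exists>g. \<forall>x\<in>UNIV. (\<lambda>m. c m / real m * sin (real m * x)) sums g x \<and>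
     (g has_field_derivative cosine_series c x) (at x within UNIV)"
  proof (rule has_field_derivative_series)
    show "((\<lambda>x. c m / real m * sin (real m * x)) has_field_derivative c m * cos (real m * x)) (at x within UNIV)" for m x
      using assms(2) by (cases "m = 0") (auto intro!: derivative_eq_intros)
    show "uniform_limit UNIV (\<lambda>N x. \<Sum>m<N. c m * cos (real m * x)) (cosine_series c) sequentially"
      by (rule cosine_series_uniform[OF assms(1)])
    show "summable (\<lambda>m. c m / real m * sin (real m * 0))" by simp
  qed auto
  then obtain g where g: "\<And>x. (\<lambda>m. c m / real m * sin (real m * x)) sums g x"
    "\<And>x. (g has_field_derivative cosine_series c x) (at x)" by auto
  have "g = sine_series (\<lambda>m. c m / real m)"
    using g(1) by (auto simp: sine_series_def sums_iff fun_eq_iff)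
  then show ?thesis using g(2) by simp
qed

lemma vel_unique:
  assumes "v 0 = 0" "\<And>\<theta>. (v has_real_derivative hilbert f \<theta>) (at \<theta>)"
  shows "vel f = v"
  unfolding vel_def
proof (rule the_equality)
  fix w assume w: "w 0 = 0 \<and> (\<forall>\<theta>. (w has_real_derivative hilbert f \<theta>) (at \<theta>))"
  have "((\<lambda>\<theta>. w \<theta> - v \<theta>) has_real_derivative 0) (at \<theta>)" for \<theta>
    using DERIV_diff[of w "hilbert f \<theta>" \<theta> UNIV v "hilbert f \<theta>"] w assms(2) by simp
  then have "w \<theta> - v \<theta> = w 0 - v 0" for \<theta> by (intro DERIV_isconst_all) auto
  then show "w = v" using w assms(1) by (simp add: fun_eq_iff)
qed (use assms in auto)

lemma odd_H1_hilbert: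
  assumes "f \<in> odd_H1"
  shows "hilbert f = (\<lambda>\<theta>. - cosine_series (sine_coeff f) \<theta>)"
  using hilbert_sine_series[OF odd_H1_summable[OF assms] sine_coeff_0]
  unfolding odd_H1_series[OF assms, symmetric] by (rule ext)

lemma odd_H1_vel:
  assumes "f \<in> odd_H1"
  shows "vel f = (\<lambda>\<theta>. - sine_series (\<lambda>m. sine_coeff f m / real m) \<theta>)"
proof (rule vel_unique)
  note s = summable_abs_sine_coeffs[OF odd_H1_summable[OF assms]]
  show "- sine_series (\<lambda>m. sine_coeff f m / real m) 0 = 0" by (simp add: sine_series_def)
  show "((\<lambda>\<theta>. - sine_series (\<lambda>m. sine_coeff f m / real m) \<theta>) has_real_derivative hilbert f \<theta>) (at \<theta>)" for \<theta>
    unfolding odd_H1_hilbert[OF assms] by (intro DERIV_minus sine_series_has_derivative s) simp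
qed

section \<open>The right-hand side of the equation\<close>

text \<open>The constant of the embedding of \<open>odd_H1\<close> into the bounded functions:
  Cauchy-Schwarz against \<open>1 / m\<close> produces \<open>zeta2\<close>, Parseval for the
  derivative produces pi.\<close>

definition embed_const :: real where "embed_const = sqrt (zeta2 / pi)"

lemma embed_const_nonneg [simp]: "embed_const \<ge> 0"
  unfolding embed_const_def zeta2_def
  by (intro real_sqrt_ge_zero divide_nonneg_nonneg suminf_nonneg summable_inverse_squares) auto

lemma odd_H1_abs_summable: "f \<in> odd_H1 \<Longrightarrow> summable (\<lambda>m. \<bar>sine_coeff f m\<bar>)"
  by (intro summable_abs_sine_coeffs odd_H1_summable)

lemma odd_H1_bound:
  assumes "f \<in> odd_H1"
  shows "\<bar>f x\<bar> \<le> embed_const * L2_norm (wderiv f)"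
    and "\<bar>hilbert f x\<bar> \<le> embed_const * L2_norm (wderiv f)"
proof -
  note s = odd_H1_abs_summable[OF assms]
  note b = odd_H1_coeffs_bound[OF assms, folded embed_const_def]
  have "f x = sine_series (sine_coeff f) x" using odd_H1_series[OF assms] by (rule fun_cong)
  then show "\<bar>f x\<bar> \<le> embed_const * L2_norm (wderiv f)"
    using sine_series_bound[OF s, of x] b by linarith
  show "\<bar>hilbert f x\<bar> \<le> embed_const * L2_norm (wderiv f)"
    unfolding odd_H1_hilbert[OF assms] using cosine_series_bound[OF s, of x] b by linarith
qed

lemma odd_H1_norm_sums:
  assumes "f \<in> odd_H1"
  shows "summable (\<lambda>m. (sine_coeff f m)\<^sup>2)" "(L2_norm f)\<^sup>2 = pi * (\<Sum>m. (sine_coeff f m)\<^sup>2)"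
  using sine_series_norm[OF odd_H1_abs_summable[OF assms] sine_coeff_0]
  unfolding odd_H1_series[OF assms, symmetric] by auto

lemma odd_H1_hilbert_norm:
  assumes "f \<in> odd_H1"
  shows "L2_norm (hilbert f) = L2_norm f"
proof -
  have "(L2_norm (hilbert f))\<^sup>2 = pi * (\<Sum>m. (sine_coeff f m)\<^sup>2)"
    unfolding odd_H1_hilbert[OF assms] L2_norm_uminus
    by (rule cosine_series_norm[OF odd_H1_abs_summable[OF assms] sine_coeff_0])
  then have "(L2_norm (hilbert f))\<^sup>2 = (L2_norm f)\<^sup>2"
    using odd_H1_norm_sums(2)[OF assms] by simp
  then show ?thesis by simp
qed

text \<open>The velocity gains one derivative, so its supremum is controlled without any derivative
  of \<open>f\<close>. This is what keeps the stability estimate in L2 closed.\<close>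

lemma odd_H1_vel_bound:
  assumes "f \<in> odd_H1"
  shows "\<bar>vel f x\<bar> \<le> embed_const * L2_norm f"
proof -
  let ?c = "\<lambda>m. sine_coeff f m / real m"
  have eq: "(\<lambda>m. (real m * ?c m)\<^sup>2) = (\<lambda>m. (sine_coeff f m)\<^sup>2)"
  proof (rule ext)
    fix m show "(real m * ?c m)\<^sup>2 = (sine_coeff f m)\<^sup>2" by (cases "m = 0") auto
  qed
  have s: "summable (\<lambda>m. (real m * ?c m)\<^sup>2)" unfolding eq by (rule odd_H1_norm_sums(1)[OF assms])
  have "\<bar>vel f x\<bar> \<le> (\<Sum>m. \<bar>?c m\<bar>)"
    unfolding odd_H1_vel[OF assms] using sine_series_bound[OF summable_abs_sine_coeffs[OF s], of x] by simp
  also have "\<dots> \<le> sqrt zeta2 * sqrt (\<Sum>m. (sine_coeff f m)\<^sup>2)"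
    using suminf_abs_sine_coeffs[OF s] unfolding eq by simp
  also have "(\<Sum>m. (sine_coeff f m)\<^sup>2) = (L2_norm f)\<^sup>2 / pi"
    using odd_H1_norm_sums(2)[OF assms] by simp
  also have "sqrt zeta2 * sqrt ((L2_norm f)\<^sup>2 / pi) = embed_const * L2_norm f"
    by (simp add: embed_const_def real_sqrt_divide)
  finally show ?thesis .
qed

lemma odd_H1_poincare:
  assumes "f \<in> odd_H1"
  shows "L2_norm f \<le> L2_norm (wderiv f)"
proof (rule power2_le_imp_le)
  have "(\<Sum>m. (sine_coeff f m)\<^sup>2) \<le> (\<Sum>m. (real m * sine_coeff f m)\<^sup>2)"
  proof (rule suminf_le)
    fix m
    show "(sine_coeff f m)\<^sup>2 \<le> (real m * sine_coeff f m)\<^sup>2"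
    proof (cases "m = 0")
      case False
      then have "1 * (sine_coeff f m)\<^sup>2 \<le> (real m)\<^sup>2 * (sine_coeff f m)\<^sup>2"
        by (intro mult_right_mono) (auto simp: one_le_power)
      then show ?thesis by (simp add: power_mult_distrib)
    qed simp
  qed (use odd_H1_norm_sums(1)[OF assms] odd_H1_summable[OF assms] in auto)
  then show "(L2_norm f)\<^sup>2 \<le> (L2_norm (wderiv f))\<^sup>2"
    unfolding odd_H1_norm_sums(2)[OF assms] odd_H1_wderiv_norm[OF assms] by simp
qed simp

lemma odd_H1_vel_bound':
  "f \<in> odd_H1 \<Longrightarrow> \<bar>vel f x\<bar> \<le> embed_const * L2_norm (wderiv f)"
  using odd_H1_vel_bound[of f x] mult_left_mono[OF odd_H1_poincare[of f] embed_const_nonneg] by linarith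

lemma odd_H1_hilbert_continuous: "f \<in> odd_H1 \<Longrightarrow> continuous_on UNIV (hilbert f)"
  unfolding odd_H1_hilbert
  by (intro continuous_intros cosine_series_continuous odd_H1_abs_summable)

lemma odd_H1_hilbert_periodic: "f \<in> odd_H1 \<Longrightarrow> hilbert f (x + 2 * pi) = hilbert f x"
  unfolding odd_H1_hilbert by (simp add: cosine_series_periodic)

lemma odd_H1_vel_periodic: "f \<in> odd_H1 \<Longrightarrow> vel f (x + 2 * pi) = vel f x"
  unfolding odd_H1_vel by (simp add: sine_series_periodic)

lemma odd_H1_vel_deriv:
  assumes "f \<in> odd_H1"
  shows "(vel f has_real_derivative hilbert f x) (at x)"
  unfolding odd_H1_vel[OF assms] odd_H1_hilbert[OF assms]
  by (intro DERIV_minus sine_series_has_derivative odd_H1_abs_summable assms) simp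

lemma odd_H1_vel_continuous: "f \<in> odd_H1 \<Longrightarrow> continuous_on UNIV (vel f)"
  by (rule C1_continuous_on[OF odd_H1_vel_deriv])

lemma odd_H1_diff:
  assumes "f \<in> odd_H1" "h \<in> odd_H1"
  shows "(\<lambda>x. f x - h x) \<in> odd_H1"
    "AE x in lborel. x \<in> {-pi..pi} \<longrightarrow> wderiv (\<lambda>x. f x - h x) x = wderiv f x - wderiv h x"
    "sine_coeff (\<lambda>x. f x - h x) m = sine_coeff f m - sine_coeff h m"
  using odd_H1_linear[OF assms, of 1 "-1"] by simp_all

lemma odd_H1_wderiv_diff_norm:
  assumes "f \<in> odd_H1" "h \<in> odd_H1"
  shows "L2_norm (wderiv (\<lambda>x. f x - h x)) = L2_norm (\<lambda>x. wderiv f x - wderiv h x)"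
  by (rule L2_norm_AE_cong[OF odd_H1_diff(2)[OF assms]])
     (intro odd_H1_wderiv_L2 odd_H1_diff(1) L2_diff assms)+

lemma odd_H1_hilbert_diff:
  assumes "f \<in> odd_H1" "h \<in> odd_H1"
  shows "hilbert (\<lambda>x. f x - h x) \<theta> = hilbert f \<theta> - hilbert h \<theta>"
proof -
  have "cosine_series (\<lambda>m. sine_coeff f m - sine_coeff h m) \<theta> = cosine_series (sine_coeff f) \<theta> - cosine_series (sine_coeff h) \<theta>"
    unfolding cosine_series_def left_diff_distrib
    using trig_series_uniform(2)[OF odd_H1_abs_summable, of _ cos] assms
    by (intro suminf_diff[symmetric]) auto
  then show ?thesis
    unfolding odd_H1_hilbert[OF odd_H1_diff(1)[OF assms]] odd_H1_hilbert[OF assms(1)] odd_H1_hilbert[OF assms(2)]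
      odd_H1_diff(3)[OF assms, abs_def] by simp
qed

lemma odd_H1_vel_diff:
  assumes "f \<in> odd_H1" "h \<in> odd_H1"
  shows "vel (\<lambda>x. f x - h x) \<theta> = vel f \<theta> - vel h \<theta>"
proof -
  have "vel (\<lambda>x. f x - h x) = (\<lambda>\<theta>. vel f \<theta> - vel h \<theta>)"
  proof (rule vel_unique)
    show "vel f 0 - vel h 0 = 0"
      unfolding odd_H1_vel[OF assms(1)] odd_H1_vel[OF assms(2)] by (simp add: sine_series_def)
    show "((\<lambda>\<theta>. vel f \<theta> - vel h \<theta>) has_real_derivative hilbert (\<lambda>x. f x - h x) \<theta>) (at \<theta>)" for \<theta>
      unfolding odd_H1_hilbert_diff[OF assms] by (intro DERIV_diff odd_H1_vel_deriv assms)
  qed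
  then show ?thesis by simp
qed

definition rhs :: "(real \<Rightarrow> real) \<Rightarrow> real \<Rightarrow> real" where
  "rhs f \<theta> = hilbert f \<theta> * f \<theta> - vel f \<theta> * wderiv f \<theta> - lin_op f \<theta>"

text \<open>\<open>-sin 2\<theta>\<close> is a steady state of the full equation, whose quadratic right-hand side is
  evaluated here at \<open>f - sin 2\<theta>\<close>.\<close>

lemma rhs_eq:
  "rhs f \<theta> = (hilbert f \<theta> + cos (2 * \<theta>)) * (f \<theta> - sin (2 * \<theta>))
     - (vel f \<theta> + 1/2 * sin (2 * \<theta>)) * (wderiv f \<theta> - 2 * cos (2 * \<theta>))"
  by (simp add: rhs_def lin_op_def algebra_simps)

section \<open>Multiplication operators and Lipschitz bounds for the right-hand side\<close>

lemma L2_norm_mult_continuous: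
  assumes "f \<in> L2" "continuous_on UNIV p" "\<And>x. p (x + 2 * pi) = p x" "\<And>x. \<bar>p x\<bar> \<le> B"
  shows "(\<lambda>x. p x * f x) \<in> L2" "L2_norm (\<lambda>x. p x * f x) \<le> B * L2_norm f"
proof -
  note m = borel_measurable_continuous_onI[OF assms(2)]
  show "(\<lambda>x. p x * f x) \<in> L2" by (rule L2_mult_bounded[OF assms(1) m]) (rule assms)+
  show "L2_norm (\<lambda>x. p x * f x) \<le> B * L2_norm f"
    by (rule L2_norm_mult_bounded[OF assms(1) m]) (rule assms)+
qed

lemma odd_H1_continuous: "f \<in> odd_H1 \<Longrightarrow> continuous_on UNIV f"
  by (simp add: odd_H1_def H1_def)

lemma odd_H1_periodic: "f \<in> odd_H1 \<Longrightarrow> f (x + 2 * pi) = f x"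
  by (rule L2_periodic[OF odd_H1_L2])

lemma sin_cos_double_periodic: "sin (2 * (x + 2 * pi)) = sin (2 * x)" "cos (2 * (x + 2 * pi)) = cos (2 * x)"
  by (rule sin_periodic_int cos_periodic_int, simp)+

lemma multiplier_vorticity:
  assumes "f \<in> odd_H1"
  shows "continuous_on UNIV (\<lambda>x. f x - sin (2 * x))" "f (x + 2 * pi) - sin (2 * (x + 2 * pi)) = f x - sin (2 * x)"
    "\<bar>f x - sin (2 * x)\<bar> \<le> embed_const * L2_norm (wderiv f) + 1"
proof -
  show "continuous_on UNIV (\<lambda>x. f x - sin (2 * x))" by (intro continuous_intros odd_H1_continuous assms)
  show "f (x + 2 * pi) - sin (2 * (x + 2 * pi)) = f x - sin (2 * x)" by (simp only: sin_cos_double_periodic odd_H1_periodic[OF assms])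
  show "\<bar>f x - sin (2 * x)\<bar> \<le> embed_const * L2_norm (wderiv f) + 1"
    using odd_H1_bound(1)[OF assms, of x] abs_sin_le_one[of "2 * x"] by linarith
qed

lemma multiplier_hilbert:
  assumes "f \<in> odd_H1"
  shows "continuous_on UNIV (\<lambda>x. hilbert f x + cos (2 * x))"
    "hilbert f (x + 2 * pi) + cos (2 * (x + 2 * pi)) = hilbert f x + cos (2 * x)"
    "\<bar>hilbert f x + cos (2 * x)\<bar> \<le> embed_const * L2_norm (wderiv f) + 1"
proof -
  show "continuous_on UNIV (\<lambda>x. hilbert f x + cos (2 * x))" by (intro continuous_intros odd_H1_hilbert_continuous assms)
  show "hilbert f (x + 2 * pi) + cos (2 * (x + 2 * pi)) = hilbert f x + cos (2 * x)"
    by (simp only: sin_cos_double_periodic odd_H1_hilbert_periodic[OF assms])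
  show "\<bar>hilbert f x + cos (2 * x)\<bar> \<le> embed_const * L2_norm (wderiv f) + 1"
    using odd_H1_bound(2)[OF assms, of x] abs_cos_le_one[of "2 * x"] by linarith
qed

lemma multiplier_vel:
  assumes "f \<in> odd_H1"
  shows "continuous_on UNIV (\<lambda>x. vel f x + 1/2 * sin (2 * x))"
    "vel f (x + 2 * pi) + 1/2 * sin (2 * (x + 2 * pi)) = vel f x + 1/2 * sin (2 * x)"
    "\<bar>vel f x + 1/2 * sin (2 * x)\<bar> \<le> embed_const * L2_norm (wderiv f) + 1"
    "((\<lambda>x. vel f x + 1/2 * sin (2 * x)) has_real_derivative hilbert f x + cos (2 * x)) (at x)"
proof -
  show "continuous_on UNIV (\<lambda>x. vel f x + 1/2 * sin (2 * x))" by (intro continuous_intros odd_H1_vel_continuous assms)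
  show "vel f (x + 2 * pi) + 1/2 * sin (2 * (x + 2 * pi)) = vel f x + 1/2 * sin (2 * x)"
    by (simp only: sin_cos_double_periodic odd_H1_vel_periodic[OF assms])
  show "\<bar>vel f x + 1/2 * sin (2 * x)\<bar> \<le> embed_const * L2_norm (wderiv f) + 1"
    using odd_H1_vel_bound'[OF assms, of x] abs_sin_le_one[of "2 * x"] by linarith
  show "((\<lambda>x. vel f x + 1/2 * sin (2 * x)) has_real_derivative hilbert f x + cos (2 * x)) (at x)"
    by (rule DERIV_add[OF odd_H1_vel_deriv[OF assms]]) (auto intro!: derivative_eq_intros)
qed

lemma cos2_L2: "(\<lambda>x. 2 * cos (2 * x)) \<in> L2"
  by (intro L2_scale cos_in_L2) simp

lemma wderiv_shift_L2:
  assumes "f \<in> odd_H1"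
  shows "(\<lambda>x. wderiv f x - 2 * cos (2 * x)) \<in> L2"
    "L2_norm (\<lambda>x. wderiv f x - 2 * cos (2 * x)) \<le> L2_norm (wderiv f) + 2 * sqrt (2 * pi)"
proof -
  show "(\<lambda>x. wderiv f x - 2 * cos (2 * x)) \<in> L2" by (intro L2_diff odd_H1_wderiv_L2 cos2_L2 assms)
  have "L2_norm (\<lambda>x. 2 * cos (2 * x)) \<le> sqrt (2 * pi) * 2"
    by (rule L2_norm_bounded[OF cos2_L2]) (simp add: abs_mult)
  then show "L2_norm (\<lambda>x. wderiv f x - 2 * cos (2 * x)) \<le> L2_norm (wderiv f) + 2 * sqrt (2 * pi)"
    using L2_norm_diff_triangle[OF odd_H1_wderiv_L2[OF assms] cos2_L2] by linarith
qed

lemma rhs_L2: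
  assumes "f \<in> odd_H1"
  shows "rhs f \<in> L2"
proof -
  have "(\<lambda>x. f x - sin (2 * x)) \<in> L2"
    by (rule L2_continuous[OF multiplier_vorticity(1,2)[OF assms]])
  from L2_diff[OF L2_norm_mult_continuous(1)[OF this multiplier_hilbert[OF assms]]
        L2_norm_mult_continuous(1)[OF wderiv_shift_L2(1)[OF assms] multiplier_vel(1-3)[OF assms]]]
  show ?thesis by (simp add: rhs_eq[abs_def])
qed

context
  fixes f g \<delta> :: "real \<Rightarrow> real"
  assumes f: "f \<in> odd_H1" and g: "g \<in> odd_H1" and \<delta>_def: "\<delta> = (\<lambda>x. f x - g x)"
begin

text \<open>The products are split so that three of the four terms contain the difference only
  through \<delta>, \<open>hilbert \<delta>\<close> and \<open>vel \<delta>\<close>. Its derivative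
  occurs in the transport term alone, multiplied by the smooth factor built from
  \<open>vel f\<close>.\<close>

lemma rhs_diff_eq:
  "rhs f \<theta> - rhs g \<theta> = (f \<theta> - sin (2 * \<theta>)) * hilbert \<delta> \<theta> + (hilbert g \<theta> + cos (2 * \<theta>)) * \<delta> \<theta>
     - (vel f \<theta> + 1/2 * sin (2 * \<theta>)) * (wderiv f \<theta> - wderiv g \<theta>) - vel \<delta> \<theta> * (wderiv g \<theta> - 2 * cos (2 * \<theta>))"
  unfolding rhs_eq \<delta>_def odd_H1_hilbert_diff[OF f g] odd_H1_vel_diff[OF f g]
  by (simp add: algebra_simps diff_divide_distrib)

lemma \<delta>_odd_H1: "\<delta> \<in> odd_H1" unfolding \<delta>_def by (rule odd_H1_diff(1)[OF f g])

lemma wdiff_L2: "(\<lambda>x. wderiv f x - wderiv g x) \<in> L2"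
  by (intro L2_diff odd_H1_wderiv_L2 f g)

lemma rhs_terms_L2:
  "(\<lambda>\<theta>. (f \<theta> - sin (2 * \<theta>)) * hilbert \<delta> \<theta>) \<in> L2"
  "L2_norm (\<lambda>\<theta>. (f \<theta> - sin (2 * \<theta>)) * hilbert \<delta> \<theta>) \<le> (embed_const * L2_norm (wderiv f) + 1) * L2_norm \<delta>"
  "(\<lambda>\<theta>. (hilbert g \<theta> + cos (2 * \<theta>)) * \<delta> \<theta>) \<in> L2"
  "L2_norm (\<lambda>\<theta>. (hilbert g \<theta> + cos (2 * \<theta>)) * \<delta> \<theta>) \<le> (embed_const * L2_norm (wderiv g) + 1) * L2_norm \<delta>"
  "(\<lambda>\<theta>. (vel f \<theta> + 1/2 * sin (2 * \<theta>)) * (wderiv f \<theta> - wderiv g \<theta>)) \<in> L2"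
  "L2_norm (\<lambda>\<theta>. (vel f \<theta> + 1/2 * sin (2 * \<theta>)) * (wderiv f \<theta> - wderiv g \<theta>))
      \<le> (embed_const * L2_norm (wderiv f) + 1) * L2_norm (\<lambda>x. wderiv f x - wderiv g x)"
  "(\<lambda>\<theta>. vel \<delta> \<theta> * (wderiv g \<theta> - 2 * cos (2 * \<theta>))) \<in> L2"
  "L2_norm (\<lambda>\<theta>. vel \<delta> \<theta> * (wderiv g \<theta> - 2 * cos (2 * \<theta>)))
      \<le> embed_const * L2_norm \<delta> * (L2_norm (wderiv g) + 2 * sqrt (2 * pi))"
proof -
  have h: "hilbert \<delta> \<in> L2"
    by (rule L2_continuous[OF odd_H1_hilbert_continuous odd_H1_hilbert_periodic]) (rule \<delta>_odd_H1)+
  note 1 = L2_norm_mult_continuous[OF h multiplier_vorticity[OF f]]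
  show "(\<lambda>\<theta>. (f \<theta> - sin (2 * \<theta>)) * hilbert \<delta> \<theta>) \<in> L2" by (rule 1)
  show "L2_norm (\<lambda>\<theta>. (f \<theta> - sin (2 * \<theta>)) * hilbert \<delta> \<theta>) \<le> (embed_const * L2_norm (wderiv f) + 1) * L2_norm \<delta>"
    using 1(2) odd_H1_hilbert_norm[OF \<delta>_odd_H1] by simp
  note 2 = L2_norm_mult_continuous[OF odd_H1_L2[OF \<delta>_odd_H1] multiplier_hilbert[OF g]]
  show "(\<lambda>\<theta>. (hilbert g \<theta> + cos (2 * \<theta>)) * \<delta> \<theta>) \<in> L2" by (rule 2)
  show "L2_norm (\<lambda>\<theta>. (hilbert g \<theta> + cos (2 * \<theta>)) * \<delta> \<theta>) \<le> (embed_const * L2_norm (wderiv g) + 1) * L2_norm \<delta>" by (rule 2)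
  note 3 = L2_norm_mult_continuous[OF wdiff_L2 multiplier_vel(1-3)[OF f]]
  show "(\<lambda>\<theta>. (vel f \<theta> + 1/2 * sin (2 * \<theta>)) * (wderiv f \<theta> - wderiv g \<theta>)) \<in> L2" by (rule 3)
  show "L2_norm (\<lambda>\<theta>. (vel f \<theta> + 1/2 * sin (2 * \<theta>)) * (wderiv f \<theta> - wderiv g \<theta>))
      \<le> (embed_const * L2_norm (wderiv f) + 1) * L2_norm (\<lambda>x. wderiv f x - wderiv g x)" by (rule 3)
  note 4 = L2_norm_mult_continuous[OF wderiv_shift_L2(1)[OF g] odd_H1_vel_continuous[OF \<delta>_odd_H1]
      odd_H1_vel_periodic[OF \<delta>_odd_H1] odd_H1_vel_bound[OF \<delta>_odd_H1]]
  show "(\<lambda>\<theta>. vel \<delta> \<theta> * (wderiv g \<theta> - 2 * cos (2 * \<theta>))) \<in> L2" by (rule 4)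
  show "L2_norm (\<lambda>\<theta>. vel \<delta> \<theta> * (wderiv g \<theta> - 2 * cos (2 * \<theta>)))
      \<le> embed_const * L2_norm \<delta> * (L2_norm (wderiv g) + 2 * sqrt (2 * pi))"
    using 4(2) mult_left_mono[OF wderiv_shift_L2(2)[OF g], of "embed_const * L2_norm \<delta>"]
    by (simp add: mult_nonneg_nonneg)
qed

text \<open>This bound loses one derivative. It gives continuity of the right-hand side along
  strongly convergent sequences and curves; uniqueness rests on \<open>rhs_energy\<close>
  instead.\<close>

lemma rhs_lipschitz:
  "L2_norm (\<lambda>x. rhs f x - rhs g x) \<le> (3 + 2 * embed_const + 2 * embed_const * sqrt (2 * pi))
     * (1 + L2_norm (wderiv f) + L2_norm (wderiv g)) * L2_norm (\<lambda>x. wderiv f x - wderiv g x)"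
proof -
  define K where "K = embed_const"
  define d where "d = L2_norm (\<lambda>x. wderiv f x - wderiv g x)"
  define F G where "F = L2_norm (wderiv f)" and "G = L2_norm (wderiv g)"
  define q where "q = sqrt (2 * pi)"
  have nn: "K \<ge> 0" "d \<ge> 0" "F \<ge> 0" "G \<ge> 0" "q \<ge> 0" by (simp_all add: K_def d_def F_def G_def q_def)
  have \<delta>d: "L2_norm \<delta> \<le> d"
    using odd_H1_poincare[OF \<delta>_odd_H1] odd_H1_wderiv_diff_norm[OF f g] by (simp add: d_def \<delta>_def)
  note T = rhs_terms_L2[folded K_def d_def F_def G_def q_def]
  have "L2_norm (\<lambda>x. rhs f x - rhs g x) \<le> (K * F + 1) * L2_norm \<delta> + (K * G + 1) * L2_norm \<delta>
      + (K * F + 1) * d + K * L2_norm \<delta> * (G + 2 * q)"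
    unfolding rhs_diff_eq
    using L2_norm_diff_triangle[OF L2_diff[OF L2_add[OF T(1,3)] T(5)] T(7)]
      L2_norm_diff_triangle[OF L2_add[OF T(1,3)] T(5)] L2_norm_triangle[OF T(1,3)] T(2,4,6,8)
    by linarith
  also have "\<dots> \<le> (K * F + 1) * d + (K * G + 1) * d + (K * F + 1) * d + K * d * (G + 2 * q)"
    using \<delta>d nn by (intro add_mono mult_left_mono mult_right_mono) auto
  also have "\<dots> = (3 + 2 * K * (F + G) + 2 * K * q) * d" by (simp add: algebra_simps)
  also have "\<dots> \<le> ((3 + 2 * K + 2 * K * q) * (1 + F + G)) * d"
  proof (rule mult_right_mono)
    have "(3 + 2 * K + 2 * K * q) * (1 + F + G) = (3 + 2 * K * (F + G) + 2 * K * q) + 2 * K + (3 + 2 * K * q) * (F + G)"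
      by (simp add: algebra_simps)
    moreover have "0 \<le> (3 + 2 * K * q) * (F + G)" using nn by (intro mult_nonneg_nonneg add_nonneg_nonneg) auto
    ultimately show "3 + 2 * K * (F + G) + 2 * K * q \<le> (3 + 2 * K + 2 * K * q) * (1 + F + G)" using nn by linarith
  qed (use nn in auto)
  finally show ?thesis by (simp add: K_def d_def F_def G_def q_def)
qed

end

lemma L2_inner_mult_swap: "L2_inner f (\<lambda>x. p x * g x) = L2_inner (\<lambda>x. p x * f x) g"
  unfolding L2_inner_def by (simp add: mult_ac)

lemma odd_H1_sum_tendsto:
  assumes "f \<in> odd_H1"
  shows "(\<lambda>N. L2_norm (\<lambda>x. (\<Sum>m<N. sine_coeff f m * sin (real m * x)) - f x)) \<longlonglongrightarrow> 0"
  using sine_series_L2_tendsto[OF odd_H1_abs_summable[OF assms]]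
  unfolding odd_H1_series[OF assms, symmetric] .

text \<open>The derivative of \<open>f\<close> is merely in L2, so \<open>p * f\<close> is not an
  admissible test function. The products of \<open>p\<close> with the partial sums of the sine
  series are, and both sides pass to the limit in L2.\<close>

lemma odd_H1_multiplier_by_parts:
  assumes f: "f \<in> odd_H1"
    and p: "\<And>x. p (x + 2 * pi) = p x" "\<And>x. (p has_real_derivative p' x) (at x)" "continuous_on UNIV p'"
    and B: "\<And>x. \<bar>p x\<bar> \<le> B" "\<And>x. \<bar>p' x\<bar> \<le> B'"
  shows "L2_inner f (\<lambda>x. p x * wderiv f x) = - (1/2) * L2_inner f (\<lambda>x. p' x * f x)"
proof -
  define u where "u = (\<lambda>N x. \<Sum>m<N. sine_coeff f m * sin (real m * x))"
  define u' where "u' = (\<lambda>N x. \<Sum>m<N. (real m * sine_coeff f m) * cos (real m * x))"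
  have u: "u N \<in> L2" "u' N \<in> L2" for N unfolding u_def u'_def by (intro sine_sum_L2 cosine_sum_L2)+
  have pc: "continuous_on UNIV p" by (rule C1_continuous_on[OF p(2)])
  have p'p: "p' (x + 2 * pi) = p' x" for x by (rule periodic_derivative[OF p(1,2)])
  have du: "(u N has_real_derivative u' N x) (at x)" for N x
    unfolding u_def u'_def by (auto intro!: derivative_eq_intros sum.cong)
  have up: "u N (x + 2 * pi) = u N x" for N x by (rule L2_periodic[OF u(1)])
  have w: "wderiv f \<in> L2" by (rule odd_H1_wderiv_L2[OF f])
  note fL = odd_H1_L2[OF f]
  note pf = L2_norm_mult_continuous(1)[OF fL pc p(1) B(1)]
  note p'f = L2_norm_mult_continuous(1)[OF fL p(3) p'p B(2)]
  note pw = L2_norm_mult_continuous(1)[OF w pc p(1) B(1)]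
  have eq: "L2_inner (\<lambda>x. p' x * f x) (u N) + L2_inner (\<lambda>x. p x * f x) (u' N) = - L2_inner (\<lambda>x. p x * wderiv f x) (u N)" for N
  proof -
    have "L2_inner f (\<lambda>x. p x * u' N x + p' x * u N x) = - L2_inner (wderiv f) (\<lambda>x. p x * u N x)"
    proof (rule weak_derivD)
      show "has_weak_deriv f (wderiv f)" using f by (simp add: odd_H1_def H1_wderiv)
      show "p (x + 2 * pi) * u N (x + 2 * pi) = p x * u N x" for x by (simp only: p(1) up)
      show "((\<lambda>x. p x * u N x) has_real_derivative p x * u' N x + p' x * u N x) (at x)" for x
        by (rule DERIV_mult'[OF p(2) du])
      show "continuous_on UNIV (\<lambda>x. p x * u' N x + p' x * u N x)"
        by (intro continuous_intros pc p(3) C1_continuous_on[OF du]) (unfold u'_def, intro continuous_intros)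
    qed
    moreover have "L2_inner f (\<lambda>x. p x * u' N x + p' x * u N x) = L2_inner f (\<lambda>x. p x * u' N x) + L2_inner f (\<lambda>x. p' x * u N x)"
      by (rule L2_inner_add_right[OF L2_norm_mult_continuous(1)[OF u(2) pc p(1) B(1)]
          L2_norm_mult_continuous(1)[OF u(1) p(3) p'p B(2)] fL])
    ultimately show ?thesis by (simp only: L2_inner_mult_swap)
  qed
  have 1: "(\<lambda>N. L2_inner (u N) h) \<longlonglongrightarrow> L2_inner f h" if "h \<in> L2" for h
    by (rule L2_inner_tendsto[OF u(1) fL that]) (unfold u_def, rule odd_H1_sum_tendsto[OF f])
  have 2: "(\<lambda>N. L2_inner (u' N) h) \<longlonglongrightarrow> L2_inner (wderiv f) h" if "h \<in> L2" for h
    by (rule L2_inner_tendsto[OF u(2) w that]) (unfold u'_def, rule odd_H1_wderiv_tendsto[OF f])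
  have "(\<lambda>N. L2_inner (u N) (\<lambda>x. p' x * f x) + L2_inner (u' N) (\<lambda>x. p x * f x))
      \<longlonglongrightarrow> L2_inner f (\<lambda>x. p' x * f x) + L2_inner (wderiv f) (\<lambda>x. p x * f x)"
    by (intro tendsto_add 1 2 p'f pf)
  moreover have "(\<lambda>N. - L2_inner (u N) (\<lambda>x. p x * wderiv f x)) \<longlonglongrightarrow> - L2_inner f (\<lambda>x. p x * wderiv f x)"
    by (intro tendsto_minus 1 pw)
  moreover have "L2_inner (u N) (\<lambda>x. p' x * f x) + L2_inner (u' N) (\<lambda>x. p x * f x) = - L2_inner (u N) (\<lambda>x. p x * wderiv f x)" for N
    using eq[of N] by (simp only: L2_inner_commute)
  ultimately have "L2_inner f (\<lambda>x. p' x * f x) + L2_inner (wderiv f) (\<lambda>x. p x * f x) = - L2_inner f (\<lambda>x. p x * wderiv f x)"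
    by (simp add: LIMSEQ_unique)
  moreover have "L2_inner (wderiv f) (\<lambda>x. p x * f x) = L2_inner f (\<lambda>x. p x * wderiv f x)"
    by (metis L2_inner_mult_swap L2_inner_commute)
  ultimately show ?thesis by simp
qed

text \<open>Integration by parts moves the derivative from the difference to the velocity, whose derivative
  \<open>hilbert f\<close> is bounded; so no norm of the derivative of the difference appears.\<close>

lemma rhs_energy:
  assumes f: "f \<in> odd_H1" and g: "g \<in> odd_H1"
  shows "\<bar>L2_inner (\<lambda>x. f x - g x) (\<lambda>x. rhs f x - rhs g x)\<bar>
     \<le> (3 + 2 * embed_const + 2 * embed_const * sqrt (2 * pi))
       * (1 + L2_norm (wderiv f) + L2_norm (wderiv g)) * (L2_norm (\<lambda>x. f x - g x))\<^sup>2"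
proof -
  define \<delta> where "\<delta> = (\<lambda>x. f x - g x)"
  define K where "K = embed_const"
  define F G where "F = L2_norm (wderiv f)" and "G = L2_norm (wderiv g)"
  define q where "q = sqrt (2 * pi)"
  define n where "n = L2_norm \<delta>"
  have nn: "K \<ge> 0" "F \<ge> 0" "G \<ge> 0" "q \<ge> 0" "n \<ge> 0" by (simp_all add: K_def F_def G_def q_def n_def)
  note T = rhs_terms_L2[OF f g \<delta>_def]
  note T' = T[folded K_def F_def G_def q_def n_def]
  have \<delta>: "\<delta> \<in> odd_H1" unfolding \<delta>_def by (rule odd_H1_diff(1)[OF f g])
  note \<delta>L = odd_H1_L2[OF \<delta>]
  note pw = L2_norm_mult_continuous(1)[OF odd_H1_wderiv_L2[OF \<delta>] multiplier_vel(1-3)[OF f]]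
  have "L2_inner \<delta> (\<lambda>\<theta>. (vel f \<theta> + 1/2 * sin (2 * \<theta>)) * (wderiv f \<theta> - wderiv g \<theta>))
      = L2_inner \<delta> (\<lambda>\<theta>. (vel f \<theta> + 1/2 * sin (2 * \<theta>)) * wderiv \<delta> \<theta>)"
    unfolding L2_inner_commute[of \<delta>]
  proof (rule L2_inner_AE_cong[OF _ T(5) pw \<delta>L])
    show "AE \<theta> in lborel. \<theta> \<in> {-pi..pi} \<longrightarrow> (vel f \<theta> + 1/2 * sin (2 * \<theta>)) * (wderiv f \<theta> - wderiv g \<theta>)
        = (vel f \<theta> + 1/2 * sin (2 * \<theta>)) * wderiv \<delta> \<theta>"
      using odd_H1_diff(2)[OF f g] unfolding \<delta>_def by eventually_elim simp
  qed
  also have "\<dots> = - (1/2) * L2_inner \<delta> (\<lambda>\<theta>. (hilbert f \<theta> + cos (2 * \<theta>)) * \<delta> \<theta>)"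
    by (rule odd_H1_multiplier_by_parts[OF \<delta> multiplier_vel(2)[OF f] multiplier_vel(4)[OF f]
        multiplier_hilbert(1)[OF f] multiplier_vel(3)[OF f] multiplier_hilbert(3)[OF f]])
  finally have e3: "L2_inner \<delta> (\<lambda>\<theta>. (vel f \<theta> + 1/2 * sin (2 * \<theta>)) * (wderiv f \<theta> - wderiv g \<theta>))
      = - (1/2) * L2_inner \<delta> (\<lambda>\<theta>. (hilbert f \<theta> + cos (2 * \<theta>)) * \<delta> \<theta>)" .
  note 3 = L2_norm_mult_continuous[OF \<delta>L multiplier_hilbert[OF f]]
  have b3: "\<bar>L2_inner \<delta> (\<lambda>\<theta>. (hilbert f \<theta> + cos (2 * \<theta>)) * \<delta> \<theta>)\<bar> \<le> n * ((K * F + 1) * n)"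
    using L2_cauchy_schwarz[OF \<delta>L 3(1)] mult_left_mono[OF 3(2), of "L2_norm \<delta>"]
    by (simp add: n_def K_def F_def)
  have b1: "\<bar>L2_inner \<delta> (\<lambda>\<theta>. (f \<theta> - sin (2 * \<theta>)) * hilbert \<delta> \<theta>)\<bar> \<le> n * ((K * F + 1) * n)"
    using L2_cauchy_schwarz[OF \<delta>L T(1), folded n_def] mult_left_mono[OF T'(2), of n] nn by linarith
  have b2: "\<bar>L2_inner \<delta> (\<lambda>\<theta>. (hilbert g \<theta> + cos (2 * \<theta>)) * \<delta> \<theta>)\<bar> \<le> n * ((K * G + 1) * n)"
    using L2_cauchy_schwarz[OF \<delta>L T(3), folded n_def] mult_left_mono[OF T'(4), of n] nn by linarith
  have b4: "\<bar>L2_inner \<delta> (\<lambda>\<theta>. vel \<delta> \<theta> * (wderiv g \<theta> - 2 * cos (2 * \<theta>)))\<bar> \<le> n * (K * n * (G + 2 * q))"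
    using L2_cauchy_schwarz[OF \<delta>L T(7), folded n_def] mult_left_mono[OF T'(8), of n] nn by linarith
  have "L2_inner \<delta> (\<lambda>x. rhs f x - rhs g x) =
      L2_inner \<delta> (\<lambda>\<theta>. (f \<theta> - sin (2 * \<theta>)) * hilbert \<delta> \<theta>) + L2_inner \<delta> (\<lambda>\<theta>. (hilbert g \<theta> + cos (2 * \<theta>)) * \<delta> \<theta>)
      - L2_inner \<delta> (\<lambda>\<theta>. (vel f \<theta> + 1/2 * sin (2 * \<theta>)) * (wderiv f \<theta> - wderiv g \<theta>))
      - L2_inner \<delta> (\<lambda>\<theta>. vel \<delta> \<theta> * (wderiv g \<theta> - 2 * cos (2 * \<theta>)))"
    unfolding rhs_diff_eq[OF f g \<delta>_def]
    by (simp only: L2_inner_diff_right[OF L2_diff[OF L2_add[OF T(1,3)] T(5)] T(7) \<delta>L]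
       L2_inner_diff_right[OF L2_add[OF T(1,3)] T(5) \<delta>L] L2_inner_add_right[OF T(1,3) \<delta>L])
  then have "\<bar>L2_inner \<delta> (\<lambda>x. rhs f x - rhs g x)\<bar> \<le> n * ((K * F + 1) * n) + n * ((K * G + 1) * n)
      + n * ((K * F + 1) * n) + n * (K * n * (G + 2 * q))"
    using b1 b2 b3 b4 unfolding e3 by linarith
  also have "\<dots> = (3 + 2 * K * (F + G) + 2 * K * q) * n\<^sup>2" by (simp add: algebra_simps power2_eq_square)
  also have "\<dots> \<le> ((3 + 2 * K + 2 * K * q) * (1 + F + G)) * n\<^sup>2"
  proof (rule mult_right_mono)
    have "(3 + 2 * K + 2 * K * q) * (1 + F + G) = (3 + 2 * K * (F + G) + 2 * K * q) + 2 * K + (3 + 2 * K * q) * (F + G)"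
      by (simp add: algebra_simps)
    moreover have "0 \<le> (3 + 2 * K * q) * (F + G)" using nn by (intro mult_nonneg_nonneg add_nonneg_nonneg) auto
    ultimately show "3 + 2 * K * (F + G) + 2 * K * q \<le> (3 + 2 * K + 2 * K * q) * (1 + F + G)" using nn by linarith
  qed simp
  finally show ?thesis by (simp add: K_def F_def G_def q_def n_def \<delta>_def)
qed

section \<open>The weighted space and uniqueness\<close>

text \<open>Its square is \<open>rho\<close> times the squared derivative, so the norm of
  \<open>HDW\<close> becomes an L2 norm. Keeping the sign of \<open>sin\<close>, rather than taking
  the root of \<open>rho\<close>, makes this function a sine series in odd frequencies for the
  even-mode data.\<close>

definition hdw_density :: "(real \<Rightarrow> real) \<Rightarrow> real \<Rightarrow> real" where
  "hdw_density f \<theta> = wderiv f \<theta> / (sqrt (4 * pi) * sin \<theta>)"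

lemma HDW_odd_H1: "f \<in> HDW \<Longrightarrow> f \<in> odd_H1"
  by (simp add: HDW_def odd_H1_def)

lemma AE_sin_nonzero: "AE x in lborel. x \<in> {-pi..pi} \<longrightarrow> sin x \<noteq> 0"
proof -
  have "AE x in lborel. x \<noteq> -pi \<and> x \<noteq> 0 \<and> x \<noteq> pi"
    using AE_lborel_singleton[of "-pi"] AE_lborel_singleton[of pi] AE_lborel_singleton[of 0]
    by eventually_elim auto
  then show ?thesis
  proof eventually_elim
    case (elim x)
    show ?case
    proof
      assume x: "x \<in> {-pi..pi}"
      show "sin x \<noteq> 0"
      proof (cases "x > 0")
        case True
        then have "sin x > 0" using x elim by (intro sin_gt_zero) auto
        then show ?thesis by simp
      next
        case False
        then have "sin (-x) > 0" using x elim by (intro sin_gt_zero) auto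
        then show ?thesis by simp
      qed
    qed
  qed
qed

lemma hdw_density_sq: "(hdw_density f \<theta>)\<^sup>2 = (1 / (4 * pi)) * (\<bar>wderiv f \<theta>\<bar>\<^sup>2 / \<bar>sin \<theta>\<bar>\<^sup>2)"
  by (simp add: hdw_density_def power_divide power_mult_distrib)

lemma hdw_density_L2:
  assumes "f \<in> HDW"
  shows "hdw_density f \<in> L2"
proof -
  have w: "wderiv f \<in> L2" by (rule odd_H1_wderiv_L2[OF HDW_odd_H1[OF assms]])
  note [measurable] = L2_measurable[OF w]
  have "set_integrable lborel {-pi..pi} (\<lambda>\<theta>. (hdw_density f \<theta>)\<^sup>2)"
    unfolding hdw_density_sq using assms by (intro set_integrable_mult_right) (simp add: HDW_def)
  moreover have "periodic (hdw_density f)"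
    using L2_periodic[OF w] by (simp add: periodic_def hdw_density_def)
  moreover have "hdw_density f \<in> borel_measurable borel" unfolding hdw_density_def[abs_def] by measurable
  ultimately show ?thesis by (simp add: L2_def)
qed

lemma HDW_norm_eq: "HDW_norm f = L2_norm (hdw_density f)"
proof -
  have "rho \<theta> * wderiv f \<theta> * wderiv f \<theta> = (hdw_density f \<theta>)\<^sup>2" for \<theta>
    unfolding hdw_density_sq by (simp add: rho_def power2_eq_square)
  then show ?thesis by (simp add: HDW_norm_def HDW_inner_def L2_norm_def)
qed

text \<open>Membership is tested by exhibiting the quotient of the derivative by the sine; the zeros
  of \<open>sin\<close> in the period form a null set.\<close>

lemma HDW_I:
  assumes f: "f \<in> odd_H1" and G: "G \<in> L2"
    and eq: "AE x in lborel. x \<in> {-pi..pi} \<longrightarrow> wderiv f x = sqrt (4 * pi) * sin x * G x"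
  shows "f \<in> HDW" "AE x in lborel. x \<in> {-pi..pi} \<longrightarrow> hdw_density f x = G x" "HDW_norm f = L2_norm G"
proof -
  have w: "wderiv f \<in> L2" by (rule odd_H1_wderiv_L2[OF f])
  note [measurable] = L2_measurable[OF w] L2_measurable[OF G]
  show ae: "AE x in lborel. x \<in> {-pi..pi} \<longrightarrow> hdw_density f x = G x"
    using eq AE_sin_nonzero by eventually_elim (auto simp: hdw_density_def)
  have "set_integrable lborel {-pi..pi} (\<lambda>x. 4 * pi * (G x)\<^sup>2)"
    using G by (intro set_integrable_mult_right) (simp add: L2_def)
  moreover have "set_integrable lborel {-pi..pi} (\<lambda>x. 4 * pi * (G x)\<^sup>2)
      \<longleftrightarrow> set_integrable lborel {-pi..pi} (\<lambda>\<theta>. \<bar>wderiv f \<theta>\<bar>\<^sup>2 / \<bar>sin \<theta>\<bar>\<^sup>2)"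
    unfolding set_integrable_def
  proof (rule integrable_cong_AE)
    show "AE x in lborel. indicator {-pi..pi} x *\<^sub>R (4 * pi * (G x)\<^sup>2)
       = indicator {-pi..pi} x *\<^sub>R (\<bar>wderiv f x\<bar>\<^sup>2 / \<bar>sin x\<bar>\<^sup>2)"
      using ae
    proof eventually_elim
      case (elim x)
      then show ?case using hdw_density_sq[of f x] by (cases "x \<in> {-pi..pi}") auto
    qed
  qed measurable
  ultimately have "set_integrable lborel {-pi..pi} (\<lambda>\<theta>. \<bar>wderiv f \<theta>\<bar>\<^sup>2 / \<bar>sin \<theta>\<bar>\<^sup>2)" by simp
  then show fH: "f \<in> HDW" using f by (simp add: HDW_def odd_H1_def)
  show "HDW_norm f = L2_norm G" unfolding HDW_norm_eq
    by (rule L2_norm_AE_cong[OF ae hdw_density_L2[OF fH] G])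
qed

lemma HDW_wderiv_AE: "AE x in lborel. x \<in> {-pi..pi} \<longrightarrow> wderiv f x = sqrt (4 * pi) * sin x * hdw_density f x"
  using AE_sin_nonzero by eventually_elim (auto simp: hdw_density_def)

lemma HDW_linear:
  assumes "f \<in> HDW" "h \<in> HDW"
  shows "(\<lambda>x. a * f x + b * h x) \<in> HDW"
    "AE x in lborel. x \<in> {-pi..pi} \<longrightarrow> hdw_density (\<lambda>x. a * f x + b * h x) x = a * hdw_density f x + b * hdw_density h x"
    "HDW_norm (\<lambda>x. a * f x + b * h x) = L2_norm (\<lambda>x. a * hdw_density f x + b * hdw_density h x)"
proof -
  note o = HDW_odd_H1[OF assms(1)] HDW_odd_H1[OF assms(2)]
  have G: "(\<lambda>x. a * hdw_density f x + b * hdw_density h x) \<in> L2"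
    by (intro L2_add L2_scale hdw_density_L2 assms)
  have "AE x in lborel. x \<in> {-pi..pi} \<longrightarrow> wderiv (\<lambda>x. a * f x + b * h x) x
      = sqrt (4 * pi) * sin x * (a * hdw_density f x + b * hdw_density h x)"
    using odd_H1_linear(2)[OF o, of a b] HDW_wderiv_AE[of f] HDW_wderiv_AE[of h]
  proof eventually_elim
    case (elim x)
    show ?case
    proof
      assume "x \<in> {-pi..pi}"
      then have "wderiv (\<lambda>x. a * f x + b * h x) x = a * wderiv f x + b * wderiv h x"
        "wderiv f x = sqrt (4 * pi) * sin x * hdw_density f x" "wderiv h x = sqrt (4 * pi) * sin x * hdw_density h x"
        using elim by auto
      then show "wderiv (\<lambda>x. a * f x + b * h x) x = sqrt (4 * pi) * sin x * (a * hdw_density f x + b * hdw_density h x)"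
        by (simp only:) (simp add: algebra_simps)
    qed
  qed
  note H = HDW_I[OF odd_H1_linear(1)[OF o] G this]
  show "(\<lambda>x. a * f x + b * h x) \<in> HDW"
    "AE x in lborel. x \<in> {-pi..pi} \<longrightarrow> hdw_density (\<lambda>x. a * f x + b * h x) x = a * hdw_density f x + b * hdw_density h x"
    "HDW_norm (\<lambda>x. a * f x + b * h x) = L2_norm (\<lambda>x. a * hdw_density f x + b * hdw_density h x)"
    using H by auto
qed

lemma HDW_diff:
  assumes "f \<in> HDW" "h \<in> HDW"
  shows "(\<lambda>x. f x - h x) \<in> HDW" "HDW_norm (\<lambda>x. f x - h x) = L2_norm (\<lambda>x. hdw_density f x - hdw_density h x)"
  using HDW_linear(1)[OF assms, of 1 "-1"] HDW_linear(3)[OF assms, of 1 "-1"] by simp_all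

lemma HDW_norm_nonneg [simp]: "HDW_norm f \<ge> 0"
  by (simp add: HDW_norm_eq)

lemma HDW_norm_triangle3:
  assumes "f \<in> HDW" "g \<in> HDW" "h \<in> HDW"
  shows "HDW_norm (\<lambda>x. f x - h x) \<le> HDW_norm (\<lambda>x. f x - g x) + HDW_norm (\<lambda>x. g x - h x)"
  unfolding HDW_diff(2)[OF assms(1,2)] HDW_diff(2)[OF assms(2,3)] HDW_diff(2)[OF assms(1,3)]
  by (intro L2_norm_triangle3 hdw_density_L2 assms)

lemma HDW_norm_reverse_triangle:
  assumes "f \<in> HDW" "h \<in> HDW"
  shows "\<bar>HDW_norm f - HDW_norm h\<bar> \<le> HDW_norm (\<lambda>x. f x - h x)"
  unfolding HDW_diff(2)[OF assms] HDW_norm_eq by (intro L2_norm_reverse_triangle hdw_density_L2 assms)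

lemma HDW_wderiv_norm:
  assumes "f \<in> HDW"
  shows "L2_norm (wderiv f) \<le> sqrt (4 * pi) * HDW_norm f"
proof -
  have per: "sqrt (4 * pi) * sin (x + 2 * pi) = sqrt (4 * pi) * sin x" for x by simp
  have bd: "\<bar>sqrt (4 * pi) * sin x\<bar> \<le> sqrt (4 * pi)" for x
    using abs_sin_le_one[of x] by (simp add: abs_mult mult_left_le)
  have c: "continuous_on UNIV (\<lambda>x. sqrt (4 * pi) * sin x)" by (intro continuous_intros)
  note m = L2_norm_mult_continuous[OF hdw_density_L2[OF assms] c per bd]
  have "L2_norm (wderiv f) = L2_norm (\<lambda>x. sqrt (4 * pi) * sin x * hdw_density f x)"
    by (rule L2_norm_AE_cong[OF HDW_wderiv_AE odd_H1_wderiv_L2[OF HDW_odd_H1[OF assms]] m(1)])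
  then show ?thesis using m(2) by (simp add: HDW_norm_eq)
qed

lemma HDW_zero:
  assumes "f \<in> HDW" "L2_norm f = 0"
  shows "f x = 0"
  by (rule continuous_AE_zero[OF odd_H1_continuous odd_H1_periodic L2_norm_zero_AE[OF odd_H1_L2 assms(2)]])
     (rule HDW_odd_H1[OF assms(1)])+

text \<open>With the difference quotient \<open>Q s\<close> one has
  \<open>\<eta> s = \<eta> t + (s - t) * Q s\<close>. The square expands accordingly, and its last
  term vanishes in the limit because \<open>Q s\<close> stays bounded in L2.\<close>

lemma L2_time_deriv_inner:
  assumes J: "\<And>s. s \<in> J \<Longrightarrow> \<eta> s \<in> L2" "t \<in> J" "has_L2_time_deriv \<eta> D t J"
  shows "((\<lambda>s. (L2_norm (\<eta> s))\<^sup>2) has_real_derivative 2 * L2_inner (\<eta> t) D) (at t within J)"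
  unfolding has_field_derivative_iff
proof -
  have D: "D \<in> L2" and lim: "((\<lambda>s. L2_norm (\<lambda>\<theta>. (\<eta> s \<theta> - \<eta> t \<theta>) / (s - t) - D \<theta>)) \<longlongrightarrow> 0) (at t within J)"
    using J(3) by (auto simp: has_L2_time_deriv_def)
  define Q where "Q = (\<lambda>s \<theta>. (\<eta> s \<theta> - \<eta> t \<theta>) / (s - t))"
  have Q: "Q s \<in> L2" if "s \<in> J" for s
    using L2_scale[OF L2_diff[OF J(1)[OF that] J(1)[OF J(2)]], of "1 / (s - t)"] by (simp add: Q_def)
  define e where "e = (\<lambda>s. L2_norm (\<lambda>\<theta>. Q s \<theta> - D \<theta>))"
  have e: "(e \<longlongrightarrow> 0) (at t within J)" using lim by (simp add: e_def Q_def)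
  have tJ: "\<forall>\<^sub>F s in at t within J. s \<in> J \<and> s \<noteq> t" by (simp add: eventually_at_filter)
  have eq: "\<forall>\<^sub>F s in at t within J. norm (((L2_norm (\<eta> s))\<^sup>2 - (L2_norm (\<eta> t))\<^sup>2) / (s - t) - 2 * L2_inner (\<eta> t) D)
      \<le> 2 * e s * L2_norm (\<eta> t) + \<bar>s - t\<bar> * (e s + L2_norm D)\<^sup>2"
    using tJ
  proof eventually_elim
    case (elim s)
    then have s: "s \<in> J" "s \<noteq> t" by auto
    note L = J(1)[OF s(1)] J(1)[OF J(2)] Q[OF s(1)] D
    have expand: "L2_inner (\<lambda>\<theta>. \<eta> t \<theta> + h * Q s \<theta>) (\<lambda>\<theta>. \<eta> t \<theta> + h * Q s \<theta>)
        = L2_inner (\<eta> t) (\<eta> t) + 2 * h * L2_inner (\<eta> t) (Q s) + h\<^sup>2 * L2_inner (Q s) (Q s)" for h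
      by (simp add: L L2_inner_add_left L2_inner_add_right L2_inner_scale_left L2_inner_scale_right L2_scale L2_add
          L2_inner_commute[of "Q s" "\<eta> t"] algebra_simps power2_eq_square)
    have \<eta>s: "\<eta> s = (\<lambda>\<theta>. \<eta> t \<theta> + (s - t) * Q s \<theta>)" using s(2) by (simp add: Q_def fun_eq_iff)
    have "(L2_norm (\<eta> s))\<^sup>2 = L2_inner (\<eta> t) (\<eta> t) + 2 * (s - t) * L2_inner (\<eta> t) (Q s) + (s - t)\<^sup>2 * L2_inner (Q s) (Q s)"
      unfolding L2_norm_sq using expand[of "s - t"] unfolding \<eta>s[symmetric] .
    then have "((L2_norm (\<eta> s))\<^sup>2 - (L2_norm (\<eta> t))\<^sup>2) / (s - t) = 2 * L2_inner (\<eta> t) (Q s) + (s - t) * L2_inner (Q s) (Q s)"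
      unfolding L2_norm_sq[of "\<eta> t"] using s(2) by (simp add: field_simps power2_eq_square)
    then have *: "((L2_norm (\<eta> s))\<^sup>2 - (L2_norm (\<eta> t))\<^sup>2) / (s - t) - 2 * L2_inner (\<eta> t) D
        = 2 * L2_inner (\<eta> t) (\<lambda>\<theta>. Q s \<theta> - D \<theta>) + (s - t) * (L2_norm (Q s))\<^sup>2"
      by (simp add: L L2_inner_diff_right L2_norm_sq)
    have 1: "\<bar>L2_inner (\<eta> t) (\<lambda>\<theta>. Q s \<theta> - D \<theta>)\<bar> \<le> L2_norm (\<eta> t) * e s"
      unfolding e_def by (intro L2_cauchy_schwarz L2_diff L)
    have "L2_norm (Q s) \<le> e s + L2_norm D"
      using L2_norm_reverse_triangle[OF L(3,4)] by (simp add: e_def abs_le_iff)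
    then have "\<bar>s - t\<bar> * (L2_norm (Q s))\<^sup>2 \<le> \<bar>s - t\<bar> * (e s + L2_norm D)\<^sup>2"
      by (intro mult_left_mono power_mono) auto
    then have 2: "\<bar>(s - t) * (L2_norm (Q s))\<^sup>2\<bar> \<le> \<bar>s - t\<bar> * (e s + L2_norm D)\<^sup>2"
      by (simp add: abs_mult)
    have 3: "\<bar>2 * a + b\<bar> \<le> 2 * \<bar>a\<bar> + \<bar>b\<bar>" for a b :: real by linarith
    have 4: "2 * e s * L2_norm (\<eta> t) = 2 * (L2_norm (\<eta> t) * e s)" by simp
    show ?case unfolding * real_norm_def 4
      by (rule order_trans[OF 3]) (intro add_mono mult_left_mono 1 2, simp)
  qed
  have "((\<lambda>s. 2 * e s * L2_norm (\<eta> t) + \<bar>s - t\<bar> * (e s + L2_norm D)\<^sup>2) \<longlongrightarrow> 2 * 0 * L2_norm (\<eta> t) + \<bar>t - t\<bar> * (0 + L2_norm D)\<^sup>2) (at t within J)"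
    by (intro tendsto_intros e)
  then have "((\<lambda>s. 2 * e s * L2_norm (\<eta> t) + \<bar>s - t\<bar> * (e s + L2_norm D)\<^sup>2) \<longlongrightarrow> 0) (at t within J)" by simp
  then show "((\<lambda>s. ((L2_norm (\<eta> s))\<^sup>2 - (L2_norm (\<eta> t))\<^sup>2) / (s - t)) \<longlongrightarrow> 2 * L2_inner (\<eta> t) D) (at t within J)"
    by (rule LIM_zero_cancel[OF Lim_null_comparison[OF eq]])
qed

text \<open>The rate may depend on time and enters through its antiderivative \<open>K\<close>, as
  the second pass of the decay estimate requires. At the end points the derivatives are one-sided,
  so monotonicity is taken from the open interval together with continuity.\<close>

lemma gronwall:
  fixes y :: "real \<Rightarrow> real"
  assumes T: "0 \<le> T" and y: "\<And>t. t \<in> {0..T} \<Longrightarrow> (y has_real_derivative y' t) (at t within {0..T})"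
    and le: "\<And>t. t \<in> {0..T} \<Longrightarrow> y' t \<le> k t * y t"
    and K: "\<And>t. t \<in> {0..T} \<Longrightarrow> (K has_real_derivative k t) (at t within {0..T})"
  shows "y T \<le> y 0 * exp (K T - K 0)"
proof -
  define z where "z = (\<lambda>t. y t * exp (- K t))"
  have z: "(z has_real_derivative (y' t - k t * y t) * exp (- K t)) (at t within {0..T})" if "t \<in> {0..T}" for t
    unfolding z_def using y[OF that] K[OF that] by (auto intro!: derivative_eq_intros simp: algebra_simps)
  have "z T \<le> z 0"
  proof (rule DERIV_nonpos_imp_decreasing_open[OF T])
    fix t assume t: "0 < t" "t < T"
    then have "(z has_real_derivative (y' t - k t * y t) * exp (- K t)) (at t)"
      using z[of t] by (simp add: at_within_Icc_at)
    moreover have "(y' t - k t * y t) * exp (- K t) \<le> 0"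
      using le[of t] t by (intro mult_nonpos_nonneg) auto
    ultimately show "\<exists>d. (z has_real_derivative d) (at t) \<and> d \<le> 0" by blast
  next
    show "continuous_on {0..T} z" using z by (rule DERIV_continuous_on)
  qed
  then have "y T * exp (- K T) * exp (K T) \<le> y 0 * exp (- K 0) * exp (K T)"
    unfolding z_def by (rule mult_right_mono) simp
  then show ?thesis by (simp add: mult.assoc exp_add[symmetric])
qed

lemma has_L2_time_deriv_diff:
  assumes "has_L2_time_deriv \<eta> D t J" "has_L2_time_deriv \<xi> E t J" "t \<in> J"
    "\<And>s. s \<in> J \<Longrightarrow> \<eta> s \<in> L2" "\<And>s. s \<in> J \<Longrightarrow> \<xi> s \<in> L2"
  shows "has_L2_time_deriv (\<lambda>s \<theta>. \<eta> s \<theta> - \<xi> s \<theta>) (\<lambda>\<theta>. D \<theta> - E \<theta>) t J"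
  unfolding has_L2_time_deriv_def
proof
  have DE: "D \<in> L2" "E \<in> L2" using assms(1,2) by (auto simp: has_L2_time_deriv_def)
  then show "(\<lambda>\<theta>. D \<theta> - E \<theta>) \<in> L2" by auto
  let ?q = "\<lambda>\<eta> D s \<theta>. (\<eta> s \<theta> - \<eta> t \<theta>) / (s - t) - D \<theta>"
  have q: "?q \<eta> D s \<in> L2" if "D \<in> L2" "s \<in> J" "\<And>s. s \<in> J \<Longrightarrow> \<eta> s \<in> L2" for \<eta> D s
    using L2_diff[OF L2_scale[OF L2_diff[OF that(3)[OF that(2)] that(3)[OF assms(3)]], of "1 / (s - t)"] that(1)] by simp
  have "((\<lambda>s. L2_norm (?q \<eta> D s) + L2_norm (?q \<xi> E s)) \<longlongrightarrow> 0 + 0) (at t within J)"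
    using assms(1,2) by (intro tendsto_add) (auto simp: has_L2_time_deriv_def)
  then have lim: "((\<lambda>s. L2_norm (?q \<eta> D s) + L2_norm (?q \<xi> E s)) \<longlongrightarrow> 0) (at t within J)" by simp
  show "((\<lambda>s. L2_norm (\<lambda>\<theta>. (\<eta> s \<theta> - \<xi> s \<theta> - (\<eta> t \<theta> - \<xi> t \<theta>)) / (s - t) - (D \<theta> - E \<theta>))) \<longlongrightarrow> 0) (at t within J)"
  proof (rule Lim_null_comparison[OF _ lim])
    have "\<forall>\<^sub>F s in at t within J. s \<in> J" by (simp add: eventually_at_filter)
    then show "\<forall>\<^sub>F s in at t within J. norm (L2_norm (\<lambda>\<theta>. (\<eta> s \<theta> - \<xi> s \<theta> - (\<eta> t \<theta> - \<xi> t \<theta>)) / (s - t) - (D \<theta> - E \<theta>)))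
        \<le> L2_norm (?q \<eta> D s) + L2_norm (?q \<xi> E s)"
    proof eventually_elim
      case (elim s)
      have "(\<lambda>\<theta>. (\<eta> s \<theta> - \<xi> s \<theta> - (\<eta> t \<theta> - \<xi> t \<theta>)) / (s - t) - (D \<theta> - E \<theta>)) = (\<lambda>\<theta>. ?q \<eta> D s \<theta> - ?q \<xi> E s \<theta>)"
        by (simp add: fun_eq_iff diff_divide_distrib)
      then show ?case
        using L2_norm_diff_triangle[OF q[OF DE(1) elim assms(4)] q[OF DE(2) elim assms(5)]] by simp
    qed
  qed
qed

text \<open>The rate depends on the solutions only through a common bound in \<open>HDW\<close>, so
  the estimate is Lipschitz in L2, uniformly over bounded families of solutions.\<close>

lemma L2_stability:
  assumes \<eta>: "solution_on {0..T} \<eta>0 \<eta>" and \<xi>: "solution_on {0..T} \<xi>0 \<xi>" and t: "t \<in> {0..T}"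
    and B: "\<And>s. s \<in> {0..T} \<Longrightarrow> HDW_norm (\<eta> s) \<le> B" "\<And>s. s \<in> {0..T} \<Longrightarrow> HDW_norm (\<xi> s) \<le> B"
  shows "(L2_norm (\<lambda>\<theta>. \<eta> t \<theta> - \<xi> t \<theta>))\<^sup>2 \<le> (L2_norm (\<lambda>\<theta>. \<eta>0 \<theta> - \<xi>0 \<theta>))\<^sup>2
     * exp (2 * ((3 + 2 * embed_const + 2 * embed_const * sqrt (2 * pi)) * (1 + 2 * (sqrt (4 * pi) * B))) * t)"
proof -
  define C where "C = (3 + 2 * embed_const + 2 * embed_const * sqrt (2 * pi))"
  define M where "M = 2 * (C * (1 + 2 * (sqrt (4 * pi) * B)))"
  have C: "C \<ge> 0" unfolding C_def by (intro add_nonneg_nonneg mult_nonneg_nonneg) auto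
  define \<delta> where "\<delta> = (\<lambda>s \<theta>. \<eta> s \<theta> - \<xi> s \<theta>)"
  have sub: "{0..t} \<subseteq> {0..T}" using t by auto
  have H: "\<eta> s \<in> HDW" "\<xi> s \<in> HDW" if "s \<in> {0..T}" for s
    using \<eta> \<xi> that unfolding solution_on_def by auto
  have L: "\<eta> s \<in> L2" "\<xi> s \<in> L2" if "s \<in> {0..T}" for s
    using H[OF that] by (auto intro: odd_H1_L2 HDW_odd_H1)
  have "\<exists>y'. ((\<lambda>s. (L2_norm (\<delta> s))\<^sup>2) has_real_derivative y') (at s within {0..t}) \<and> y' \<le> M * (L2_norm (\<delta> s))\<^sup>2"
    if s: "s \<in> {0..t}" for s
  proof -
    have sT: "s \<in> {0..T}" using s sub by auto
    have W: "L2_norm (wderiv (\<eta> s)) \<le> sqrt (4 * pi) * B" "L2_norm (wderiv (\<xi> s)) \<le> sqrt (4 * pi) * B"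
      using order_trans[OF HDW_wderiv_norm[OF H(1)[OF sT]] mult_left_mono[OF B(1)[OF sT], of "sqrt (4 * pi)"]]
        order_trans[OF HDW_wderiv_norm[OF H(2)[OF sT]] mult_left_mono[OF B(2)[OF sT], of "sqrt (4 * pi)"]] by auto
    obtain D where D: "has_L2_time_deriv \<eta> D s {0..T}"
      "AE \<theta> in lborel. D \<theta> + lin_op (\<eta> s) \<theta> = hilbert (\<eta> s) \<theta> * \<eta> s \<theta> - vel (\<eta> s) \<theta> * wderiv (\<eta> s) \<theta>"
      using \<eta> sT unfolding solution_on_def by blast
    obtain E where E: "has_L2_time_deriv \<xi> E s {0..T}"
      "AE \<theta> in lborel. E \<theta> + lin_op (\<xi> s) \<theta> = hilbert (\<xi> s) \<theta> * \<xi> s \<theta> - vel (\<xi> s) \<theta> * wderiv (\<xi> s) \<theta>"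
      using \<xi> sT unfolding solution_on_def by blast
    have DL: "(\<lambda>\<theta>. D \<theta> - E \<theta>) \<in> L2" using D(1) E(1) by (auto simp: has_L2_time_deriv_def)
    have RL: "(\<lambda>\<theta>. rhs (\<eta> s) \<theta> - rhs (\<xi> s) \<theta>) \<in> L2"
      by (intro L2_diff rhs_L2 HDW_odd_H1 H sT)
    have "((\<lambda>s. (L2_norm (\<delta> s))\<^sup>2) has_real_derivative 2 * L2_inner (\<delta> s) (\<lambda>\<theta>. D \<theta> - E \<theta>)) (at s within {0..T})"
      unfolding \<delta>_def
      by (rule L2_time_deriv_inner[OF _ sT has_L2_time_deriv_diff[OF D(1) E(1) sT L(1) L(2)]])
         (intro L2_diff L; assumption)+
    then have 1: "((\<lambda>s. (L2_norm (\<delta> s))\<^sup>2) has_real_derivative 2 * L2_inner (\<delta> s) (\<lambda>\<theta>. D \<theta> - E \<theta>)) (at s within {0..t})"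
      by (rule has_field_derivative_subset[OF _ sub])
    have "AE \<theta> in lborel. \<theta> \<in> {-pi..pi} \<longrightarrow> D \<theta> - E \<theta> = rhs (\<eta> s) \<theta> - rhs (\<xi> s) \<theta>"
      using D(2) E(2) by eventually_elim (simp add: rhs_def)
    then have "L2_inner (\<lambda>\<theta>. D \<theta> - E \<theta>) (\<delta> s) = L2_inner (\<lambda>\<theta>. rhs (\<eta> s) \<theta> - rhs (\<xi> s) \<theta>) (\<delta> s)"
      by (rule L2_inner_AE_cong[OF _ DL RL]) (unfold \<delta>_def, intro L2_diff L sT)
    then have eq: "L2_inner (\<delta> s) (\<lambda>\<theta>. D \<theta> - E \<theta>) = L2_inner (\<delta> s) (\<lambda>\<theta>. rhs (\<eta> s) \<theta> - rhs (\<xi> s) \<theta>)"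
      by (simp only: L2_inner_commute)
    have "L2_inner (\<delta> s) (\<lambda>\<theta>. rhs (\<eta> s) \<theta> - rhs (\<xi> s) \<theta>)
        \<le> C * (1 + L2_norm (wderiv (\<eta> s)) + L2_norm (wderiv (\<xi> s))) * (L2_norm (\<delta> s))\<^sup>2"
      using rhs_energy[OF HDW_odd_H1[OF H(1)[OF sT]] HDW_odd_H1[OF H(2)[OF sT]]]
      unfolding \<delta>_def C_def by linarith
    also have "\<dots> \<le> C * (1 + 2 * (sqrt (4 * pi) * B)) * (L2_norm (\<delta> s))\<^sup>2"
      using W C by (intro mult_right_mono mult_left_mono) auto
    finally have 2: "2 * L2_inner (\<delta> s) (\<lambda>\<theta>. D \<theta> - E \<theta>) \<le> M * (L2_norm (\<delta> s))\<^sup>2"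
      unfolding eq M_def by simp
    show ?thesis using 1 2 by blast
  qed
  then obtain y' where y': "\<And>s. s \<in> {0..t} \<Longrightarrow> ((\<lambda>s. (L2_norm (\<delta> s))\<^sup>2) has_real_derivative y' s) (at s within {0..t})"
    "\<And>s. s \<in> {0..t} \<Longrightarrow> y' s \<le> M * (L2_norm (\<delta> s))\<^sup>2" by metis
  have "(L2_norm (\<delta> t))\<^sup>2 \<le> (L2_norm (\<delta> 0))\<^sup>2 * exp (M * t - M * 0)"
  proof (rule gronwall[where k = "\<lambda>_. M"])
    show "((\<lambda>s. M * s) has_real_derivative M) (at s within {0..t})" for s
      by (auto intro!: derivative_eq_intros)
  qed (use t y' in auto)
  moreover have "\<delta> 0 = (\<lambda>\<theta>. \<eta>0 \<theta> - \<xi>0 \<theta>)"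
    using \<eta> \<xi> by (simp add: \<delta>_def solution_on_def)
  ultimately show ?thesis by (simp add: \<delta>_def M_def C_def)
qed

lemma solution_HDW_norm_bounded:
  assumes "solution_on {0..T} \<eta>0 \<eta>"
  obtains B where "\<And>s. s \<in> {0..T} \<Longrightarrow> HDW_norm (\<eta> s) \<le> B"
proof -
  have H: "\<eta> s \<in> HDW" if "s \<in> {0..T}" for s using assms that by (simp add: solution_on_def)
  have "((\<lambda>s. HDW_norm (\<eta> s)) \<longlongrightarrow> HDW_norm (\<eta> t)) (at t within {0..T})" if t: "t \<in> {0..T}" for t
  proof (rule LIM_zero_cancel, rule Lim_null_comparison)
    show "((\<lambda>s. HDW_norm (\<lambda>\<theta>. \<eta> s \<theta> - \<eta> t \<theta>)) \<longlongrightarrow> 0) (at t within {0..T})"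
      using assms t by (simp add: solution_on_def)
    have "\<forall>\<^sub>F s in at t within {0..T}. s \<in> {0..T}" by (simp add: eventually_at_filter)
    then show "\<forall>\<^sub>F s in at t within {0..T}. norm (HDW_norm (\<eta> s) - HDW_norm (\<eta> t)) \<le> HDW_norm (\<lambda>\<theta>. \<eta> s \<theta> - \<eta> t \<theta>)"
    proof eventually_elim
      case (elim s)
      show ?case using HDW_norm_reverse_triangle[OF H[OF elim] H[OF t]] by simp
    qed
  qed
  then have "continuous_on {0..T} (\<lambda>s. HDW_norm (\<eta> s))" by (simp add: continuous_on_def)
  then have "bounded ((\<lambda>s. HDW_norm (\<eta> s)) ` {0..T})"
    by (intro compact_imp_bounded compact_continuous_image compact_Icc)
  then obtain B where "\<forall>s\<in>{0..T}. norm (HDW_norm (\<eta> s)) \<le> B" unfolding bounded_iff by blast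
  then show ?thesis using that[of B] by auto
qed

text \<open>Continuity in time bounds both solutions on the compact interval, and equal data make
  the stability bound vanish. Neither smallness nor even modes are assumed, so any solution with an
  admissible datum must be the one constructed later.\<close>

lemma solution_unique:
  assumes "solution_on {0..T} \<eta>0 \<eta>" "solution_on {0..T} \<eta>0 \<xi>" "t \<in> {0..T}"
  shows "\<eta> t = \<xi> t"
proof -
  obtain B1 where B1: "\<And>s. s \<in> {0..T} \<Longrightarrow> HDW_norm (\<eta> s) \<le> B1"
    using solution_HDW_norm_bounded[OF assms(1)] by blast
  obtain B2 where B2: "\<And>s. s \<in> {0..T} \<Longrightarrow> HDW_norm (\<xi> s) \<le> B2"
    using solution_HDW_norm_bounded[OF assms(2)] by blast
  have H: "\<eta> t \<in> HDW" "\<xi> t \<in> HDW" using assms by (auto simp: solution_on_def)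
  have B: "HDW_norm (\<eta> s) \<le> max B1 B2" "HDW_norm (\<xi> s) \<le> max B1 B2" if "s \<in> {0..T}" for s
    using B1[OF that] B2[OF that] by auto
  have "(L2_norm (\<lambda>\<theta>. \<eta> t \<theta> - \<xi> t \<theta>))\<^sup>2 \<le> 0"
    using L2_stability[OF assms B] by (simp add: L2_norm_eq)
  then have "L2_norm (\<lambda>\<theta>. \<eta> t \<theta> - \<xi> t \<theta>) = 0" by simp
  then have "\<eta> t \<theta> - \<xi> t \<theta> = 0" for \<theta> by (rule HDW_zero[OF HDW_diff(1)[OF H]])
  then show ?thesis by (simp add: fun_eq_iff)
qed

lemma solution_on_subset:
  assumes "solution_on J \<eta>0 \<eta>" "J' \<subseteq> J"
  shows "solution_on J' \<eta>0 \<eta>"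
  using assms unfolding solution_on_def has_L2_time_deriv_def
  by (meson subsetD tendsto_within_subset)

section \<open>The weighted trilinear estimate\<close>

text \<open>The square of \<open>growth\<close> bounds ratios of weights; sharing a weight between
  two indices costs one factor \<open>growth\<close>. The exponent 1/4 keeps
  \<open>growth m / m\<close> square summable.\<close>

definition growth :: "int \<Rightarrow> real" where
  "growth k = sqrt (sqrt (1 + 2 * \<bar>real_of_int k\<bar>))"

lemma growth_ge_1: "1 \<le> growth k" by (simp add: growth_def)

lemma growth_nonneg [simp]: "0 \<le> growth k" using growth_ge_1[of k] by linarith

lemma growth_minus [simp]: "growth (- k) = growth k" by (simp add: growth_def)

lemma growth_mono: "\<bar>k\<bar> \<le> \<bar>l\<bar> \<Longrightarrow> growth k \<le> growth l"
  unfolding growth_def by (intro real_sqrt_le_mono) linarith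

text \<open>Admissible weights vary so slowly that commutators of the weight with the transport
  operator are of lower order; the bounds below depend on the weight only through these ratios.\<close>

definition admissible_weight :: "(int \<Rightarrow> real) \<Rightarrow> bool" where
  "admissible_weight w \<longleftrightarrow> (\<forall>p. 0 < w p) \<and> (\<forall>p. w (- 1 - p) = w p) \<and>
     (\<forall>p q. w p \<le> (growth (p - q))\<^sup>2 * w q) \<and>
     (\<forall>p q. \<bar>real_of_int p + 1/2\<bar> * \<bar>w p - w q\<bar> \<le> \<bar>real_of_int (p - q)\<bar> * w p)"

text \<open>The coefficients of the expansion of \<open>\<partial>\<^sub>x f / sin (x / 2)\<close> into the half-integer modes
  \<open>sin ((p + 1/2) x)\<close>, \<open>p \<in> \<int>\<close>.\<close>

definition odd_ext :: "(nat \<Rightarrow> real) \<Rightarrow> int \<Rightarrow> real" where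
  "odd_ext a p = (if p \<ge> 0 then a (nat p) else - a (nat (- 1 - p)))"

lemma odd_ext_reflect: "odd_ext a (- 1 - p) = - odd_ext a p"
  by (auto simp: odd_ext_def)

text \<open>For positive \<open>m\<close> this is \<open>m\<close> times the coefficient of
  \<open>sin (2 * m * \<theta>)\<close>, continued to negative \<open>m\<close> as an even
  sequence.\<close>

definition int_diff :: "(nat \<Rightarrow> real) \<Rightarrow> int \<Rightarrow> real" where
  "int_diff a m = odd_ext a (m - 1) - odd_ext a m"

lemma int_diff_minus: "int_diff a (- m) = int_diff a m"
proof -
  have "- m - 1 = - 1 - m" "- m = - 1 - (m - 1)" by simp_all
  then show ?thesis using odd_ext_reflect[of a m] odd_ext_reflect[of a "m - 1"]
    unfolding int_diff_def by (metis minus_diff_minus minus_diff_eq)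
qed

text \<open>For nonzero \<open>m\<close> this is (m^2 - n^2) / (2 m) times
  \<open>int_diff a m\<close>, split into the part that acts as a derivative and the smoothing part.
  The value 0 at \<open>m = 0\<close>, due to the convention for division, agrees with oddness in
  \<open>m\<close>.\<close>

definition conv_coeff :: "(nat \<Rightarrow> real) \<Rightarrow> int \<Rightarrow> int \<Rightarrow> real" where
  "conv_coeff a n m = (1/2) * (real_of_int m * int_diff a m - (real_of_int n)\<^sup>2 * (int_diff a m / real_of_int m))"

lemma conv_coeff_minus: "conv_coeff a n (- m) = - conv_coeff a n m"
proof -
  have "real_of_int (- m) * int_diff a m = - (real_of_int m * int_diff a m)"
    "int_diff a m / real_of_int (- m) = - (int_diff a m / real_of_int m)" by simp_all
  then show ?thesis unfolding conv_coeff_def int_diff_minus by (simp only:) (simp add: right_diff_distrib)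
qed

text \<open>Coordinate \<open>p\<close> of the quadratic part of the right-hand side. The outer
  factor is a multiple of the velocity coefficient at frequency \<open>n\<close>. The window appears
  because reading off coordinate \<open>p\<close> sums the Fourier modes up to \<open>p\<close>, and
  the negative indices in it merge the frequencies \<open>m - n\<close> and \<open>m + n\<close> of
  a product.\<close>

definition quad_coeff :: "(nat \<Rightarrow> real) \<Rightarrow> int \<Rightarrow> int \<Rightarrow> real" where
  "quad_coeff a L p = (\<Sum>n\<in>{1..L}. int_diff a n / (real_of_int n)\<^sup>2 * (\<Sum>m\<in>{p - n + 1..p + n}. conv_coeff a n m))"

section \<open>Folding, shifting and telescoping sums over the integers\<close>

lemma sum_odd_fold:
  fixes \<kappa> f :: "int \<Rightarrow> real"
  assumes "\<And>m. \<kappa> (- m) = - \<kappa> m"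
  shows "(\<Sum>m\<in>{-R..R}. \<kappa> m * f m) = (\<Sum>m\<in>{1..R}. \<kappa> m * (f m - f (- m)))"
proof (cases "R \<ge> 0")
  case True
  have "\<kappa> 0 = 0" using assms[of 0] by simp
  have "{-R..R} = {-R..-1} \<union> ({0} \<union> {1..R})" using True by auto
  then have "(\<Sum>m\<in>{-R..R}. \<kappa> m * f m) = (\<Sum>m\<in>{-R..-1}. \<kappa> m * f m) + ((\<Sum>m\<in>{0}. \<kappa> m * f m) + (\<Sum>m\<in>{1..R}. \<kappa> m * f m))"
    by (simp only:) (subst sum.union_disjoint; simp)+
  also have "(\<Sum>m\<in>{-R..-1}. \<kappa> m * f m) = (\<Sum>m\<in>{1..R}. \<kappa> (- m) * f (- m))"
    by (rule sum.reindex_bij_witness[of _ uminus uminus]) auto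
  finally show ?thesis
    using \<open>\<kappa> 0 = 0\<close> by (simp add: assms right_diff_distrib sum_subtractf sum_negf)
qed simp

text \<open>Folding an odd sequence at 0 cancels the part of the window that is symmetric about 0.
  What is left are the frequency conditions for \<open>\<bar>m - n\<bar>\<close> and
  \<open>m + n\<close> over positive indices.\<close>

lemma odd_window_sum:
  fixes \<kappa> :: "int \<Rightarrow> real"
  assumes odd: "\<And>m. \<kappa> (- m) = - \<kappa> m" and supp: "\<And>m. m > L \<Longrightarrow> \<kappa> m = 0" and np: "n \<ge> 1" "p \<ge> 0"
  shows "(\<Sum>m\<in>{1..L}. \<kappa> m * (of_bool (\<bar>m - n\<bar> \<le> p) - of_bool (m + n \<le> p))) = (\<Sum>m\<in>{p - n + 1..p + n}. \<kappa> m)"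
proof -
  define R where "R = max L (p + n)"
  have "(\<Sum>m\<in>{p - n + 1..p + n}. \<kappa> m) = (\<Sum>m\<in>{-R..R}. if m \<in> {p - n + 1..p + n} then \<kappa> m else 0)"
    using np by (subst sum.inter_filter[symmetric]) (auto simp: R_def intro!: sum.cong)
  also have "\<dots> = (\<Sum>m\<in>{-R..R}. \<kappa> m * of_bool (m \<in> {p - n + 1..p + n}))"
    by (rule sum.cong) auto
  also have "\<dots> = (\<Sum>m\<in>{1..R}. \<kappa> m * (of_bool (m \<in> {p - n + 1..p + n}) - of_bool (- m \<in> {p - n + 1..p + n})))"
    by (rule sum_odd_fold[where \<kappa> = \<kappa>, OF odd])
  also have "\<dots> = (\<Sum>m\<in>{1..R}. \<kappa> m * (of_bool (\<bar>m - n\<bar> \<le> p) - of_bool (m + n \<le> p)))"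
  proof (rule sum.cong[OF refl])
    fix m assume "m \<in> {1..R}"
    then have "of_bool (m \<in> {p - n + 1..p + n}) - of_bool (- m \<in> {p - n + 1..p + n})
       = (of_bool (\<bar>m - n\<bar> \<le> p) - of_bool (m + n \<le> p) :: real)"
      using np by (auto simp: of_bool_def)
    then show "\<kappa> m * (of_bool (m \<in> {p - n + 1..p + n}) - of_bool (- m \<in> {p - n + 1..p + n}))
       = \<kappa> m * (of_bool (\<bar>m - n\<bar> \<le> p) - of_bool (m + n \<le> p))" by simp
  qed
  also have "\<dots> = (\<Sum>m\<in>{1..L}. \<kappa> m * (of_bool (\<bar>m - n\<bar> \<le> p) - of_bool (m + n \<le> p)))"
    by (rule sum.mono_neutral_right) (auto simp: R_def supp)
  finally show ?thesis ..
qed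

lemma sum_shift_support:
  fixes F :: "int \<Rightarrow> real"
  assumes "finite S" "\<And>p. F p \<noteq> 0 \<Longrightarrow> p \<in> S \<and> p - n \<in> S"
  shows "(\<Sum>p\<in>S. F p) = (\<Sum>q\<in>S. F (q + n))"
  by (rule sum.reindex_bij_witness_not_neutral[of "{p\<in>S. F p = 0}" "{q\<in>S. F (q + n) = 0}" _ "\<lambda>q. q + n" "\<lambda>p. p - n"])
     (use assms in auto)

lemma sum_int_telescope:
  fixes B b :: "int \<Rightarrow> real"
  assumes "\<And>y. B (y - 1) - B y = b y" "x \<le> y"
  shows "(\<Sum>m\<in>{x + 1..y}. b m) = B x - B y"
  using assms(2)
proof (induction y rule: int_ge_induct)
  case (step i)
  have "{x + 1..i + 1} = insert (i + 1) {x + 1..i}" using step by auto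
  then show ?case using step assms(1)[of "i + 1"] by simp
qed simp

text \<open>Summation by parts: the factor \<open>m\<close> survives only in the boundary terms.
  These carry the whole unbounded part of the nonlinearity.\<close>

lemma sum_int_abel:
  fixes A :: "int \<Rightarrow> real"
  assumes "x + 1 \<le> y"
  shows "(\<Sum>m\<in>{x + 1..y}. real_of_int m * (A (m - 1) - A m))
     = real_of_int (x + 1) * A x - real_of_int y * A y + (\<Sum>m\<in>{x + 1..y - 1}. A m)"
  using assms
proof (induction y rule: int_ge_induct)
  case (step i)
  have "{x + 1..i + 1} = insert (i + 1) {x + 1..i}" "{x + 1..i + 1 - 1} = insert i {x + 1..i - 1}" using step by auto
  then show ?case using step by (simp add: algebra_simps)
qed (simp add: algebra_simps)

context
  fixes a :: "nat \<Rightarrow> real" and N :: nat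
  assumes a0: "a 0 = 0" and supp: "\<And>k. k > N \<Longrightarrow> a k = 0"
begin

lemma odd_ext_support: "odd_ext a p \<noteq> 0 \<Longrightarrow> p \<in> {- 1 - int N..int N}"
proof (rule ccontr)
  assume p: "odd_ext a p \<noteq> 0" "p \<notin> {- 1 - int N..int N}"
  show False
  proof (cases "p \<ge> 0")
    case True
    then have "nat p > N" using p(2) by auto
    then show False using supp p(1) True by (simp add: odd_ext_def)
  next
    case False
    then have "nat (- 1 - p) > N" using p(2) by auto
    then show False using supp p(1) False by (simp add: odd_ext_def)
  qed
qed

lemma int_diff_support: "m > int N + 1 \<Longrightarrow> int_diff a m = 0"
proof -
  assume m: "m > int N + 1"
  then have "m \<notin> {- 1 - int N..int N}" "m - 1 \<notin> {- 1 - int N..int N}" by auto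
  then have "odd_ext a m = 0" "odd_ext a (m - 1) = 0" using odd_ext_support by blast+
  then show ?thesis by (simp add: int_diff_def)
qed

text \<open>A discrete antiderivative of the odd sequence \<open>int_diff a m / m\<close>, up to
  sign. Antiderivatives of odd sequences are symmetric about -1/2, and building this in makes one
  formula valid on all integers.\<close>

definition primitive :: "int \<Rightarrow> real" where
  "primitive j = (\<Sum>m\<in>{(if j \<ge> 0 then j else - 1 - j) + 1..int N + 1}. int_diff a m / real_of_int m)"

lemma primitive_reflect: "primitive (- 1 - j) = primitive j"
  by (simp add: primitive_def)

lemma primitive_diff: "primitive (y - 1) - primitive y = int_diff a y / real_of_int y"
proof -
  have pos: "primitive (y - 1) - primitive y = int_diff a y / real_of_int y" if "y \<ge> 1" for y
  proof (cases "y \<le> int N + 1")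
    case True
    then have "{y..int N + 1} = insert y {y + 1..int N + 1}" by auto
    then show ?thesis using that by (simp add: primitive_def)
  next
    case False
    then show ?thesis using that int_diff_support[of y] by (simp add: primitive_def)
  qed
  consider "y \<ge> 1" | "y = 0" | "y \<le> -1" by linarith
  then show ?thesis
  proof cases
    case 2
    then show ?thesis using primitive_reflect[of 0] by simp
  next
    case 3
    have "primitive (y - 1) = primitive (- y)" "primitive y = primitive (- y - 1)"
      using primitive_reflect[of "- y"] primitive_reflect[of "- y - 1"] by simp_all
    then show ?thesis using pos[of "- y"] 3 by (simp add: int_diff_minus)
  qed (use pos in auto)
qed

text \<open>The derivative part is summed by parts, the smoothing part telescopes. The factor n^2 in
  front of the latter cancels the 1 / n^2 of the velocity coefficient in
  \<open>quad_coeff\<close>.\<close>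

lemma conv_sum:
  assumes "n \<ge> 1"
  shows "(\<Sum>m\<in>{p - n + 1..p + n}. conv_coeff a n m)
    = (1/2) * (real_of_int (p - n + 1) * odd_ext a (p - n) - real_of_int (p + n) * odd_ext a (p + n)
        + (\<Sum>m\<in>{p - n + 1..p + n - 1}. odd_ext a m)) - (1/2) * (real_of_int n)\<^sup>2 * (primitive (p - n) - primitive (p + n))"
proof -
  have 1: "(\<Sum>m\<in>{p - n + 1..p + n}. int_diff a m / real_of_int m) = primitive (p - n) - primitive (p + n)"
    by (rule sum_int_telescope) (use assms primitive_diff in auto)
  have 2: "(\<Sum>m\<in>{p - n + 1..p + n}. real_of_int m * int_diff a m)
     = real_of_int (p - n + 1) * odd_ext a (p - n) - real_of_int (p + n) * odd_ext a (p + n) + (\<Sum>m\<in>{p - n + 1..p + n - 1}. odd_ext a m)"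
    unfolding int_diff_def by (rule sum_int_abel) (use assms in auto)
  have "(\<Sum>m\<in>{p - n + 1..p + n}. conv_coeff a n m) = (1/2) * (\<Sum>m\<in>{p - n + 1..p + n}. real_of_int m * int_diff a m)
      - (1/2) * (real_of_int n)\<^sup>2 * (\<Sum>m\<in>{p - n + 1..p + n}. int_diff a m / real_of_int m)"
    unfolding conv_coeff_def
    by (simp add: sum_subtractf sum_distrib_left right_diff_distrib sum_divide_distrib diff_divide_distrib mult_ac)
  then show ?thesis unfolding 1 2 by simp
qed

text \<open>The \<open>\<ell>\<^sup>1\<close> norm that controls the velocity; it is bounded by the \<open>\<ell>\<^sup>2\<close> norm
  because \<open>growth m / m\<close> is square summable.\<close>

definition vel_norm :: real where
  "vel_norm = (\<Sum>m\<in>{1..N}. \<bar>a m\<bar> * growth (int m + 1) / real m)"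

lemma vel_norm_nonneg: "vel_norm \<ge> 0"
  unfolding vel_norm_def by (intro sum_nonneg) auto

text \<open>Each \<open>int_diff\<close> involves two neighbours, hence the factor 2. Shifting the
  index of the first neighbour is the reason for the argument \<open>m + 1\<close> of
  \<open>growth\<close> in \<open>vel_norm\<close>.\<close>

lemma velocity_sum: "(\<Sum>n\<in>{1..int N + 1}. \<bar>int_diff a n\<bar> * growth n / real_of_int n) \<le> 2 * vel_norm"
proof -
  have "(\<Sum>n\<in>{1..int N + 1}. \<bar>int_diff a n\<bar> * growth n / real_of_int n)
     = (\<Sum>n\<in>{1..N + 1}. \<bar>a (n - 1) - a n\<bar> * growth (int n) / real n)"
    by (rule sum.reindex_bij_witness[of _ int nat]) (auto simp: int_diff_def odd_ext_def nat_diff_distrib)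
  also have "\<dots> \<le> (\<Sum>n\<in>{1..N + 1}. \<bar>a (n - 1)\<bar> * growth (int n) / real n + \<bar>a n\<bar> * growth (int n) / real n)"
  proof (rule sum_mono)
    fix n
    have "\<bar>a (n - 1) - a n\<bar> * growth (int n) / real n \<le> (\<bar>a (n - 1)\<bar> + \<bar>a n\<bar>) * growth (int n) / real n"
      by (intro divide_right_mono mult_right_mono) auto
    then show "\<bar>a (n - 1) - a n\<bar> * growth (int n) / real n \<le> \<bar>a (n - 1)\<bar> * growth (int n) / real n + \<bar>a n\<bar> * growth (int n) / real n"
      by (simp add: distrib_right add_divide_distrib)
  qed
  also have "\<dots> = (\<Sum>n\<in>{1..N + 1}. \<bar>a (n - 1)\<bar> * growth (int n) / real n) + (\<Sum>n\<in>{1..N + 1}. \<bar>a n\<bar> * growth (int n) / real n)"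
    by (rule sum.distrib)
  also have "(\<Sum>n\<in>{1..N + 1}. \<bar>a (n - 1)\<bar> * growth (int n) / real n) = (\<Sum>m\<in>{0..N}. \<bar>a m\<bar> * growth (int m + 1) / (real m + 1))"
    by (rule sum.reindex_bij_witness[of _ Suc "\<lambda>n. n - 1"]) (auto simp: add.commute)
  also have "\<dots> = (\<Sum>m\<in>{1..N}. \<bar>a m\<bar> * growth (int m + 1) / (real m + 1))"
    by (rule sum.mono_neutral_right) (auto simp: a0 Suc_le_eq)
  also have "\<dots> \<le> vel_norm" unfolding vel_norm_def
    by (intro sum_mono divide_left_mono) auto
  also have "(\<Sum>n\<in>{1..N + 1}. \<bar>a n\<bar> * growth (int n) / real n) = (\<Sum>n\<in>{1..N}. \<bar>a n\<bar> * growth (int n) / real n)"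
    by (rule sum.mono_neutral_right) (auto intro!: supp)
  also have "\<dots> \<le> vel_norm" unfolding vel_norm_def
    by (intro sum_mono divide_right_mono mult_left_mono growth_mono) auto
  finally show ?thesis by simp
qed

text \<open>Summation by parts moves the difference from \<open>a\<close> to \<open>1 / m\<close>
  and gains a factor \<open>1 / m\<close>. Taking absolute values in the definition directly would
  lead, after summation over \<open>j\<close>, to the sum of all
  \<open>\<bar>int_diff a m\<bar>\<close>, which the l2 norm does not control.\<close>

lemma primitive_nat_bound:
  "\<bar>primitive (int j)\<bar> \<le> \<bar>a j\<bar> / (real j + 1) + (\<Sum>m\<in>{j + 1..N}. \<bar>a m\<bar> / (real m * (real m + 1)))"
proof (cases "j \<le> N")
  case True
  have "primitive (int j) = (\<Sum>m\<in>{j + 1..N + 1}. (a (m - 1) - a m) / real m)"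
    unfolding primitive_def
    by (rule sum.reindex_bij_witness[of _ int nat]) (auto simp: int_diff_def odd_ext_def nat_diff_distrib)
  also have "\<dots> = a j / (real j + 1) - (\<Sum>m\<in>{j + 1..N}. a m / (real m * (real m + 1)))"
    using True
  proof (induction "N - j" arbitrary: j)
    case 0
    then have "j = N" by simp
    then show ?case using supp[of "Suc N"] by (simp add: add.commute)
  next
    case (Suc d)
    then have j: "j < N" "d = N - (j + 1)" by auto
    have "{j + 1..N + 1} = insert (j + 1) {j + 1 + 1..N + 1}" "{j + 1..N} = insert (j + 1) {j + 1 + 1..N}"
      using j by auto
    then have "(\<Sum>m\<in>{j + 1..N + 1}. (a (m - 1) - a m) / real m)
        = (a j - a (j + 1)) / real (j + 1) + (\<Sum>m\<in>{j + 1 + 1..N + 1}. (a (m - 1) - a m) / real m)"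
      "(\<Sum>m\<in>{j + 1..N}. a m / (real m * (real m + 1))) = a (j + 1) / (real (j + 1) * (real (j + 1) + 1)) + (\<Sum>m\<in>{j + 1 + 1..N}. a m / (real m * (real m + 1)))"
      by simp_all
    moreover have "a (j + 1) / (real (j + 1) + 1) = a (j + 1) / real (j + 1) - a (j + 1) / (real (j + 1) * (real (j + 1) + 1))"
      by (simp add: divide_simps) (simp add: algebra_simps)
    ultimately show ?case
      using Suc(1)[OF j(2)] j(1) by (simp add: diff_divide_distrib add.commute)
  qed
  finally have eq: "primitive (int j) = a j / (real j + 1) - (\<Sum>m\<in>{j + 1..N}. a m / (real m * (real m + 1)))" .
  have "\<bar>\<Sum>m\<in>{j + 1..N}. a m / (real m * (real m + 1))\<bar> \<le> (\<Sum>m\<in>{j + 1..N}. \<bar>a m / (real m * (real m + 1))\<bar>)"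
    by (rule sum_abs)
  also have "\<dots> = (\<Sum>m\<in>{j + 1..N}. \<bar>a m\<bar> / (real m * (real m + 1)))"
    by (rule sum.cong) (auto simp: abs_mult)
  finally show ?thesis unfolding eq
    using abs_triangle_ineq4[of "a j / (real j + 1)" "\<Sum>m\<in>{j + 1..N}. a m / (real m * (real m + 1))"]
    by simp
next
  case False
  then show ?thesis using supp[of j] by (simp add: primitive_def)
qed

text \<open>After exchanging the sums, each \<open>m\<close> is counted for the \<open>m\<close>
  indices below it, which cancels one factor of the denominator. Both the boundary term and the
  double sum are then dominated by \<open>vel_norm\<close>.\<close>

lemma primitive_nat_sum:
  "(\<Sum>j\<in>{0..J}. growth (int j + 1) * \<bar>primitive (int j)\<bar>) \<le> 2 * vel_norm"
proof -
  have 0: "primitive (int j) = 0" if "j > N" for j using that by (simp add: primitive_def)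
  have "(\<Sum>j\<in>{0..J}. growth (int j + 1) * \<bar>primitive (int j)\<bar>) \<le> (\<Sum>j\<in>{0..max J N}. growth (int j + 1) * \<bar>primitive (int j)\<bar>)"
    by (rule sum_mono2) auto
  also have "\<dots> = (\<Sum>j\<in>{0..N}. growth (int j + 1) * \<bar>primitive (int j)\<bar>)"
    by (rule sum.mono_neutral_right) (auto intro!: 0)
  also have "\<dots> \<le> (\<Sum>j\<in>{0..N}. growth (int j + 1) * \<bar>a j\<bar> / (real j + 1)
      + (\<Sum>m\<in>{1..N}. if j < m then growth (int j + 1) * \<bar>a m\<bar> / (real m * (real m + 1)) else 0))"
  proof (rule sum_mono)
    fix j
    have "(\<Sum>m\<in>{1..N}. if j < m then growth (int j + 1) * \<bar>a m\<bar> / (real m * (real m + 1)) else 0)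
       = (\<Sum>m\<in>{j + 1..N}. growth (int j + 1) * \<bar>a m\<bar> / (real m * (real m + 1)))"
      by (subst sum.inter_filter[symmetric]) (auto intro!: sum.cong)
    then show "growth (int j + 1) * \<bar>primitive (int j)\<bar> \<le> growth (int j + 1) * \<bar>a j\<bar> / (real j + 1)
      + (\<Sum>m\<in>{1..N}. if j < m then growth (int j + 1) * \<bar>a m\<bar> / (real m * (real m + 1)) else 0)"
      using mult_left_mono[OF primitive_nat_bound[of j] growth_nonneg[of "int j + 1"]]
      by (simp add: distrib_left sum_distrib_left)
  qed
  also have "\<dots> = (\<Sum>j\<in>{0..N}. growth (int j + 1) * \<bar>a j\<bar> / (real j + 1))
     + (\<Sum>j\<in>{0..N}. \<Sum>m\<in>{1..N}. if j < m then growth (int j + 1) * \<bar>a m\<bar> / (real m * (real m + 1)) else 0)"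
    by (rule sum.distrib)
  also have "(\<Sum>j\<in>{0..N}. growth (int j + 1) * \<bar>a j\<bar> / (real j + 1)) = (\<Sum>j\<in>{1..N}. growth (int j + 1) * \<bar>a j\<bar> / (real j + 1))"
    by (rule sum.mono_neutral_right) (auto simp: a0 Suc_le_eq)
  also have "\<dots> \<le> vel_norm" unfolding vel_norm_def
    by (intro sum_mono) (auto simp: mult.commute intro!: divide_left_mono)
  also have "(\<Sum>j\<in>{0..N}. \<Sum>m\<in>{1..N}. if j < m then growth (int j + 1) * \<bar>a m\<bar> / (real m * (real m + 1)) else 0)
     = (\<Sum>m\<in>{1..N}. \<Sum>j\<in>{0..N}. if j < m then growth (int j + 1) * \<bar>a m\<bar> / (real m * (real m + 1)) else 0)"
    by (rule sum.swap)
  also have "\<dots> \<le> vel_norm" unfolding vel_norm_def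
  proof (rule sum_mono)
    fix m assume m: "m \<in> {1..N}"
    have "(\<Sum>j\<in>{0..N}. if j < m then growth (int j + 1) * \<bar>a m\<bar> / (real m * (real m + 1)) else 0)
      = (\<Sum>j\<in>{0..<m}. growth (int j + 1) * \<bar>a m\<bar> / (real m * (real m + 1)))"
      using m by (subst sum.inter_filter[symmetric]) (auto intro!: sum.cong)
    also have "\<dots> \<le> (\<Sum>j\<in>{0..<m}. growth (int m + 1) * \<bar>a m\<bar> / (real m * (real m + 1)))"
      by (intro sum_mono divide_right_mono mult_right_mono growth_mono) auto
    also have "\<dots> = growth (int m + 1) * \<bar>a m\<bar> / (real m + 1)" using m by simp
    also have "\<dots> \<le> \<bar>a m\<bar> * growth (int m + 1) / real m"
      using m by (subst mult.commute) (intro divide_left_mono; simp)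
    finally show "(\<Sum>j\<in>{0..N}. if j < m then growth (int j + 1) * \<bar>a m\<bar> / (real m * (real m + 1)) else 0)
      \<le> \<bar>a m\<bar> * growth (int m + 1) / real m" .
  qed
  finally show ?thesis by simp
qed

lemma primitive_sum:
  assumes "finite S"
  shows "(\<Sum>j\<in>S. growth j * \<bar>primitive j\<bar>) \<le> 4 * vel_norm"
proof -
  obtain J :: nat where J: "S \<subseteq> {- 1 - int J..int J}"
  proof -
    have "finite ((\<lambda>j. \<bar>j\<bar>) ` S)" using assms by simp
    then obtain B where B: "\<And>j. j \<in> S \<Longrightarrow> \<bar>j\<bar> \<le> B" by (meson bdd_above.unfold bdd_above_finite image_eqI)
    show ?thesis by (rule that[of "nat B"]) (use B in fastforce)
  qed
  have "(\<Sum>j\<in>S. growth j * \<bar>primitive j\<bar>) \<le> (\<Sum>j\<in>{- 1 - int J..int J}. growth j * \<bar>primitive j\<bar>)"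
    by (rule sum_mono2) (use J in auto)
  also have "{- 1 - int J..int J} = {- 1 - int J..- 1} \<union> {0..int J}" by auto
  also have "(\<Sum>j\<in>{- 1 - int J..- 1} \<union> {0..int J}. growth j * \<bar>primitive j\<bar>)
     = (\<Sum>j\<in>{- 1 - int J..- 1}. growth j * \<bar>primitive j\<bar>) + (\<Sum>j\<in>{0..int J}. growth j * \<bar>primitive j\<bar>)"
    by (rule sum.union_disjoint) auto
  also have "(\<Sum>j\<in>{- 1 - int J..- 1}. growth j * \<bar>primitive j\<bar>) = (\<Sum>j\<in>{0..J}. growth (int j + 1) * \<bar>primitive (int j)\<bar>)"
  proof (rule sum.reindex_bij_witness[of _ "\<lambda>j. - 1 - int j" "\<lambda>j. nat (- 1 - j)"])
    fix j assume j: "j \<in> {- 1 - int J..- 1}"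
    then show "growth (int (nat (- 1 - j)) + 1) * \<bar>primitive (int (nat (- 1 - j)))\<bar> = growth j * \<bar>primitive j\<bar>"
      using primitive_reflect[of j] growth_minus[of j] by simp
  qed auto
  also have "(\<Sum>j\<in>{0..int J}. growth j * \<bar>primitive j\<bar>) = (\<Sum>j\<in>{0..J}. growth (int j) * \<bar>primitive (int j)\<bar>)"
    by (rule sum.reindex_bij_witness[of _ int nat]) auto
  also have "\<dots> \<le> (\<Sum>j\<in>{0..J}. growth (int j + 1) * \<bar>primitive (int j)\<bar>)"
    by (intro sum_mono mult_right_mono growth_mono) auto
  finally show ?thesis using primitive_nat_sum[of J] by linarith
qed

section \<open>Weighted estimates for shifted products\<close>

context
  fixes w :: "int \<Rightarrow> real"
  assumes w: "admissible_weight w"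
begin

lemma w_pos: "0 < w p" and w_reflect: "w (- 1 - p) = w p"
  and w_ratio: "w p \<le> (growth (p - q))\<^sup>2 * w q"
  and w_diff: "\<bar>real_of_int p + 1/2\<bar> * \<bar>w p - w q\<bar> \<le> \<bar>real_of_int (p - q)\<bar> * w p"
  using w unfolding admissible_weight_def by blast+

lemma w_nonneg [simp]: "0 \<le> w p" using w_pos[of p] by simp

lemma sqrt_w_ratio: "sqrt (w p) \<le> growth (p - q) * sqrt (w q)"
proof -
  have "sqrt (w p) \<le> sqrt ((growth (p - q))\<^sup>2 * w q)" by (intro real_sqrt_le_mono w_ratio)
  then show ?thesis by (simp add: real_sqrt_mult)
qed

text \<open>Shares the weight evenly between two indices, so that weighted sums of products become
  sums of products of \<alpha>.\<close>

lemma w_le_geometric: "w p \<le> growth (p - q) * (sqrt (w p) * sqrt (w q))"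
proof -
  have "w p = sqrt (w p) * sqrt (w p)" by simp
  also have "\<dots> \<le> sqrt (w p) * (growth (p - q) * sqrt (w q))"
    by (intro mult_left_mono sqrt_w_ratio) simp
  finally show ?thesis by (simp add: mult_ac)
qed

definition weighted_energy :: real where
  "weighted_energy = (\<Sum>p\<in>{1..N}. w (int p) * (a p)\<^sup>2)"

definition \<alpha> :: "int \<Rightarrow> real" where "\<alpha> p = sqrt (w p) * \<bar>odd_ext a p\<bar>"

lemma \<alpha>_nonneg [simp]: "0 \<le> \<alpha> p" by (simp add: \<alpha>_def)

lemma \<alpha>_sq: "(\<alpha> p)\<^sup>2 = w p * (odd_ext a p)\<^sup>2"
  by (simp add: \<alpha>_def power_mult_distrib)

lemma reflect_fold:
  fixes F :: "int \<Rightarrow> real"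
  assumes "\<And>p. F (- 1 - p) = F p" "F 0 = 0"
  shows "(\<Sum>p\<in>{- 1 - int N..int N}. F p) = 2 * (\<Sum>p\<in>{1..N}. F (int p))"
proof -
  have "{- 1 - int N..int N} = {- 1 - int N..- 1} \<union> {0..int N}" by auto
  also have "(\<Sum>p\<in>{- 1 - int N..- 1} \<union> {0..int N}. F p) = (\<Sum>p\<in>{- 1 - int N..- 1}. F p) + (\<Sum>p\<in>{0..int N}. F p)"
    by (rule sum.union_disjoint) auto
  also have "(\<Sum>p\<in>{- 1 - int N..- 1}. F p) = (\<Sum>p\<in>{0..int N}. F p)"
    by (rule sum.reindex_bij_witness[of _ "\<lambda>p. - 1 - p" "\<lambda>p. - 1 - p"]) (auto simp: assms(1))
  also have "(\<Sum>p\<in>{0..int N}. F p) = (\<Sum>p\<in>{0..N}. F (int p))"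
    by (rule sum.reindex_bij_witness[of _ int nat]) auto
  also have "\<dots> = (\<Sum>p\<in>{1..N}. F (int p))"
    by (rule sum.mono_neutral_right) (auto simp: assms(2) Suc_le_eq)
  finally show ?thesis by simp
qed

lemma weighted_energy_nonneg: "0 \<le> weighted_energy"
  unfolding weighted_energy_def by (intro sum_nonneg mult_nonneg_nonneg) auto

lemma sum_\<alpha>_sq:
  assumes "finite S"
  shows "(\<Sum>p\<in>S. (\<alpha> p)\<^sup>2) \<le> 2 * weighted_energy"
proof -
  have "(\<Sum>p\<in>S. (\<alpha> p)\<^sup>2) \<le> (\<Sum>p\<in>S \<union> {- 1 - int N..int N}. (\<alpha> p)\<^sup>2)"
    using assms by (intro sum_mono2) auto
  also have "\<dots> = (\<Sum>p\<in>{- 1 - int N..int N}. (\<alpha> p)\<^sup>2)"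
  proof (rule sum.mono_neutral_right)
    show "\<forall>p\<in>S \<union> {- 1 - int N..int N} - {- 1 - int N..int N}. (\<alpha> p)\<^sup>2 = 0"
      using odd_ext_support by (auto simp: \<alpha>_sq)
  qed (use assms in auto)
  also have "\<dots> = 2 * (\<Sum>p\<in>{1..N}. (\<alpha> (int p))\<^sup>2)"
    by (rule reflect_fold) (auto simp: \<alpha>_sq w_reflect odd_ext_reflect, simp add: odd_ext_def a0)
  also have "(\<Sum>p\<in>{1..N}. (\<alpha> (int p))\<^sup>2) = weighted_energy"
    by (simp add: weighted_energy_def \<alpha>_sq odd_ext_def)
  finally show ?thesis .
qed

lemma sum_\<alpha>_shift:
  assumes "finite S"
  shows "(\<Sum>p\<in>S. \<alpha> p * \<alpha> (p + k)) \<le> 2 * weighted_energy"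
proof -
  have "(\<Sum>p\<in>S. (\<alpha> (p + k))\<^sup>2) = (\<Sum>p\<in>(\<lambda>p. p + k) ` S. (\<alpha> p)\<^sup>2)"
    by (subst sum.reindex) (auto simp: inj_on_def)
  also have "\<dots> \<le> 2 * weighted_energy" by (rule sum_\<alpha>_sq) (use assms in simp)
  finally have 1: "(\<Sum>p\<in>S. (\<alpha> (p + k))\<^sup>2) \<le> 2 * weighted_energy" .
  have "(\<Sum>p\<in>S. \<alpha> p * \<alpha> (p + k)) \<le> (\<Sum>p\<in>S. (1/2) * (\<alpha> p)\<^sup>2 + (1/2) * (\<alpha> (p + k))\<^sup>2)"
  proof (rule sum_mono)
    fix p show "\<alpha> p * \<alpha> (p + k) \<le> (1/2) * (\<alpha> p)\<^sup>2 + (1/2) * (\<alpha> (p + k))\<^sup>2"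
      using sum_squares_bound[of "\<alpha> p" "\<alpha> (p + k)"] by simp
  qed
  also have "\<dots> = (1/2) * (\<Sum>p\<in>S. (\<alpha> p)\<^sup>2) + (1/2) * (\<Sum>p\<in>S. (\<alpha> (p + k))\<^sup>2)"
    by (simp add: sum.distrib sum_distrib_left sum_divide_distrib)
  finally show ?thesis using 1 sum_\<alpha>_sq[OF assms] by simp
qed

text \<open>For constant weight the left-hand side is \<open>n - 1\<close>: the unbounded index
  \<open>q\<close> cancels. For a varying weight the error is \<open>q\<close> times its variation,
  which admissibility bounds by a multiple of \<open>n\<close>.\<close>

lemma transport_commutator:
  assumes "n \<ge> 1"
  shows "\<bar>w (q + n) * real_of_int (q + 1) - w q * real_of_int (q + n)\<bar> \<le> 2 * real_of_int n * growth n * (sqrt (w q) * sqrt (w (q + n)))"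
proof -
  \<comment> \<open>Centred at \<open>q + 1/2\<close>, the multiplier that the definition of
    admissible weights provides for.\<close>
  have "w (q + n) * real_of_int (q + 1) - w q * real_of_int (q + n)
    = (real_of_int q + 1/2) * (w (q + n) - w q) + (1/2) * w (q + n) - (real_of_int n - 1/2) * w q"
    by (simp add: algebra_simps)
  moreover have "\<bar>(real_of_int q + 1/2) * (w (q + n) - w q)\<bar> \<le> real_of_int n * w q"
    using w_diff[of q "q + n"] assms by (simp add: abs_mult abs_minus_commute)
  moreover have "\<bar>(real_of_int n - 1/2) * w q\<bar> = (real_of_int n - 1/2) * w q" "\<bar>(1/2) * w (q + n)\<bar> = (1/2) * w (q + n)"
    using assms by (auto simp: abs_mult)
  ultimately have "\<bar>w (q + n) * real_of_int (q + 1) - w q * real_of_int (q + n)\<bar>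
     \<le> real_of_int n * w q + (1/2) * w (q + n) + (real_of_int n - 1/2) * w q"
    by linarith
  also have "\<dots> = (2 * real_of_int n - 1/2) * w q + (1/2) * w (q + n)" by (simp add: algebra_simps)
  also have "\<dots> \<le> (2 * real_of_int n - 1/2) * (growth n * (sqrt (w q) * sqrt (w (q + n))))
      + (1/2) * (growth n * (sqrt (w q) * sqrt (w (q + n))))"
    using w_le_geometric[of q "q + n"] w_le_geometric[of "q + n" q] assms
    by (intro add_mono mult_left_mono) (auto simp: mult.commute)
  finally show ?thesis by (simp add: algebra_simps)
qed

text \<open>Discrete integration by parts: shifting the first sum by \<open>n\<close> makes both
  sums run over the same products at \<open>q\<close> and \<open>q + n\<close>, so their unbounded
  coefficients combine into the commutator.\<close>

lemma transport_bound:
  assumes "n \<ge> 1"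
  shows "\<bar>\<Sum>p\<in>{- 1 - int N..int N}. w p * odd_ext a p *
      (real_of_int (p - n + 1) * odd_ext a (p - n) - real_of_int (p + n) * odd_ext a (p + n))\<bar>
    \<le> 4 * real_of_int n * growth n * weighted_energy"
proof -
  let ?S = "{- 1 - int N..int N}"
  have "(\<Sum>p\<in>?S. w p * odd_ext a p * (real_of_int (p - n + 1) * odd_ext a (p - n)))
      = (\<Sum>q\<in>?S. w (q + n) * odd_ext a (q + n) * (real_of_int (q + 1) * odd_ext a q))"
    by (subst sum_shift_support[where n = n]) (use odd_ext_support in auto)
  then have eq: "(\<Sum>p\<in>?S. w p * odd_ext a p *
      (real_of_int (p - n + 1) * odd_ext a (p - n) - real_of_int (p + n) * odd_ext a (p + n)))
     = (\<Sum>q\<in>?S. (w (q + n) * real_of_int (q + 1) - w q * real_of_int (q + n)) * (odd_ext a q * odd_ext a (q + n)))"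
    unfolding right_diff_distrib sum_subtractf by (simp add: sum_subtractf[symmetric] algebra_simps)
  have "\<bar>\<Sum>q\<in>?S. (w (q + n) * real_of_int (q + 1) - w q * real_of_int (q + n)) * (odd_ext a q * odd_ext a (q + n))\<bar>
      \<le> (\<Sum>q\<in>?S. \<bar>(w (q + n) * real_of_int (q + 1) - w q * real_of_int (q + n)) * (odd_ext a q * odd_ext a (q + n))\<bar>)"
    by (rule sum_abs)
  also have "\<dots> \<le> (\<Sum>q\<in>?S. 2 * real_of_int n * growth n * (\<alpha> q * \<alpha> (q + n)))"
  proof (rule sum_mono)
    fix q
    define c where "c = w (q + n) * real_of_int (q + 1) - w q * real_of_int (q + n)"
    have "\<bar>c\<bar> * (\<bar>odd_ext a q\<bar> * \<bar>odd_ext a (q + n)\<bar>)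
      \<le> (2 * real_of_int n * growth n * (sqrt (w q) * sqrt (w (q + n)))) * (\<bar>odd_ext a q\<bar> * \<bar>odd_ext a (q + n)\<bar>)"
      unfolding c_def by (rule mult_right_mono[OF transport_commutator[OF assms]]) simp
    also have "\<dots> = 2 * real_of_int n * growth n * (\<alpha> q * \<alpha> (q + n))" by (simp only: \<alpha>_def mult_ac)
    finally have "\<bar>c * (odd_ext a q * odd_ext a (q + n))\<bar> \<le> 2 * real_of_int n * growth n * (\<alpha> q * \<alpha> (q + n))"
      by (simp only: abs_mult)
    then show "\<bar>(w (q + n) * real_of_int (q + 1) - w q * real_of_int (q + n)) * (odd_ext a q * odd_ext a (q + n))\<bar>
      \<le> 2 * real_of_int n * growth n * (\<alpha> q * \<alpha> (q + n))" unfolding c_def .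
  qed
  also have "\<dots> = 2 * real_of_int n * growth n * (\<Sum>q\<in>?S. \<alpha> q * \<alpha> (q + n))" by (simp add: sum_distrib_left)
  also have "\<dots> \<le> 2 * real_of_int n * growth n * (2 * weighted_energy)"
    using assms by (intro mult_left_mono sum_\<alpha>_shift) auto
  finally show ?thesis unfolding eq by (simp add: algebra_simps)
qed

text \<open>There are \<open>2 * n - 1\<close> shifts in the window, and each costs one factor
  \<open>growth n\<close> for moving the weight and one application of the bound for shifted
  products.\<close>

lemma window_bound:
  assumes "n \<ge> 1"
  shows "\<bar>\<Sum>p\<in>{- 1 - int N..int N}. w p * odd_ext a p * (\<Sum>m\<in>{p - n + 1..p + n - 1}. odd_ext a m)\<bar>
    \<le> 4 * real_of_int n * growth n * weighted_energy"
proof -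
  let ?S = "{- 1 - int N..int N}" and ?K = "{- (n - 1)..n - 1}"
  have "(\<Sum>p\<in>?S. w p * odd_ext a p * (\<Sum>m\<in>{p - n + 1..p + n - 1}. odd_ext a m))
     = (\<Sum>p\<in>?S. \<Sum>k\<in>?K. w p * odd_ext a p * odd_ext a (p + k))"
  proof (rule sum.cong[OF refl])
    fix p
    have "(\<Sum>m\<in>{p - n + 1..p + n - 1}. odd_ext a m) = (\<Sum>k\<in>?K. odd_ext a (p + k))"
      by (rule sum.reindex_bij_witness[of _ "\<lambda>k. p + k" "\<lambda>m. m - p"]) auto
    then show "w p * odd_ext a p * (\<Sum>m\<in>{p - n + 1..p + n - 1}. odd_ext a m) = (\<Sum>k\<in>?K. w p * odd_ext a p * odd_ext a (p + k))"
      by (simp add: sum_distrib_left)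
  qed
  also have "\<dots> = (\<Sum>k\<in>?K. \<Sum>p\<in>?S. w p * odd_ext a p * odd_ext a (p + k))" by (rule sum.swap)
  finally have eq: "(\<Sum>p\<in>?S. w p * odd_ext a p * (\<Sum>m\<in>{p - n + 1..p + n - 1}. odd_ext a m))
     = (\<Sum>k\<in>?K. \<Sum>p\<in>?S. w p * odd_ext a p * odd_ext a (p + k))" .
  have "\<bar>\<Sum>k\<in>?K. \<Sum>p\<in>?S. w p * odd_ext a p * odd_ext a (p + k)\<bar> \<le> (\<Sum>k\<in>?K. \<bar>\<Sum>p\<in>?S. w p * odd_ext a p * odd_ext a (p + k)\<bar>)" by (rule sum_abs)
  also have "\<dots> \<le> (\<Sum>k\<in>?K. growth n * (2 * weighted_energy))"
  proof (rule sum_mono)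
    fix k assume k: "k \<in> ?K"
    have "\<bar>\<Sum>p\<in>?S. w p * odd_ext a p * odd_ext a (p + k)\<bar> \<le> (\<Sum>p\<in>?S. \<bar>w p * odd_ext a p * odd_ext a (p + k)\<bar>)"
      by (rule sum_abs)
    also have "\<dots> \<le> (\<Sum>p\<in>?S. growth n * (\<alpha> p * \<alpha> (p + k)))"
    proof (rule sum_mono)
      fix p
      have "w p \<le> growth (- k) * (sqrt (w p) * sqrt (w (p + k)))" using w_le_geometric[of p "p + k"] by simp
      also have "\<dots> \<le> growth n * (sqrt (w p) * sqrt (w (p + k)))"
        using k by (intro mult_right_mono growth_mono) auto
      finally have "w p * \<bar>odd_ext a p * odd_ext a (p + k)\<bar> \<le> growth n * (sqrt (w p) * sqrt (w (p + k))) * \<bar>odd_ext a p * odd_ext a (p + k)\<bar>"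
        by (rule mult_right_mono) simp
      then show "\<bar>w p * odd_ext a p * odd_ext a (p + k)\<bar> \<le> growth n * (\<alpha> p * \<alpha> (p + k))"
        by (simp add: \<alpha>_def abs_mult mult_ac)
    qed
    also have "\<dots> = growth n * (\<Sum>p\<in>?S. \<alpha> p * \<alpha> (p + k))" by (simp add: sum_distrib_left)
    also have "\<dots> \<le> growth n * (2 * weighted_energy)" by (intro mult_left_mono sum_\<alpha>_shift) auto
    finally show "\<bar>\<Sum>p\<in>?S. w p * odd_ext a p * odd_ext a (p + k)\<bar> \<le> growth n * (2 * weighted_energy)" .
  qed
  also have "\<dots> = (2 * real_of_int n - 1) * (growth n * (2 * weighted_energy))"
    using assms by simp
  also have "\<dots> \<le> (2 * real_of_int n) * (growth n * (2 * weighted_energy))"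
    by (intro mult_right_mono mult_nonneg_nonneg) (auto simp: weighted_energy_nonneg)
  finally show ?thesis unfolding eq by (simp add: algebra_simps)
qed

text \<open>The neighbours contribute 4 and 2, the first doubled by the ratio of adjacent weights;
  12 is twice their sum.\<close>

lemma sum_int_diff_sq:
  assumes "finite S"
  shows "(\<Sum>n\<in>S. w n * (int_diff a n)\<^sup>2) \<le> 12 * weighted_energy"
proof -
  have g1: "(growth 1)\<^sup>2 \<le> 2" by (simp add: growth_def real_le_lsqrt)
  have "w n * (int_diff a n)\<^sup>2 \<le> 4 * (\<alpha> (n - 1))\<^sup>2 + 2 * (\<alpha> n)\<^sup>2" for n
  proof -
    have "(int_diff a n)\<^sup>2 \<le> 2 * (odd_ext a (n - 1))\<^sup>2 + 2 * (odd_ext a n)\<^sup>2"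
      unfolding int_diff_def using zero_le_power2[of "odd_ext a (n - 1) + odd_ext a n"]
      by (simp add: power2_sum power2_diff)
    then have "w n * (int_diff a n)\<^sup>2 \<le> w n * (2 * (odd_ext a (n - 1))\<^sup>2 + 2 * (odd_ext a n)\<^sup>2)"
      by (intro mult_left_mono) auto
    also have "\<dots> = w n * (2 * (odd_ext a (n - 1))\<^sup>2) + 2 * (\<alpha> n)\<^sup>2" by (simp add: \<alpha>_sq algebra_simps)
    also have "w n * (2 * (odd_ext a (n - 1))\<^sup>2) \<le> (2 * w (n - 1)) * (2 * (odd_ext a (n - 1))\<^sup>2)"
    proof (rule mult_right_mono)
      have "w n \<le> (growth 1)\<^sup>2 * w (n - 1)" using w_ratio[of n "n - 1"] by simp
      also have "\<dots> \<le> 2 * w (n - 1)" by (intro mult_right_mono g1) simp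
      finally show "w n \<le> 2 * w (n - 1)" .
    qed simp
    finally show ?thesis by (simp add: \<alpha>_sq algebra_simps)
  qed
  then have "(\<Sum>n\<in>S. w n * (int_diff a n)\<^sup>2) \<le> (\<Sum>n\<in>S. 4 * (\<alpha> (n - 1))\<^sup>2 + 2 * (\<alpha> n)\<^sup>2)"
    by (rule sum_mono)
  also have "\<dots> = 4 * (\<Sum>n\<in>S. (\<alpha> (n - 1))\<^sup>2) + 2 * (\<Sum>n\<in>S. (\<alpha> n)\<^sup>2)"
    by (simp add: sum.distrib sum_distrib_left)
  also have "(\<Sum>n\<in>S. (\<alpha> (n - 1))\<^sup>2) = (\<Sum>p\<in>(\<lambda>n. n - 1) ` S. (\<alpha> p)\<^sup>2)"
    by (subst sum.reindex) (auto simp: inj_on_def)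
  finally show ?thesis
    using sum_\<alpha>_sq[OF assms] sum_\<alpha>_sq[of "(\<lambda>n. n - 1) ` S"] assms by simp
qed

text \<open>A Schur test: \<open>primitive\<close> is summable with the factor
  \<open>growth\<close>, and the other two factors are square summable with half of the weight each.
  The constant is 2 * 2 + 2 * 12.\<close>

lemma stretching_bound:
  assumes "finite T"
  shows "(\<Sum>n\<in>T. \<Sum>p\<in>{- 1 - int N..int N}. \<bar>int_diff a n\<bar> * (w p * \<bar>odd_ext a p\<bar> * \<bar>primitive (p - n)\<bar>))
    \<le> 28 * vel_norm * weighted_energy"
proof -
  let ?S = "{- 1 - int N..int N}"
  define \<theta> where "\<theta> = (\<lambda>j. growth j * \<bar>primitive j\<bar>)"
  define \<gamma> where "\<gamma> = (\<lambda>n. sqrt (w n) * \<bar>int_diff a n\<bar>)"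
  have nn: "0 \<le> \<theta> j" "0 \<le> \<gamma> n" for j n by (auto simp: \<theta>_def \<gamma>_def)
  have \<gamma>2: "(\<gamma> n)\<^sup>2 = w n * (int_diff a n)\<^sup>2" for n by (simp add: \<gamma>_def power_mult_distrib)
  have "(\<Sum>n\<in>T. \<Sum>p\<in>?S. \<bar>int_diff a n\<bar> * (w p * \<bar>odd_ext a p\<bar> * \<bar>primitive (p - n)\<bar>))
      \<le> (\<Sum>n\<in>T. \<Sum>p\<in>?S. (1/2) * ((\<alpha> p)\<^sup>2 * \<theta> (p - n)) + (1/2) * ((\<gamma> n)\<^sup>2 * \<theta> (p - n)))"
  proof (intro sum_mono)
    fix n p
    have "w p * (\<bar>int_diff a n\<bar> * \<bar>odd_ext a p\<bar> * \<bar>primitive (p - n)\<bar>)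
       \<le> growth (p - n) * (sqrt (w p) * sqrt (w n)) * (\<bar>int_diff a n\<bar> * \<bar>odd_ext a p\<bar> * \<bar>primitive (p - n)\<bar>)"
      by (intro mult_right_mono w_le_geometric) auto
    also have "\<dots> = (\<alpha> p * \<gamma> n) * \<theta> (p - n)" by (simp add: \<alpha>_def \<gamma>_def \<theta>_def mult_ac)
    also have "\<dots> \<le> ((1/2) * ((\<alpha> p)\<^sup>2 + (\<gamma> n)\<^sup>2)) * \<theta> (p - n)"
      using sum_squares_bound[of "\<alpha> p" "\<gamma> n"] nn by (intro mult_right_mono) auto
    finally show "\<bar>int_diff a n\<bar> * (w p * \<bar>odd_ext a p\<bar> * \<bar>primitive (p - n)\<bar>)
      \<le> (1/2) * ((\<alpha> p)\<^sup>2 * \<theta> (p - n)) + (1/2) * ((\<gamma> n)\<^sup>2 * \<theta> (p - n))" by (simp add: algebra_simps)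
  qed
  also have "\<dots> = (1/2) * (\<Sum>p\<in>?S. (\<alpha> p)\<^sup>2 * (\<Sum>n\<in>T. \<theta> (p - n))) + (1/2) * (\<Sum>n\<in>T. (\<gamma> n)\<^sup>2 * (\<Sum>p\<in>?S. \<theta> (p - n)))"
  proof -
    have "(\<Sum>n\<in>T. \<Sum>p\<in>?S. (\<alpha> p)\<^sup>2 * \<theta> (p - n)) = (\<Sum>p\<in>?S. \<Sum>n\<in>T. (\<alpha> p)\<^sup>2 * \<theta> (p - n))" by (rule sum.swap)
    then show ?thesis by (simp add: sum.distrib sum_distrib_left[symmetric] sum_divide_distrib[symmetric])
  qed
  also have "\<dots> \<le> (1/2) * (\<Sum>p\<in>?S. (\<alpha> p)\<^sup>2 * (4 * vel_norm)) + (1/2) * (\<Sum>n\<in>T. (\<gamma> n)\<^sup>2 * (4 * vel_norm))"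
  proof -
    have "(\<Sum>n\<in>T. \<theta> (p - n)) = (\<Sum>j\<in>(\<lambda>n. p - n) ` T. \<theta> j)" for p
      by (subst sum.reindex) (auto simp: inj_on_def)
    then have 1: "(\<Sum>n\<in>T. \<theta> (p - n)) \<le> 4 * vel_norm" for p
      using primitive_sum[of "(\<lambda>n. p - n) ` T"] assms by (simp add: \<theta>_def)
    have "(\<Sum>p\<in>?S. \<theta> (p - n)) = (\<Sum>j\<in>(\<lambda>p. p - n) ` ?S. \<theta> j)" for n
      by (subst sum.reindex) (auto simp: inj_on_def)
    then have 2: "(\<Sum>p\<in>?S. \<theta> (p - n)) \<le> 4 * vel_norm" for n
      using primitive_sum[of "(\<lambda>p. p - n) ` ?S"] by (simp add: \<theta>_def)
    show ?thesis by (intro add_mono mult_left_mono sum_mono 1 2) auto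
  qed
  also have "\<dots> = (2 * vel_norm) * (\<Sum>p\<in>?S. (\<alpha> p)\<^sup>2) + (2 * vel_norm) * (\<Sum>n\<in>T. (\<gamma> n)\<^sup>2)"
    by (simp add: sum_distrib_left sum_distrib_right mult_ac)
  also have "\<dots> \<le> (2 * vel_norm) * (2 * weighted_energy) + (2 * vel_norm) * (12 * weighted_energy)"
    using sum_\<alpha>_sq[of ?S] sum_int_diff_sq[OF assms] vel_norm_nonneg unfolding \<gamma>2
    by (intro add_mono mult_left_mono) auto
  finally show ?thesis by (simp add: algebra_simps)
qed

text \<open>In the transport and window terms a factor \<open>n * growth n\<close> meets 1 / n^2 and
  leaves the summand of \<open>velocity_sum\<close>; they contribute 8. The stretching term
  contributes half of 28.\<close>

lemma trilinear_bound_int: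
  "\<bar>\<Sum>p\<in>{- 1 - int N..int N}. w p * odd_ext a p * quad_coeff a (int N + 1) p\<bar> \<le> 22 * vel_norm * weighted_energy"
proof -
  let ?S = "{- 1 - int N..int N}" and ?T = "{1..int N + 1}"
  define I where "I = (\<lambda>n. \<Sum>p\<in>?S. w p * odd_ext a p *
      (real_of_int (p - n + 1) * odd_ext a (p - n) - real_of_int (p + n) * odd_ext a (p + n)))"
  define J where "J = (\<lambda>n. \<Sum>p\<in>?S. w p * odd_ext a p * (\<Sum>m\<in>{p - n + 1..p + n - 1}. odd_ext a m))"
  define K where "K = (\<lambda>n. \<Sum>p\<in>?S. w p * odd_ext a p * (primitive (p - n) - primitive (p + n)))"
  have "(\<Sum>p\<in>?S. w p * odd_ext a p * quad_coeff a (int N + 1) p)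
      = (\<Sum>p\<in>?S. \<Sum>n\<in>?T. w p * odd_ext a p * (int_diff a n / (real_of_int n)\<^sup>2 * (\<Sum>m\<in>{p - n + 1..p + n}. conv_coeff a n m)))"
    by (simp add: quad_coeff_def sum_distrib_left)
  also have "\<dots> = (\<Sum>n\<in>?T. \<Sum>p\<in>?S. w p * odd_ext a p * (int_diff a n / (real_of_int n)\<^sup>2 * (\<Sum>m\<in>{p - n + 1..p + n}. conv_coeff a n m)))"
    by (rule sum.swap)
  also have "\<dots> = (\<Sum>n\<in>?T. int_diff a n / (real_of_int n)\<^sup>2 * ((1/2) * (I n + J n)) - (1/2) * (int_diff a n * K n))"
  proof (rule sum.cong[OF refl])
    fix n assume n: "n \<in> ?T"
    have "(\<Sum>p\<in>?S. w p * odd_ext a p * (int_diff a n / (real_of_int n)\<^sup>2 * (\<Sum>m\<in>{p - n + 1..p + n}. conv_coeff a n m)))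
      = (\<Sum>p\<in>?S. int_diff a n / (real_of_int n)\<^sup>2 * ((1/2) * (w p * odd_ext a p * (real_of_int (p - n + 1) * odd_ext a (p - n) - real_of_int (p + n) * odd_ext a (p + n))
         + w p * odd_ext a p * (\<Sum>m\<in>{p - n + 1..p + n - 1}. odd_ext a m)))
         - (1/2) * (int_diff a n * (w p * odd_ext a p * (primitive (p - n) - primitive (p + n)))))"
    proof (rule sum.cong[OF refl])
      fix p
      define X Y Z u c where "X = real_of_int (p - n + 1) * odd_ext a (p - n) - real_of_int (p + n) * odd_ext a (p + n)"
        and "Y = (\<Sum>m\<in>{p - n + 1..p + n - 1}. odd_ext a m)" and "Z = primitive (p - n) - primitive (p + n)"
        and "u = w p * odd_ext a p" and "c = int_diff a n"
      have n0: "real_of_int n \<noteq> 0" using n by auto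
      have "u * (c / (real_of_int n)\<^sup>2 * ((1/2) * (X + Y) - (1/2) * (real_of_int n)\<^sup>2 * Z))
          = c / (real_of_int n)\<^sup>2 * ((1/2) * (u * X + u * Y)) - (1/2) * (c * (u * Z))"
        using n0 by (simp add: field_simps)
      then show "w p * odd_ext a p * (int_diff a n / (real_of_int n)\<^sup>2 * (\<Sum>m\<in>{p - n + 1..p + n}. conv_coeff a n m))
        = int_diff a n / (real_of_int n)\<^sup>2 * ((1/2) * (w p * odd_ext a p * (real_of_int (p - n + 1) * odd_ext a (p - n) - real_of_int (p + n) * odd_ext a (p + n))
         + w p * odd_ext a p * (\<Sum>m\<in>{p - n + 1..p + n - 1}. odd_ext a m)))
         - (1/2) * (int_diff a n * (w p * odd_ext a p * (primitive (p - n) - primitive (p + n))))"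
        using conv_sum[of n p] n by (simp add: X_def Y_def Z_def u_def c_def)
    qed
    also have "\<dots> = int_diff a n / (real_of_int n)\<^sup>2 * ((1/2) * (I n + J n)) - (1/2) * (int_diff a n * K n)"
      unfolding I_def J_def K_def sum_subtractf sum.distrib[symmetric] sum_distrib_left by simp
    finally show "(\<Sum>p\<in>?S. w p * odd_ext a p * (int_diff a n / (real_of_int n)\<^sup>2 * (\<Sum>m\<in>{p - n + 1..p + n}. conv_coeff a n m)))
      = int_diff a n / (real_of_int n)\<^sup>2 * ((1/2) * (I n + J n)) - (1/2) * (int_diff a n * K n)" .
  qed
  also have "\<dots> = (\<Sum>n\<in>?T. int_diff a n / (real_of_int n)\<^sup>2 * ((1/2) * (I n + J n))) - (1/2) * (\<Sum>n\<in>?T. int_diff a n * K n)"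
    by (simp add: sum_subtractf sum_distrib_left sum_divide_distrib)
  finally have eq: "(\<Sum>p\<in>?S. w p * odd_ext a p * quad_coeff a (int N + 1) p)
     = (\<Sum>n\<in>?T. int_diff a n / (real_of_int n)\<^sup>2 * ((1/2) * (I n + J n))) - (1/2) * (\<Sum>n\<in>?T. int_diff a n * K n)" .
  have "\<bar>\<Sum>n\<in>?T. int_diff a n / (real_of_int n)\<^sup>2 * ((1/2) * (I n + J n))\<bar>
     \<le> (\<Sum>n\<in>?T. \<bar>int_diff a n / (real_of_int n)\<^sup>2 * ((1/2) * (I n + J n))\<bar>)" by (rule sum_abs)
  also have "\<dots> \<le> (\<Sum>n\<in>?T. 4 * weighted_energy * (\<bar>int_diff a n\<bar> * growth n / real_of_int n))"
  proof (rule sum_mono)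
    fix n assume n: "n \<in> ?T"
    have "\<bar>I n\<bar> \<le> 4 * real_of_int n * growth n * weighted_energy"
      unfolding I_def by (rule transport_bound) (use n in simp)
    moreover have "\<bar>J n\<bar> \<le> 4 * real_of_int n * growth n * weighted_energy"
      unfolding J_def by (rule window_bound) (use n in simp)
    moreover have "\<bar>(1/2) * (x + y)\<bar> \<le> B" if "\<bar>x\<bar> \<le> B" "\<bar>y\<bar> \<le> B" for x y B :: real
      using that by (auto simp: abs_le_iff)
    ultimately have "\<bar>(1/2) * (I n + J n)\<bar> \<le> 4 * real_of_int n * growth n * weighted_energy"
      by blast
    then have "\<bar>int_diff a n\<bar> / (real_of_int n)\<^sup>2 * \<bar>(1/2) * (I n + J n)\<bar>
        \<le> \<bar>int_diff a n\<bar> / (real_of_int n)\<^sup>2 * (4 * real_of_int n * growth n * weighted_energy)"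
      by (rule mult_left_mono) simp
    then show "\<bar>int_diff a n / (real_of_int n)\<^sup>2 * ((1/2) * (I n + J n))\<bar>
        \<le> 4 * weighted_energy * (\<bar>int_diff a n\<bar> * growth n / real_of_int n)"
      using n by (simp add: abs_mult power2_eq_square mult_ac)
  qed
  also have "\<dots> = 4 * weighted_energy * (\<Sum>n\<in>?T. \<bar>int_diff a n\<bar> * growth n / real_of_int n)" by (simp add: sum_distrib_left)
  also have "\<dots> \<le> 4 * weighted_energy * (2 * vel_norm)"
    using velocity_sum weighted_energy_nonneg by (intro mult_left_mono) auto
  finally have 1: "\<bar>\<Sum>n\<in>?T. int_diff a n / (real_of_int n)\<^sup>2 * ((1/2) * (I n + J n))\<bar> \<le> 4 * weighted_energy * (2 * vel_norm)" .
  define G where "G = (\<lambda>n p. \<bar>int_diff a n\<bar> * (w p * \<bar>odd_ext a p\<bar> * \<bar>primitive (p - n)\<bar>))"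
  have "\<bar>\<Sum>n\<in>?T. int_diff a n * K n\<bar> \<le> (\<Sum>n\<in>?T. \<bar>int_diff a n * K n\<bar>)" by (rule sum_abs)
  also have "\<dots> \<le> (\<Sum>n\<in>?T. (\<Sum>p\<in>?S. G n p) + (\<Sum>p\<in>?S. G (- n) p))"
  proof (rule sum_mono)
    fix n
    have "\<bar>int_diff a n * K n\<bar> = \<bar>int_diff a n\<bar> * \<bar>K n\<bar>" by (rule abs_mult)
    also have "\<dots> \<le> \<bar>int_diff a n\<bar> * (\<Sum>p\<in>?S. \<bar>w p * odd_ext a p * (primitive (p - n) - primitive (p + n))\<bar>)"
      unfolding K_def by (rule mult_left_mono[OF sum_abs]) simp
    also have "\<dots> = (\<Sum>p\<in>?S. \<bar>int_diff a n\<bar> * \<bar>w p * odd_ext a p * (primitive (p - n) - primitive (p + n))\<bar>)"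
      by (rule sum_distrib_left)
    also have "\<dots> \<le> (\<Sum>p\<in>?S. G n p + G (- n) p)"
    proof (rule sum_mono)
      fix p
      have "\<bar>w p * odd_ext a p * (primitive (p - n) - primitive (p + n))\<bar>
          \<le> w p * \<bar>odd_ext a p\<bar> * (\<bar>primitive (p - n)\<bar> + \<bar>primitive (p + n)\<bar>)"
        unfolding abs_mult[of "w p * odd_ext a p"] abs_mult[of "w p"]
        by (intro mult_mono) (auto simp: abs_triangle_ineq4)
      then have "\<bar>int_diff a n\<bar> * \<bar>w p * odd_ext a p * (primitive (p - n) - primitive (p + n))\<bar>
          \<le> \<bar>int_diff a n\<bar> * (w p * \<bar>odd_ext a p\<bar> * (\<bar>primitive (p - n)\<bar> + \<bar>primitive (p + n)\<bar>))"
        by (rule mult_left_mono) simp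
      then show "\<bar>int_diff a n\<bar> * \<bar>w p * odd_ext a p * (primitive (p - n) - primitive (p + n))\<bar> \<le> G n p + G (- n) p"
        by (simp add: G_def int_diff_minus distrib_left)
    qed
    finally show "\<bar>int_diff a n * K n\<bar> \<le> (\<Sum>p\<in>?S. G n p) + (\<Sum>p\<in>?S. G (- n) p)" by (simp add: sum.distrib)
  qed
  also have "\<dots> = (\<Sum>n\<in>?T. \<Sum>p\<in>?S. G n p) + (\<Sum>n\<in>?T. \<Sum>p\<in>?S. G (- n) p)" by (rule sum.distrib)
  \<comment> \<open>Since \<open>int_diff\<close> is even, the terms with
    \<open>primitive (p + n)\<close> are those of index \<open>- n\<close>. Both families form one
    sum over a symmetric set, to which the Schur test applies once.\<close>
  also have "(\<Sum>n\<in>?T. \<Sum>p\<in>?S. G (- n) p) = (\<Sum>n\<in>uminus ` ?T. \<Sum>p\<in>?S. G n p)"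
    by (subst sum.reindex) (auto simp: inj_on_def)
  also have "(\<Sum>n\<in>?T. \<Sum>p\<in>?S. G n p) + (\<Sum>n\<in>uminus ` ?T. \<Sum>p\<in>?S. G n p) = (\<Sum>n\<in>?T \<union> uminus ` ?T. \<Sum>p\<in>?S. G n p)"
    by (rule sum.union_disjoint[symmetric]) auto
  also have "\<dots> \<le> 28 * vel_norm * weighted_energy"
    unfolding G_def by (rule stretching_bound) simp
  finally have 2: "\<bar>\<Sum>n\<in>?T. int_diff a n * K n\<bar> \<le> 28 * vel_norm * weighted_energy" .
  have eq2: "4 * weighted_energy * (2 * vel_norm) = 8 * (vel_norm * weighted_energy)"
    "28 * vel_norm * weighted_energy = 28 * (vel_norm * weighted_energy)"
    "22 * vel_norm * weighted_energy = 22 * (vel_norm * weighted_energy)" by simp_all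
  show ?thesis using 1 2 unfolding eq eq2 by linarith
qed

lemma quad_coeff_reflect: "quad_coeff a L (- 1 - p) = - quad_coeff a L p"
proof -
  have "(\<Sum>m\<in>{- 1 - p - n + 1..- 1 - p + n}. conv_coeff a n m) = (\<Sum>m\<in>{p - n + 1..p + n}. conv_coeff a n (- m))" for n
    by (rule sum.reindex_bij_witness[of _ uminus uminus]) auto
  then show ?thesis by (simp add: quad_coeff_def conv_coeff_minus sum_negf)
qed

lemma trilinear_bound:
  "\<bar>\<Sum>p\<in>{1..N}. w (int p) * a p * quad_coeff a (int N + 1) (int p)\<bar> \<le> 11 * vel_norm * weighted_energy"
proof -
  have "(\<Sum>p\<in>{- 1 - int N..int N}. w p * odd_ext a p * quad_coeff a (int N + 1) p)
      = 2 * (\<Sum>p\<in>{1..N}. w (int p) * odd_ext a (int p) * quad_coeff a (int N + 1) (int p))"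
    by (rule reflect_fold) (simp_all add: w_reflect odd_ext_reflect quad_coeff_reflect, simp add: odd_ext_def a0)
  also have "\<dots> = 2 * (\<Sum>p\<in>{1..N}. w (int p) * a p * quad_coeff a (int N + 1) (int p))"
    by (simp add: odd_ext_def)
  finally show ?thesis using trilinear_bound_int by simp
qed

end

end

section \<open>Energy estimates for the Galerkin system\<close>

definition trilinear_const :: real where
  "trilinear_const = 11 * sqrt (\<Sum>m. (growth (int m + 1) / real m)\<^sup>2)"

lemma summable_growth_sq: "summable (\<lambda>m. (growth (int m + 1) / real m)\<^sup>2)"
proof (rule summable_comparison_test_ev)
  show "summable (\<lambda>m. sqrt 5 * real m powr (-3/2))"
    by (intro summable_mult) (simp add: summable_real_powr_iff)
  show "\<forall>\<^sub>F m in sequentially. norm ((growth (int m + 1) / real m)\<^sup>2) \<le> sqrt 5 * real m powr (-3/2)"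
    using eventually_gt_at_top[of 0]
  proof eventually_elim
    case (elim m)
    have "(growth (int m + 1))\<^sup>2 = sqrt (1 + 2 * (real m + 1))" by (simp add: growth_def)
    also have "\<dots> \<le> sqrt (5 * real m)" using elim by (intro real_sqrt_le_mono) auto
    also have "\<dots> = sqrt 5 * real m powr (1/2)" by (simp add: real_sqrt_mult powr_half_sqrt)
    finally have "(growth (int m + 1))\<^sup>2 / (real m)\<^sup>2 \<le> sqrt 5 * real m powr (1/2) / (real m)\<^sup>2"
      by (intro divide_right_mono) auto
    also have "(real m)\<^sup>2 = real m powr 2" using elim by simp
    also have "sqrt 5 * real m powr (1/2) / real m powr 2 = sqrt 5 * real m powr (-3/2)"
      using powr_diff[of "real m" "1/2" 2] by simp
    finally show ?case by (simp add: power_divide)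
  qed
qed

lemma trilinear_const_nonneg: "0 \<le> trilinear_const"
  unfolding trilinear_const_def
  by (intro mult_nonneg_nonneg real_sqrt_ge_zero suminf_nonneg summable_growth_sq) auto

section \<open>The constant weight and the weights that isolate high modes\<close>

lemma admissible_weight_one: "admissible_weight (\<lambda>_. 1)"
  unfolding admissible_weight_def using growth_ge_1 by (auto simp: one_le_power)

text \<open>The truncated linear function already varies slowly, but its ratios grow linearly in
  \<open>p - q\<close>. The square root halves that exponent; without it the corresponding
  \<open>growth m / m\<close> would just fail to be square summable. The centre -1/2 gives the
  reflection symmetry and positivity at every integer.\<close>

definition cutoff_weight :: "real \<Rightarrow> int \<Rightarrow> real" where
  "cutoff_weight M p = sqrt (min 1 (\<bar>real_of_int p + 1/2\<bar> / M))"

lemma half_le_abs_half: "1/2 \<le> \<bar>real_of_int p + 1/2\<bar>"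
proof (cases "p \<ge> 0")
  case False
  then have "real_of_int p \<le> -1" by linarith
  then show ?thesis by linarith
qed auto

lemma cutoff_weight_sq: "M > 0 \<Longrightarrow> (cutoff_weight M p)\<^sup>2 = min 1 (\<bar>real_of_int p + 1/2\<bar> / M)"
  by (simp add: cutoff_weight_def)

lemma cutoff_weight_pos: "M > 0 \<Longrightarrow> 0 < cutoff_weight M p"
proof -
  assume "M > 0"
  moreover have "0 < \<bar>real_of_int p + 1/2\<bar>" using half_le_abs_half[of p] by linarith
  ultimately have "0 < \<bar>real_of_int p + 1/2\<bar> / M" by (intro divide_pos_pos)
  then show ?thesis by (simp add: cutoff_weight_def)
qed

lemma admissible_cutoff_weight:
  assumes M: "M > 0"
  shows "admissible_weight (cutoff_weight M)"
  unfolding admissible_weight_def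
proof (intro conjI allI)
  fix p q :: int
  define P Q n where "P = \<bar>real_of_int p + 1/2\<bar>" and "Q = \<bar>real_of_int q + 1/2\<bar>" and "n = \<bar>real_of_int (p - q)\<bar>"
  have PQ: "P \<ge> 1/2" "Q \<ge> 1/2" unfolding P_def Q_def by (rule half_le_abs_half)+
  have d: "\<bar>P - Q\<bar> \<le> n" unfolding P_def Q_def n_def by (simp add: abs_triangle_ineq3[of "real_of_int p + 1/2" "real_of_int q + 1/2", simplified])
  have n: "n \<ge> 0" by (simp add: n_def)
  show "0 < cutoff_weight M p" by (rule cutoff_weight_pos[OF M])
  have "\<bar>real_of_int (- 1 - p) + 1/2\<bar> = \<bar>real_of_int p + 1/2\<bar>" by (simp add: abs_if)
  then show "cutoff_weight M (- 1 - p) = cutoff_weight M p" by (simp add: cutoff_weight_def)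
  have "min 1 (P / M) \<le> (1 + 2 * n) * min 1 (Q / M)"
  proof -
    \<comment> \<open>The lower bound 1/2 for \<open>Q\<close> turns the additive comparison of
      \<open>P\<close> and \<open>Q\<close> into a multiplicative one.\<close>
    have "n * 1 \<le> n * (2 * Q)" using n PQ by (intro mult_left_mono) auto
    then have "P \<le> (1 + 2 * n) * Q" using d by (simp add: algebra_simps)
    then have "P / M \<le> (1 + 2 * n) * (Q / M)" using M by (simp add: divide_simps)
    then show ?thesis using n by (auto simp: min_def)
  qed
  then have "sqrt (min 1 (P / M)) \<le> sqrt ((1 + 2 * n) * min 1 (Q / M))" by (rule real_sqrt_le_mono)
  then show "cutoff_weight M p \<le> (growth (p - q))\<^sup>2 * cutoff_weight M q"
    by (simp add: real_sqrt_mult cutoff_weight_def growth_def P_def Q_def n_def)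
  define u v where "u = cutoff_weight M p" and "v = cutoff_weight M q"
  have uv: "u > 0" "v > 0" using cutoff_weight_pos[OF M] by (auto simp: u_def v_def)
  have u2: "u\<^sup>2 = min 1 (P / M)" "v\<^sup>2 = min 1 (Q / M)" using cutoff_weight_sq[OF M] by (auto simp: u_def v_def P_def Q_def)
  \<comment> \<open>Slow variation is proved for the squares first. It passes to the roots by
    factoring the difference of squares, bounding \<open>u + v\<close> below by \<open>u\<close>,
    and cancelling \<open>u\<close>.\<close>
  have "P * \<bar>min 1 (P / M) - min 1 (Q / M)\<bar> \<le> min 1 (P / M) * \<bar>P - Q\<bar>"
  proof (cases "P \<ge> M"; cases "Q \<ge> M")
    assume "P \<ge> M" "\<not> Q \<ge> M"
    then have "P * (1 - Q / M) \<le> P - Q"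
      using M PQ mult_right_mono[of M P "Q / M"] by (simp add: algebra_simps)
    then show ?thesis using M \<open>P \<ge> M\<close> \<open>\<not> Q \<ge> M\<close> by (simp add: min_def abs_if)
  next
    assume "\<not> P \<ge> M" "Q \<ge> M"
    then have "P * (1 - P / M) \<le> (P / M) * (Q - P)" using M PQ mult_left_mono[of M Q "P / M"] by (simp add: algebra_simps diff_divide_distrib)
    then show ?thesis using M \<open>\<not> P \<ge> M\<close> \<open>Q \<ge> M\<close> by (simp add: min_def abs_if)
  next
    assume "\<not> P \<ge> M" "\<not> Q \<ge> M"
    have "\<bar>P / M - Q / M\<bar> = \<bar>P - Q\<bar> / M" using M by (simp add: diff_divide_distrib[symmetric])
    then show ?thesis using M \<open>\<not> P \<ge> M\<close> \<open>\<not> Q \<ge> M\<close> PQ by (simp add: min_def)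
  next
    assume "P \<ge> M" "Q \<ge> M"
    then show ?thesis using M by (simp add: min_def)
  qed
  also have "\<dots> \<le> u\<^sup>2 * n" unfolding u2 using d M PQ by (intro mult_left_mono) auto
  finally have "P * \<bar>u\<^sup>2 - v\<^sup>2\<bar> \<le> u\<^sup>2 * n" unfolding u2 .
  moreover have "\<bar>u\<^sup>2 - v\<^sup>2\<bar> = \<bar>u - v\<bar> * (u + v)" using uv by (simp add: power2_eq_square square_diff_square_factored abs_mult mult.commute)
  moreover have "P * \<bar>u - v\<bar> * u \<le> P * \<bar>u - v\<bar> * (u + v)" using uv PQ by (intro mult_left_mono) auto
  ultimately have "u * (P * \<bar>u - v\<bar>) \<le> u * (n * u)" by (simp add: power2_eq_square mult_ac)
  then have "P * \<bar>u - v\<bar> \<le> n * u" using uv by simp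
  then show "\<bar>real_of_int p + 1/2\<bar> * \<bar>cutoff_weight M p - cutoff_weight M q\<bar> \<le> \<bar>real_of_int (p - q)\<bar> * cutoff_weight M p"
    by (simp add: P_def u_def v_def n_def)
qed

text \<open>In the coordinates \<open>a\<^sub>p\<close> the linear operator is tridiagonal with these entries; the spectral gap
  \<open>3/8\<close> is the minimum of \<open>lin_diag (p + 1) - lin_diag p\<close>, attained at \<open>p = 1\<close>.\<close>

definition lin_diag :: "nat \<Rightarrow> real" where
  "lin_diag m = (real m - 1)\<^sup>2 * (real m + 1) / (2 * (real m)\<^sup>2)"

definition lin_coeff :: "(nat \<Rightarrow> real) \<Rightarrow> nat \<Rightarrow> real" where
  "lin_coeff a p = lin_diag p * (a (p - 1) - a p) + lin_diag (p + 1) * (a p - a (p + 1))"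

lemma lin_diag_1 [simp]: "lin_diag (Suc 0) = 0" by (simp add: lin_diag_def)

lemma lin_diag_nonneg: "0 \<le> lin_diag m" by (simp add: lin_diag_def)

lemma lin_diag_Suc_le: "lin_diag (p + 1) \<le> real p / 2"
proof -
  have "real p * (real p + 2) / (real p + 1)\<^sup>2 \<le> 1"
    by (subst divide_le_eq_1_pos) (simp_all add: power2_eq_square algebra_simps add_pos_nonneg)
  from mult_left_mono[OF this, of "real p / 2"]
  have "(real p)\<^sup>2 * (real p + 2) / (2 * (real p + 1)\<^sup>2) \<le> real p / 2"
    by (simp add: power2_eq_square mult_ac)
  then show ?thesis by (simp add: lin_diag_def algebra_simps)
qed

text \<open>The first difference is exactly 3/8, as \<open>lin_diag\<close> takes the values 0 and
  3/8 at 1 and 2. From \<open>p = 2\<close> on, the difference is at least 1/2, the excess having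
  the numerator x^2 - x - 1.\<close>

lemma lin_diag_diff:
  assumes "p \<ge> 1"
  shows "3/8 \<le> lin_diag (p + 1) - lin_diag p"
proof (cases "p = 1")
  case True
  then show ?thesis by (simp add: lin_diag_def power2_eq_square)
next
  case False
  define x where "x = real p"
  have x: "x \<ge> 2" using assms False by (simp add: x_def)
  have e1: "lin_diag (p + 1) = x\<^sup>2 * (x + 2) / (2 * (x + 1)\<^sup>2)" by (simp add: lin_diag_def x_def algebra_simps)
  have e2: "lin_diag p = (x - 1)\<^sup>2 * (x + 1) / (2 * x\<^sup>2)" by (simp add: lin_diag_def x_def)
  have "lin_diag (p + 1) - lin_diag p - 1/2 = (x\<^sup>2 - x - 1) / (2 * x\<^sup>2 * (x + 1)\<^sup>2)"
    unfolding e1 e2 using x by (simp add: divide_simps) (simp add: algebra_simps power2_eq_square)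
  moreover have "x\<^sup>2 - x - 1 \<ge> 0"
    using mult_mono[of 2 x 1 "x - 1"] x by (simp add: power2_eq_square algebra_simps)
  ultimately have "lin_diag (p + 1) - lin_diag p - 1/2 \<ge> 0" using x by simp
  then show ?thesis by simp
qed

lemma sum_shift_one:
  fixes f :: "nat \<Rightarrow> real"
  shows "(\<Sum>p\<in>{1..N}. f p) = (\<Sum>p\<in>{1..N}. f (p + 1)) + f 1 - f (N + 1)"
  by (induction N) auto

text \<open>The entries next to the diagonal are skew: \<open>lin_diag p\<close> at position (p, p -
  1) and its negative at (p - 1, p). For constant weight they cancel; otherwise only the increment
  of the weight survives.\<close>

lemma lin_energy:
  assumes "a (N + 1) = 0"
  shows "(\<Sum>p\<in>{1..N}. w p * a p * lin_coeff a p)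
    = (\<Sum>p\<in>{1..N}. (lin_diag (p + 1) - lin_diag p) * (w p * (a p)\<^sup>2))
      + (\<Sum>p\<in>{1..N}. (w (p + 1) - w p) * lin_diag (p + 1) * (a p * a (p + 1)))"
proof -
  have "(\<Sum>p\<in>{1..N}. w p * a p * (lin_diag p * a (p - 1))) = (\<Sum>p\<in>{1..N}. w (p + 1) * a (p + 1) * (lin_diag (p + 1) * a p))"
    using sum_shift_one[of "\<lambda>p. w p * a p * (lin_diag p * a (p - 1))" N] assms by simp
  moreover have "(\<Sum>p\<in>{1..N}. w p * a p * lin_coeff a p) = (\<Sum>p\<in>{1..N}. w p * a p * (lin_diag p * a (p - 1)))
      + (\<Sum>p\<in>{1..N}. (lin_diag (p + 1) - lin_diag p) * (w p * (a p)\<^sup>2)) - (\<Sum>p\<in>{1..N}. w p * a p * (lin_diag (p + 1) * a (p + 1)))"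
    unfolding sum.distrib[symmetric] sum_subtractf[symmetric]
    by (rule sum.cong) (auto simp: lin_coeff_def algebra_simps power2_eq_square)
  ultimately have "(\<Sum>p\<in>{1..N}. w p * a p * lin_coeff a p) = (\<Sum>p\<in>{1..N}. w (p + 1) * a (p + 1) * (lin_diag (p + 1) * a p))
      + (\<Sum>p\<in>{1..N}. (lin_diag (p + 1) - lin_diag p) * (w p * (a p)\<^sup>2)) - (\<Sum>p\<in>{1..N}. w p * a p * (lin_diag (p + 1) * a (p + 1)))"
    by simp
  also have "\<dots> = (\<Sum>p\<in>{1..N}. (lin_diag (p + 1) - lin_diag p) * (w p * (a p)\<^sup>2))
      + (\<Sum>p\<in>{1..N}. (w (p + 1) - w p) * lin_diag (p + 1) * (a p * a (p + 1)))"
    unfolding sum.distrib[symmetric] sum_subtractf[symmetric]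
    by (rule sum.cong) (auto simp: algebra_simps)
  finally show ?thesis .
qed

text \<open>For sequences supported in 1..N the differences reach one index further, hence the bound
  \<open>N + 1\<close>.\<close>

definition galerkin_field :: "nat \<Rightarrow> (nat \<Rightarrow> real) \<Rightarrow> nat \<Rightarrow> real" where
  "galerkin_field N a p = quad_coeff a (int N + 1) (int p) - lin_coeff a p"

context
  fixes a :: "nat \<Rightarrow> real" and N :: nat
  assumes a0: "a 0 = 0" and supp: "\<And>k. k > N \<Longrightarrow> a k = 0"
begin

lemma vel_norm_bound: "11 * vel_norm a N \<le> trilinear_const * sqrt (\<Sum>p\<in>{1..N}. (a p)\<^sup>2)"
proof -
  have "(\<Sum>m\<in>{1..N}. \<bar>a m\<bar> * (growth (int m + 1) / real m))\<^sup>2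
      \<le> (\<Sum>m\<in>{1..N}. \<bar>a m\<bar>\<^sup>2) * (\<Sum>m\<in>{1..N}. (growth (int m + 1) / real m)\<^sup>2)"
    by (rule Cauchy_Schwarz_ineq_sum)
  also have "\<dots> \<le> (\<Sum>m\<in>{1..N}. (a m)\<^sup>2) * (\<Sum>m. (growth (int m + 1) / real m)\<^sup>2)"
    unfolding power2_abs
    by (intro mult_left_mono sum_le_suminf summable_growth_sq) (auto intro: sum_nonneg)
  finally have "(vel_norm a N)\<^sup>2 \<le> (\<Sum>m\<in>{1..N}. (a m)\<^sup>2) * (\<Sum>m. (growth (int m + 1) / real m)\<^sup>2)"
    by (simp add: vel_norm_def[where a = a and N = N, OF a0 supp])
  then have "vel_norm a N \<le> sqrt ((\<Sum>m\<in>{1..N}. (a m)\<^sup>2) * (\<Sum>m. (growth (int m + 1) / real m)\<^sup>2))"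
    by (rule real_le_rsqrt)
  then show ?thesis by (simp add: trilinear_const_def real_sqrt_mult mult_ac)
qed

lemma galerkin_energy:
  "(\<Sum>p\<in>{1..N}. a p * galerkin_field N a p)
    \<le> (- (3/8) + trilinear_const * sqrt (\<Sum>p\<in>{1..N}. (a p)\<^sup>2)) * (\<Sum>p\<in>{1..N}. (a p)\<^sup>2)"
proof -
  define S where "S = (\<Sum>p\<in>{1..N}. (a p)\<^sup>2)"
  have S: "weighted_energy a N (\<lambda>_. 1) = S" by (simp add: weighted_energy_def[where a = a and N = N, OF a0 supp admissible_weight_one] S_def)
  have S0: "S \<ge> 0" by (simp add: S_def sum_nonneg)
  have "\<bar>\<Sum>p\<in>{1..N}. 1 * a p * quad_coeff a (int N + 1) (int p)\<bar> \<le> 11 * vel_norm a N * S"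
    using trilinear_bound[where a = a and N = N, OF a0 supp admissible_weight_one] unfolding S .
  also have "\<dots> \<le> (trilinear_const * sqrt S) * S"
    using vel_norm_bound S0 unfolding S_def[symmetric] by (intro mult_right_mono) auto
  finally have 1: "\<bar>\<Sum>p\<in>{1..N}. a p * quad_coeff a (int N + 1) (int p)\<bar> \<le> (trilinear_const * sqrt S) * S" by simp
  have "(\<Sum>p\<in>{1..N}. a p * lin_coeff a p) = (\<Sum>p\<in>{1..N}. (lin_diag (p + 1) - lin_diag p) * (a p)\<^sup>2)"
    using lin_energy[of a N "\<lambda>_. 1"] supp by simp
  also have "\<dots> \<ge> (\<Sum>p\<in>{1..N}. (3/8) * (a p)\<^sup>2)"
    using lin_diag_diff by (intro sum_mono mult_right_mono) auto
  finally have 2: "(3/8) * S \<le> (\<Sum>p\<in>{1..N}. a p * lin_coeff a p)" by (simp add: S_def sum_distrib_left)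
  have "(\<Sum>p\<in>{1..N}. a p * galerkin_field N a p) = (\<Sum>p\<in>{1..N}. a p * quad_coeff a (int N + 1) (int p)) - (\<Sum>p\<in>{1..N}. a p * lin_coeff a p)"
    by (simp add: galerkin_field_def right_diff_distrib sum_subtractf)
  then have "(\<Sum>p\<in>{1..N}. a p * galerkin_field N a p) \<le> (trilinear_const * sqrt S) * S - (3/8) * S"
    using 1 2 by linarith
  then show ?thesis unfolding S_def[symmetric] by (simp add: algebra_simps)
qed

text \<open>The dissipative diagonal is discarded. \<open>lin_diag\<close> grows linearly, but
  multiplied by the increment of an admissible weight it is bounded by the weight itself, and the
  bound for shifted products gives the constant 2.\<close>

lemma galerkin_weighted_energy:
  assumes w: "admissible_weight w"
  shows "(\<Sum>p\<in>{1..N}. w (int p) * a p * galerkin_field N a p)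
    \<le> (2 + trilinear_const * sqrt (\<Sum>p\<in>{1..N}. (a p)\<^sup>2)) * (\<Sum>p\<in>{1..N}. w (int p) * (a p)\<^sup>2)"
proof -
  define S E where "S = (\<Sum>p\<in>{1..N}. (a p)\<^sup>2)" and "E = (\<Sum>p\<in>{1..N}. w (int p) * (a p)\<^sup>2)"
  have E: "weighted_energy a N w = E" by (simp add: weighted_energy_def[where a = a and N = N, OF a0 supp w] E_def)
  have E0: "E \<ge> 0" using weighted_energy_nonneg[where a = a and N = N, OF a0 supp w] by (simp add: E)
  have "\<bar>\<Sum>p\<in>{1..N}. w (int p) * a p * quad_coeff a (int N + 1) (int p)\<bar> \<le> 11 * vel_norm a N * E"
    using trilinear_bound[where a = a and N = N, OF a0 supp w] unfolding E .
  also have "\<dots> \<le> (trilinear_const * sqrt S) * E"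
    using vel_norm_bound E0 unfolding S_def[symmetric] by (intro mult_right_mono) auto
  finally have 1: "\<bar>\<Sum>p\<in>{1..N}. w (int p) * a p * quad_coeff a (int N + 1) (int p)\<bar> \<le> (trilinear_const * sqrt S) * E" .
  have g1: "growth 1 \<le> 2" by (simp add: growth_def real_le_lsqrt)
  have "\<bar>\<Sum>p\<in>{1..N}. (w (int (p + 1)) - w (int p)) * lin_diag (p + 1) * (a p * a (p + 1))\<bar>
      \<le> (\<Sum>p\<in>{1..N}. \<bar>(w (int (p + 1)) - w (int p)) * lin_diag (p + 1) * (a p * a (p + 1))\<bar>)" by (rule sum_abs)
  also have "\<dots> \<le> (\<Sum>p\<in>{1..N}. \<alpha> a w (int p) * \<alpha> a w (int p + 1))"
  proof (rule sum_mono)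
    fix p assume p: "p \<in> {1..N}"
    have wn: "w k \<ge> 0" for k using w unfolding admissible_weight_def by (simp add: less_imp_le)
    have "\<bar>w (int (p + 1)) - w (int p)\<bar> * lin_diag (p + 1) \<le> \<bar>w (int (p + 1)) - w (int p)\<bar> * ((real p + 1/2) / 2)"
      using lin_diag_Suc_le[of p] by (intro mult_left_mono) auto
    also have "\<dots> = (\<bar>real_of_int (int p) + 1/2\<bar> * \<bar>w (int p) - w (int p + 1)\<bar>) / 2"
      by (simp add: abs_minus_commute mult.commute add.commute)
    also have "\<dots> \<le> (\<bar>real_of_int (int p - (int p + 1))\<bar> * w (int p)) / 2"
      using w_diff[where a = a and N = N and p = "int p" and q = "int p + 1", OF a0 supp w] by (intro divide_right_mono) auto
    also have "\<dots> \<le> (growth (int p - (int p + 1)) * (sqrt (w (int p)) * sqrt (w (int p + 1)))) / 2"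
      using w_le_geometric[where a = a and N = N and p = "int p" and q = "int p + 1", OF a0 supp w] by simp
    also have "\<dots> \<le> (2 * (sqrt (w (int p)) * sqrt (w (int p + 1)))) / 2"
      using g1 wn by (intro divide_right_mono mult_right_mono) auto
    finally have *: "\<bar>w (int (p + 1)) - w (int p)\<bar> * lin_diag (p + 1) \<le> sqrt (w (int p)) * sqrt (w (int p + 1))" by simp
    have "\<bar>(w (int (p + 1)) - w (int p)) * lin_diag (p + 1) * (a p * a (p + 1))\<bar>
      = (\<bar>w (int (p + 1)) - w (int p)\<bar> * lin_diag (p + 1)) * (\<bar>a p\<bar> * \<bar>a (p + 1)\<bar>)"
      using lin_diag_nonneg[of "p + 1"] by (simp add: abs_mult)
    also have "\<dots> \<le> (sqrt (w (int p)) * sqrt (w (int p + 1))) * (\<bar>a p\<bar> * \<bar>a (p + 1)\<bar>)"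
      by (rule mult_right_mono[OF *]) simp
    also have "\<dots> = \<alpha> a w (int p) * \<alpha> a w (int p + 1)"
      by (simp add: \<alpha>_def[where a = a and N = N, OF a0 supp w] odd_ext_def nat_add_distrib)
    finally show "\<bar>(w (int (p + 1)) - w (int p)) * lin_diag (p + 1) * (a p * a (p + 1))\<bar> \<le> \<alpha> a w (int p) * \<alpha> a w (int p + 1)" .
  qed
  also have "\<dots> = (\<Sum>p\<in>int ` {1..N}. \<alpha> a w p * \<alpha> a w (p + 1))" by (subst sum.reindex) auto
  also have "\<dots> \<le> 2 * E" using sum_\<alpha>_shift[where a = a and N = N and S = "int ` {1..N}" and k = 1, OF a0 supp w] unfolding E by simp
  finally have 2: "\<bar>\<Sum>p\<in>{1..N}. (w (int (p + 1)) - w (int p)) * lin_diag (p + 1) * (a p * a (p + 1))\<bar> \<le> 2 * E" .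
  have "0 \<le> (lin_diag (p + 1) - lin_diag p) * (w (int p) * (a p)\<^sup>2)" if "p \<in> {1..N}" for p
  proof -
    have "w (int p) \<ge> 0" using w unfolding admissible_weight_def by (simp add: less_imp_le)
    then show ?thesis using lin_diag_diff[of p] that by (intro mult_nonneg_nonneg) auto
  qed
  then have 3: "0 \<le> (\<Sum>p\<in>{1..N}. (lin_diag (p + 1) - lin_diag p) * (w (int p) * (a p)\<^sup>2))" by (rule sum_nonneg)
  have 4: "(\<Sum>p\<in>{1..N}. w (int p) * a p * lin_coeff a p) = (\<Sum>p\<in>{1..N}. (lin_diag (p + 1) - lin_diag p) * (w (int p) * (a p)\<^sup>2))
      + (\<Sum>p\<in>{1..N}. (w (int (p + 1)) - w (int p)) * lin_diag (p + 1) * (a p * a (p + 1)))"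
    using lin_energy[of a N "\<lambda>p. w (int p)"] supp by simp
  have "(\<Sum>p\<in>{1..N}. w (int p) * a p * galerkin_field N a p) = (\<Sum>p\<in>{1..N}. w (int p) * a p * quad_coeff a (int N + 1) (int p))
      - (\<Sum>p\<in>{1..N}. w (int p) * a p * lin_coeff a p)"
    by (simp add: galerkin_field_def right_diff_distrib sum_subtractf)
  then have "(\<Sum>p\<in>{1..N}. w (int p) * a p * galerkin_field N a p) \<le> (trilinear_const * sqrt S) * E + 2 * E"
    using 1 2 3 4 by linarith
  then show ?thesis unfolding S_def[symmetric] E_def[symmetric] by (simp add: algebra_simps)
qed

text \<open>Back to natural indices. This form is visibly a polynomial in finitely many coordinates,
  which gives the Lipschitz property, and it can be compared with the Fourier coefficients of the
  equation.\<close>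

lemma quad_coeff_nat:
  "quad_coeff a (int N + 1) (int p) = (\<Sum>n\<in>{1..N + 1}. \<Sum>m\<in>{1..N + 1}.
     (a (n - 1) - a n) / (real n)\<^sup>2 * (((real m)\<^sup>2 - (real n)\<^sup>2) / (2 * real m) * (a (m - 1) - a m)
       * (of_bool (\<bar>int m - int n\<bar> \<le> int p) - of_bool (m + n \<le> p))))"
proof -
  have idiff: "int_diff a (int n) = a (n - 1) - a n" if "n \<in> {1..N + 1}" for n
    using that by (auto simp: int_diff_def odd_ext_def nat_diff_distrib)
  have "quad_coeff a (int N + 1) (int p) = (\<Sum>n\<in>{1..int N + 1}. int_diff a n / (real_of_int n)\<^sup>2 *
      (\<Sum>m\<in>{1..int N + 1}. conv_coeff a n m * (of_bool (\<bar>m - n\<bar> \<le> int p) - of_bool (m + n \<le> int p))))"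
    unfolding quad_coeff_def
  proof (rule sum.cong[OF refl])
    fix n assume n: "n \<in> {1..int N + 1}"
    have "conv_coeff a n m = 0" if "m > int N + 1" for m
      using int_diff_support[where a = a and N = N and m = m, OF a0 supp] that by (simp add: conv_coeff_def)
    then show "int_diff a n / (real_of_int n)\<^sup>2 * (\<Sum>m\<in>{int p - n + 1..int p + n}. conv_coeff a n m)
       = int_diff a n / (real_of_int n)\<^sup>2 * (\<Sum>m\<in>{1..int N + 1}. conv_coeff a n m * (of_bool (\<bar>m - n\<bar> \<le> int p) - of_bool (m + n \<le> int p)))"
      using odd_window_sum[where \<kappa> = "conv_coeff a n" and L = "int N + 1" and n = n and p = "int p"] n
      by (simp add: conv_coeff_minus)
  qed
  also have "\<dots> = (\<Sum>n\<in>{1..N + 1}. int_diff a (int n) / (real n)\<^sup>2 *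
      (\<Sum>m\<in>{1..int N + 1}. conv_coeff a (int n) m * (of_bool (\<bar>m - int n\<bar> \<le> int p) - of_bool (m + int n \<le> int p))))"
    by (rule sum.reindex_bij_witness[of _ int nat]) auto
  also have "\<dots> = (\<Sum>n\<in>{1..N + 1}. \<Sum>m\<in>{1..N + 1}.
     (a (n - 1) - a n) / (real n)\<^sup>2 * (((real m)\<^sup>2 - (real n)\<^sup>2) / (2 * real m) * (a (m - 1) - a m)
       * (of_bool (\<bar>int m - int n\<bar> \<le> int p) - of_bool (m + n \<le> p))))"
  proof (rule sum.cong[OF refl])
    fix n assume n: "n \<in> {1..N + 1}"
    have "(\<Sum>m\<in>{1..int N + 1}. conv_coeff a (int n) m * (of_bool (\<bar>m - int n\<bar> \<le> int p) - of_bool (m + int n \<le> int p)))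
      = (\<Sum>m\<in>{1..N + 1}. conv_coeff a (int n) (int m) * (of_bool (\<bar>int m - int n\<bar> \<le> int p) - of_bool (m + n \<le> p)))"
      by (rule sum.reindex_bij_witness[of _ int nat]) (auto simp: of_bool_def)
    also have "\<dots> = (\<Sum>m\<in>{1..N + 1}. ((real m)\<^sup>2 - (real n)\<^sup>2) / (2 * real m) * (a (m - 1) - a m)
       * (of_bool (\<bar>int m - int n\<bar> \<le> int p) - of_bool (m + n \<le> p)))"
    proof (rule sum.cong[OF refl])
      fix m assume m: "m \<in> {1..N + 1}"
      have "conv_coeff a (int n) (int m) = ((real m)\<^sup>2 - (real n)\<^sup>2) / (2 * real m) * (a (m - 1) - a m)"
        unfolding conv_coeff_def idiff[OF m] using m by (simp add: field_simps power2_eq_square)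
      then show "conv_coeff a (int n) (int m) * (of_bool (\<bar>int m - int n\<bar> \<le> int p) - of_bool (m + n \<le> p))
        = ((real m)\<^sup>2 - (real n)\<^sup>2) / (2 * real m) * (a (m - 1) - a m) * (of_bool (\<bar>int m - int n\<bar> \<le> int p) - of_bool (m + n \<le> p))"
        by simp
    qed
    finally have eq: "(\<Sum>m\<in>{1..int N + 1}. conv_coeff a (int n) m * (of_bool (\<bar>m - int n\<bar> \<le> int p) - of_bool (m + int n \<le> int p)))
      = (\<Sum>m\<in>{1..N + 1}. ((real m)\<^sup>2 - (real n)\<^sup>2) / (2 * real m) * (a (m - 1) - a m)
       * (of_bool (\<bar>int m - int n\<bar> \<le> int p) - of_bool (m + n \<le> p)))" .
    show "int_diff a (int n) / (real n)\<^sup>2 *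
      (\<Sum>m\<in>{1..int N + 1}. conv_coeff a (int n) m * (of_bool (\<bar>m - int n\<bar> \<le> int p) - of_bool (m + int n \<le> int p)))
      = (\<Sum>m\<in>{1..N + 1}. (a (n - 1) - a n) / (real n)\<^sup>2 * (((real m)\<^sup>2 - (real n)\<^sup>2) / (2 * real m) * (a (m - 1) - a m)
       * (of_bool (\<bar>int m - int n\<bar> \<le> int p) - of_bool (m + n \<le> p))))"
      unfolding idiff[OF n] eq by (rule sum_distrib_left)
  qed
  finally show ?thesis .
qed

end

section \<open>Global solutions of the Galerkin system\<close>

lemma indefinite_integral_deriv:
  fixes f :: "real \<Rightarrow> 'a::banach"
  assumes f: "continuous_on {0..} f" and t: "t \<ge> 0"
  shows "((\<lambda>u. integral {0..u} f) has_vector_derivative f t) (at t within {0..})"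
proof -
  have "((\<lambda>u. integral {0..u} f) has_vector_derivative f t) (at t within {0..t + 1})"
    by (rule integral_has_vector_derivative[OF continuous_on_subset[OF f]]) (use t in auto)
  moreover have "at t within {0..t + 1} = at t within {0..}"
    by (rule at_within_nhd[where S = "{..<t + 1}"]) auto
  ultimately show ?thesis by simp
qed

lemma exp_weight_bound:
  fixes K \<tau> :: real
  assumes "0 < K" "0 \<le> \<tau>"
  shows "exp (- (2 * K * \<tau>)) * \<tau> \<le> 1 / K"
proof -
  have "2 * K * \<tau> \<le> exp (2 * K * \<tau>)" using exp_ge_add_one_self[of "2 * K * \<tau>"] by linarith
  then have "K * \<tau> \<le> exp (2 * K * \<tau>)" using assms mult_nonneg_nonneg[of K \<tau>] by linarith
  then have "exp (- (2 * K * \<tau>)) * (K * \<tau>) \<le> exp (- (2 * K * \<tau>)) * exp (2 * K * \<tau>)"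
    by (intro mult_left_mono) auto
  then show ?thesis using assms by (simp add: exp_add[symmetric] field_simps)
qed

text \<open>In the norm weighted by \<open>exp (- 2 K t)\<close> the Picard map is a contraction on the whole half-line.\<close>

lemma picard_global:
  fixes F :: "'a::banach \<Rightarrow> 'a"
  assumes lip: "\<And>x y. norm (F x - F y) \<le> K * norm (x - y)" and K: "K > 0"
    and B: "\<And>x. norm (F x) \<le> B"
  shows "\<exists>x. x 0 = x0 \<and> (\<forall>t\<ge>0. (x has_vector_derivative F (x t)) (at t within {0..}))"
proof -
  have Fc: "continuous_on UNIV F"
    by (rule lipschitz_on_continuous_on[where L = K]) (use lip K in \<open>auto simp: lipschitz_on_def dist_norm\<close>)
  \<comment> \<open>The unknown is the solution divided by \<open>exp (2 * K * t)\<close>. It is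
    bounded, because the solution grows at most linearly.\<close>
  define f where "f = (\<lambda>(y :: real \<Rightarrow>\<^sub>C 'a) s. F (exp (2 * K * s) *\<^sub>R apply_bcontfun y s))"
  have fc: "continuous_on S (f y)" for y S
    unfolding f_def by (intro continuous_on_compose2[OF Fc] continuous_intros) auto
  define I where "I = (\<lambda>y t. integral {0..t} (f y))"
  have Ider: "(I y has_vector_derivative f y t) (at t within {0..})" if "t \<ge> 0" for y t
    unfolding I_def by (rule indefinite_integral_deriv[OF fc that])
  have Ic: "continuous_on {0..} (I y)" for y
    by (rule continuous_on_vector_derivative) (use Ider in auto)
  \<comment> \<open>The \<open>max\<close> extends the map to negative times, so that its values are
    bounded continuous functions on the whole line.\<close>
  define \<Phi> where "\<Phi> = (\<lambda>y t. exp (- (2 * K * max 0 t)) *\<^sub>R (x0 + I y (max 0 t)))"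
  have \<Phi>c: "continuous_on UNIV (\<Phi> y)" for y
    unfolding \<Phi>_def by (intro continuous_intros continuous_on_compose2[OF Ic]) auto
  have B0: "B \<ge> 0" using B[of 0] norm_ge_zero order_trans by blast
  have Ib: "norm (I y \<tau>) \<le> B * \<tau>" if "\<tau> \<ge> 0" for y \<tau>
    unfolding I_def using integral_bound[OF that fc[of "{0..\<tau>}" y], of B] B by (simp add: f_def)
  have \<Phi>b: "norm (\<Phi> y t) \<le> norm x0 + B / K" for y t
  proof -
    define \<tau> where "\<tau> = max 0 t"
    have \<tau>: "\<tau> \<ge> 0" by (simp add: \<tau>_def)
    have "norm (\<Phi> y t) = exp (- (2 * K * \<tau>)) * norm (x0 + I y \<tau>)" by (simp add: \<Phi>_def \<tau>_def)
    also have "\<dots> \<le> exp (- (2 * K * \<tau>)) * (norm x0 + B * \<tau>)"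
      by (intro mult_left_mono order_trans[OF norm_triangle_ineq] add_left_mono Ib \<tau>) auto
    also have "\<dots> = exp (- (2 * K * \<tau>)) * norm x0 + B * (exp (- (2 * K * \<tau>)) * \<tau>)" by (simp add: algebra_simps)
    also have "\<dots> \<le> 1 * norm x0 + B * (1 / K)"
      using K \<tau> B0 by (intro add_mono mult_right_mono mult_left_mono exp_weight_bound) auto
    finally show ?thesis by simp
  qed
  have \<Phi>in: "\<Phi> y \<in> bcontfun" for y by (rule bcontfun_normI[OF \<Phi>c \<Phi>b])
  define P where "P = (\<lambda>y. Bcontfun (\<Phi> y))"
  have P: "apply_bcontfun (P y) = \<Phi> y" for y unfolding P_def by (rule Bcontfun_inverse[OF \<Phi>in])
  \<comment> \<open>The integral of \<open>K * exp (2 * K * s)\<close> is at most half of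
    \<open>exp (2 * K * t)\<close>; the exponent \<open>2 * K\<close> of the weight is the source of
    the factor 1/2.\<close>
  have "dist (P y) (P z) \<le> (1/2) * dist y z" for y z
  proof (rule dist_bound)
    fix t :: real
    define \<tau> where "\<tau> = max 0 t"
    have \<tau>: "\<tau> \<ge> 0" by (simp add: \<tau>_def)
    define D where "D = dist y z"
    have D: "norm (apply_bcontfun y s - apply_bcontfun z s) \<le> D" for s
      unfolding D_def dist_norm[symmetric] by (rule dist_bounded)
    have "norm (I y \<tau> - I z \<tau>) = norm (integral {0..\<tau>} (\<lambda>s. f y s - f z s))"
      unfolding I_def by (subst integral_diff) (auto intro!: integrable_continuous_real fc)
    also have "\<dots> \<le> integral {0..\<tau>} (\<lambda>s. (D / 2) * (2 * K * exp (2 * K * s)))"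
    proof (rule integral_norm_bound_integral)
      show "(\<lambda>s. f y s - f z s) integrable_on {0..\<tau>}" by (intro integrable_continuous_real continuous_intros fc)
      show "(\<lambda>s. (D / 2) * (2 * K * exp (2 * K * s))) integrable_on {0..\<tau>}"
        by (intro integrable_continuous_real continuous_intros)
      fix s
      have "norm (f y s - f z s) \<le> K * norm (exp (2 * K * s) *\<^sub>R (apply_bcontfun y s - apply_bcontfun z s))"
        unfolding f_def scaleR_right_diff_distrib by (rule lip)
      also have "\<dots> \<le> K * (exp (2 * K * s) * D)" using D[of s] K by simp
      finally show "norm (f y s - f z s) \<le> (D / 2) * (2 * K * exp (2 * K * s))" by (simp add: mult_ac)
    qed
    also have "\<dots> = (D / 2) * exp (2 * K * \<tau>) - (D / 2) * exp (2 * K * 0)"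
      by (intro integral_unique fundamental_theorem_of_calculus \<tau>)
         (auto intro!: derivative_eq_intros simp: has_real_derivative_iff_has_vector_derivative[symmetric])
    finally have "norm (I y \<tau> - I z \<tau>) \<le> (D / 2) * exp (2 * K * \<tau>)" using order_trans[OF norm_ge_zero D] by simp
    then have "exp (- (2 * K * \<tau>)) * norm (I y \<tau> - I z \<tau>) \<le> exp (- (2 * K * \<tau>)) * ((D / 2) * exp (2 * K * \<tau>))"
      by (intro mult_left_mono) auto
    also have "\<dots> = D / 2" by (simp add: mult.left_commute exp_add[symmetric])
    finally have "exp (- (2 * K * \<tau>)) * norm (I y \<tau> - I z \<tau>) \<le> D / 2" .
    moreover have "dist (\<Phi> y t) (\<Phi> z t) = exp (- (2 * K * \<tau>)) * norm (I y \<tau> - I z \<tau>)"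
      unfolding dist_norm \<Phi>_def \<tau>_def scaleR_right_diff_distrib[symmetric] by simp
    ultimately show "dist (apply_bcontfun (P y) t) (apply_bcontfun (P z) t) \<le> (1/2) * dist y z" by (simp add: P D_def)
  qed
  then obtain y where y: "P y = y" using banach_fix_type[of "1/2" P] by auto
  define x where "x = (\<lambda>t. x0 + I y t)"
  have xy: "exp (2 * K * t) *\<^sub>R apply_bcontfun y t = x t" if "t \<ge> 0" for t
  proof -
    have "apply_bcontfun y t = \<Phi> y t" using P[of y] y by simp
    then show ?thesis using that by (simp add: \<Phi>_def x_def exp_add[symmetric])
  qed
  have "(x has_vector_derivative F (x t)) (at t within {0..})" if "t \<ge> 0" for t
    using Ider[OF that, of y] xy[OF that] unfolding x_def f_def by (auto intro!: derivative_eq_intros)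
  moreover have "x 0 = x0" by (simp add: x_def I_def)
  ultimately show ?thesis by blast
qed

instance bcontfun :: (metric_space, banach) banach ..

text \<open>Products of Lipschitz functions are Lipschitz if the factors are bounded. Carrying both
  properties together yields a class closed under polynomial operations.\<close>

definition bounded_lipschitz :: "('a::real_normed_vector \<Rightarrow> real) \<Rightarrow> bool" where
  "bounded_lipschitz g \<longleftrightarrow> (\<exists>B K. \<forall>x y. \<bar>g x\<bar> \<le> B \<and> \<bar>g x - g y\<bar> \<le> K * norm (x - y))"

lemma bounded_lipschitzI:
  "(\<And>x. \<bar>g x\<bar> \<le> B) \<Longrightarrow> (\<And>x y. \<bar>g x - g y\<bar> \<le> K * norm (x - y)) \<Longrightarrow> bounded_lipschitz g"
  unfolding bounded_lipschitz_def by blast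

lemma bounded_lipschitzE:
  assumes "bounded_lipschitz g"
  obtains B K where "B \<ge> 0" "K \<ge> 0" "\<And>x. \<bar>g x\<bar> \<le> B" "\<And>x y. \<bar>g x - g y\<bar> \<le> K * norm (x - y)"
proof -
  obtain B K where BK: "\<And>x. \<bar>g x\<bar> \<le> B" "\<And>x y. \<bar>g x - g y\<bar> \<le> K * norm (x - y)"
    using assms unfolding bounded_lipschitz_def by blast
  have "\<bar>g x - g y\<bar> \<le> \<bar>K\<bar> * norm (x - y)" for x y
    by (rule order_trans[OF BK(2)]) (intro mult_right_mono, auto)
  moreover have "B \<ge> 0" using BK(1) abs_ge_zero order_trans by blast
  ultimately show ?thesis using that[of B "\<bar>K\<bar>"] BK(1) by simp
qed

lemma bounded_lipschitz_const: "bounded_lipschitz (\<lambda>x. c)"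
  by (rule bounded_lipschitzI[of _ "\<bar>c\<bar>" 0]) auto

lemma bounded_lipschitz_add:
  assumes "bounded_lipschitz f" "bounded_lipschitz g"
  shows "bounded_lipschitz (\<lambda>x. f x + g x)"
proof -
  obtain B K where f: "\<And>x. \<bar>f x\<bar> \<le> B" "\<And>x y. \<bar>f x - f y\<bar> \<le> K * norm (x - y)" using assms(1) by (rule bounded_lipschitzE) auto
  obtain B' K' where g: "\<And>x. \<bar>g x\<bar> \<le> B'" "\<And>x y. \<bar>g x - g y\<bar> \<le> K' * norm (x - y)" using assms(2) by (rule bounded_lipschitzE) auto
  show ?thesis
  proof (rule bounded_lipschitzI)
    show "\<bar>f x + g x\<bar> \<le> B + B'" for x using f(1)[of x] g(1)[of x] by linarith
    show "\<bar>f x + g x - (f y + g y)\<bar> \<le> (K + K') * norm (x - y)" for x y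
      using f(2)[of x y] g(2)[of x y] unfolding distrib_right by linarith
  qed
qed

lemma bounded_lipschitz_mult:
  assumes "bounded_lipschitz f" "bounded_lipschitz g"
  shows "bounded_lipschitz (\<lambda>x. f x * g x)"
proof -
  obtain B K where f: "B \<ge> 0" "K \<ge> 0" "\<And>x. \<bar>f x\<bar> \<le> B" "\<And>x y. \<bar>f x - f y\<bar> \<le> K * norm (x - y)"
    using assms(1) by (rule bounded_lipschitzE) auto
  obtain B' K' where g: "B' \<ge> 0" "K' \<ge> 0" "\<And>x. \<bar>g x\<bar> \<le> B'" "\<And>x y. \<bar>g x - g y\<bar> \<le> K' * norm (x - y)"
    using assms(2) by (rule bounded_lipschitzE) auto
  show ?thesis
  proof (rule bounded_lipschitzI)
    show "\<bar>f x * g x\<bar> \<le> B * B'" for x unfolding abs_mult by (intro mult_mono f g) auto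
    fix x y
    have "f x * g x - f y * g y = f x * (g x - g y) + (f x - f y) * g y" by (simp add: algebra_simps)
    also have "\<bar>\<dots>\<bar> \<le> \<bar>f x\<bar> * \<bar>g x - g y\<bar> + \<bar>f x - f y\<bar> * \<bar>g y\<bar>"
      unfolding abs_mult[symmetric] by (rule abs_triangle_ineq)
    also have "\<dots> \<le> B * (K' * norm (x - y)) + (K * norm (x - y)) * B'"
      by (intro add_mono mult_mono f g) (auto intro!: mult_nonneg_nonneg f g)
    finally show "\<bar>f x * g x - f y * g y\<bar> \<le> (B * K' + K * B') * norm (x - y)" by (simp add: algebra_simps)
  qed
qed

lemma bounded_lipschitz_diff:
  "bounded_lipschitz f \<Longrightarrow> bounded_lipschitz g \<Longrightarrow> bounded_lipschitz (\<lambda>x. f x - g x)"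
  using bounded_lipschitz_add[OF _ bounded_lipschitz_mult[OF bounded_lipschitz_const[of "-1"]], of f g] by simp

lemma bounded_lipschitz_sum:
  "(\<And>i. i \<in> I \<Longrightarrow> bounded_lipschitz (g i)) \<Longrightarrow> bounded_lipschitz (\<lambda>x. \<Sum>i\<in>I. g i x)"
  by (induction I rule: infinite_finite_induct) (auto intro: bounded_lipschitz_const bounded_lipschitz_add)

lemma bounded_lipschitz_clamp:
  assumes "\<And>x y. \<bar>g x - g y\<bar> \<le> K * norm (x - y)"
  shows "bounded_lipschitz (\<lambda>x. max b (min c (g x)))"
proof (rule bounded_lipschitzI)
  show "\<bar>max b (min c (g x))\<bar> \<le> \<bar>b\<bar> + \<bar>c\<bar>" for x by (auto simp: max_def min_def)
  fix x y
  have "\<bar>max b (min c (g x)) - max b (min c (g y))\<bar> \<le> \<bar>g x - g y\<bar>" by (auto simp: max_def min_def)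
  then show "\<bar>max b (min c (g x)) - max b (min c (g y))\<bar> \<le> K * norm (x - y)" using assms order_trans by blast
qed

lemmas bounded_lipschitz_intros = bounded_lipschitz_const bounded_lipschitz_add bounded_lipschitz_mult
  bounded_lipschitz_diff bounded_lipschitz_sum

text \<open>Finite sequences are carried by hat functions at the integers inside \<open>real \<Rightarrow>\<^sub>C real\<close>,
  because bounded continuous functions form a Banach space only over a metric domain.\<close>

definition hat_sum :: "nat \<Rightarrow> (nat \<Rightarrow> real) \<Rightarrow> real \<Rightarrow> real" where
  "hat_sum N v r = (\<Sum>p\<in>{1..N}. v p * max 0 (1 - \<bar>r - real p\<bar>))"

lemma hat_sum_bound: "\<bar>hat_sum N v r\<bar> \<le> (\<Sum>p\<in>{1..N}. \<bar>v p\<bar>)"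
  unfolding hat_sum_def
  by (rule order_trans[OF sum_abs], rule sum_mono) (auto simp: abs_mult intro!: mult_left_le)

lemma hat_sum_diff: "hat_sum N v r - hat_sum N u r = hat_sum N (\<lambda>p. v p - u p) r"
  by (simp add: hat_sum_def sum_subtractf left_diff_distrib)

lemma hat_sum_at: "k \<in> {1..N} \<Longrightarrow> hat_sum N v (real k) = v k"
proof -
  assume k: "k \<in> {1..N}"
  have "hat_sum N v (real k) = (\<Sum>p\<in>{1..N}. if k = p then v p else 0)"
    unfolding hat_sum_def
  proof (rule sum.cong[OF refl])
    fix p
    have "1 \<le> \<bar>real k - real p\<bar>" if "k \<noteq> p" using that by linarith
    then show "v p * max 0 (1 - \<bar>real k - real p\<bar>) = (if k = p then v p else 0)" by (cases "k = p") auto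
  qed
  then show ?thesis using k by simp
qed

lemma hat_sum_bcontfun: "hat_sum N v \<in> bcontfun"
proof (rule bcontfun_normI)
  show "continuous_on UNIV (hat_sum N v)" unfolding hat_sum_def[abs_def] by (intro continuous_intros)
  show "norm (hat_sum N v r) \<le> (\<Sum>p\<in>{1..N}. \<bar>v p\<bar>)" for r using hat_sum_bound by simp
qed

text \<open>Clamping the coordinates makes the quadratic field globally bounded and Lipschitz. It is
  inactive while the sum of squares stays below 1.\<close>

definition clamped :: "nat \<Rightarrow> (real \<Rightarrow>\<^sub>C real) \<Rightarrow> nat \<Rightarrow> real" where
  "clamped N x k = (if k \<in> {1..N} then max (-1) (min 1 (apply_bcontfun x (real k))) else 0)"

lemma clamped_support: "clamped N x 0 = 0" "k > N \<Longrightarrow> clamped N x k = 0"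
  by (auto simp: clamped_def)

lemma bounded_lipschitz_clamped: "bounded_lipschitz (\<lambda>x. clamped N x k)"
proof (cases "k \<in> {1..N}")
  case True
  have "bounded_lipschitz (\<lambda>x :: real \<Rightarrow>\<^sub>C real. max (-1) (min 1 (apply_bcontfun x (real k))))"
  proof (rule bounded_lipschitz_clamp)
    fix x y :: "real \<Rightarrow>\<^sub>C real"
    show "\<bar>apply_bcontfun x (real k) - apply_bcontfun y (real k)\<bar> \<le> 1 * norm (x - y)"
      using norm_bounded[of "x - y" "real k"] by simp
  qed
  then show ?thesis using True by (simp add: clamped_def)
next
  case False
  then show ?thesis by (auto simp: clamped_def intro: bounded_lipschitz_const)
qed

lemma quad_coeff_clamped:
  "quad_coeff (clamped N x) (int N + 1) (int p) = (\<Sum>n\<in>{1..N + 1}. \<Sum>m\<in>{1..N + 1}.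
     (clamped N x (n - 1) - clamped N x n) / (real n)\<^sup>2 * (((real m)\<^sup>2 - (real n)\<^sup>2) / (2 * real m)
       * (clamped N x (m - 1) - clamped N x m) * (of_bool (\<bar>int m - int n\<bar> \<le> int p) - of_bool (m + n \<le> p))))"
  by (rule quad_coeff_nat) (rule clamped_support)+

lemma bounded_lipschitz_galerkin: "bounded_lipschitz (\<lambda>x. galerkin_field N (clamped N x) p)"
  unfolding galerkin_field_def lin_coeff_def quad_coeff_clamped divide_inverse
  by (intro bounded_lipschitz_intros bounded_lipschitz_clamped)

text \<open>Equal to 1 up to the energy \<epsilon>^2 and to 0 from 2 \<epsilon>^2 on, for nonzero
  \<epsilon>. The field is thus switched off before the energy leaves the region where the linear
  damping dominates.\<close>

definition cutoff :: "real \<Rightarrow> nat \<Rightarrow> (real \<Rightarrow>\<^sub>C real) \<Rightarrow> real" where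
  "cutoff \<epsilon> N x = max 0 (min 1 (2 - (\<Sum>k\<in>{1..N}. (clamped N x k)\<^sup>2) / \<epsilon>\<^sup>2))"

lemma bounded_lipschitz_cutoff: "bounded_lipschitz (cutoff \<epsilon> N)"
proof -
  have "bounded_lipschitz (\<lambda>x. 2 - (1 / \<epsilon>\<^sup>2) * (\<Sum>k\<in>{1..N}. clamped N x k * clamped N x k))"
    by (intro bounded_lipschitz_intros bounded_lipschitz_clamped)
  then obtain K where "\<And>x y. \<bar>(2 - (1 / \<epsilon>\<^sup>2) * (\<Sum>k\<in>{1..N}. clamped N x k * clamped N x k))
      - (2 - (1 / \<epsilon>\<^sup>2) * (\<Sum>k\<in>{1..N}. clamped N y k * clamped N y k))\<bar> \<le> K * norm (x - y)"
    by (rule bounded_lipschitzE) auto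
  from bounded_lipschitz_clamp[OF this, of 0 1] show ?thesis
    by (simp add: cutoff_def[abs_def] power2_eq_square)
qed

text \<open>Solves a modified, globally Lipschitz system, which replaces a continuation argument.
  Wherever the cutoff is nonzero, the energy is below 2 \<epsilon>^2 and the trilinear term is
  absorbed by the gap 3/8, so the energy never increases. A solution that starts in the ball stays
  there, where the modified field is the original one.\<close>

lemma galerkin_exists:
  assumes \<epsilon>: "0 < \<epsilon>" "\<epsilon> \<le> 1/2" "trilinear_const * (sqrt 2 * \<epsilon>) \<le> 3/8"
    and c: "(\<Sum>p\<in>{1..N}. (c p)\<^sup>2) \<le> \<epsilon>\<^sup>2"
  shows "\<exists>x. (\<forall>t p. p \<notin> {1..N} \<longrightarrow> x t p = 0) \<and> (\<forall>p\<in>{1..N}. x 0 p = c p) \<and>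
     (\<forall>t\<ge>0. \<forall>p\<in>{1..N}. ((\<lambda>t. x t p) has_real_derivative galerkin_field N (x t) p) (at t within {0..})) \<and>
     (\<forall>t\<ge>0. (\<Sum>p\<in>{1..N}. (x t p)\<^sup>2) \<le> (\<Sum>p\<in>{1..N}. (c p)\<^sup>2))"
proof -
  define g where "g = (\<lambda>p (x :: real \<Rightarrow>\<^sub>C real). cutoff \<epsilon> N x * galerkin_field N (clamped N x) p)"
  have "bounded_lipschitz (g p)" for p
    unfolding g_def by (intro bounded_lipschitz_mult bounded_lipschitz_cutoff bounded_lipschitz_galerkin)
  then have "\<exists>B K. B \<ge> 0 \<and> K \<ge> 0 \<and> (\<forall>x. \<bar>g p x\<bar> \<le> B) \<and> (\<forall>x y. \<bar>g p x - g p y\<bar> \<le> K * norm (x - y))" for p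
    by (rule bounded_lipschitzE) blast
  then obtain B K where BK: "\<And>p. B p \<ge> 0" "\<And>p. K p \<ge> 0" "\<And>p x. \<bar>g p x\<bar> \<le> B p"
      "\<And>p x y. \<bar>g p x - g p y\<bar> \<le> K p * norm (x - y)" by metis
  define B' K' where "B' = (\<Sum>p\<in>{1..N}. B p)" and "K' = (\<Sum>p\<in>{1..N}. K p) + 1"
  have K'0: "K' > 0" using sum_nonneg[of "{1..N}" K] BK(2) by (auto simp: K'_def add_nonneg_pos)
  define F where "F = (\<lambda>x. Bcontfun (hat_sum N (\<lambda>p. g p x)))"
  have F: "apply_bcontfun (F x) = hat_sum N (\<lambda>p. g p x)" for x
    unfolding F_def by (rule Bcontfun_inverse[OF hat_sum_bcontfun])
  have "norm (F x - F y) \<le> K' * norm (x - y)" for x y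
  proof (rule norm_bound)
    fix r
    have "norm (apply_bcontfun (F x - F y) r) \<le> (\<Sum>p\<in>{1..N}. \<bar>g p x - g p y\<bar>)"
      using hat_sum_bound[of N "\<lambda>p. g p x - g p y" r] by (simp add: F hat_sum_diff)
    also have "\<dots> \<le> (\<Sum>p\<in>{1..N}. K p * norm (x - y))" by (rule sum_mono) (rule BK(4))
    also have "\<dots> \<le> K' * norm (x - y)" by (simp add: K'_def sum_distrib_right distrib_right)
    finally show "norm (apply_bcontfun (F x - F y) r) \<le> K' * norm (x - y)" .
  qed
  moreover have "norm (F x) \<le> B'" for x
  proof (rule norm_bound)
    fix r
    have "norm (apply_bcontfun (F x) r) \<le> (\<Sum>p\<in>{1..N}. \<bar>g p x\<bar>)" using hat_sum_bound by (simp add: F)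
    also have "\<dots> \<le> B'" unfolding B'_def by (rule sum_mono) (rule BK(3))
    finally show "norm (apply_bcontfun (F x) r) \<le> B'" .
  qed
  ultimately obtain X where X: "X 0 = Bcontfun (hat_sum N c)"
      "\<And>t. t \<ge> 0 \<Longrightarrow> (X has_vector_derivative F (X t)) (at t within {0..})"
    using picard_global[of F K' B' "Bcontfun (hat_sum N c)"] K'0 by blast
  define x where "x = (\<lambda>t p. if p \<in> {1..N} then apply_bcontfun (X t) (real p) else 0)"
  have x0: "x 0 p = c p" if "p \<in> {1..N}" for p
    using that hat_sum_at[OF that] by (simp add: x_def X(1) Bcontfun_inverse[OF hat_sum_bcontfun])
  have bl: "bounded_linear (\<lambda>f :: real \<Rightarrow>\<^sub>C real. apply_bcontfun f r)" for r
  proof (rule bounded_linear_intro[where K = 1])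
    show "norm (apply_bcontfun f r) \<le> norm f * 1" for f :: "real \<Rightarrow>\<^sub>C real"
      using norm_bounded[of f r] by simp
  qed simp_all
  have der: "((\<lambda>t. x t p) has_real_derivative g p (X t)) (at t within {0..})" if "t \<ge> 0" "p \<in> {1..N}" for t p
    using bounded_linear.has_vector_derivative[OF bl[of "real p"] X(2)[OF that(1)]] that(2) hat_sum_at[OF that(2)]
    by (simp add: x_def F has_real_derivative_iff_has_vector_derivative)
  define y where "y = (\<lambda>t. \<Sum>p\<in>{1..N}. (x t p)\<^sup>2)"
  have yder: "(y has_real_derivative 2 * (\<Sum>p\<in>{1..N}. x t p * g p (X t))) (at t within {0..})" if "t \<ge> 0" for t
    unfolding y_def sum_distrib_left using der[OF that]
    by (auto intro!: derivative_eq_intros sum.cong)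
  have small: "clamped N (X t) = x t" if "(\<Sum>p\<in>{1..N}. (clamped N (X t) p)\<^sup>2) < 1" for t
  proof
    fix p
    show "clamped N (X t) p = x t p"
    proof (cases "p \<in> {1..N}")
      case True
      have "(clamped N (X t) p)\<^sup>2 < 1"
        using member_le_sum[of p "{1..N}" "\<lambda>p. (clamped N (X t) p)\<^sup>2"] True that by simp
      then have "\<bar>clamped N (X t) p\<bar> < 1" by (simp add: abs_square_less_1)
      then show ?thesis using True by (auto simp: clamped_def x_def max_def min_def split: if_splits)
    qed (auto simp: clamped_def x_def)
  qed
  have sup: "x t 0 = 0" "\<And>k. k > N \<Longrightarrow> x t k = 0" for t by (auto simp: x_def)
  have dissip: "(\<Sum>p\<in>{1..N}. x t p * g p (X t)) \<le> 0" for t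
  proof (cases "cutoff \<epsilon> N (X t) = 0")
    case True
    then show ?thesis by (simp add: g_def)
  next
    case False
    define S where "S = (\<Sum>p\<in>{1..N}. (clamped N (X t) p)\<^sup>2)"
    have "S / \<epsilon>\<^sup>2 < 2" using False by (auto simp: cutoff_def S_def max_def min_def split: if_splits)
    then have S2: "S < 2 * \<epsilon>\<^sup>2" using \<epsilon>(1) by (simp add: field_simps)
    also have "\<dots> \<le> 2 * (1/2)\<^sup>2" using \<epsilon> by (intro mult_left_mono power_mono) auto
    finally have "S < 1" by (simp add: power2_eq_square)
    then have eq: "clamped N (X t) = x t" unfolding S_def by (rule small)
    have "sqrt S \<le> sqrt (2 * \<epsilon>\<^sup>2)" using S2 by (intro real_sqrt_le_mono) auto
    also have "\<dots> = sqrt 2 * \<epsilon>" using \<epsilon> by (simp add: real_sqrt_mult)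
    finally have "trilinear_const * sqrt S \<le> trilinear_const * (sqrt 2 * \<epsilon>)"
      using trilinear_const_nonneg by (intro mult_left_mono)
    then have "trilinear_const * sqrt S \<le> 3/8" using \<epsilon>(3) by linarith
    then have "(- (3/8) + trilinear_const * sqrt S) * S \<le> 0"
      by (intro mult_nonpos_nonneg) (auto simp: S_def sum_nonneg)
    then have "(\<Sum>p\<in>{1..N}. x t p * galerkin_field N (x t) p) \<le> 0"
      using galerkin_energy[where a = "x t" and N = N, OF sup] unfolding S_def eq by linarith
    moreover have "(\<Sum>p\<in>{1..N}. x t p * g p (X t)) = cutoff \<epsilon> N (X t) * (\<Sum>p\<in>{1..N}. x t p * galerkin_field N (x t) p)"
      by (simp add: g_def eq sum_distrib_left mult_ac)
    moreover have "cutoff \<epsilon> N (X t) \<ge> 0" by (simp add: cutoff_def)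
    ultimately show ?thesis by (simp add: mult_nonneg_nonpos)
  qed
  have y0: "y 0 = (\<Sum>p\<in>{1..N}. (c p)\<^sup>2)" by (simp add: y_def x0)
  have ydec: "y t \<le> y 0" if "t \<ge> 0" for t
  proof -
    have "y t \<le> y 0 * exp (0 - 0)"
    proof (rule gronwall[OF that, where k = "\<lambda>_. 0" and K = "\<lambda>_. 0"])
      fix s assume "s \<in> {0..t}"
      then show "(y has_real_derivative 2 * (\<Sum>p\<in>{1..N}. x s p * g p (X s))) (at s within {0..t})"
        using yder[of s] by (auto intro: has_field_derivative_subset)
      show "2 * (\<Sum>p\<in>{1..N}. x s p * g p (X s)) \<le> 0 * y s" using dissip[of s] by simp
    qed simp
    then show ?thesis by simp
  qed
  have field: "g p (X t) = galerkin_field N (x t) p" if "t \<ge> 0" for t p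
  proof -
    have "(\<Sum>p\<in>{1..N}. (clamped N (X t) p)\<^sup>2) \<le> y t"
      unfolding y_def
    proof (rule sum_mono)
      fix p assume p: "p \<in> {1..N}"
      then have "\<bar>clamped N (X t) p\<bar> \<le> \<bar>x t p\<bar>" by (auto simp: clamped_def x_def max_def min_def)
      then show "(clamped N (X t) p)\<^sup>2 \<le> (x t p)\<^sup>2" by (simp add: abs_le_square_iff)
    qed
    also have "\<dots> \<le> \<epsilon>\<^sup>2" using ydec[OF that] y0 c by linarith
    finally have S: "(\<Sum>p\<in>{1..N}. (clamped N (X t) p)\<^sup>2) \<le> \<epsilon>\<^sup>2" .
    also have "\<epsilon>\<^sup>2 \<le> (1/2)\<^sup>2" using \<epsilon> by (intro power_mono) auto
    finally have "(\<Sum>p\<in>{1..N}. (clamped N (X t) p)\<^sup>2) < 1" by (simp add: power2_eq_square)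
    then have eq: "clamped N (X t) = x t" by (rule small)
    have "(\<Sum>p\<in>{1..N}. (clamped N (X t) p)\<^sup>2) / \<epsilon>\<^sup>2 \<le> 1" using S \<epsilon>(1) by simp
    then have "cutoff \<epsilon> N (X t) = 1" by (simp add: cutoff_def)
    then show ?thesis by (simp add: g_def eq)
  qed
  show ?thesis
  proof (intro exI[of _ x] conjI allI ballI impI)
    show "x t p = 0" if "p \<notin> {1..N}" for t p using that by (auto simp: x_def)
    show "((\<lambda>t. x t p) has_real_derivative galerkin_field N (x t) p) (at t within {0..})" if "t \<ge> 0" "p \<in> {1..N}" for t p
      using der[OF that] field[OF that(1)] by simp
    show "(\<Sum>p\<in>{1..N}. (x t p)\<^sup>2) \<le> (\<Sum>p\<in>{1..N}. (c p)\<^sup>2)" if "t \<ge> 0" for t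
      using ydec[OF that] y0 by (simp add: y_def)
  qed (use x0 in auto)
qed

section \<open>Coordinates on the even modes\<close>

definition l2 :: "(nat \<Rightarrow> real) set" where
  "l2 = {a. a 0 = 0 \<and> summable (\<lambda>p. (a p)\<^sup>2)}"

definition l2_norm :: "(nat \<Rightarrow> real) \<Rightarrow> real" where
  "l2_norm a = sqrt (\<Sum>p. (a p)\<^sup>2)"

text \<open>The function \<open>\<Sum>p. 2 a\<^sub>p e\<^sub>2\<^sub>p\<close>: by telescoping, the coefficient of \<open>sin (2 m \<theta>)\<close> is
  \<open>(a\<^sub>m\<^sub>-\<^sub>1 - a\<^sub>m) / m\<close> with \<open>a\<^sub>0 = 0\<close>. The value at \<open>k = 0\<close> vanishes because \<open>x / 0 = 0\<close>.\<close>

definition eta_coeff :: "(nat \<Rightarrow> real) \<Rightarrow> nat \<Rightarrow> real" where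
  "eta_coeff a k = (if even k then (a (k div 2 - 1) - a (k div 2)) / real (k div 2) else 0)"

definition eta_of :: "(nat \<Rightarrow> real) \<Rightarrow> real \<Rightarrow> real" where
  "eta_of a = sine_series (eta_coeff a)"

lemma l2_zero: "a \<in> l2 \<Longrightarrow> a 0 = 0" by (simp add: l2_def)

lemma l2_summable: "a \<in> l2 \<Longrightarrow> summable (\<lambda>p. (a p)\<^sup>2)" by (simp add: l2_def)

lemma l2_diff: "a \<in> l2 \<Longrightarrow> b \<in> l2 \<Longrightarrow> (\<lambda>p. a p - b p) \<in> l2"
proof -
  assume "a \<in> l2" "b \<in> l2"
  then have "summable (\<lambda>p. 2 * (a p)\<^sup>2 + 2 * (b p)\<^sup>2)" by (intro summable_add summable_mult l2_summable)
  then have "summable (\<lambda>p. (a p - b p)\<^sup>2)"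
  proof (rule summable_comparison_test'[where N = 0])
    fix p
    have "(a p - b p)\<^sup>2 \<le> 2 * (a p)\<^sup>2 + 2 * (b p)\<^sup>2"
      using zero_le_power2[of "a p + b p"] unfolding power2_sum power2_diff by linarith
    then show "norm ((a p - b p)\<^sup>2) \<le> 2 * (a p)\<^sup>2 + 2 * (b p)\<^sup>2" by simp
  qed
  then show ?thesis using \<open>a \<in> l2\<close> \<open>b \<in> l2\<close> by (simp add: l2_def)
qed

lemma l2_finite: "a 0 = 0 \<Longrightarrow> (\<And>k. k > N \<Longrightarrow> a k = 0) \<Longrightarrow> a \<in> l2"
proof -
  assume a: "a 0 = 0" "\<And>k. k > N \<Longrightarrow> a k = 0"
  have "summable (\<lambda>p. (a p)\<^sup>2)"
  proof (rule summable_finite[of "{..N}"])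
    fix n assume "n \<notin> {..N}"
    then show "(a n)\<^sup>2 = 0" using a(2)[of n] by simp
  qed simp
  then show ?thesis using a(1) by (simp add: l2_def)
qed

lemma l2_norm_sq: "a \<in> l2 \<Longrightarrow> (l2_norm a)\<^sup>2 = (\<Sum>p. (a p)\<^sup>2)"
  unfolding l2_norm_def by (simp add: suminf_nonneg l2_summable)

lemma l2_norm_nonneg: "a \<in> l2 \<Longrightarrow> 0 \<le> l2_norm a"
  unfolding l2_norm_def by (simp add: suminf_nonneg l2_summable)

lemma eta_coeff_even: "eta_coeff a (2 * m) = (a (m - 1) - a m) / real m"
  by (simp add: eta_coeff_def)

lemma eta_coeff_0 [simp]: "eta_coeff a 0 = 0" by (simp add: eta_coeff_def)

lemma summable_eta_coeff:
  assumes "a \<in> l2"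
  shows "summable (\<lambda>k. (real k * eta_coeff a k)\<^sup>2)"
proof -
  have 1: "summable (\<lambda>m. (a (m - 1))\<^sup>2)"
    using l2_summable[OF assms] by (subst summable_Suc_iff[symmetric]) simp
  have "summable (\<lambda>m. (real (2 * m) * eta_coeff a (2 * m))\<^sup>2)"
  proof (rule summable_comparison_test'[where N = 1])
    show "summable (\<lambda>m. 8 * (a (m - 1))\<^sup>2 + 8 * (a m)\<^sup>2)"
      by (intro summable_add summable_mult 1 l2_summable[OF assms])
    fix m :: nat assume "m \<ge> 1"
    then have "real (2 * m) * eta_coeff a (2 * m) = 2 * (a (m - 1) - a m)" unfolding eta_coeff_even by simp
    then have "(real (2 * m) * eta_coeff a (2 * m))\<^sup>2 = 4 * (a (m - 1) - a m)\<^sup>2"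
      by (simp only: power_mult_distrib) simp
    moreover have "4 * (a (m - 1) - a m)\<^sup>2 \<le> 8 * (a (m - 1))\<^sup>2 + 8 * (a m)\<^sup>2"
    proof -
      have "4 * (x - y)\<^sup>2 = 8 * x\<^sup>2 + 8 * y\<^sup>2 - 4 * (x + y)\<^sup>2" for x y :: real
        by (simp add: power2_sum power2_diff)
      then show ?thesis by simp
    qed
    ultimately show "norm ((real (2 * m) * eta_coeff a (2 * m))\<^sup>2) \<le> 8 * (a (m - 1))\<^sup>2 + 8 * (a m)\<^sup>2"
      by simp
  qed
  moreover have "summable (\<lambda>m. (real (2 * m) * eta_coeff a (2 * m))\<^sup>2) \<longleftrightarrow> summable (\<lambda>k. (real k * eta_coeff a k)\<^sup>2)"
    by (rule summable_mono_reindex[of "\<lambda>m. 2 * m"]) (auto simp: strict_mono_def eta_coeff_def elim!: evenE)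
  ultimately show ?thesis by simp
qed

lemma eta_of_odd_H1: "a \<in> l2 \<Longrightarrow> eta_of a \<in> odd_H1"
  unfolding eta_of_def by (intro sine_series_odd_H1 summable_eta_coeff)

lemma summable_abs_eta_coeff: "a \<in> l2 \<Longrightarrow> summable (\<lambda>k. \<bar>eta_coeff a k\<bar>)"
  by (intro summable_abs_sine_coeffs summable_eta_coeff)

lemma sine_coeff_eta_of: "a \<in> l2 \<Longrightarrow> sine_coeff (eta_of a) = eta_coeff a"
  unfolding eta_of_def by (rule ext, rule sine_coeff_sine_series) (simp_all add: summable_abs_eta_coeff)

definition basis_sum :: "(nat \<Rightarrow> real) \<Rightarrow> nat \<Rightarrow> real \<Rightarrow> real" where
  "basis_sum a N \<theta> = (\<Sum>p=1..N. (2 * a p) * basis_o (2 * p) \<theta>)"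

text \<open>Truncating the sum over the basis leaves the higher frequency of its last element
  unpaired. This is the additional term.\<close>

lemma basis_sum_eq:
  assumes "a 0 = 0"
  shows "basis_sum a N \<theta> = (\<Sum>k<2 * N + 1. eta_coeff a k * sin (real k * \<theta>)) + a N / real (N + 1) * sin (real (2 * (N + 1)) * \<theta>)"
proof (induction N)
  case 0
  then show ?case using assms by (simp add: basis_sum_def)
next
  case (Suc N)
  have "2 * Suc N + 1 = Suc (Suc (2 * N + 1))" by simp
  then have "(\<Sum>k<2 * Suc N + 1. eta_coeff a k * sin (real k * \<theta>))
      = (\<Sum>k<2 * N + 1. eta_coeff a k * sin (real k * \<theta>)) + eta_coeff a (2 * N + 1) * sin (real (2 * N + 1) * \<theta>)
        + eta_coeff a (2 * Suc N) * sin (real (2 * Suc N) * \<theta>)" by simp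
  moreover have "eta_coeff a (2 * N + 1) = 0" by (simp add: eta_coeff_def)
  moreover have "eta_coeff a (2 * Suc N) = (a N - a (Suc N)) / real (Suc N)" using eta_coeff_even[of a "Suc N"] by simp
  moreover have "basis_sum a (Suc N) \<theta> = basis_sum a N \<theta> + 2 * a (Suc N) * basis_o (2 * Suc N) \<theta>"
    by (simp add: basis_sum_def)
  moreover have "2 * a (Suc N) * basis_o (2 * Suc N) \<theta> = a (Suc N) / real (Suc N + 1) * sin (real (2 * (Suc N + 1)) * \<theta>)
      - a (Suc N) / real (Suc N) * sin (real (2 * Suc N) * \<theta>)"
  proof -
    have "real (2 * Suc N + 2) = 2 * real (Suc N + 1)" "real (2 * Suc N) = 2 * real (Suc N)"
      "2 * Suc N + 2 = 2 * (Suc N + 1)" by simp_all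
    then show ?thesis unfolding basis_o_def by (simp only:) (simp add: field_simps del: of_nat_Suc of_nat_add)
  qed
  ultimately show ?case using Suc by (simp add: diff_divide_distrib left_diff_distrib)
qed

lemma basis_sum_L2:
  assumes "a 0 = 0"
  shows "basis_sum a N \<in> L2"
proof -
  have "basis_sum a N = (\<lambda>\<theta>. (\<Sum>k<2 * N + 1. eta_coeff a k * sin (real k * \<theta>)) + a N / real (N + 1) * sin (real (2 * (N + 1)) * \<theta>))"
    by (rule ext) (rule basis_sum_eq, rule assms)
  moreover have "\<dots> \<in> L2" by (intro L2_add sine_sum_L2 L2_scale sin_in_L2) simp
  ultimately show ?thesis by simp
qed

lemma eta_of_L2: "a \<in> l2 \<Longrightarrow> eta_of a \<in> L2"
  by (intro odd_H1_L2 eta_of_odd_H1)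

lemma l2_tendsto_0: "a \<in> l2 \<Longrightarrow> a \<longlonglongrightarrow> 0"
  using tendsto_real_sqrt[OF summable_LIMSEQ_zero[OF l2_summable]] by (simp add: tendsto_rabs_zero_iff)

text \<open>The unpaired term is bounded by \<open>\<bar>a N\<bar>\<close>, uniformly in \<theta>,
  and square summable sequences tend to 0.\<close>

lemma basis_sum_tendsto:
  assumes "a \<in> l2"
  shows "(\<lambda>N. L2_norm (\<lambda>\<theta>. basis_sum a N \<theta> - eta_of a \<theta>)) \<longlonglongrightarrow> 0"
    "(\<lambda>N. basis_sum a N \<theta>) \<longlonglongrightarrow> eta_of a \<theta>"
proof -
  let ?P = "\<lambda>N \<theta>. \<Sum>k<2 * N + 1. eta_coeff a k * sin (real k * \<theta>)"
  have s: "filterlim (\<lambda>N :: nat. 2 * N + 1) at_top sequentially"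
    by (rule filterlim_subseq) (auto simp: strict_mono_def)
  have ab: "(\<lambda>N. \<bar>a N\<bar>) \<longlonglongrightarrow> 0" using l2_tendsto_0[OF assms] by (rule tendsto_rabs_zero)
  have bd: "\<bar>a N / real (N + 1) * sin x\<bar> \<le> \<bar>a N\<bar>" for N x
  proof -
    have "\<bar>a N / real (N + 1) * sin x\<bar> \<le> \<bar>a N\<bar> * 1"
      unfolding abs_mult by (intro mult_mono) (auto simp: divide_le_eq mult_le_cancel_left1)
    then show ?thesis by simp
  qed
  have "(\<lambda>N. L2_norm (\<lambda>\<theta>. ?P N \<theta> - eta_of a \<theta>)) \<longlonglongrightarrow> 0"
    using filterlim_compose[OF sine_series_L2_tendsto[OF summable_abs_eta_coeff[OF assms]] s]
    by (simp only: eta_of_def)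
  then have lim: "(\<lambda>N. L2_norm (\<lambda>\<theta>. ?P N \<theta> - eta_of a \<theta>) + sqrt (2 * pi) * \<bar>a N\<bar>) \<longlonglongrightarrow> 0"
    using tendsto_add[OF _ tendsto_mult_right_zero[OF ab]] by fastforce
  show "(\<lambda>N. L2_norm (\<lambda>\<theta>. basis_sum a N \<theta> - eta_of a \<theta>)) \<longlonglongrightarrow> 0"
  proof (rule Lim_null_comparison[OF always_eventually lim], rule allI)
    fix N
    let ?t = "\<lambda>\<theta>. a N / real (N + 1) * sin (real (2 * (N + 1)) * \<theta>)"
    have t: "?t \<in> L2" by (intro L2_scale sin_in_L2) simp
    have "(\<lambda>\<theta>. basis_sum a N \<theta> - eta_of a \<theta>) = (\<lambda>\<theta>. (?P N \<theta> - eta_of a \<theta>) + ?t \<theta>)"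
      unfolding basis_sum_eq[where a = a and N = N, OF l2_zero[OF assms]] by (simp only: add_diff_eq diff_add_eq)
    then have "L2_norm (\<lambda>\<theta>. basis_sum a N \<theta> - eta_of a \<theta>) \<le> L2_norm (\<lambda>\<theta>. ?P N \<theta> - eta_of a \<theta>) + L2_norm ?t"
      using L2_norm_triangle[OF L2_diff[OF sine_sum_L2 eta_of_L2[OF assms]] t] by (simp only:)
    also have "L2_norm ?t \<le> sqrt (2 * pi) * \<bar>a N\<bar>" by (rule L2_norm_bounded[OF t bd])
    finally show "norm (L2_norm (\<lambda>\<theta>. basis_sum a N \<theta> - eta_of a \<theta>))
        \<le> L2_norm (\<lambda>\<theta>. ?P N \<theta> - eta_of a \<theta>) + sqrt (2 * pi) * \<bar>a N\<bar>" by simp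
  qed
  have "(\<lambda>n. \<Sum>k<n. eta_coeff a k * sin (real k * \<theta>)) \<longlonglongrightarrow> eta_of a \<theta>"
    unfolding eta_of_def sine_series_def using trig_series_uniform(2)[OF summable_abs_eta_coeff[OF assms], of sin]
    by (intro summable_LIMSEQ) simp
  from filterlim_compose[OF this s]
  have "(\<lambda>N. ?P N \<theta>) \<longlonglongrightarrow> eta_of a \<theta>" .
  moreover have "(\<lambda>N. a N / real (N + 1) * sin (real (2 * (N + 1)) * \<theta>)) \<longlonglongrightarrow> 0"
    by (rule Lim_null_comparison[OF always_eventually ab]) (use bd in simp)
  ultimately have "(\<lambda>N. ?P N \<theta> + a N / real (N + 1) * sin (real (2 * (N + 1)) * \<theta>)) \<longlonglongrightarrow> eta_of a \<theta> + 0"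
    by (rule tendsto_add)
  then show "(\<lambda>N. basis_sum a N \<theta>) \<longlonglongrightarrow> eta_of a \<theta>"
    unfolding basis_sum_eq[where a = a, OF l2_zero[OF assms]] by simp
qed

lemma eta_of_finite:
  assumes "a 0 = 0" "\<And>k. k > N \<Longrightarrow> a k = 0"
  shows "eta_of a \<theta> = basis_sum a N \<theta>"
proof -
  have "basis_sum a M \<theta> = basis_sum a N \<theta>" if "M \<ge> N" for M
    unfolding basis_sum_def by (rule sum.mono_neutral_right) (use that assms(2) in auto)
  then have "(\<lambda>M. basis_sum a M \<theta>) \<longlonglongrightarrow> basis_sum a N \<theta>"
    by (intro tendsto_eventually eventually_sequentiallyI[of N])
  then show ?thesis using basis_sum_tendsto(2)[OF l2_finite[where a = a and N = N, OF assms]] LIMSEQ_unique by blast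
qed

lemma eta_of_diff:
  assumes "a \<in> l2" "b \<in> l2"
  shows "eta_of (\<lambda>p. a p - b p) \<theta> = eta_of a \<theta> - eta_of b \<theta>"
proof -
  have "basis_sum (\<lambda>p. a p - b p) N \<theta> = basis_sum a N \<theta> - basis_sum b N \<theta>" for N
    by (simp add: basis_sum_def sum_subtractf[symmetric] algebra_simps)
  then have "(\<lambda>N. basis_sum (\<lambda>p. a p - b p) N \<theta>) \<longlonglongrightarrow> eta_of a \<theta> - eta_of b \<theta>"
    using tendsto_diff[OF basis_sum_tendsto(2)[OF assms(1)] basis_sum_tendsto(2)[OF assms(2)]] by simp
  then show ?thesis using basis_sum_tendsto(2)[OF l2_diff[OF assms]] LIMSEQ_unique by blast
qed

text \<open>By the formula for a difference of cosines, each basis function has the derivative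
  \<open>- 2 * sin \<theta> * sin ((2 * p + 1) * \<theta>)\<close>. The factor
  \<open>sin \<theta>\<close> is what the weight of \<open>HDW\<close> divides out, leaving
  orthogonal sines.\<close>

lemma basis_sum_weak_deriv:
  "has_weak_deriv (basis_sum a N) (\<lambda>\<theta>. sqrt (4 * pi) * sin \<theta> * (\<Sum>p<N + 1. (- 4 / sqrt (4 * pi) * (if p = 0 then 0 else a p)) * sin (real (2 * p + 1) * \<theta>)))"
proof (rule weak_deriv_C1)
  fix \<theta>
  show "basis_sum a N (\<theta> + 2 * pi) = basis_sum a N \<theta>"
    unfolding basis_sum_def basis_o_def by (simp only: sin_periodic_int Ints_of_nat)
  have d: "(basis_o (2 * p) has_real_derivative (- 2) * (sin \<theta> * sin (real (2 * p + 1) * \<theta>))) (at \<theta>)" if "p \<ge> 1" for p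
  proof -
    have "(basis_o (2 * p) has_real_derivative cos (real (2 * p + 2) * \<theta>) - cos (real (2 * p) * \<theta>)) (at \<theta>)"
      unfolding basis_o_def[abs_def] using that by (auto intro!: derivative_eq_intros)
    moreover have "cos (real (2 * p + 2) * \<theta>) - cos (real (2 * p) * \<theta>) = (- 2) * (sin \<theta> * sin (real (2 * p + 1) * \<theta>))"
    proof -
      have "(real (2 * p + 2) * \<theta> + real (2 * p) * \<theta>) / 2 = real (2 * p + 1) * \<theta>"
        "(real (2 * p) * \<theta> - real (2 * p + 2) * \<theta>) / 2 = - \<theta>" by (simp_all add: algebra_simps)
      then show ?thesis unfolding cos_diff_cos by simp
    qed
    ultimately show ?thesis by simp
  qed
  have "(basis_sum a N has_real_derivative (\<Sum>p=1..N. (2 * a p) * ((- 2) * (sin \<theta> * sin (real (2 * p + 1) * \<theta>))))) (at \<theta>)"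
    unfolding basis_sum_def[abs_def] by (intro DERIV_sum DERIV_cmult d) simp
  also have "(\<Sum>p=1..N. (2 * a p) * ((- 2) * (sin \<theta> * sin (real (2 * p + 1) * \<theta>))))
     = (\<Sum>p<N + 1. if p = 0 then 0 else (2 * a p) * ((- 2) * (sin \<theta> * sin (real (2 * p + 1) * \<theta>))))"
    by (rule sum.mono_neutral_cong_left) auto
  also have "\<dots> = sqrt (4 * pi) * sin \<theta> * (\<Sum>p<N + 1. (- 4 / sqrt (4 * pi) * (if p = 0 then 0 else a p)) * sin (real (2 * p + 1) * \<theta>))"
    unfolding sum_distrib_left by (rule sum.cong) auto
  finally show "(basis_sum a N has_real_derivative sqrt (4 * pi) * sin \<theta> * (\<Sum>p<N + 1. (- 4 / sqrt (4 * pi) * (if p = 0 then 0 else a p)) * sin (real (2 * p + 1) * \<theta>))) (at \<theta>)" .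
qed (intro continuous_intros)

text \<open>The density of \<open>eta_of a\<close> has the coefficients
  \<open>- 4 / sqrt (4 * pi) * a p\<close>: 2 from the normalisation of the coordinates, -2 from the
  derivative of a basis function. As the sines have squared norm pi, the squared norm is four times
  the l2 sum.\<close>

lemma eta_of_HDW:
  assumes "a \<in> l2"
  shows "eta_of a \<in> HDW" "HDW_norm (eta_of a) = 2 * l2_norm a"
proof -
  define g where "g = (\<lambda>p. - 4 / sqrt (4 * pi) * (if p = 0 then 0 else a p))"
  have ga: "g p = - 4 / sqrt (4 * pi) * a p" for p using l2_zero[OF assms] by (simp add: g_def)
  have g2: "pi * (g p)\<^sup>2 = 4 * (a p)\<^sup>2" for p
    by (simp add: ga power_mult_distrib power_divide)
  have "summable (\<lambda>p. pi * (g p)\<^sup>2)" unfolding g2 by (intro summable_mult l2_summable assms)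
  from orthogonal_series_converges[where e = "\<lambda>p x. sin (real (2 * p + 1) * x)" and \<kappa> = "\<lambda>_. pi" and c = g, OF _ _ this]
  obtain G where G: "G \<in> L2" "(\<lambda>N. L2_norm (\<lambda>x. (\<Sum>p<N. g p * sin (real (2 * p + 1) * x)) - G x)) \<longlonglongrightarrow> 0"
    "(L2_norm G)\<^sup>2 = (\<Sum>p. pi * (g p)\<^sup>2)"
    by (auto simp: L2_inner_sin_sin simp del: of_nat_add of_nat_mult of_nat_Suc)
  let ?S = "\<lambda>\<theta>. sqrt (4 * pi) * sin \<theta>"
  let ?u = "\<lambda>N x. \<Sum>p<N + 1. g p * sin (real (2 * p + 1) * x)"
  have per: "?S (x + 2 * pi) = ?S x" for x by simp
  have bd: "\<bar>?S x\<bar> \<le> sqrt (4 * pi)" for x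
    using abs_sin_le_one[of x] by (simp add: abs_mult mult_left_le)
  have Sc: "continuous_on UNIV ?S" by (intro continuous_intros)
  have uL: "?u N \<in> L2" for N by (intro L2_sum L2_scale sin_in_L2) simp
  note SG = L2_norm_mult_continuous(1)[OF G(1) Sc per bd]
  note Su = L2_norm_mult_continuous(1)[OF uL Sc per bd]
  have conv: "(\<lambda>N. L2_norm (\<lambda>x. ?S x * ?u N x - ?S x * G x)) \<longlonglongrightarrow> 0"
  proof (rule Lim_null_comparison[OF always_eventually])
    have "(\<lambda>N. L2_norm (\<lambda>x. ?u N x - G x)) \<longlonglongrightarrow> 0" using LIMSEQ_Suc[OF G(2)] by simp
    then show "(\<lambda>N. sqrt (4 * pi) * L2_norm (\<lambda>x. ?u N x - G x)) \<longlonglongrightarrow> 0" by (rule tendsto_mult_right_zero)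
    have "L2_norm (\<lambda>x. ?S x * (?u N x - G x)) \<le> sqrt (4 * pi) * L2_norm (\<lambda>x. ?u N x - G x)" for N
      by (rule L2_norm_mult_continuous(2)[OF L2_diff[OF uL G(1)] Sc per bd])
    then show "\<forall>N. norm (L2_norm (\<lambda>x. ?S x * ?u N x - ?S x * G x)) \<le> sqrt (4 * pi) * L2_norm (\<lambda>x. ?u N x - G x)"
      by (simp add: right_diff_distrib)
  qed
  have wd: "has_weak_deriv (basis_sum a N) (\<lambda>x. ?S x * ?u N x)" for N
    unfolding g_def by (rule basis_sum_weak_deriv)
  have w: "has_weak_deriv (eta_of a) (\<lambda>x. ?S x * G x)"
    by (rule weak_deriv_limit[OF basis_sum_L2[where a = a, OF l2_zero[OF assms]] Su wd eta_of_L2[OF assms] SG basis_sum_tendsto(1)[OF assms] conv])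
  have o: "eta_of a \<in> odd_H1" by (rule eta_of_odd_H1[OF assms])
  note H = HDW_I[OF o G(1) H1_I(2)[OF odd_H1_continuous[OF o] odd_H1_periodic[OF o] SG w]]
  show "eta_of a \<in> HDW" by (rule H(1))
  have "(HDW_norm (eta_of a))\<^sup>2 = (2 * l2_norm a)\<^sup>2"
    unfolding H(3) G(3) g2 by (simp add: power_mult_distrib l2_norm_sq[OF assms] suminf_mult l2_summable[OF assms])
  then show "HDW_norm (eta_of a) = 2 * l2_norm a"
    by (rule power2_eq_imp_eq) (use l2_norm_nonneg[OF assms] in auto)
qed

lemma eta_of_dist:
  assumes "a \<in> l2" "b \<in> l2"
  shows "HDW_norm (\<lambda>\<theta>. eta_of a \<theta> - eta_of b \<theta>) = 2 * l2_norm (\<lambda>p. a p - b p)"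
  using eta_of_HDW(2)[OF l2_diff[OF assms]] unfolding eta_of_diff[OF assms, abs_def] .

text \<open>The coordinates are half the given coefficients. Partial sums converging to
  \<open>f\<close> are bounded in \<open>HDW\<close>, which makes the coordinates square summable.
  Two functions at distance 0 in \<open>HDW\<close> coincide, by the Poincare inequality and
  continuity.\<close>

lemma even_mode_data_eta_of:
  assumes "f \<in> even_mode_data"
  shows "\<exists>a\<in>l2. f = eta_of a"
proof -
  obtain c :: "nat \<Rightarrow> real" where f: "f \<in> HDW" and
    lim: "(\<lambda>n. HDW_norm (\<lambda>\<theta>. f \<theta> - (\<Sum>k=1..n. c (2 * k) * basis_o (2 * k) \<theta>))) \<longlonglongrightarrow> 0"
    using assms by (auto simp: even_mode_data_def)
  define a where "a = (\<lambda>p. if p = 0 then 0 else c (2 * p) / 2)"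
  define t where "t = (\<lambda>n p. if p \<le> n then a p else 0)"
  have a0: "a 0 = 0" by (simp add: a_def)
  have t: "t n 0 = 0" "k > n \<Longrightarrow> t n k = 0" for n k by (auto simp: t_def a0)
  have tl: "t n \<in> l2" for n by (rule l2_finite[where N = n]) (rule t, simp add: t)
  have S: "(\<lambda>\<theta>. \<Sum>k=1..n. c (2 * k) * basis_o (2 * k) \<theta>) = eta_of (t n)" for n
  proof
    fix \<theta>
    have "eta_of (t n) \<theta> = basis_sum (t n) n \<theta>" by (rule eta_of_finite) (rule t, simp add: t)
    also have "\<dots> = (\<Sum>k=1..n. c (2 * k) * basis_o (2 * k) \<theta>)"
      unfolding basis_sum_def by (rule sum.cong) (auto simp: t_def a_def)
    finally show "(\<Sum>k=1..n. c (2 * k) * basis_o (2 * k) \<theta>) = eta_of (t n) \<theta>" by simp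
  qed
  have Seq: "(\<Sum>k=1..n. c (2 * k) * basis_o (2 * k) \<theta>) = eta_of (t n) \<theta>" for n \<theta>
    using fun_cong[OF S[of n], of \<theta>] .
  have lim': "(\<lambda>n. HDW_norm (\<lambda>\<theta>. f \<theta> - eta_of (t n) \<theta>)) \<longlonglongrightarrow> 0" using lim unfolding Seq .
  have tn: "(l2_norm (t n))\<^sup>2 = (\<Sum>p\<le>n. (a p)\<^sup>2)" for n
  proof -
    have "(\<Sum>p. (t n p)\<^sup>2) = (\<Sum>p\<le>n. (t n p)\<^sup>2)" by (rule suminf_finite) (auto simp: t_def)
    then show ?thesis unfolding l2_norm_sq[OF tl] by (simp add: t_def)
  qed
  obtain B where B: "\<And>n. norm (HDW_norm (\<lambda>\<theta>. f \<theta> - eta_of (t n) \<theta>)) \<le> B"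
    using convergent_imp_Bseq[OF convergentI[OF lim']] unfolding Bseq_def by blast
  have bound: "(\<Sum>p\<le>n. (a p)\<^sup>2) \<le> (HDW_norm f + B)\<^sup>2" for n
  proof -
    have "\<bar>HDW_norm f - HDW_norm (eta_of (t n))\<bar> \<le> HDW_norm (\<lambda>\<theta>. f \<theta> - eta_of (t n) \<theta>)"
      by (rule HDW_norm_reverse_triangle[OF f eta_of_HDW(1)[OF tl]])
    then have "2 * l2_norm (t n) \<le> HDW_norm f + B" using B[of n] unfolding eta_of_HDW(2)[OF tl] by simp
    then have "l2_norm (t n) \<le> HDW_norm f + B" using l2_norm_nonneg[OF tl, of n] by linarith
    then have "(l2_norm (t n))\<^sup>2 \<le> (HDW_norm f + B)\<^sup>2" using l2_norm_nonneg[OF tl] by (intro power_mono)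
    then show ?thesis unfolding tn .
  qed
  have sum: "summable (\<lambda>p. (a p)\<^sup>2)" by (rule bounded_imp_summable[OF _ bound]) simp
  then have al: "a \<in> l2" by (simp add: l2_def a0)
  have "(\<lambda>n. HDW_norm (\<lambda>\<theta>. eta_of (t n) \<theta> - eta_of a \<theta>)) \<longlonglongrightarrow> 0"
  proof -
    have "(\<Sum>p. (t n p - a p)\<^sup>2) = (\<Sum>p. (a p)\<^sup>2) - (\<Sum>p\<le>n. (a p)\<^sup>2)" for n
    proof -
      have "(\<Sum>p. (t n p - a p)\<^sup>2) = (\<Sum>p. (a p)\<^sup>2 - (t n p)\<^sup>2)"
        by (rule suminf_cong) (auto simp: t_def)
      also have "\<dots> = (\<Sum>p. (a p)\<^sup>2) - (\<Sum>p. (t n p)\<^sup>2)" by (rule suminf_diff[OF sum l2_summable[OF tl], symmetric])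
      finally show ?thesis using tn[of n] l2_norm_sq[OF tl, of n] by simp
    qed
    then have eq: "HDW_norm (\<lambda>\<theta>. eta_of (t n) \<theta> - eta_of a \<theta>) = 2 * sqrt ((\<Sum>p. (a p)\<^sup>2) - (\<Sum>p\<le>n. (a p)\<^sup>2))" for n
      by (simp add: eta_of_dist[OF tl al] l2_norm_def)
    have "(\<lambda>n. 2 * sqrt ((\<Sum>p. (a p)\<^sup>2) - (\<Sum>p\<le>n. (a p)\<^sup>2))) \<longlonglongrightarrow> 2 * sqrt ((\<Sum>p. (a p)\<^sup>2) - (\<Sum>p. (a p)\<^sup>2))"
      by (intro tendsto_intros summable_LIMSEQ' sum)
    then show ?thesis unfolding eq by simp
  qed
  from tendsto_add[OF lim' this]
  have lim0: "(\<lambda>n. HDW_norm (\<lambda>\<theta>. f \<theta> - eta_of (t n) \<theta>) + HDW_norm (\<lambda>\<theta>. eta_of (t n) \<theta> - eta_of a \<theta>)) \<longlonglongrightarrow> 0" by simp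
  have "HDW_norm (\<lambda>\<theta>. f \<theta> - eta_of a \<theta>) \<le> 0"
    by (rule LIMSEQ_le_const[OF lim0]) (intro exI allI impI HDW_norm_triangle3 f eta_of_HDW(1) tl al)
  then have z: "HDW_norm (\<lambda>\<theta>. f \<theta> - eta_of a \<theta>) = 0" using HDW_norm_nonneg by (simp add: antisym)
  have d: "(\<lambda>\<theta>. f \<theta> - eta_of a \<theta>) \<in> HDW" by (rule HDW_diff(1)[OF f eta_of_HDW(1)[OF al]])
  have "L2_norm (\<lambda>\<theta>. f \<theta> - eta_of a \<theta>) \<le> 0"
    using order_trans[OF odd_H1_poincare[OF HDW_odd_H1[OF d]] HDW_wderiv_norm[OF d]] z by simp
  then have "L2_norm (\<lambda>\<theta>. f \<theta> - eta_of a \<theta>) = 0" by (simp add: antisym)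
  then have "f \<theta> - eta_of a \<theta> = 0" for \<theta> by (rule HDW_zero[OF d])
  then have "f = eta_of a" by (simp add: fun_eq_iff)
  then show ?thesis using al by blast
qed

section \<open>The equation in coordinates\<close>

text \<open>Undoes the telescoping: applied to \<open>\<Sum>p. 2 a\<^sub>p e\<^sub>2\<^sub>p\<close> it returns \<open>a\<^sub>p\<close>, and it is continuous on \<open>L2\<close>.\<close>

definition mode_proj :: "nat \<Rightarrow> (real \<Rightarrow> real) \<Rightarrow> real" where
  "mode_proj p D = - (\<Sum>j\<in>{1..p}. real j * (L2_inner D (\<lambda>x. sin (real (2 * j) * x)) / pi))"

text \<open>The frequencies of the product are \<open>m + n\<close> and \<open>m - n\<close>. The
  sign of the second decides which of the two last indicators is active, since subtraction of
  naturals is truncated.\<close>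

lemma L2_inner_cos_sin_sin:
  assumes "k \<ge> 1"
  shows "L2_inner (\<lambda>x. cos (real (2 * n) * x) * sin (real (2 * m) * x)) (\<lambda>x. sin (real k * x))
    = (pi / 2) * (of_bool (k = 2 * (m + n)) + of_bool (n < m \<and> k = 2 * (m - n)) - of_bool (m < n \<and> k = 2 * (n - m)))"
proof -
  have L: "(\<lambda>x. (1/2) * sin (real i * x)) \<in> L2" for i by (intro L2_scale sin_in_L2) simp
  have s: "(\<lambda>x. sin (real k * x)) \<in> L2" by simp
  have in1: "L2_inner (\<lambda>x. (1/2) * sin (real i * x)) (\<lambda>x. sin (real k * x)) = (pi / 2) * of_bool (k = i)" for i
    unfolding L2_inner_scale_left L2_inner_sin_sin using assms by auto
  have base: "cos (real (2 * n) * x) * sin (real (2 * m) * x)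
      = (1/2) * sin (real (2 * (m + n)) * x) - (1/2) * sin ((real (2 * n) - real (2 * m)) * x)" for x
    by (simp add: cos_times_sin algebra_simps diff_divide_distrib)
  consider "n < m" | "m < n" | "m = n" by linarith
  then show ?thesis
  proof cases
    case 1
    then have e: "real (2 * n) - real (2 * m) = - real (2 * (m - n))" by (simp add: of_nat_diff)
    have "(\<lambda>x. cos (real (2 * n) * x) * sin (real (2 * m) * x)) = (\<lambda>x. (1/2) * sin (real (2 * (m + n)) * x) + (1/2) * sin (real (2 * (m - n)) * x))"
      unfolding base e by simp
    then show ?thesis using 1 by (simp only: L2_inner_add_left[OF L L s] in1) (simp add: distrib_left)
  next
    case 2
    then have e: "real (2 * n) - real (2 * m) = real (2 * (n - m))" by (simp add: of_nat_diff)
    have "(\<lambda>x. cos (real (2 * n) * x) * sin (real (2 * m) * x)) = (\<lambda>x. (1/2) * sin (real (2 * (m + n)) * x) - (1/2) * sin (real (2 * (n - m)) * x))"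
      unfolding base e by simp
    then show ?thesis using 2 by (simp only: L2_inner_diff_left[OF L L s] in1) (simp add: right_diff_distrib)
  next
    case 3
    then have "(\<lambda>x. cos (real (2 * n) * x) * sin (real (2 * m) * x)) = (\<lambda>x. (1/2) * sin (real (2 * (m + n)) * x))"
      unfolding base by simp
    then show ?thesis using 3 by (simp only: in1) simp
  qed
qed

lemma cos_sin_L2: "(\<lambda>x. cos (real i * x) * sin (real j * x)) \<in> L2"
  by (rule L2_continuous) (intro continuous_intros, simp only: cos_periodic_int sin_periodic_int Ints_of_nat)

section \<open>Finitely supported coordinates: the equation as a trigonometric polynomial\<close>

context
  fixes a :: "nat \<Rightarrow> real" and N :: nat
  assumes a0: "a 0 = 0" and supp: "\<And>k. k > N \<Longrightarrow> a k = 0"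
begin

definition "bmode m = (a (m - 1) - a m) / real m"

text \<open>The coefficients of \<eta> minus \<open>sin (2 * \<theta>)\<close>, the latter being the
  mode \<open>m = 1\<close>.\<close>

definition "bshift m = bmode m - of_bool (m = 1)"

lemma eta_coeff_series: "(\<Sum>k. eta_coeff a k * h k) = (\<Sum>m\<in>{1..N + 1}. bmode m * h (2 * m))"
proof -
  have z: "eta_coeff a k = 0" if "k \<notin> (\<lambda>m. 2 * m) ` {1..N + 1}" for k
  proof (cases "even k")
    case True
    then obtain m where k: "k = 2 * m" by (elim evenE)
    then have "m = 0 \<or> m > N + 1" using that by fastforce
    then show ?thesis using supp[of m] supp[of "m - 1"] by (auto simp: k eta_coeff_even)
  qed (simp add: eta_coeff_def)
  have "(\<Sum>k. eta_coeff a k * h k) = (\<Sum>k\<in>(\<lambda>m. 2 * m) ` {1..N + 1}. eta_coeff a k * h k)"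
    by (rule suminf_finite) (use z in auto)
  also have "\<dots> = (\<Sum>m\<in>{1..N + 1}. bmode m * h (2 * m))"
    by (subst sum.reindex) (auto simp: inj_on_def bmode_def eta_coeff_even)
  finally show ?thesis .
qed

lemma a_l2: "a \<in> l2" by (rule l2_finite[where a = a and N = N, OF a0 supp])

lemma eta_finite: "eta_of a \<theta> = (\<Sum>m\<in>{1..N + 1}. bmode m * sin (real (2 * m) * \<theta>))"
  unfolding eta_of_def sine_series_def by (rule eta_coeff_series)

lemma hilbert_finite: "hilbert (eta_of a) \<theta> = - (\<Sum>m\<in>{1..N + 1}. bmode m * cos (real (2 * m) * \<theta>))"
  unfolding odd_H1_hilbert[OF eta_of_odd_H1[OF a_l2]] sine_coeff_eta_of[OF a_l2] cosine_series_def
  by (subst eta_coeff_series) simp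

lemma vel_finite: "vel (eta_of a) \<theta> = - (\<Sum>m\<in>{1..N + 1}. bmode m / (2 * real m) * sin (real (2 * m) * \<theta>))"
  unfolding odd_H1_vel[OF eta_of_odd_H1[OF a_l2]] sine_coeff_eta_of[OF a_l2] sine_series_def
  using eta_coeff_series[of "\<lambda>k. sin (real k * \<theta>) / real k"] by simp

lemma wderiv_finite:
  "AE \<theta> in lborel. \<theta> \<in> {-pi..pi} \<longrightarrow> wderiv (eta_of a) \<theta> = (\<Sum>m\<in>{1..N + 1}. bmode m * (2 * real m) * cos (real (2 * m) * \<theta>))"
proof (rule H1_I(2))
  let ?d = "\<lambda>\<theta>. \<Sum>m\<in>{1..N + 1}. bmode m * (2 * real m) * cos (real (2 * m) * \<theta>)"
  note o = eta_of_odd_H1[OF a_l2]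
  show "continuous_on UNIV (eta_of a)" by (rule odd_H1_continuous[OF o])
  show "eta_of a (x + 2 * pi) = eta_of a x" for x by (rule odd_H1_periodic[OF o])
  show "?d \<in> L2" by (intro L2_sum L2_scale cos_in_L2) simp
  show "has_weak_deriv (eta_of a) ?d"
  proof (rule weak_deriv_C1)
    show "eta_of a (x + 2 * pi) = eta_of a x" for x by (rule odd_H1_periodic[OF o])
    show "(eta_of a has_real_derivative ?d x) (at x)" for x
      unfolding eta_finite[abs_def] by (auto intro!: derivative_eq_intros sum.cong)
  qed (intro continuous_intros)
qed

text \<open>The quadratic form of \<open>rhs_eq\<close> in Fourier modes, with \<open>n\<close> from
  the velocity and \<open>m\<close> from the vorticity. The quotient \<open>m / n\<close> combines
  the derivative of the one with the integration that defines the other.\<close>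

definition "rhs_poly \<theta> = (\<Sum>n\<in>{1..N + 1}. \<Sum>m\<in>{1..N + 1}. (bshift n * bshift m) *
   ((real m / real n) * (cos (real (2 * m) * \<theta>) * sin (real (2 * n) * \<theta>)) - cos (real (2 * n) * \<theta>) * sin (real (2 * m) * \<theta>)))"

lemma sum_bshift: "(\<Sum>m\<in>{1..N + 1}. bshift m * h m) = (\<Sum>m\<in>{1..N + 1}. bmode m * h m) - h 1"
proof -
  have "(\<Sum>m\<in>{1..N + 1}. of_bool (m = 1) * h m) = (\<Sum>m\<in>{1..N + 1}. if m = 1 then h m else 0)" by (rule sum.cong) auto
  also have "\<dots> = h 1" by (subst sum.delta) auto
  finally show ?thesis by (simp only: bshift_def left_diff_distrib sum_subtractf)
qed

lemma rhs_finite: "AE \<theta> in lborel. \<theta> \<in> {-pi..pi} \<longrightarrow> rhs (eta_of a) \<theta> = rhs_poly \<theta>"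
  using wderiv_finite
proof eventually_elim
  case (elim \<theta>)
  show ?case
  proof
    assume \<theta>: "\<theta> \<in> {-pi..pi}"
    have 1: "eta_of a \<theta> - sin (2 * \<theta>) = (\<Sum>m\<in>{1..N + 1}. bshift m * sin (real (2 * m) * \<theta>))"
      unfolding eta_finite sum_bshift by simp
    have 2: "hilbert (eta_of a) \<theta> + cos (2 * \<theta>) = - (\<Sum>n\<in>{1..N + 1}. bshift n * cos (real (2 * n) * \<theta>))"
      unfolding hilbert_finite sum_bshift by simp
    have 3: "vel (eta_of a) \<theta> + 1/2 * sin (2 * \<theta>) = - (\<Sum>n\<in>{1..N + 1}. bshift n * (sin (real (2 * n) * \<theta>) / (2 * real n)))"
      unfolding vel_finite sum_bshift by simp
    have 4: "wderiv (eta_of a) \<theta> - 2 * cos (2 * \<theta>) = (\<Sum>m\<in>{1..N + 1}. bshift m * (2 * real m * cos (real (2 * m) * \<theta>)))"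
      unfolding sum_bshift using elim \<theta> by (simp add: mult.assoc)
    show "rhs (eta_of a) \<theta> = rhs_poly \<theta>"
      unfolding rhs_eq 1 2 3 4 minus_mult_left[symmetric] sum_product rhs_poly_def sum_negf[symmetric] sum_subtractf[symmetric]
      by (intro sum.cong refl) (simp add: field_simps)
  qed
qed

lemma rhs_poly_summand_L2: "(\<lambda>\<theta>. c * ((real m / real n) * (cos (real (2 * m) * \<theta>) * sin (real (2 * n) * \<theta>)) - cos (real (2 * n) * \<theta>) * sin (real (2 * m) * \<theta>))) \<in> L2"
  by (intro L2_scale L2_diff cos_sin_L2)

lemma rhs_poly_L2: "rhs_poly \<in> L2"
  unfolding rhs_poly_def[abs_def] by (intro L2_sum rhs_poly_summand_L2)

lemma rhs_poly_cos: "L2_inner rhs_poly (\<lambda>x. cos (real k * x)) = 0"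
proof (rule odd_inner_cos)
  have *: "(\<Sum>n\<in>I. \<Sum>m\<in>I. - f n m) = - (\<Sum>n\<in>I. \<Sum>m\<in>I. f n m)" for I and f :: "nat \<Rightarrow> nat \<Rightarrow> real"
    by (simp add: sum_negf)
  show "rhs_poly (- x) = - rhs_poly x" for x
    unfolding rhs_poly_def *[symmetric]
    by (intro sum.cong refl) (simp add: algebra_simps)
qed

definition "rhs_kernel n m k = (real m / real n) * (of_bool (k = 2 * (n + m)) + of_bool (m < n \<and> k = 2 * (n - m)) - of_bool (n < m \<and> k = 2 * (m - n)))
   - (of_bool (k = 2 * (m + n)) + of_bool (n < m \<and> k = 2 * (m - n)) - of_bool (m < n \<and> k = 2 * (n - m)))"

lemma rhs_poly_sin:
  assumes "k \<ge> 1"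
  shows "L2_inner rhs_poly (\<lambda>x. sin (real k * x)) = (\<Sum>n\<in>{1..N + 1}. \<Sum>m\<in>{1..N + 1}. (bshift n * bshift m) * ((pi / 2) * rhs_kernel n m k))"
proof -
  have s: "(\<lambda>x. sin (real k * x)) \<in> L2" by simp
  have t: "L2_inner (\<lambda>\<theta>. c * ((real m / real n) * (cos (real (2 * m) * \<theta>) * sin (real (2 * n) * \<theta>)) - cos (real (2 * n) * \<theta>) * sin (real (2 * m) * \<theta>))) (\<lambda>x. sin (real k * x))
     = c * ((pi / 2) * rhs_kernel n m k)" for c n m
    unfolding L2_inner_scale_left L2_inner_diff_left[OF L2_scale[OF cos_sin_L2] cos_sin_L2 s] L2_inner_cos_sin_sin[OF assms] rhs_kernel_def
    by (simp only: right_diff_distrib mult_ac)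
  show ?thesis unfolding rhs_poly_def[abs_def]
    by (simp only: L2_inner_sum_left[OF L2_sum[OF rhs_poly_summand_L2] s] L2_inner_sum_left[OF rhs_poly_summand_L2 s] t)
qed

definition "quad_kernel n m p = ((real m)\<^sup>2 - (real n)\<^sup>2) / (2 * real n) * (of_bool (\<bar>int m - int n\<bar> \<le> int p) - of_bool (m + n \<le> p))"

lemma sum_of_bool_index:
  assumes "i \<ge> 1"
  shows "(\<Sum>j\<in>{1..p}. real j * of_bool (P \<and> 2 * j = 2 * i)) = real i * of_bool (P \<and> i \<le> p)"
proof -
  have "(\<Sum>j\<in>{1..p}. real j * of_bool (P \<and> 2 * j = 2 * i)) = (\<Sum>j\<in>{1..p}. if j = i then real i * of_bool P else 0)"
    by (rule sum.cong) auto
  also have "\<dots> = real i * of_bool (P \<and> i \<le> p)" using assms by (subst sum.delta) auto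
  finally show ?thesis .
qed

text \<open>Of the modes up to \<open>p\<close>, only those of index \<open>m + n\<close> and
  \<open>\<bar>m - n\<bar>\<close> contribute. The weight \<open>j\<close> of
  \<open>mode_proj\<close> equals that index and completes the factors \<open>1 - m / n\<close> and
  \<open>1 + m / n\<close> to a difference of squares.\<close>

lemma rhs_kernel_sum:
  assumes "n \<ge> 1" "m \<ge> 1"
  shows "- (\<Sum>j\<in>{1..p}. real j * ((1/2) * rhs_kernel n m (2 * j))) = quad_kernel n m p"
proof -
  have 1: "(\<Sum>j\<in>{1..p}. real j * of_bool (2 * j = 2 * (m + n))) = real (m + n) * of_bool (m + n \<le> p)"
    using sum_of_bool_index[of "m + n" True p] assms by simp
  have 2: "(\<Sum>j\<in>{1..p}. real j * of_bool (n < m \<and> 2 * j = 2 * (m - n))) = real (m - n) * of_bool (n < m \<and> m - n \<le> p)"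
  proof (cases "n < m")
    case True
    then show ?thesis using sum_of_bool_index[of "m - n" "n < m" p] by simp
  qed simp
  have 3: "(\<Sum>j\<in>{1..p}. real j * of_bool (m < n \<and> 2 * j = 2 * (n - m))) = real (n - m) * of_bool (m < n \<and> n - m \<le> p)"
  proof (cases "m < n")
    case True
    then show ?thesis using sum_of_bool_index[of "n - m" "m < n" p] by simp
  qed simp
  have "- (\<Sum>j\<in>{1..p}. real j * ((1/2) * rhs_kernel n m (2 * j)))
    = (1/2) * (1 - real m / real n) * (\<Sum>j\<in>{1..p}. real j * of_bool (2 * j = 2 * (m + n)))
      + (1/2) * (1 + real m / real n) * (\<Sum>j\<in>{1..p}. real j * of_bool (n < m \<and> 2 * j = 2 * (m - n)))
      - (1/2) * (1 + real m / real n) * (\<Sum>j\<in>{1..p}. real j * of_bool (m < n \<and> 2 * j = 2 * (n - m)))"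
    unfolding sum_distrib_left sum.distrib[symmetric] sum_subtractf[symmetric] sum_negf[symmetric] rhs_kernel_def add.commute[of n m]
    by (rule sum.cong[OF refl]) (simp add: algebra_simps)
  also have "\<dots> = (1/2) * (1 - real m / real n) * (real (m + n) * of_bool (m + n \<le> p))
      + (1/2) * (1 + real m / real n) * (real (m - n) * of_bool (n < m \<and> m - n \<le> p))
      - (1/2) * (1 + real m / real n) * (real (n - m) * of_bool (m < n \<and> n - m \<le> p))"
    unfolding 1 2 3 ..
  also have "\<dots> = quad_kernel n m p"
  proof -
    have c1: "(1/2) * (1 - real m / real n) * real (m + n) = - (((real m)\<^sup>2 - (real n)\<^sup>2) / (2 * real n))"
      using assms by (simp add: field_simps power2_eq_square)
    have c2: "(1/2) * (1 + real m / real n) * (real m - real n) = ((real m)\<^sup>2 - (real n)\<^sup>2) / (2 * real n)"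
      using assms by (simp add: field_simps power2_eq_square)
    consider "n < m" | "m < n" | "m = n" by linarith
    then show ?thesis
    proof cases
      case 1
      then have "real (m - n) = real m - real n" "(\<bar>int m - int n\<bar> \<le> int p) = (m - n \<le> p)" by (auto simp: of_nat_diff)
      then show ?thesis using 1 c1 c2 unfolding quad_kernel_def mult.assoc[symmetric] by (simp add: right_diff_distrib)
    next
      case 2
      then have e: "real (n - m) = - (real m - real n)" "(\<bar>int m - int n\<bar> \<le> int p) = (n - m \<le> p)" by (auto simp: of_nat_diff)
      have "(1/2) * (1 + real m / real n) * real (n - m) = - (((real m)\<^sup>2 - (real n)\<^sup>2) / (2 * real n))"
        unfolding e(1) mult_minus_right c2 ..
      then show ?thesis using 2 c1 e(2) unfolding quad_kernel_def mult.assoc[symmetric] by (simp add: right_diff_distrib)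
    next
      case 3
      then show ?thesis using c1 by (simp add: quad_kernel_def)
    qed
  qed
  finally show ?thesis .
qed

lemma mode_proj_rhs_poly:
  "mode_proj p rhs_poly = (\<Sum>n\<in>{1..N + 1}. \<Sum>m\<in>{1..N + 1}. (bshift n * bshift m) * quad_kernel n m p)"
proof -
  have "mode_proj p rhs_poly = - (\<Sum>j\<in>{1..p}. \<Sum>n\<in>{1..N + 1}. \<Sum>m\<in>{1..N + 1}. (bshift n * bshift m) * (real j * ((1/2) * rhs_kernel n m (2 * j))))"
    unfolding mode_proj_def
  proof (intro arg_cong[where f = uminus] sum.cong refl)
    fix j assume "j \<in> {1..p}"
    then have j: "2 * j \<ge> 1" by simp
    show "real j * (L2_inner rhs_poly (\<lambda>x. sin (real (2 * j) * x)) / pi)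
      = (\<Sum>n\<in>{1..N + 1}. \<Sum>m\<in>{1..N + 1}. (bshift n * bshift m) * (real j * ((1/2) * rhs_kernel n m (2 * j))))"
      unfolding rhs_poly_sin[OF j] sum_divide_distrib sum_distrib_left
      by (intro sum.cong refl) simp
  qed
  also have "(\<Sum>j\<in>{1..p}. \<Sum>n\<in>{1..N + 1}. \<Sum>m\<in>{1..N + 1}. (bshift n * bshift m) * (real j * ((1/2) * rhs_kernel n m (2 * j))))
     = (\<Sum>n\<in>{1..N + 1}. \<Sum>j\<in>{1..p}. \<Sum>m\<in>{1..N + 1}. (bshift n * bshift m) * (real j * ((1/2) * rhs_kernel n m (2 * j))))"
    by (rule sum.swap)
  also have "\<dots> = (\<Sum>n\<in>{1..N + 1}. \<Sum>m\<in>{1..N + 1}. \<Sum>j\<in>{1..p}. (bshift n * bshift m) * (real j * ((1/2) * rhs_kernel n m (2 * j))))"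
    by (intro sum.cong refl sum.swap)
  also have "- \<dots> = (\<Sum>n\<in>{1..N + 1}. \<Sum>m\<in>{1..N + 1}. (bshift n * bshift m) * (- (\<Sum>j\<in>{1..p}. real j * ((1/2) * rhs_kernel n m (2 * j)))))"
    by (simp only: sum_negf sum_distrib_left mult_minus_right)
  also have "\<dots> = (\<Sum>n\<in>{1..N + 1}. \<Sum>m\<in>{1..N + 1}. (bshift n * bshift m) * quad_kernel n m p)"
    by (intro sum.cong refl) (simp only: rhs_kernel_sum atLeastAtMost_iff)
  finally show ?thesis .
qed

text \<open>On finitely supported sequences the Galerkin field is thus the exact right-hand side in
  the coordinates up to \<open>N\<close>. The linear part arises as the cross terms of the quadratic
  form with the steady state.\<close>

lemma mode_proj_rhs_finite:
  assumes p: "p \<in> {1..N}"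
  shows "mode_proj p (rhs (eta_of a)) = galerkin_field N a p"
proof -
  define c where "c = (\<lambda>m. a (m - 1) - a m)"
  define K where "K = (\<lambda>n m. ((real m)\<^sup>2 - (real n)\<^sup>2) / (2 * (real n)\<^sup>2 * real m) * (of_bool (\<bar>int m - int n\<bar> \<le> int p) - of_bool (m + n \<le> p)))"
  define I where "I = {1..N + 1}"
  have "mode_proj p (rhs (eta_of a)) = mode_proj p rhs_poly"
    unfolding mode_proj_def
    by (simp add: L2_inner_AE_cong[OF rhs_finite rhs_L2[OF eta_of_odd_H1[OF a_l2]] rhs_poly_L2])
  also have "\<dots> = (\<Sum>n\<in>I. \<Sum>m\<in>I. ((c n - of_bool (n = 1)) * (c m - of_bool (m = 1))) * K n m)"
    unfolding mode_proj_rhs_poly I_def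
  proof (intro sum.cong refl)
    fix n m assume nm: "n \<in> {1..N + 1}" "m \<in> {1..N + 1}"
    have b: "bshift k = (c k - of_bool (k = 1)) / real k" if "k \<in> {1..N + 1}" for k
      using that by (auto simp: bshift_def bmode_def c_def diff_divide_distrib)
    show "(bshift n * bshift m) * quad_kernel n m p = ((c n - of_bool (n = 1)) * (c m - of_bool (m = 1))) * K n m"
      unfolding b[OF nm(1)] b[OF nm(2)] quad_kernel_def K_def using nm by (simp add: power2_eq_square mult_ac)
  qed
  also have "\<dots> = (\<Sum>n\<in>I. \<Sum>m\<in>I. c n * c m * K n m) - (\<Sum>n\<in>I. \<Sum>m\<in>I. of_bool (n = 1) * (c m * K n m))
      - (\<Sum>n\<in>I. \<Sum>m\<in>I. of_bool (m = 1) * (c n * K n m)) + (\<Sum>n\<in>I. \<Sum>m\<in>I. of_bool (n = 1) * (of_bool (m = 1) * K n m))"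
    unfolding sum_subtractf[symmetric] sum.distrib[symmetric] by (intro sum.cong refl) (simp add: algebra_simps)
  also have "(\<Sum>n\<in>I. \<Sum>m\<in>I. of_bool (n = 1) * (c m * K n m)) = (\<Sum>m\<in>I. c m * K 1 m)"
  proof -
    have "(\<Sum>n\<in>I. \<Sum>m\<in>I. of_bool (n = 1) * (c m * K n m)) = (\<Sum>n\<in>I. if n = 1 then (\<Sum>m\<in>I. c m * K 1 m) else 0)"
      by (rule sum.cong) auto
    then show ?thesis by (simp add: I_def)
  qed
  also have "(\<Sum>n\<in>I. \<Sum>m\<in>I. of_bool (m = 1) * (c n * K n m)) = (\<Sum>n\<in>I. c n * K n 1)"
  proof (rule sum.cong[OF refl])
    fix n
    have "(\<Sum>m\<in>I. of_bool (m = 1) * (c n * K n m)) = (\<Sum>m\<in>I. if m = 1 then c n * K n 1 else 0)" by (rule sum.cong) auto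
    then show "(\<Sum>m\<in>I. of_bool (m = 1) * (c n * K n m)) = c n * K n 1" by (simp add: I_def)
  qed
  \<comment> \<open>The vanishing of \<open>K 1 1\<close> expresses that
    \<open>- sin (2 * \<theta>)\<close> is a steady state.\<close>
  also have "(\<Sum>n\<in>I. \<Sum>m\<in>I. of_bool (n = 1) * (of_bool (m = 1) * K n m)) = 0"
    by (intro sum.neutral ballI) (auto simp: K_def)
  finally have eq: "mode_proj p (rhs (eta_of a)) = (\<Sum>n\<in>I. \<Sum>m\<in>I. c n * c m * K n m) - (\<Sum>m\<in>I. c m * (K 1 m + K m 1))"
    by (simp add: distrib_left sum.distrib)
  \<comment> \<open>Against mode 1 the window leaves only \<open>m = p\<close> and
    \<open>m = p + 1\<close>, which makes the linear operator tridiagonal.\<close>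
  have "(\<Sum>m\<in>I. c m * (K 1 m + K m 1)) = (\<Sum>m\<in>I. (if m = p then c p * lin_diag p else 0) + (if m = p + 1 then c (p + 1) * lin_diag (p + 1) else 0))"
  proof (rule sum.cong[OF refl])
    fix m assume "m \<in> I"
    then have m: "m \<ge> 1" by (simp add: I_def)
    define B :: real where "B = of_bool (\<bar>int m - 1\<bar> \<le> int p) - of_bool (m + 1 \<le> p)"
    have B: "B = of_bool (m = p) + of_bool (m = p + 1)" using m p by (auto simp: B_def)
    have "K 1 m + K m 1 = (((real m)\<^sup>2 - 1) / (2 * real m) + (1 - (real m)\<^sup>2) / (2 * (real m)\<^sup>2)) * B"
      by (simp add: K_def B_def distrib_right abs_minus_commute add.commute)
    also have "((real m)\<^sup>2 - 1) / (2 * real m) + (1 - (real m)\<^sup>2) / (2 * (real m)\<^sup>2) = lin_diag m"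
      using m by (simp add: lin_diag_def field_simps power2_eq_square)
    finally show "c m * (K 1 m + K m 1) = (if m = p then c p * lin_diag p else 0) + (if m = p + 1 then c (p + 1) * lin_diag (p + 1) else 0)"
      unfolding B by auto
  qed
  also have "\<dots> = c p * lin_diag p + c (p + 1) * lin_diag (p + 1)"
    using p by (simp only: sum.distrib sum.delta I_def finite_atLeastAtMost atLeastAtMost_iff) simp
  also have "\<dots> = lin_coeff a p" by (simp add: c_def lin_coeff_def mult.commute)
  finally have lin: "(\<Sum>m\<in>I. c m * (K 1 m + K m 1)) = lin_coeff a p" .
  have "quad_coeff a (int N + 1) (int p) = (\<Sum>n\<in>I. \<Sum>m\<in>I. c n * c m * K n m)"
    unfolding I_def
  proof (rule trans[OF quad_coeff_nat[where a = a and N = N]])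
    show "(\<Sum>n\<in>{1..N + 1}. \<Sum>m\<in>{1..N + 1}. (a (n - 1) - a n) / (real n)\<^sup>2 * (((real m)\<^sup>2 - (real n)\<^sup>2) / (2 * real m) * (a (m - 1) - a m)
       * (of_bool (\<bar>int m - int n\<bar> \<le> int p) - of_bool (m + n \<le> p)))) = (\<Sum>n\<in>{1..N + 1}. \<Sum>m\<in>{1..N + 1}. c n * c m * K n m)"
      by (intro sum.cong refl) (simp add: K_def c_def mult_ac)
  qed (use a0 supp in auto)
  then show ?thesis unfolding eq lin by (simp add: galerkin_field_def)
qed

end

section \<open>Time derivatives and tails\<close>

definition truncate :: "(nat \<Rightarrow> real) \<Rightarrow> nat \<Rightarrow> nat \<Rightarrow> real" where
  "truncate a n p = (if p \<le> n then a p else 0)"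

lemma truncate_support: "a \<in> l2 \<Longrightarrow> truncate a n 0 = 0" "k > n \<Longrightarrow> truncate a n k = 0"
  by (auto simp: truncate_def l2_zero)

lemma truncate_l2: "a \<in> l2 \<Longrightarrow> truncate a n \<in> l2"
  by (rule l2_finite[where N = n]) (simp_all add: truncate_support)

lemma truncate_tendsto:
  assumes "a \<in> l2"
  shows "(\<lambda>n. l2_norm (\<lambda>p. truncate a n p - a p)) \<longlonglongrightarrow> 0"
proof -
  have "(\<Sum>p. (truncate a n p - a p)\<^sup>2) = (\<Sum>p. (a p)\<^sup>2) - (\<Sum>p\<le>n. (a p)\<^sup>2)" for n
  proof -
    have "(\<Sum>p. (truncate a n p - a p)\<^sup>2) = (\<Sum>p. (a p)\<^sup>2 - (truncate a n p)\<^sup>2)"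
      by (rule suminf_cong) (auto simp: truncate_def)
    also have "\<dots> = (\<Sum>p. (a p)\<^sup>2) - (\<Sum>p. (truncate a n p)\<^sup>2)"
      by (rule suminf_diff[OF l2_summable[OF assms] l2_summable[OF truncate_l2[OF assms]], symmetric])
    also have "(\<Sum>p. (truncate a n p)\<^sup>2) = (\<Sum>p\<le>n. (truncate a n p)\<^sup>2)" by (rule suminf_finite) (auto simp: truncate_def)
    finally show ?thesis by (simp add: truncate_def)
  qed
  moreover have "(\<lambda>n. sqrt ((\<Sum>p. (a p)\<^sup>2) - (\<Sum>p\<le>n. (a p)\<^sup>2))) \<longlonglongrightarrow> sqrt ((\<Sum>p. (a p)\<^sup>2) - (\<Sum>p. (a p)\<^sup>2))"
    by (intro tendsto_intros summable_LIMSEQ' l2_summable assms)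
  ultimately show ?thesis by (simp add: l2_norm_def)
qed

lemma l2_norm_mono:
  assumes "a \<in> l2" "b \<in> l2" "\<And>p. \<bar>a p\<bar> \<le> \<bar>b p\<bar>"
  shows "l2_norm a \<le> l2_norm b"
  unfolding l2_norm_def
  by (intro real_sqrt_le_mono suminf_le l2_summable assms) (use assms(3) in \<open>simp add: abs_le_square_iff\<close>)

lemma eta_wderiv_norm: "a \<in> l2 \<Longrightarrow> L2_norm (wderiv (eta_of a)) \<le> 2 * sqrt (4 * pi) * l2_norm a"
  using HDW_wderiv_norm[OF eta_of_HDW(1)[of a]] eta_of_HDW(2)[of a] by (simp add: mult_ac)

definition rhs_const :: real where
  "rhs_const = (3 + 2 * embed_const + 2 * embed_const * sqrt (2 * pi)) * (1 + 2 * sqrt (4 * pi)) * (2 * sqrt (4 * pi))"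

lemma rhs_const_nonneg: "0 \<le> rhs_const"
  unfolding rhs_const_def by (intro mult_nonneg_nonneg add_nonneg_nonneg) auto

lemma rhs_eta_lipschitz:
  assumes "a \<in> l2" "b \<in> l2"
  shows "L2_norm (\<lambda>\<theta>. rhs (eta_of a) \<theta> - rhs (eta_of b) \<theta>)
    \<le> rhs_const * (1 + l2_norm a + l2_norm b) * l2_norm (\<lambda>p. a p - b p)"
proof -
  define s C where "s = 2 * sqrt (4 * pi)" and "C = 3 + 2 * embed_const + 2 * embed_const * sqrt (2 * pi)"
  have s: "s \<ge> 0" by (simp add: s_def)
  have C: "C \<ge> 0" unfolding C_def by (intro add_nonneg_nonneg mult_nonneg_nonneg) auto
  note o = eta_of_odd_H1[OF assms(1)] eta_of_odd_H1[OF assms(2)]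
  have n: "0 \<le> l2_norm a" "0 \<le> l2_norm b" "0 \<le> l2_norm (\<lambda>p. a p - b p)"
    using l2_norm_nonneg assms l2_diff by auto
  have d: "L2_norm (\<lambda>x. wderiv (eta_of a) x - wderiv (eta_of b) x) \<le> s * l2_norm (\<lambda>p. a p - b p)"
    using eta_wderiv_norm[OF l2_diff[OF assms]] odd_H1_wderiv_diff_norm[OF o]
    unfolding eta_of_diff[OF assms, abs_def] s_def by simp
  have w: "L2_norm (wderiv (eta_of a)) \<le> s * l2_norm a" "L2_norm (wderiv (eta_of b)) \<le> s * l2_norm b"
    using eta_wderiv_norm assms unfolding s_def by auto
  have "L2_norm (\<lambda>\<theta>. rhs (eta_of a) \<theta> - rhs (eta_of b) \<theta>)
    \<le> C * (1 + L2_norm (wderiv (eta_of a)) + L2_norm (wderiv (eta_of b))) * L2_norm (\<lambda>x. wderiv (eta_of a) x - wderiv (eta_of b) x)"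
    unfolding C_def by (rule rhs_lipschitz[OF o refl])
  also have "\<dots> \<le> C * ((1 + s) * (1 + l2_norm a + l2_norm b)) * (s * l2_norm (\<lambda>p. a p - b p))"
  proof (intro mult_mono mult_left_mono d)
    have "1 + s * l2_norm a + s * l2_norm b \<le> (1 + s) * (1 + l2_norm a + l2_norm b)"
      using n s by (simp add: algebra_simps)
    then show "1 + L2_norm (wderiv (eta_of a)) + L2_norm (wderiv (eta_of b)) \<le> (1 + s) * (1 + l2_norm a + l2_norm b)"
      using w by linarith
  qed (use n s C in \<open>auto intro!: mult_nonneg_nonneg\<close>)
  also have "\<dots> = (C * (1 + s) * s) * (1 + l2_norm a + l2_norm b) * l2_norm (\<lambda>p. a p - b p)" by (simp only: mult_ac)
  finally show ?thesis unfolding rhs_const_def C_def s_def .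
qed

section \<open>Continuity of the coordinates on L2\<close>

definition proj_const :: "nat \<Rightarrow> real" where
  "proj_const p = (\<Sum>j\<in>{1..p}. real j * (sqrt (2 * pi) / pi))"

lemma proj_const_nonneg: "0 \<le> proj_const p"
  unfolding proj_const_def by (intro sum_nonneg mult_nonneg_nonneg) auto

lemma mode_proj_bound:
  assumes "D \<in> L2"
  shows "\<bar>mode_proj p D\<bar> \<le> proj_const p * L2_norm D"
proof -
  have "\<bar>mode_proj p D\<bar> \<le> (\<Sum>j\<in>{1..p}. \<bar>real j * (L2_inner D (\<lambda>x. sin (real (2 * j) * x)) / pi)\<bar>)"
    unfolding mode_proj_def abs_minus_cancel by (rule sum_abs)
  also have "\<dots> \<le> (\<Sum>j\<in>{1..p}. real j * (sqrt (2 * pi) / pi) * L2_norm D)"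
  proof (rule sum_mono)
    fix j
    have s: "(\<lambda>x. sin (real (2 * j) * x)) \<in> L2" by (rule sin_in_L2) simp
    have "L2_norm (\<lambda>x. sin (real (2 * j) * x)) \<le> sqrt (2 * pi) * 1"
      by (rule L2_norm_bounded[OF s]) (rule abs_sin_le_one)
    then have "\<bar>L2_inner D (\<lambda>x. sin (real (2 * j) * x))\<bar> \<le> L2_norm D * sqrt (2 * pi)"
      using L2_cauchy_schwarz[OF assms s] mult_left_mono[of "L2_norm (\<lambda>x. sin (real (2 * j) * x))" "sqrt (2 * pi)" "L2_norm D"] by simp
    then have "real j * (\<bar>L2_inner D (\<lambda>x. sin (real (2 * j) * x))\<bar> / pi) \<le> real j * ((L2_norm D * sqrt (2 * pi)) / pi)"
      by (intro mult_left_mono divide_right_mono) auto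
    then show "\<bar>real j * (L2_inner D (\<lambda>x. sin (real (2 * j) * x)) / pi)\<bar> \<le> real j * (sqrt (2 * pi) / pi) * L2_norm D"
      by (simp add: abs_mult mult_ac)
  qed
  finally show ?thesis by (simp add: proj_const_def sum_distrib_right)
qed

lemma mode_proj_diff:
  "D \<in> L2 \<Longrightarrow> E \<in> L2 \<Longrightarrow> mode_proj p (\<lambda>x. D x - E x) = mode_proj p D - mode_proj p E"
  unfolding mode_proj_def by (simp add: L2_inner_diff_left sum_subtractf diff_divide_distrib right_diff_distrib)

lemma mode_proj_0 [simp]: "mode_proj 0 D = 0" by (simp add: mode_proj_def)

text \<open>Inverse of the summation in \<open>mode_proj\<close>; it converts the equations for the
  coordinates into equations for the Fourier coefficients.\<close>

lemma mode_proj_sine_coeff: "j \<ge> 1 \<Longrightarrow> real j * sine_coeff D (2 * j) = mode_proj (j - 1) D - mode_proj j D"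
proof -
  assume "j \<ge> 1"
  then have "{1..j} = insert j {1..j - 1}" by auto
  then show ?thesis using \<open>j \<ge> 1\<close> by (simp add: mode_proj_def sine_coeff_def)
qed

lemma mode_proj_eta:
  assumes "a \<in> l2"
  shows "mode_proj p (eta_of a) = a p"
proof (induction p)
  case (Suc p)
  have "real (Suc p) * sine_coeff (eta_of a) (2 * Suc p) = a p - a (Suc p)"
    unfolding sine_coeff_eta_of[OF assms] eta_coeff_even by simp
  then show ?case using mode_proj_sine_coeff[of "Suc p" "eta_of a"] Suc by simp
qed (simp add: l2_zero[OF assms])

lemma rhs_eta_L2: "a \<in> l2 \<Longrightarrow> rhs (eta_of a) \<in> L2"
  by (intro rhs_L2 eta_of_odd_H1)

lemma rhs_truncate_tendsto:
  assumes "a \<in> l2"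
  shows "(\<lambda>n. L2_norm (\<lambda>\<theta>. rhs (eta_of (truncate a n)) \<theta> - rhs (eta_of a) \<theta>)) \<longlonglongrightarrow> 0"
proof (rule Lim_null_comparison[OF always_eventually])
  show "(\<lambda>n. rhs_const * (1 + l2_norm a + l2_norm a) * l2_norm (\<lambda>p. truncate a n p - a p)) \<longlonglongrightarrow> 0"
    by (intro tendsto_mult_right_zero truncate_tendsto assms)
  show "\<forall>n. norm (L2_norm (\<lambda>\<theta>. rhs (eta_of (truncate a n)) \<theta> - rhs (eta_of a) \<theta>))
     \<le> rhs_const * (1 + l2_norm a + l2_norm a) * l2_norm (\<lambda>p. truncate a n p - a p)"
  proof
    fix n
    note t = truncate_l2[OF assms, of n]
    have "l2_norm (truncate a n) \<le> l2_norm a" by (rule l2_norm_mono[OF t assms]) (simp add: truncate_def)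
    then have "rhs_const * (1 + l2_norm (truncate a n) + l2_norm a) * l2_norm (\<lambda>p. truncate a n p - a p)
       \<le> rhs_const * (1 + l2_norm a + l2_norm a) * l2_norm (\<lambda>p. truncate a n p - a p)"
      using rhs_const_nonneg l2_norm_nonneg[OF l2_diff[OF t assms]] by (intro mult_right_mono mult_left_mono) auto
    then show "norm (L2_norm (\<lambda>\<theta>. rhs (eta_of (truncate a n)) \<theta> - rhs (eta_of a) \<theta>))
     \<le> rhs_const * (1 + l2_norm a + l2_norm a) * l2_norm (\<lambda>p. truncate a n p - a p)"
      using rhs_eta_lipschitz[OF t assms] by simp
  qed
qed

text \<open>The even modes \<open>sin (2 j \<theta>)\<close> are invariant under the flow.\<close>

lemma rhs_eta_modes:
  assumes "a \<in> l2"
  shows "L2_inner (rhs (eta_of a)) (\<lambda>x. cos (real k * x)) = 0" "odd k \<Longrightarrow> L2_inner (rhs (eta_of a)) (\<lambda>x. sin (real k * x)) = 0"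
proof -
  have lim: "(\<lambda>n. L2_inner (rhs (eta_of (truncate a n))) h) \<longlonglongrightarrow> L2_inner (rhs (eta_of a)) h" if "h \<in> L2" for h
    by (rule L2_inner_tendsto[OF rhs_eta_L2[OF truncate_l2[OF assms]] rhs_eta_L2[OF assms] that rhs_truncate_tendsto[OF assms]])
  have fin: "L2_inner (rhs (eta_of (truncate a n))) h = L2_inner (rhs_poly (truncate a n) n) h" if "h \<in> L2" for h n
  proof (rule L2_inner_AE_cong[OF rhs_finite rhs_eta_L2[OF truncate_l2[OF assms]] rhs_poly_L2 that])
    show "truncate a n 0 = 0" by (rule truncate_support(1)[OF assms])
    show "truncate a n 0 = 0" by (rule truncate_support(1)[OF assms])
  qed (simp_all add: truncate_def)
  have "L2_inner (rhs (eta_of (truncate a n))) (\<lambda>x. cos (real k * x)) = 0" for n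
    unfolding fin[OF cos_in_L2[OF Ints_of_nat]]
    by (rule rhs_poly_cos) (simp_all add: l2_zero[OF assms] truncate_def)
  then show "L2_inner (rhs (eta_of a)) (\<lambda>x. cos (real k * x)) = 0"
    using lim[OF cos_in_L2[OF Ints_of_nat], of k] by (simp add: LIMSEQ_const_iff)
  assume odd: "odd k"
  then have k: "k \<ge> 1" by (cases k) auto
  have "L2_inner (rhs (eta_of (truncate a n))) (\<lambda>x. sin (real k * x)) = 0" for n
  proof -
    have "rhs_kernel i m k = 0" for i m
    proof -
      have "(k = 2 * j) = False" for j using odd by auto
      then show ?thesis by (subst rhs_kernel_def[where a = "\<lambda>_. 0" and N = 0]) (simp_all only: simp_thms of_bool_eq, simp)
    qed
    moreover have "L2_inner (rhs_poly (truncate a n) n) (\<lambda>x. sin (real k * x)) = (\<Sum>i\<in>{1..n + 1}. \<Sum>m\<in>{1..n + 1}.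
       (bshift (truncate a n) i * bshift (truncate a n) m) * ((pi / 2) * rhs_kernel i m k))"
      by (rule rhs_poly_sin[OF _ _ k]) (simp_all add: l2_zero[OF assms] truncate_def)
    ultimately show ?thesis unfolding fin[OF sin_in_L2[OF Ints_of_nat]] by simp
  qed
  then show "L2_inner (rhs (eta_of a)) (\<lambda>x. sin (real k * x)) = 0"
    using lim[OF sin_in_L2[OF Ints_of_nat], of k] by (simp add: LIMSEQ_const_iff)
qed

section \<open>Parseval's identity for sines and differentiability in time\<close>

lemma sine_bessel:
  assumes "D \<in> L2"
  shows "summable (\<lambda>m. (sine_coeff D m)\<^sup>2)" "(\<Sum>m<M. (sine_coeff D m)\<^sup>2) \<le> (L2_norm D)\<^sup>2 / pi"
proof -
  have c: "L2_inner D (\<lambda>x. sin (real m * x)) = (if m = 0 then 0 else pi) * sine_coeff D m" for m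
    by (simp add: sine_coeff_def L2_inner_commute[of D "\<lambda>x. 0"])
  have eq: "(if m = 0 then 0 else pi) * (sine_coeff D m)\<^sup>2 = pi * (sine_coeff D m)\<^sup>2" for m by simp
  note b = bessel[where e = "\<lambda>m x. sin (real m * x)" and c = "sine_coeff D", OF _ sin_orthogonal assms c, unfolded eq]
  have "summable (\<lambda>m. pi * (sine_coeff D m)\<^sup>2)" by (rule b) simp
  then have "summable (\<lambda>m. (1 / pi) * (pi * (sine_coeff D m)\<^sup>2))" by (rule summable_mult)
  then show "summable (\<lambda>m. (sine_coeff D m)\<^sup>2)" by simp
  have "(\<Sum>m<M. pi * (sine_coeff D m)\<^sup>2) \<le> (L2_norm D)\<^sup>2" by (rule b(2)) simp
  then show "(\<Sum>m<M. (sine_coeff D m)\<^sup>2) \<le> (L2_norm D)\<^sup>2 / pi"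
    by (simp add: sum_distrib_left[symmetric] field_simps)
qed

lemma sine_parseval:
  assumes D: "D \<in> L2" and "\<And>m::nat. L2_inner D (\<lambda>x. cos (real m * x)) = 0"
  shows "(L2_norm D)\<^sup>2 = pi * (\<Sum>m. (sine_coeff D m)\<^sup>2)"
proof -
  have eq: "(if m = 0 then 0 else pi) * (sine_coeff D m)\<^sup>2 = pi * (sine_coeff D m)\<^sup>2" for m by simp
  have sm: "summable (\<lambda>m. (if m = 0 then 0 else pi) * (sine_coeff D m)\<^sup>2)"
    unfolding eq by (intro summable_mult sine_bessel D)
  from orthogonal_series_converges[where e = "\<lambda>m x. sin (real m * x)", OF _ sin_orthogonal sm]
  obtain G where G: "G \<in> L2" "(\<lambda>N. L2_norm (\<lambda>x. (\<Sum>m<N. sine_coeff D m * sin (real m * x)) - G x)) \<longlonglongrightarrow> 0"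
     "\<And>m. L2_inner G (\<lambda>x. sin (real m * x)) = (if m = 0 then 0 else pi) * sine_coeff D m"
     "(L2_norm G)\<^sup>2 = (\<Sum>m. (if m = 0 then 0 else pi) * (sine_coeff D m)\<^sup>2)" by auto
  have Gc: "L2_inner G (\<lambda>x. cos (real k * x)) = 0" for k :: nat
  proof -
    have c: "(\<lambda>x. cos (real k * x)) \<in> L2" by simp
    have "L2_inner (\<lambda>x. \<Sum>m<N. sine_coeff D m * sin (real m * x)) (\<lambda>x. cos (real k * x)) = 0" for N
      by (rule odd_inner_cos) (simp add: sum_negf)
    then show ?thesis using L2_inner_tendsto[OF sine_sum_L2 G(1) c G(2)] by (simp add: LIMSEQ_const_iff)
  qed
  have "AE x in lborel. x \<in> {-pi..pi} \<longrightarrow> D x - G x = 0"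
  proof (rule trig_complete)
    show "L2_inner (\<lambda>x. D x - G x) (\<lambda>x. sin (real m * x)) = 0" for m
      using G(3)[of m] by (simp add: L2_inner_diff_left D G(1) sine_coeff_def L2_inner_commute[of D "\<lambda>x. 0"])
    show "L2_inner (\<lambda>x. D x - G x) (\<lambda>x. cos (real m * x)) = 0" for m
      using Gc assms(2) by (simp add: L2_inner_diff_left D G(1))
  qed (intro L2_diff D G(1))
  then have "L2_norm D = L2_norm G" by (intro L2_norm_AE_cong D G(1)) (auto elim: eventually_mono)
  then show ?thesis using G(4) unfolding eq by (simp add: suminf_mult sine_bessel D)
qed

text \<open>Pairing the error of the difference quotient with itself gives, by the mean value theorem for a
  single scalar function, a bound by the oscillation of the right-hand side; coefficientwise
  differentiability alone would not give convergence in \<open>L2\<close>.\<close>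

lemma eta_L2_time_deriv:
  assumes al: "\<And>t. t \<ge> 0 \<Longrightarrow> a t \<in> l2" and bd: "\<And>t. t \<ge> 0 \<Longrightarrow> l2_norm (a t) \<le> B"
    and cont: "\<And>t. t \<ge> 0 \<Longrightarrow> ((\<lambda>s. l2_norm (\<lambda>p. a s p - a t p)) \<longlongrightarrow> 0) (at t within {0..})"
    and der: "\<And>t p. t \<ge> 0 \<Longrightarrow> ((\<lambda>t. a t p) has_real_derivative mode_proj p (rhs (eta_of (a t)))) (at t within {0..})"
    and t: "t \<ge> 0"
  shows "has_L2_time_deriv (\<lambda>t. eta_of (a t)) (rhs (eta_of (a t))) t {0..}"
  unfolding has_L2_time_deriv_def
proof
  define R where "R = (\<lambda>t. rhs (eta_of (a t)))"
  have RL: "R \<tau> \<in> L2" if "\<tau> \<ge> 0" for \<tau> unfolding R_def by (rule rhs_eta_L2[OF al[OF that]])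
  then show "rhs (eta_of (a t)) \<in> L2" using t by (simp add: R_def)
  have Rcont: "((\<lambda>s. L2_norm (\<lambda>\<theta>. R s \<theta> - R t \<theta>)) \<longlongrightarrow> 0) (at t within {0..})"
  proof (rule Lim_null_comparison)
    show "((\<lambda>s. rhs_const * (1 + B + B) * l2_norm (\<lambda>p. a s p - a t p)) \<longlongrightarrow> 0) (at t within {0..})"
      by (intro tendsto_mult_right_zero cont t)
    have "\<forall>\<^sub>F s in at t within {0..}. s \<ge> 0" by (simp add: eventually_at_filter)
    then show "\<forall>\<^sub>F s in at t within {0..}. norm (L2_norm (\<lambda>\<theta>. R s \<theta> - R t \<theta>)) \<le> rhs_const * (1 + B + B) * l2_norm (\<lambda>p. a s p - a t p)"
    proof eventually_elim
      case (elim s)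
      have "rhs_const * (1 + l2_norm (a s) + l2_norm (a t)) * l2_norm (\<lambda>p. a s p - a t p) \<le> rhs_const * (1 + B + B) * l2_norm (\<lambda>p. a s p - a t p)"
        using rhs_const_nonneg l2_norm_nonneg[OF l2_diff[OF al[OF elim] al[OF t]]] bd[OF elim] bd[OF t]
        by (intro mult_right_mono mult_left_mono) auto
      then show ?case unfolding R_def using rhs_eta_lipschitz[OF al[OF elim] al[OF t]] by simp
    qed
  qed
  have bder: "((\<lambda>\<tau>. eta_coeff (a \<tau>) m) has_real_derivative sine_coeff (R \<tau>) m) (at \<tau> within {0..})" if \<tau>: "\<tau> \<ge> 0" for m \<tau>
  proof (cases "even m \<and> m > 0")
    case True
    then obtain j where j: "m = 2 * j" "j \<ge> 1" by (elim conjE evenE) auto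
    have "sine_coeff (R \<tau>) m = (mode_proj (j - 1) (R \<tau>) - mode_proj j (R \<tau>)) / real j"
      using mode_proj_sine_coeff[OF j(2), of "R \<tau>"] j by (simp add: field_simps)
    moreover have "((\<lambda>\<tau>. (a \<tau> (j - 1) - a \<tau> j) / real j) has_real_derivative (mode_proj (j - 1) (R \<tau>) - mode_proj j (R \<tau>)) / real j) (at \<tau> within {0..})"
      unfolding R_def by (intro DERIV_cdivide DERIV_diff der \<tau>)
    ultimately show ?thesis unfolding j(1) eta_coeff_even by simp
  next
    case False
    then have "eta_coeff c m = 0" for c by (auto simp: eta_coeff_def)
    moreover have "sine_coeff (R \<tau>) m = 0"
    proof (cases "m = 0")
      case False
      then have "odd m" using \<open>\<not> (even m \<and> m > 0)\<close> by simp
      then show ?thesis unfolding sine_coeff_def R_def using rhs_eta_modes(2)[OF al[OF \<tau>]] by simp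
    qed simp
    ultimately show ?thesis by simp
  qed
  show "((\<lambda>s. L2_norm (\<lambda>\<theta>. (eta_of (a s) \<theta> - eta_of (a t) \<theta>) / (s - t) - rhs (eta_of (a t)) \<theta>)) \<longlongrightarrow> 0) (at t within {0..})"
    unfolding tendsto_iff
  proof (intro allI impI)
    fix e :: real assume e: "e > 0"
    have "\<forall>\<^sub>F s in at t within {0..}. dist (L2_norm (\<lambda>\<theta>. R s \<theta> - R t \<theta>)) 0 < e / 2"
      using Rcont e unfolding tendsto_iff by (metis half_gt_zero)
    then obtain \<delta> where \<delta>: "\<delta> > 0" "\<And>s. s \<in> {0..} \<Longrightarrow> s \<noteq> t \<Longrightarrow> dist s t < \<delta> \<Longrightarrow> dist (L2_norm (\<lambda>\<theta>. R s \<theta> - R t \<theta>)) 0 < e / 2"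
      unfolding eventually_at by blast
    have R\<delta>: "L2_norm (\<lambda>\<theta>. R s \<theta> - R t \<theta>) \<le> e / 2" if "s \<ge> 0" "\<bar>s - t\<bar> < \<delta>" for s
    proof (cases "s = t")
      case True
      then show ?thesis using e by (simp add: L2_norm_eq)
    next
      case False
      then show ?thesis using \<delta>(2)[of s] that by (simp add: dist_real_def)
    qed
    have *: "dist (L2_norm (\<lambda>\<theta>. (eta_of (a s) \<theta> - eta_of (a t) \<theta>) / (s - t) - rhs (eta_of (a t)) \<theta>)) 0 < e"
      if s: "s \<ge> 0" "s \<noteq> t" "\<bar>s - t\<bar> < \<delta>" for s
    proof -
      define Q where "Q = (\<lambda>\<theta>. (1 / (s - t)) * (eta_of (a s) \<theta> - eta_of (a t) \<theta>) - R t \<theta>)"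
      define q where "q = sine_coeff Q"
      note eL = eta_of_L2[OF al[OF s(1)]] eta_of_L2[OF al[OF t]]
      have QL: "Q \<in> L2" unfolding Q_def by (intro L2_diff L2_scale eL RL t)
      have Qc: "L2_inner Q (\<lambda>x. cos (real m * x)) = 0" for m :: nat
      proof -
        have ec: "L2_inner (eta_of (a \<tau>)) (\<lambda>x. cos (real m * x)) = 0" if "\<tau> \<ge> 0" for \<tau>
          using eta_of_odd_H1[OF al[OF that]] by (intro odd_inner_cos) (simp add: odd_H1_def)
        have "L2_inner Q (\<lambda>x. cos (real m * x)) = (1 / (s - t)) * (0 - 0) - L2_inner (R t) (\<lambda>x. cos (real m * x))"
          unfolding Q_def by (simp only: L2_inner_diff_left[OF L2_scale[OF L2_diff[OF eL]] RL[OF t] cos_in_L2[OF Ints_of_nat]]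
             L2_inner_scale_left L2_inner_diff_left[OF eL cos_in_L2[OF Ints_of_nat]] ec[OF s(1)] ec[OF t])
        then show ?thesis by (simp add: R_def rhs_eta_modes(1)[OF al[OF t]])
      qed
      have qm: "q m = (eta_coeff (a s) m - eta_coeff (a t) m) / (s - t) - sine_coeff (R t) m" for m
      proof -
        have ec: "L2_inner (eta_of (a \<tau>)) (\<lambda>x. sin (real m * x)) = pi * eta_coeff (a \<tau>) m" if "\<tau> \<ge> 0" for \<tau>
          using fun_cong[OF sine_coeff_eta_of[OF al[OF that]], of m] by (simp add: sine_coeff_def field_simps)
        have "L2_inner Q (\<lambda>x. sin (real m * x)) = (1 / (s - t)) * (pi * eta_coeff (a s) m - pi * eta_coeff (a t) m) - L2_inner (R t) (\<lambda>x. sin (real m * x))"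
          unfolding Q_def by (simp only: L2_inner_diff_left[OF L2_scale[OF L2_diff[OF eL]] RL[OF t] sin_in_L2[OF Ints_of_nat]]
             L2_inner_scale_left L2_inner_diff_left[OF eL sin_in_L2[OF Ints_of_nat]] ec[OF s(1)] ec[OF t])
        moreover have "((1 / (s - t)) * (pi * x - pi * y) - z) / pi = (x - y) / (s - t) - z / pi" for x y z
          by (simp add: diff_divide_distrib)
        ultimately show ?thesis by (cases "m = 0") (simp_all add: q_def sine_coeff_def)
      qed
      have fin: "(\<Sum>m<M. (q m)\<^sup>2) \<le> (e / 2)\<^sup>2 / pi" for M
      proof -
        define \<phi> where "\<phi> = (\<lambda>\<tau>. \<Sum>m<M. q m * (eta_coeff (a \<tau>) m - sine_coeff (R t) m * \<tau>))"
        define \<phi>' where "\<phi>' = (\<lambda>\<tau>. \<Sum>m<M. q m * (sine_coeff (R \<tau>) m - sine_coeff (R t) m))"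
        have d\<phi>: "(\<phi> has_real_derivative \<phi>' \<tau>) (at \<tau> within {0..})" if "\<tau> \<ge> 0" for \<tau>
          unfolding \<phi>_def \<phi>'_def
          by (intro DERIV_sum DERIV_cmult DERIV_diff bder that) (auto intro!: derivative_eq_intros)
        define l u where "l = min s t" and "u = max s t"
        have lu: "l \<le> u" "0 \<le> l" using s t by (auto simp: l_def u_def)
        have "\<exists>\<xi>\<in>{l..u}. \<phi> u - \<phi> l = (*) (\<phi>' \<xi>) (u - l)"
        proof (rule mvt_very_simple[OF lu(1)])
          fix \<xi> assume "l \<le> \<xi>" "\<xi> \<le> u"
          then have "(\<phi> has_real_derivative \<phi>' \<xi>) (at \<xi> within {l..u})"
            using lu by (intro has_field_derivative_subset[OF d\<phi>]) auto
          then show "(\<phi> has_derivative (*) (\<phi>' \<xi>)) (at \<xi> within {l..u})" by (simp add: has_field_derivative_def)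
        qed
        then obtain \<xi> where \<xi>: "\<xi> \<in> {l..u}" "\<phi> u - \<phi> l = \<phi>' \<xi> * (u - l)" by blast
        have \<xi>0: "\<xi> \<ge> 0" "\<bar>\<xi> - t\<bar> < \<delta>" using \<xi>(1) lu s t by (auto simp: l_def u_def min_def max_def split: if_splits)
        have "\<phi> s - \<phi> t = \<phi>' \<xi> * (s - t)"
          using \<xi>(2) by (cases "s \<le> t") (simp_all add: l_def u_def algebra_simps)
        then have "\<phi>' \<xi> = (\<phi> s - \<phi> t) / (s - t)" using s(2) by simp
        also have "\<dots> = (\<Sum>m<M. (q m)\<^sup>2)"
        proof -
          have "\<phi> s - \<phi> t = (\<Sum>m<M. q m * ((eta_coeff (a s) m - eta_coeff (a t) m) - sine_coeff (R t) m * (s - t)))"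
            unfolding \<phi>_def sum_subtractf[symmetric] by (intro sum.cong refl) (simp add: algebra_simps)
          then have "(\<phi> s - \<phi> t) / (s - t) = (\<Sum>m<M. q m * ((eta_coeff (a s) m - eta_coeff (a t) m) - sine_coeff (R t) m * (s - t)) / (s - t))"
            by (simp add: sum_divide_distrib)
          also have "\<dots> = (\<Sum>m<M. (q m)\<^sup>2)"
          proof (intro sum.cong refl)
            fix m
            have "((eta_coeff (a s) m - eta_coeff (a t) m) - sine_coeff (R t) m * (s - t)) / (s - t) = q m"
              unfolding qm using s(2) by (simp add: diff_divide_distrib)
            then show "q m * ((eta_coeff (a s) m - eta_coeff (a t) m) - sine_coeff (R t) m * (s - t)) / (s - t) = (q m)\<^sup>2"
              unfolding times_divide_eq_right[symmetric] power2_eq_square by (simp only:)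
          qed
          finally show ?thesis .
        qed
        finally have eq: "\<phi>' \<xi> = (\<Sum>m<M. (q m)\<^sup>2)" .
        define f where "f = (\<lambda>m. sine_coeff (R \<xi>) m - sine_coeff (R t) m)"
        have f: "f m = sine_coeff (\<lambda>\<theta>. R \<xi> \<theta> - R t \<theta>) m" for m
          unfolding f_def sine_coeff_def by (simp add: L2_inner_diff_left RL \<xi>0 t diff_divide_distrib)
        have "(\<Sum>m<M. (f m)\<^sup>2) \<le> (L2_norm (\<lambda>\<theta>. R \<xi> \<theta> - R t \<theta>))\<^sup>2 / pi"
          unfolding f by (rule sine_bessel(2)) (intro L2_diff RL \<xi>0 t)
        also have "\<dots> \<le> (e / 2)\<^sup>2 / pi" using R\<delta>[OF \<xi>0] by (intro divide_right_mono power_mono) auto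
        finally have fb: "(\<Sum>m<M. (f m)\<^sup>2) \<le> (e / 2)\<^sup>2 / pi" .
        have "(\<Sum>m<M. (q m)\<^sup>2) = (\<Sum>m<M. q m * f m)" using eq by (simp add: \<phi>'_def f_def)
        also have "\<dots> \<le> (\<Sum>m<M. (1/2) * (q m)\<^sup>2 + (1/2) * (f m)\<^sup>2)"
        proof (rule sum_mono)
          fix m show "q m * f m \<le> (1/2) * (q m)\<^sup>2 + (1/2) * (f m)\<^sup>2" using sum_squares_bound[of "q m" "f m"] by simp
        qed
        also have "\<dots> = (1/2) * (\<Sum>m<M. (q m)\<^sup>2) + (1/2) * (\<Sum>m<M. (f m)\<^sup>2)" by (simp add: sum.distrib sum_distrib_left sum_divide_distrib)
        finally show ?thesis using fb by simp
      qed
      have "(L2_norm Q)\<^sup>2 = pi * (\<Sum>m. (q m)\<^sup>2)" unfolding q_def by (rule sine_parseval[OF QL Qc])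
      also have "\<dots> \<le> pi * ((e / 2)\<^sup>2 / pi)"
        unfolding q_def by (intro mult_left_mono suminf_le_const sine_bessel QL fin[unfolded q_def]) auto
      finally have "(L2_norm Q)\<^sup>2 \<le> (e / 2)\<^sup>2" by simp
      then have "L2_norm Q \<le> e / 2" by (rule power2_le_imp_le) (use e in simp)
      moreover have "(\<lambda>\<theta>. (eta_of (a s) \<theta> - eta_of (a t) \<theta>) / (s - t) - rhs (eta_of (a t)) \<theta>) = Q"
        unfolding Q_def R_def by simp
      moreover have "0 \<le> L2_norm Q" by simp
      ultimately show ?thesis using e by (simp only: dist_real_def)
    qed
    show "\<forall>\<^sub>F s in at t within {0..}. dist (L2_norm (\<lambda>\<theta>. (eta_of (a s) \<theta> - eta_of (a t) \<theta>) / (s - t) - rhs (eta_of (a t)) \<theta>)) 0 < e"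
      unfolding eventually_at
    proof (intro exI[of _ \<delta>] conjI ballI impI \<delta>(1))
      fix s assume "s \<in> {0..}" "s \<noteq> t \<and> dist s t < \<delta>"
      then have "s \<ge> 0" "s \<noteq> t" "\<bar>s - t\<bar> < \<delta>" by (auto simp: dist_real_def)
      then show "dist (L2_norm (\<lambda>\<theta>. (eta_of (a s) \<theta> - eta_of (a t) \<theta>) / (s - t) - rhs (eta_of (a t)) \<theta>)) 0 < e"
        by (rule *)
    qed
  qed
qed

text \<open>For each fixed mode the weight tends to 0 as \<open>M\<close> grows, and the terms are
  dominated by \<open>(a p)\<^sup>2\<close>; this is dominated convergence for series.\<close>

lemma tail_weight_tendsto:
  assumes "a \<in> l2"
  shows "(\<lambda>M. \<Sum>p. cutoff_weight (real (Suc M)) (int p) * (a p)\<^sup>2) \<longlonglongrightarrow> 0"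
    "summable (\<lambda>p. cutoff_weight (real (Suc M)) (int p) * (a p)\<^sup>2)"
proof -
  have w1: "0 \<le> cutoff_weight (real (Suc M)) q" "cutoff_weight (real (Suc M)) q \<le> 1" for M q
    using cutoff_weight_pos[of "real (Suc M)" q] by (auto simp: cutoff_weight_def)
  have b: "norm (cutoff_weight (real (Suc M)) (int p) * (a p)\<^sup>2) \<le> (a p)\<^sup>2" for M p
    using w1[of M "int p"] by (simp add: abs_mult mult_left_le_one_le)
  show "summable (\<lambda>p. cutoff_weight (real (Suc M)) (int p) * (a p)\<^sup>2)"
    by (rule summable_comparison_test'[OF l2_summable[OF assms]]) (rule b)
  have lim: "(\<lambda>M. cutoff_weight (real (Suc M)) (int p) * (a p)\<^sup>2) \<longlonglongrightarrow> 0" for p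
  proof -
    have "(\<lambda>M. \<bar>real_of_int (int p) + 1/2\<bar> / real (Suc M)) \<longlonglongrightarrow> 0"
      by (rule LIMSEQ_Suc) (rule lim_const_over_n)
    then have "(\<lambda>M. sqrt (min 1 (\<bar>real_of_int (int p) + 1/2\<bar> / real (Suc M)))) \<longlonglongrightarrow> sqrt (min 1 0)"
      by (intro tendsto_intros)
    then show ?thesis unfolding cutoff_weight_def by (intro tendsto_mult_left_zero) simp
  qed
  have "(\<lambda>M. \<Sum>p. cutoff_weight (real (Suc M)) (int p) * (a p)\<^sup>2) \<longlonglongrightarrow> (\<Sum>p. 0)"
  proof (rule tannerys_theorem[where M = "\<lambda>p. (a p)\<^sup>2", THEN conjunct2, THEN conjunct2])
    show "\<forall>\<^sub>F (p, M) in at_top \<times>\<^sub>F sequentially. norm (cutoff_weight (real (Suc M)) (int p) * (a p)\<^sup>2) \<le> (a p)\<^sup>2"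
      by (rule always_eventually) (use b in auto)
  qed (use lim l2_summable[OF assms] in auto)
  then show "(\<lambda>M. \<Sum>p. cutoff_weight (real (Suc M)) (int p) * (a p)\<^sup>2) \<longlonglongrightarrow> 0" by simp
qed

text \<open>From \<open>M\<close> on the weight is 1, so \<open>T\<close> bounds both tails; the
  constant 4 comes from bounding the square of a difference by twice the sum of the squares.\<close>

lemma l2_split:
  assumes x: "x \<in> l2" and y: "y \<in> l2" and M: "M \<ge> 1"
    and T: "\<And>K. (\<Sum>p\<in>{1..K}. cutoff_weight (real M) (int p) * (x p)\<^sup>2) \<le> T"
      "\<And>K. (\<Sum>p\<in>{1..K}. cutoff_weight (real M) (int p) * (y p)\<^sup>2) \<le> T"
  shows "(l2_norm (\<lambda>p. x p - y p))\<^sup>2 \<le> (\<Sum>p<M. (x p - y p)\<^sup>2) + 4 * T"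
proof -
  have w: "cutoff_weight (real M) (int p) = 1" if "p \<ge> M" for p
  proof -
    have "1 \<le> \<bar>real_of_int (int p) + 1/2\<bar> / real M" using that M by (simp add: le_divide_eq)
    then show ?thesis by (simp add: cutoff_weight_def)
  qed
  have wp: "0 \<le> cutoff_weight (real M) q" for q using cutoff_weight_pos[of "real M" q] M by simp
  have tail: "(\<Sum>p\<in>{M..<K}. (z p)\<^sup>2) \<le> T"
    if z: "\<And>K. (\<Sum>p\<in>{1..K}. cutoff_weight (real M) (int p) * (z p)\<^sup>2) \<le> T" for z K
  proof -
    have "(\<Sum>p\<in>{M..<K}. (z p)\<^sup>2) = (\<Sum>p\<in>{M..<K}. cutoff_weight (real M) (int p) * (z p)\<^sup>2)"
      by (rule sum.cong) (auto simp: w)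
    also have "\<dots> \<le> (\<Sum>p\<in>{1..K}. cutoff_weight (real M) (int p) * (z p)\<^sup>2)"
      using M by (intro sum_mono2) (auto simp: wp)
    also have "\<dots> \<le> T" by (rule z)
    finally show ?thesis .
  qed
  have sq: "(u - v)\<^sup>2 \<le> 2 * u\<^sup>2 + 2 * v\<^sup>2" for u v :: real
  proof -
    have "(u - v)\<^sup>2 = 2 * u\<^sup>2 + 2 * v\<^sup>2 - (u + v)\<^sup>2" by (simp add: power2_sum power2_diff)
    then show ?thesis by simp
  qed
  have "(\<Sum>p. (x p - y p)\<^sup>2) \<le> (\<Sum>p<M. (x p - y p)\<^sup>2) + 4 * T"
  proof (rule suminf_le_const[OF l2_summable[OF l2_diff[OF x y]]])
    fix K
    have "(\<Sum>p<K. (x p - y p)\<^sup>2) \<le> (\<Sum>p<M. (x p - y p)\<^sup>2) + (\<Sum>p\<in>{M..<K}. (x p - y p)\<^sup>2)"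
    proof (cases "M \<le> K")
      case True
      have "{..<M} \<union> {M..<K} = {..<K}" using True by auto
      moreover have "sum f ({..<M} \<union> {M..<K}) = sum f {..<M} + sum f {M..<K}" for f :: "nat \<Rightarrow> real"
        by (rule sum.union_disjoint) auto
      ultimately show ?thesis by (metis order_refl)
    next
      case False
      then show ?thesis using sum_mono2[of "{..<M}" "{..<K}" "\<lambda>p. (x p - y p)\<^sup>2"] by simp
    qed
    also have "(\<Sum>p\<in>{M..<K}. (x p - y p)\<^sup>2) \<le> (\<Sum>p\<in>{M..<K}. 2 * (x p)\<^sup>2 + 2 * (y p)\<^sup>2)"
      by (rule sum_mono) (rule sq)
    also have "\<dots> = 2 * (\<Sum>p\<in>{M..<K}. (x p)\<^sup>2) + 2 * (\<Sum>p\<in>{M..<K}. (y p)\<^sup>2)" by (simp add: sum.distrib sum_distrib_left)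
    finally show "(\<Sum>p<K. (x p - y p)\<^sup>2) \<le> (\<Sum>p<M. (x p - y p)\<^sup>2) + 4 * T"
      using tail[OF T(1), of K] tail[OF T(2), of K] by linarith
  qed
  then show ?thesis unfolding l2_norm_sq[OF l2_diff[OF x y]] .
qed

section \<open>The Galerkin limit\<close>

text \<open>The weight is small on low modes and equals \<open>1\<close> beyond \<open>M\<close>, so this controls the tail of
  \<open>a\<close>, and it tends to \<open>0\<close> as \<open>M\<close> grows.\<close>

definition tail_energy :: "nat \<Rightarrow> (nat \<Rightarrow> real) \<Rightarrow> real" where
  "tail_energy M a = (\<Sum>p. cutoff_weight (real (Suc M)) (int p) * (a p)\<^sup>2)"

lemma cutoff_weight_nonneg: "0 \<le> cutoff_weight (real (Suc M)) q"
  using cutoff_weight_pos[of "real (Suc M)" q] by simp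

lemma tail_energy_nonneg: "a \<in> l2 \<Longrightarrow> 0 \<le> tail_energy M a"
  unfolding tail_energy_def by (intro suminf_nonneg tail_weight_tendsto mult_nonneg_nonneg cutoff_weight_nonneg) auto

lemma tail_energy_partial:
  assumes "a \<in> l2"
  shows "(\<Sum>p\<in>{1..K}. cutoff_weight (real (Suc M)) (int p) * (a p)\<^sup>2) \<le> tail_energy M a"
  unfolding tail_energy_def
  by (intro sum_le_suminf tail_weight_tendsto assms ballI mult_nonneg_nonneg cutoff_weight_nonneg) auto

lemma tail_energy_leI:
  assumes "a \<in> l2" "\<And>K. (\<Sum>p\<in>{1..K}. cutoff_weight (real (Suc M)) (int p) * (a p)\<^sup>2) \<le> T"
  shows "tail_energy M a \<le> T"
  unfolding tail_energy_def
proof (rule suminf_le_const[OF tail_weight_tendsto(2)[OF assms(1)]])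
  fix n
  have "(\<Sum>p<n. cutoff_weight (real (Suc M)) (int p) * (a p)\<^sup>2) = (\<Sum>p\<in>{1..n - 1}. cutoff_weight (real (Suc M)) (int p) * (a p)\<^sup>2)"
    by (rule sum.mono_neutral_right) (auto simp: l2_zero[OF assms(1)] not_le Suc_le_eq)
  then show "(\<Sum>p<n. cutoff_weight (real (Suc M)) (int p) * (a p)\<^sup>2) \<le> T" using assms(2)[of "n - 1"] by simp
qed

lemma l2_dist_tail:
  assumes "x \<in> l2" "y \<in> l2" "tail_energy M x \<le> T" "tail_energy M y \<le> T"
  shows "(l2_norm (\<lambda>p. x p - y p))\<^sup>2 \<le> (\<Sum>p<Suc M. (x p - y p)\<^sup>2) + 4 * T"
  by (rule l2_split[OF assms(1,2)])
     (use order_trans[OF tail_energy_partial[OF assms(1)] assms(3)] order_trans[OF tail_energy_partial[OF assms(2)] assms(4)] in auto)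

lemma tail_energy_tendsto: "a \<in> l2 \<Longrightarrow> (\<lambda>M. tail_energy M a) \<longlonglongrightarrow> 0"
  unfolding tail_energy_def by (rule tail_weight_tendsto)

text \<open>Tails dominated by those of one fixed sequence \<open>a\<close> can be made small by a
  single \<open>M\<close> for all indices, which upgrades coordinatewise to strong convergence. The
  filter is arbitrary because the lemma serves both the Galerkin limit and continuity in
  time.\<close>

lemma l2_tendsto:
  assumes y: "y \<in> l2" "\<And>M. tail_energy M y \<le> C * tail_energy M a" and a: "a \<in> l2"
    and x: "\<forall>\<^sub>F i in F. x i \<in> l2 \<and> (\<forall>M. tail_energy M (x i) \<le> C * tail_energy M a)"
    and lim: "\<And>p. ((\<lambda>i. x i p) \<longlongrightarrow> y p) F"
  shows "((\<lambda>i. l2_norm (\<lambda>p. x i p - y p)) \<longlongrightarrow> 0) F"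
  unfolding tendsto_iff
proof (intro allI impI)
  fix e :: real assume e: "e > 0"
  have "(\<lambda>M. 4 * (C * tail_energy M a)) \<longlonglongrightarrow> 0"
    by (intro tendsto_mult_right_zero tail_energy_tendsto a)
  then have "\<forall>\<^sub>F M in sequentially. 4 * (C * tail_energy M a) < e\<^sup>2 / 2"
    by (rule order_tendstoD) (use e in simp)
  then obtain M where M: "4 * (C * tail_energy M a) < e\<^sup>2 / 2"
    using eventually_happens'[OF sequentially_bot] by blast
  have "((\<lambda>i. \<Sum>p<Suc M. (x i p - y p)\<^sup>2) \<longlongrightarrow> (\<Sum>p<Suc M. (y p - y p)\<^sup>2)) F"
    by (intro tendsto_intros lim)
  then have "\<forall>\<^sub>F i in F. (\<Sum>p<Suc M. (x i p - y p)\<^sup>2) < e\<^sup>2 / 2"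
    by (rule order_tendstoD) (use e in simp)
  with x show "\<forall>\<^sub>F i in F. dist (l2_norm (\<lambda>p. x i p - y p)) 0 < e"
  proof eventually_elim
    case (elim i)
    have "(l2_norm (\<lambda>p. x i p - y p))\<^sup>2 < e\<^sup>2"
      using l2_dist_tail[of "x i" y M "C * tail_energy M a"] elim y M by fastforce
    then have "l2_norm (\<lambda>p. x i p - y p) < e"
      by (rule power2_less_imp_less) (use e in simp)
    then show ?case using l2_norm_nonneg[OF l2_diff, of "x i" y] elim y by simp
  qed
qed

text \<open>The bound 1/8 stays below the gap 3/8, so that the first pass of Gronwall already yields
  exponential decay.\<close>

definition galerkin_flow :: "nat \<Rightarrow> (real \<Rightarrow> nat \<Rightarrow> real) \<Rightarrow> bool" where
  "galerkin_flow N x \<longleftrightarrow> (\<forall>t p. p \<notin> {1..N} \<longrightarrow> x t p = 0) \<and>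
     (\<forall>t\<ge>0. \<forall>p\<in>{1..N}. ((\<lambda>t. x t p) has_real_derivative galerkin_field N (x t) p) (at t within {0..})) \<and>
     (\<forall>t\<ge>0. (\<Sum>p\<in>{1..N}. (x t p)\<^sup>2) \<le> 1 \<and> trilinear_const * sqrt (\<Sum>p\<in>{1..N}. (x t p)\<^sup>2) \<le> 1/8)"

lemma galerkin_flow_support:
  assumes "galerkin_flow N x"
  shows "x t 0 = 0" "k > N \<Longrightarrow> x t k = 0"
  using assms by (auto simp: galerkin_flow_def)

lemma galerkin_flow_energy_deriv:
  assumes "galerkin_flow N x" "t \<in> {0..T}"
  shows "((\<lambda>t. \<Sum>p\<in>{1..N}. w (int p) * (x t p)\<^sup>2) has_real_derivative
     2 * (\<Sum>p\<in>{1..N}. w (int p) * x t p * galerkin_field N (x t) p)) (at t within {0..T})"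
proof -
  have d: "((\<lambda>t. x t p) has_real_derivative galerkin_field N (x t) p) (at t within {0..T})" if "p \<in> {1..N}" for p
    by (rule has_field_derivative_subset[where s = "{0..}"]) (use assms that in \<open>auto simp: galerkin_flow_def\<close>)
  have "((\<lambda>t. \<Sum>p\<in>{1..N}. w (int p) * (x t p)\<^sup>2) has_real_derivative
     (\<Sum>p\<in>{1..N}. w (int p) * (real 2 * (galerkin_field N (x t) p * x t p ^ (2 - Suc 0))))) (at t within {0..T})"
    by (intro DERIV_sum DERIV_cmult DERIV_power d)
  moreover have "(\<Sum>p\<in>{1..N}. w (int p) * (real 2 * (galerkin_field N (x t) p * x t p ^ (2 - Suc 0))))
    = 2 * (\<Sum>p\<in>{1..N}. w (int p) * x t p * galerkin_field N (x t) p)"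
    unfolding sum_distrib_left by (intro sum.cong refl) simp
  ultimately show ?thesis by simp
qed

text \<open>The rate \<open>3/8\<close> is not lost to the quadratic term: a first pass of Gronwall gives decay at a
  slower rate, which makes the quadratic contribution integrable in time for a second pass.\<close>

lemma galerkin_flow_decay:
  assumes x: "galerkin_flow N x" and t: "t \<ge> 0"
  shows "(\<Sum>p\<in>{1..N}. (x t p)\<^sup>2) \<le> exp 1 * exp (- (3/4) * t) * (\<Sum>p\<in>{1..N}. (x 0 p)\<^sup>2)"
proof -
  define S where "S = (\<lambda>t. \<Sum>p\<in>{1..N}. (x t p)\<^sup>2)"
  define S' where "S' = (\<lambda>t. 2 * (\<Sum>p\<in>{1..N}. x t p * galerkin_field N (x t) p))"
  have S0: "S s \<ge> 0" for s by (simp add: S_def sum_nonneg)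
  have der: "(S has_real_derivative S' s) (at s within {0..T})" if "s \<in> {0..T}" for s T
    using galerkin_flow_energy_deriv[OF x that, of "\<lambda>_. 1"] by (simp add: S_def S'_def)
  have S': "S' s \<le> 2 * ((- (3/8) + trilinear_const * sqrt (S s)) * S s)" for s
    unfolding S'_def S_def
    by (intro mult_left_mono galerkin_energy galerkin_flow_support[OF x]) simp_all
  have small: "trilinear_const * sqrt (S s) \<le> 1/8" if "s \<ge> 0" for s
    using x that by (simp add: galerkin_flow_def S_def)
  have first: "S s \<le> S 0 * exp (- (1/2) * s)" if s: "s \<ge> 0" for s
  proof -
    have "S s \<le> S 0 * exp (- (1/2) * s - - (1/2) * 0)"
    proof (rule gronwall[where k = "\<lambda>_. - (1/2)", OF s der])
      fix \<tau> assume \<tau>: "\<tau> \<in> {0..s}"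
      have "(- (3/8) + trilinear_const * sqrt (S \<tau>)) * S \<tau> \<le> (- (1/4)) * S \<tau>"
        using small[of \<tau>] \<tau> by (intro mult_right_mono S0) auto
      then show "S' \<tau> \<le> - (1/2) * S \<tau>" using S'[of \<tau>] by linarith
      show "((\<lambda>\<tau>. - (1/2) * \<tau>) has_real_derivative - (1/2)) (at \<tau> within {0..s})"
        by (auto intro!: derivative_eq_intros)
    qed
    then show ?thesis by simp
  qed
  have small2: "trilinear_const * sqrt (S s) \<le> 1/8 * exp (- (1/4) * s)" if s: "s \<ge> 0" for s
  proof -
    have "sqrt (S s) \<le> sqrt (S 0 * exp (- (1/2) * s))" by (intro real_sqrt_le_mono first s)
    also have "\<dots> = sqrt (S 0) * exp (- (1/4) * s)"
    proof -
      have "exp (- (1/2) * s) = (exp (- (1/4) * s))\<^sup>2" by (simp add: exp_double[symmetric])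
      then show ?thesis by (simp add: real_sqrt_mult)
    qed
    finally have "trilinear_const * sqrt (S s) \<le> (trilinear_const * sqrt (S 0)) * exp (- (1/4) * s)"
      using trilinear_const_nonneg by (simp add: mult_left_mono mult.assoc)
    also have "\<dots> \<le> 1/8 * exp (- (1/4) * s)" using small[of 0] by (intro mult_right_mono) auto
    finally show ?thesis .
  qed
  have "S t \<le> S 0 * exp ((- (3/4) * t - exp (- (1/4) * t)) - (- (3/4) * 0 - exp (- (1/4) * 0)))"
  proof (rule gronwall[where k = "\<lambda>s. - (3/4) + 1/4 * exp (- (1/4) * s)", OF t der])
    fix s assume s: "s \<in> {0..t}"
    have "(- (3/8) + trilinear_const * sqrt (S s)) * S s \<le> (- (3/8) + 1/8 * exp (- (1/4) * s)) * S s"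
      using small2[of s] s by (intro mult_right_mono S0) auto
    then have "S' s \<le> 2 * ((- (3/8) + 1/8 * exp (- (1/4) * s)) * S s)" using S'[of s] by linarith
    also have "\<dots> = (- (3/4) + 1/4 * exp (- (1/4) * s)) * S s" by (simp add: algebra_simps)
    finally show "S' s \<le> (- (3/4) + 1/4 * exp (- (1/4) * s)) * S s" .
    show "((\<lambda>s. - (3/4) * s - exp (- (1/4) * s)) has_real_derivative - (3/4) + 1/4 * exp (- (1/4) * s)) (at s within {0..t})"
      by (auto intro!: derivative_eq_intros)
  qed
  also have "\<dots> \<le> S 0 * exp (1 + - (3/4) * t)"
    by (intro mult_left_mono S0) simp
  also have "\<dots> = exp 1 * exp (- (3/4) * t) * S 0" unfolding exp_add by (simp only: mult_ac)
  finally show ?thesis by (simp add: S_def)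
qed

text \<open>The exponent is 6 because 2 + 1/8 is at most 3, and the energy is a sum of squares. What
  matters is that it depends neither on \<open>N\<close> nor on the weight.\<close>

lemma galerkin_flow_tail:
  assumes x: "galerkin_flow N x" and t: "t \<ge> 0" and w: "admissible_weight w" "\<And>q. 0 \<le> w q"
  shows "(\<Sum>p\<in>{1..N}. w (int p) * (x t p)\<^sup>2) \<le> exp (6 * t) * (\<Sum>p\<in>{1..N}. w (int p) * (x 0 p)\<^sup>2)"
proof -
  define E where "E = (\<lambda>t. \<Sum>p\<in>{1..N}. w (int p) * (x t p)\<^sup>2)"
  have E0: "E s \<ge> 0" for s unfolding E_def by (intro sum_nonneg mult_nonneg_nonneg w) simp
  have "E t \<le> E 0 * exp (6 * t - 6 * 0)"
  proof (rule gronwall[where k = "\<lambda>_. 6", OF t])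
    fix s assume s: "s \<in> {0..t}"
    show "(E has_real_derivative 2 * (\<Sum>p\<in>{1..N}. w (int p) * x s p * galerkin_field N (x s) p)) (at s within {0..t})"
      unfolding E_def by (rule galerkin_flow_energy_deriv[OF x s])
    have "trilinear_const * sqrt (\<Sum>p\<in>{1..N}. (x s p)\<^sup>2) \<le> 1/8" using x s by (simp add: galerkin_flow_def)
    then have "(2 + trilinear_const * sqrt (\<Sum>p\<in>{1..N}. (x s p)\<^sup>2)) * E s \<le> 3 * E s"
      by (intro mult_right_mono E0) simp
    moreover have "(\<Sum>p\<in>{1..N}. w (int p) * x s p * galerkin_field N (x s) p)
        \<le> (2 + trilinear_const * sqrt (\<Sum>p\<in>{1..N}. (x s p)\<^sup>2)) * E s"
      unfolding E_def by (rule galerkin_weighted_energy[OF _ _ w(1)]) (rule galerkin_flow_support[OF x], assumption?)+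
    ultimately show "2 * (\<Sum>p\<in>{1..N}. w (int p) * x s p * galerkin_field N (x s) p) \<le> 6 * E s" by linarith
    show "((\<lambda>s. 6 * s) has_real_derivative 6) (at s within {0..t})"
      by (auto intro!: derivative_eq_intros)
  qed
  then show ?thesis by (simp add: E_def mult_ac)
qed

text \<open>A speed limit for coordinate \<open>p\<close> inside the unit ball: the Lipschitz
  estimate towards the zero sequence, with \<open>(1 + 1) * 1 = 2\<close>, plus the value
  there.\<close>

definition mode_lip :: "nat \<Rightarrow> real" where
  "mode_lip p = proj_const p * (rhs_const * 2) + \<bar>mode_proj p (rhs (eta_of (\<lambda>_. 0)))\<bar>"

lemma mode_lip_nonneg: "0 \<le> mode_lip p"
  unfolding mode_lip_def by (intro add_nonneg_nonneg mult_nonneg_nonneg proj_const_nonneg rhs_const_nonneg) auto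

lemma mode_proj_rhs_lipschitz:
  assumes "a \<in> l2" "b \<in> l2"
  shows "\<bar>mode_proj p (rhs (eta_of a)) - mode_proj p (rhs (eta_of b))\<bar>
    \<le> proj_const p * (rhs_const * (1 + l2_norm a + l2_norm b) * l2_norm (\<lambda>p. a p - b p))"
proof -
  note r = rhs_eta_L2[OF assms(1)] rhs_eta_L2[OF assms(2)]
  show ?thesis
    unfolding mode_proj_diff[OF r, symmetric]
    using mode_proj_bound[OF L2_diff[OF r], of p] mult_left_mono[OF rhs_eta_lipschitz[OF assms] proj_const_nonneg[of p]]
    by linarith
qed

lemma zero_l2: "(\<lambda>_. 0) \<in> l2" "l2_norm (\<lambda>_. 0) = 0" by (simp_all add: l2_def l2_norm_def)

lemma mode_proj_rhs_bound:
  assumes "a \<in> l2" "l2_norm a \<le> 1"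
  shows "\<bar>mode_proj p (rhs (eta_of a))\<bar> \<le> mode_lip p"
proof -
  have "(1 + l2_norm a) * l2_norm a \<le> 2 * 1"
    using assms l2_norm_nonneg[OF assms(1)] by (intro mult_mono) auto
  then have "proj_const p * (rhs_const * ((1 + l2_norm a) * l2_norm a)) \<le> proj_const p * (rhs_const * 2)"
    by (intro mult_left_mono proj_const_nonneg rhs_const_nonneg) simp
  moreover have "\<bar>mode_proj p (rhs (eta_of a)) - mode_proj p (rhs (eta_of (\<lambda>_. 0)))\<bar> \<le> proj_const p * (rhs_const * ((1 + l2_norm a) * l2_norm a))"
    using mode_proj_rhs_lipschitz[OF assms(1) zero_l2(1), of p] by (simp add: zero_l2 mult.assoc)
  ultimately show ?thesis unfolding mode_lip_def by linarith
qed

lemma mode_proj_rhs_tendsto: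
  assumes x: "\<forall>\<^sub>F i in F. x i \<in> l2 \<and> l2_norm (x i) \<le> B" and y: "y \<in> l2"
    and lim: "((\<lambda>i. l2_norm (\<lambda>p. x i p - y p)) \<longlongrightarrow> 0) F"
  shows "((\<lambda>i. mode_proj p (rhs (eta_of (x i)))) \<longlongrightarrow> mode_proj p (rhs (eta_of y))) F"
proof (rule LIM_zero_cancel, rule Lim_null_comparison)
  show "((\<lambda>i. proj_const p * (rhs_const * (1 + B + l2_norm y) * l2_norm (\<lambda>p. x i p - y p))) \<longlongrightarrow> 0) F"
    by (intro tendsto_mult_right_zero lim)
  from x show "\<forall>\<^sub>F i in F. norm (mode_proj p (rhs (eta_of (x i))) - mode_proj p (rhs (eta_of y)))
      \<le> proj_const p * (rhs_const * (1 + B + l2_norm y) * l2_norm (\<lambda>p. x i p - y p))"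
  proof eventually_elim
    case (elim i)
    have "proj_const p * (rhs_const * (1 + l2_norm (x i) + l2_norm y) * l2_norm (\<lambda>p. x i p - y p))
       \<le> proj_const p * (rhs_const * (1 + B + l2_norm y) * l2_norm (\<lambda>p. x i p - y p))"
      using elim by (intro mult_left_mono mult_right_mono proj_const_nonneg rhs_const_nonneg l2_norm_nonneg l2_diff y) auto
    then show ?case using mode_proj_rhs_lipschitz[of "x i" y p] elim y by simp
  qed
qed

text \<open>A diagonal subsequence converges at the countably many pairs of a rational time and a
  mode. The Lipschitz bounds, uniform in \<open>n\<close>, carry convergence over to all
  times.\<close>

lemma lipschitz_subsequence:
  fixes X :: "nat \<Rightarrow> real \<Rightarrow> nat \<Rightarrow> real"
  assumes bd: "\<And>n t p. t \<ge> 0 \<Longrightarrow> \<bar>X n t p\<bar> \<le> B"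
    and lip: "\<And>n s t p. s \<ge> 0 \<Longrightarrow> t \<ge> 0 \<Longrightarrow> \<bar>X n t p - X n s p\<bar> \<le> L p * \<bar>t - s\<bar>"
    and L: "\<And>p. L p \<ge> 0"
  obtains r :: "nat \<Rightarrow> nat" where "strict_mono r" "\<And>t p. t \<ge> 0 \<Longrightarrow> convergent (\<lambda>n. X (r n) t p)"
proof -
  define S where "S = ((\<rat> \<inter> {0..}) \<times> UNIV :: (real \<times> nat) set)"
  have cS: "countable S" unfolding S_def by (intro countable_SIGMA countable_Int1 countable_rat) auto
  define g where "g = (\<lambda>n z. X n (fst z) (snd z))"
  have gB: "norm (g n z) \<le> B" if "z \<in> S" for z n
    using that bd by (auto simp: S_def g_def)
  obtain r :: "nat \<Rightarrow> nat" where r: "strict_mono r" and lim: "\<And>z. z \<in> S \<Longrightarrow> \<exists>l. (\<lambda>n. g (r n) z) \<longlonglongrightarrow> l"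
    by (rule function_convergent_subsequence[OF cS, of g B]) (erule gB, blast)
  have "convergent (\<lambda>n. X (r n) t p)" if t: "t \<ge> 0" for t p
  proof (rule Cauchy_convergent, rule CauchyI)
    fix e :: real assume e: "e > 0"
    \<comment> \<open>Chosen to the right of \<open>t\<close>, so that it is a nonnegative time;
      adding 1 to \<open>L p\<close> avoids a zero denominator.\<close>
    obtain q where q: "q \<in> \<rat>" "t < q" "q < t + e / (3 * (L p + 1))"
      using Rats_dense_in_real[of t "t + e / (3 * (L p + 1))"] e L[of p] by auto
    have q0: "q \<ge> 0" using q t by simp
    have "L p * \<bar>t - q\<bar> \<le> (L p + 1) * (e / (3 * (L p + 1)))"
      using q L[of p] by (intro mult_mono) auto
    also have "\<dots> = e / 3"
    proof -
      have "k * (e / (3 * k)) = e / 3" if "k > 0" for k using that by simp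
      moreover have "L p + 1 > 0" using L[of p] by simp
      ultimately show ?thesis by blast
    qed
    finally have close: "\<bar>X n t p - X n q p\<bar> \<le> e / 3" for n
      using lip[OF q0 t, of n p] by linarith
    have "convergent (\<lambda>n. X (r n) q p)" using lim[of "(q, p)"] q q0 by (simp add: S_def g_def convergent_def)
    then have "Cauchy (\<lambda>n. X (r n) q p)" by (rule convergent_Cauchy)
    moreover have "e / 3 > 0" using e by simp
    ultimately obtain M where M: "\<And>m n. m \<ge> M \<Longrightarrow> n \<ge> M \<Longrightarrow> norm (X (r m) q p - X (r n) q p) < e / 3"
      by (meson CauchyD)
    show "\<exists>M. \<forall>m\<ge>M. \<forall>n\<ge>M. norm (X (r m) t p - X (r n) t p) < e"
    proof (intro exI[of _ M] allI impI)
      fix m n assume "M \<le> m" "M \<le> n"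
      then have "norm (X (r m) q p - X (r n) q p) < e / 3" by (rule M)
      then show "norm (X (r m) t p - X (r n) t p) < e"
        using close[of "r m"] close[of "r n"] unfolding real_norm_def by linarith
    qed
  qed
  with r show ?thesis by (rule that)
qed

lemma galerkin_flow_l2:
  assumes "galerkin_flow N x"
  shows "x t \<in> l2" "l2_norm (x t) = sqrt (\<Sum>p\<in>{1..N}. (x t p)\<^sup>2)"
    "tail_energy M (x t) = (\<Sum>p\<in>{1..N}. cutoff_weight (real (Suc M)) (int p) * (x t p)\<^sup>2)"
proof -
  show "x t \<in> l2" by (rule l2_finite[where N = N]) (use galerkin_flow_support[OF assms] in auto)
  have z: "x t p = 0" if "p \<notin> {1..N}" for p using assms that by (simp add: galerkin_flow_def)
  have "(\<Sum>p. (x t p)\<^sup>2) = (\<Sum>p\<in>{1..N}. (x t p)\<^sup>2)" by (rule suminf_finite) (simp_all add: z)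
  then show "l2_norm (x t) = sqrt (\<Sum>p\<in>{1..N}. (x t p)\<^sup>2)" by (simp add: l2_norm_def)
  show "tail_energy M (x t) = (\<Sum>p\<in>{1..N}. cutoff_weight (real (Suc M)) (int p) * (x t p)\<^sup>2)"
    unfolding tail_energy_def by (rule suminf_finite) (simp_all add: z)
qed

lemma galerkin_flow_norm_le_1: "galerkin_flow N x \<Longrightarrow> t \<ge> 0 \<Longrightarrow> l2_norm (x t) \<le> 1"
  by (simp add: galerkin_flow_l2(2) galerkin_flow_def)

lemma galerkin_flow_deriv:
  assumes x: "galerkin_flow N x" and "t \<ge> 0" "p \<in> {1..N}"
  shows "((\<lambda>t. x t p) has_real_derivative mode_proj p (rhs (eta_of (x t)))) (at t within {0..})"
proof -
  have "mode_proj p (rhs (eta_of (x t))) = galerkin_field N (x t) p"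
    by (rule mode_proj_rhs_finite) (use galerkin_flow_support[OF x] assms(3) in auto)
  then show ?thesis using assms by (simp add: galerkin_flow_def)
qed

lemma galerkin_flow_lipschitz:
  assumes x: "galerkin_flow N x" and st: "s \<ge> 0" "t \<ge> 0"
  shows "\<bar>x t p - x s p\<bar> \<le> mode_lip p * \<bar>t - s\<bar>"
proof (cases "p \<in> {1..N}")
  case True
  have "norm (x t p - x s p) \<le> mode_lip p * norm (t - s)"
  proof (rule field_differentiable_bound[where S = "{0..}" and f = "\<lambda>t. x t p"])
    fix \<tau> :: real assume "\<tau> \<in> {0..}"
    then have \<tau>: "\<tau> \<ge> 0" by simp
    show "((\<lambda>t. x t p) has_field_derivative mode_proj p (rhs (eta_of (x \<tau>)))) (at \<tau> within {0..})"
      by (rule galerkin_flow_deriv[OF x \<tau> True])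
    show "norm (mode_proj p (rhs (eta_of (x \<tau>)))) \<le> mode_lip p"
      using mode_proj_rhs_bound[OF galerkin_flow_l2(1)[OF x] galerkin_flow_norm_le_1[OF x \<tau>]] by simp
  qed (use st in auto)
  then show ?thesis by simp
next
  case False
  then have "x t p = 0" "x s p = 0" using x by (auto simp: galerkin_flow_def)
  then show ?thesis using mult_nonneg_nonneg[OF mode_lip_nonneg[of p], of "\<bar>t - s\<bar>"] by simp
qed

text \<open>With \<open>\<epsilon> \<le> 1/2\<close> the clamp is inactive throughout the support of
  the cutoff. The factor \<open>sqrt 2\<close> covers energies up to 2 \<epsilon>^2 while the cutoff
  acts, and the last condition provides the margin required by \<open>galerkin_flow\<close>.\<close>

definition small_radius :: "real \<Rightarrow> bool" where
  "small_radius \<epsilon> \<longleftrightarrow> 0 < \<epsilon> \<and> \<epsilon> \<le> 1/2 \<and> trilinear_const * (sqrt 2 * \<epsilon>) \<le> 3/8 \<and> trilinear_const * \<epsilon> \<le> 1/8"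

lemma l2_partial_sum:
  assumes "a \<in> l2"
  shows "(\<Sum>p\<in>{1..N}. (a p)\<^sup>2) \<le> (l2_norm a)\<^sup>2"
  unfolding l2_norm_sq[OF assms] by (intro sum_le_suminf l2_summable assms) auto

lemma galerkin_flow_exists:
  assumes \<epsilon>: "small_radius \<epsilon>" and a: "a \<in> l2" "l2_norm a \<le> \<epsilon>"
  shows "\<exists>x. galerkin_flow N x \<and> (\<forall>p\<in>{1..N}. x 0 p = a p)"
proof -
  have e: "0 < \<epsilon>" "\<epsilon> \<le> 1/2" "trilinear_const * (sqrt 2 * \<epsilon>) \<le> 3/8" "trilinear_const * \<epsilon> \<le> 1/8"
    using \<epsilon> by (auto simp: small_radius_def)
  have le: "(\<Sum>p\<in>{1..N}. (a p)\<^sup>2) \<le> \<epsilon>\<^sup>2"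
    using l2_partial_sum[OF a(1), of N] power_mono[OF a(2) l2_norm_nonneg[OF a(1)], of 2] by linarith
  obtain x where x: "\<forall>t p. p \<notin> {1..N} \<longrightarrow> x t p = 0" "\<forall>p\<in>{1..N}. x 0 p = a p"
     "\<forall>t\<ge>0. \<forall>p\<in>{1..N}. ((\<lambda>t. x t p) has_real_derivative galerkin_field N (x t) p) (at t within {0..})"
     "\<forall>t\<ge>0. (\<Sum>p\<in>{1..N}. (x t p)\<^sup>2) \<le> (\<Sum>p\<in>{1..N}. (a p)\<^sup>2)"
    using galerkin_exists[OF e(1-3) le] by blast
  have "(\<Sum>p\<in>{1..N}. (x t p)\<^sup>2) \<le> 1 \<and> trilinear_const * sqrt (\<Sum>p\<in>{1..N}. (x t p)\<^sup>2) \<le> 1/8" if "t \<ge> 0" for t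
  proof
    have S: "(\<Sum>p\<in>{1..N}. (x t p)\<^sup>2) \<le> \<epsilon>\<^sup>2" using x(4)[rule_format, OF that] le by linarith
    have "\<epsilon>\<^sup>2 \<le> 1" using e by (simp add: power_le_one)
    with S show "(\<Sum>p\<in>{1..N}. (x t p)\<^sup>2) \<le> 1" by linarith
    have "sqrt (\<Sum>p\<in>{1..N}. (x t p)\<^sup>2) \<le> \<epsilon>" using real_sqrt_le_mono[OF S] e by simp
    then show "trilinear_const * sqrt (\<Sum>p\<in>{1..N}. (x t p)\<^sup>2) \<le> 1/8"
      using mult_left_mono[OF _ trilinear_const_nonneg, of "sqrt (\<Sum>p\<in>{1..N}. (x t p)\<^sup>2)" \<epsilon>] e(4) by linarith
  qed
  with x(1-3) have "galerkin_flow N x" unfolding galerkin_flow_def by simp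
  with x(2) show ?thesis by (intro exI[of _ x] conjI)
qed

lemma galerkin_flow_bounds:
  assumes x: "galerkin_flow N x" "\<And>p. p \<in> {1..N} \<Longrightarrow> x 0 p = a p" and a: "a \<in> l2" and t: "t \<ge> 0"
  shows "l2_norm (x t) \<le> exp (1/2) * exp (- 3 / 8 * t) * l2_norm a"
    "tail_energy M (x t) \<le> exp (6 * t) * tail_energy M a"
proof -
  have "(l2_norm (x t))\<^sup>2 = (\<Sum>p\<in>{1..N}. (x t p)\<^sup>2)" by (simp add: galerkin_flow_l2(2)[OF x(1)] sum_nonneg)
  also have "\<dots> \<le> exp 1 * exp (- (3/4) * t) * (\<Sum>p\<in>{1..N}. (x 0 p)\<^sup>2)" by (rule galerkin_flow_decay[OF x(1) t])
  also have "(\<Sum>p\<in>{1..N}. (x 0 p)\<^sup>2) = (\<Sum>p\<in>{1..N}. (a p)\<^sup>2)" using x(2) by simp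
  also have "exp 1 * exp (- (3/4) * t) * \<dots> \<le> exp 1 * exp (- (3/4) * t) * (l2_norm a)\<^sup>2"
    by (intro mult_left_mono l2_partial_sum a) simp
  also have "\<dots> = (exp (1/2) * exp (- 3 / 8 * t) * l2_norm a)\<^sup>2"
    by (simp add: power_mult_distrib exp_double[symmetric])
  finally show "l2_norm (x t) \<le> exp (1/2) * exp (- 3 / 8 * t) * l2_norm a"
    by (rule power2_le_imp_le) (simp add: l2_norm_nonneg a)
  have "tail_energy M (x t) \<le> exp (6 * t) * (\<Sum>p\<in>{1..N}. cutoff_weight (real (Suc M)) (int p) * (x 0 p)\<^sup>2)"
    unfolding galerkin_flow_l2(3)[OF x(1)]
    by (rule galerkin_flow_tail[OF x(1) t admissible_cutoff_weight cutoff_weight_nonneg]) simp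
  also have "(\<Sum>p\<in>{1..N}. cutoff_weight (real (Suc M)) (int p) * (x 0 p)\<^sup>2) = (\<Sum>p\<in>{1..N}. cutoff_weight (real (Suc M)) (int p) * (a p)\<^sup>2)"
    using x(2) by simp
  also have "exp (6 * t) * \<dots> \<le> exp (6 * t) * tail_energy M a"
    by (intro mult_left_mono tail_energy_partial a) simp
  finally show "tail_energy M (x t) \<le> exp (6 * t) * tail_energy M a" .
qed

text \<open>The norm and tail bounds survive the coordinatewise limit because they are bounds on
  finite partial sums. The tail bound makes the convergence strong at each fixed time, and this is
  what allows the limit in the quadratic term.\<close>

lemma galerkin_limit:
  assumes \<epsilon>: "small_radius \<epsilon>" and a: "a \<in> l2" "l2_norm a \<le> \<epsilon>"
  obtains A where "A 0 = a" "\<And>t. t \<ge> 0 \<Longrightarrow> A t \<in> l2"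
    "\<And>t. t \<ge> 0 \<Longrightarrow> l2_norm (A t) \<le> exp (1/2) * exp (- 3 / 8 * t) * l2_norm a"
    "\<And>t M. t \<ge> 0 \<Longrightarrow> tail_energy M (A t) \<le> exp (6 * t) * tail_energy M a"
    "\<And>t. t \<ge> 0 \<Longrightarrow> ((\<lambda>s. l2_norm (\<lambda>p. A s p - A t p)) \<longlongrightarrow> 0) (at t within {0..})"
    "\<And>t p. t \<ge> 0 \<Longrightarrow> ((\<lambda>t. A t p) has_real_derivative mode_proj p (rhs (eta_of (A t)))) (at t within {0..})"
proof -
  have "\<forall>N. \<exists>x. galerkin_flow N x \<and> (\<forall>p\<in>{1..N}. x 0 p = a p)"
    using galerkin_flow_exists[OF \<epsilon> a] by blast
  then obtain X where X: "\<And>N. galerkin_flow N (X N)" "\<And>N p. p \<in> {1..N} \<Longrightarrow> X N 0 p = a p"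
    unfolding choice_iff by blast
  have Xl: "X N t \<in> l2" for N t by (rule galerkin_flow_l2[OF X(1)])
  have X1: "l2_norm (X N t) \<le> 1" if "t \<ge> 0" for N t by (rule galerkin_flow_norm_le_1[OF X(1) that])
  note Xb = galerkin_flow_bounds[OF X a(1)]
  have Xlip: "\<bar>X N t p - X N s p\<bar> \<le> mode_lip p * \<bar>t - s\<bar>" if "s \<ge> 0" "t \<ge> 0" for N s t p
    by (rule galerkin_flow_lipschitz[OF X(1) that])
  have comp: "\<bar>x p\<bar> \<le> l2_norm x" if "x \<in> l2" for x p
  proof (rule abs_le_square_iff[THEN iffD2, of "x p" "l2_norm x", unfolded abs_of_nonneg[OF l2_norm_nonneg[OF that]]])
    have "(\<Sum>p\<in>{p}. (x p)\<^sup>2) \<le> (\<Sum>p. (x p)\<^sup>2)" by (intro sum_le_suminf l2_summable that) auto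
    then show "(x p)\<^sup>2 \<le> (l2_norm x)\<^sup>2" by (simp add: l2_norm_sq[OF that])
  qed
  have Xp: "\<bar>X N t p\<bar> \<le> 1" if "t \<ge> 0" for N t p
    using comp[OF Xl, of N t p] X1[OF that, of N] by linarith
  obtain r where r: "strict_mono r" and conv: "\<And>t p. t \<ge> 0 \<Longrightarrow> convergent (\<lambda>n. X (r n) t p)"
  proof (rule lipschitz_subsequence[where X = X and B = 1 and L = mode_lip, OF Xp Xlip mode_lip_nonneg])
    fix r :: "nat \<Rightarrow> nat"
    assume "strict_mono r" "\<And>t p. t \<ge> 0 \<Longrightarrow> convergent (\<lambda>n. X (r n) t p)"
    then show thesis by (rule that)
  qed
  define A where "A = (\<lambda>t p. lim (\<lambda>n. X (r n) t p))"
  have lim: "(\<lambda>n. X (r n) t p) \<longlonglongrightarrow> A t p" if "t \<ge> 0" for t p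
    using conv[OF that] by (simp add: A_def convergent_LIMSEQ_iff)
  have rp: "r n \<ge> n" for n by (rule seq_suble[OF r])
  have A00: "A t 0 = 0" if "t \<ge> 0" for t
    using lim[OF that, of 0] by (simp add: galerkin_flow_support[OF X(1)] LIMSEQ_const_iff)
  have A0: "A 0 = a"
  proof
    fix p
    show "A 0 p = a p"
    proof (cases "p = 0")
      case False
      have "\<forall>\<^sub>F n in sequentially. X (r n) 0 p = a p"
        using eventually_ge_at_top[of p]
      proof eventually_elim
        case (elim n)
        then have "p \<in> {1..r n}" using False rp[of n] by simp
        then show ?case by (rule X(2))
      qed
      then have "(\<lambda>n. X (r n) 0 p) \<longlonglongrightarrow> a p" by (rule tendsto_eventually)
      then show ?thesis using lim[of 0 p] LIMSEQ_unique by auto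
    qed (simp add: A00 l2_zero[OF a(1)])
  qed
  have Asum: "(\<Sum>p<n. (A t p)\<^sup>2) \<le> (exp (1/2) * exp (- 3 / 8 * t) * l2_norm a)\<^sup>2" if "t \<ge> 0" for t n
  proof (rule LIMSEQ_le_const2)
    show "(\<lambda>k. \<Sum>p<n. (X (r k) t p)\<^sup>2) \<longlonglongrightarrow> (\<Sum>p<n. (A t p)\<^sup>2)" by (intro tendsto_intros lim that)
    have "(\<Sum>p<n. (X (r k) t p)\<^sup>2) \<le> (exp (1/2) * exp (- 3 / 8 * t) * l2_norm a)\<^sup>2" for k
    proof -
      have "(\<Sum>p<n. (X (r k) t p)\<^sup>2) \<le> (l2_norm (X (r k) t))\<^sup>2"
        unfolding l2_norm_sq[OF Xl] by (intro sum_le_suminf l2_summable Xl) auto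
      also have "\<dots> \<le> (exp (1/2) * exp (- 3 / 8 * t) * l2_norm a)\<^sup>2" by (intro power_mono Xb(1) that l2_norm_nonneg Xl)
      finally show ?thesis .
    qed
    then show "\<exists>N. \<forall>k\<ge>N. (\<Sum>p<n. (X (r k) t p)\<^sup>2) \<le> (exp (1/2) * exp (- 3 / 8 * t) * l2_norm a)\<^sup>2" by blast
  qed
  have Al: "A t \<in> l2" if "t \<ge> 0" for t
  proof -
    have "summable (\<lambda>p. (A t p)\<^sup>2)"
      by (rule summableI_nonneg_bounded[OF _ Asum[OF that]]) simp
    then show ?thesis by (simp add: l2_def A00 that)
  qed
  have Ab: "l2_norm (A t) \<le> exp (1/2) * exp (- 3 / 8 * t) * l2_norm a" if "t \<ge> 0" for t
  proof (rule power2_le_imp_le)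
    show "(l2_norm (A t))\<^sup>2 \<le> (exp (1/2) * exp (- 3 / 8 * t) * l2_norm a)\<^sup>2"
      unfolding l2_norm_sq[OF Al[OF that]] by (rule suminf_le_const[OF l2_summable[OF Al[OF that]] Asum[OF that]])
  qed (simp add: l2_norm_nonneg a)
  have At: "tail_energy M (A t) \<le> exp (6 * t) * tail_energy M a" if t: "t \<ge> 0" for t M
  proof (rule tail_energy_leI[OF Al[OF t]])
    fix K
    show "(\<Sum>p\<in>{1..K}. cutoff_weight (real (Suc M)) (int p) * (A t p)\<^sup>2) \<le> exp (6 * t) * tail_energy M a"
    proof (rule LIMSEQ_le_const2)
      show "(\<lambda>k. \<Sum>p\<in>{1..K}. cutoff_weight (real (Suc M)) (int p) * (X (r k) t p)\<^sup>2)
          \<longlonglongrightarrow> (\<Sum>p\<in>{1..K}. cutoff_weight (real (Suc M)) (int p) * (A t p)\<^sup>2)"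
        by (intro tendsto_intros lim t)
      show "\<exists>N. \<forall>k\<ge>N. (\<Sum>p\<in>{1..K}. cutoff_weight (real (Suc M)) (int p) * (X (r k) t p)\<^sup>2) \<le> exp (6 * t) * tail_energy M a"
        using order_trans[OF tail_energy_partial[OF Xl] Xb(2)[OF _ t]] by (intro exI[of _ 0] allI impI)
    qed
  qed
  have A1: "l2_norm (A t) \<le> exp (1/2) * 1 * l2_norm a" if t: "t \<ge> 0" for t
    by (rule order_trans[OF Ab[OF t]], intro mult_right_mono mult_left_mono l2_norm_nonneg a) (use t in auto)
  have Xlim: "(\<lambda>n. mode_proj p (rhs (eta_of (X (r n) t)))) \<longlonglongrightarrow> mode_proj p (rhs (eta_of (A t)))" if t: "t \<ge> 0" for t p
  proof (rule mode_proj_rhs_tendsto[where B = 1])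
    show "\<forall>\<^sub>F n in sequentially. X (r n) t \<in> l2 \<and> l2_norm (X (r n) t) \<le> 1" using Xl X1[OF t] by simp
    show "(\<lambda>n. l2_norm (\<lambda>p. X (r n) t p - A t p)) \<longlonglongrightarrow> 0"
      by (rule l2_tendsto[OF Al[OF t] At[OF t] a(1)]) (use Xl Xb(2)[OF _ t] lim[OF t] in auto)
  qed (rule Al[OF t])
  have Alip: "\<bar>A t p - A s p\<bar> \<le> mode_lip p * \<bar>t - s\<bar>" if st: "s \<ge> 0" "t \<ge> 0" for s t p
  proof (rule LIMSEQ_le_const2)
    show "(\<lambda>n. \<bar>X (r n) t p - X (r n) s p\<bar>) \<longlonglongrightarrow> \<bar>A t p - A s p\<bar>" by (intro tendsto_intros lim st)
  qed (use Xlip[OF st] in blast)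
  have Acont: "((\<lambda>s. l2_norm (\<lambda>p. A s p - A t p)) \<longlongrightarrow> 0) (at t within {0..})" if t: "t \<ge> 0" for t
  \<comment> \<open>For times below \<open>t + 1\<close> this constant bounds all tails at once,
    which is enough near \<open>t\<close>.\<close>
  proof (rule l2_tendsto[OF Al[OF t] _ a(1), where C = "exp (6 * (t + 1))"])
    have mono: "exp (6 * s) * tail_energy M a \<le> exp (6 * (t + 1)) * tail_energy M a" if "s \<le> t + 1" for s M
      by (intro mult_right_mono tail_energy_nonneg a) (use that in simp)
    show "tail_energy M (A t) \<le> exp (6 * (t + 1)) * tail_energy M a" for M
      using At[OF t, of M] mono[of t M] by linarith
    have "\<forall>\<^sub>F s in at t within {0..}. s \<in> {0..}" by (simp add: eventually_at_filter)
    moreover have "\<forall>\<^sub>F s in at t within {0..}. s < t + 1"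
      by (rule order_tendstoD[OF tendsto_ident_at]) simp
    ultimately show "\<forall>\<^sub>F s in at t within {0..}. A s \<in> l2 \<and> (\<forall>M. tail_energy M (A s) \<le> exp (6 * (t + 1)) * tail_energy M a)"
    proof eventually_elim
      case (elim s)
      then show ?case using Al[of s] order_trans[OF At mono, of s] by auto
    qed
    show "((\<lambda>s. A s p) \<longlongrightarrow> A t p) (at t within {0..})" for p
    proof (rule LIM_zero_cancel, rule Lim_null_comparison)
      have "((\<lambda>s. mode_lip p * \<bar>s - t\<bar>) \<longlongrightarrow> mode_lip p * \<bar>t - t\<bar>) (at t within {0..})" by (intro tendsto_intros)
      then show "((\<lambda>s. mode_lip p * \<bar>s - t\<bar>) \<longlongrightarrow> 0) (at t within {0..})" by simp
      have "\<forall>\<^sub>F s in at t within {0..}. s \<in> {0..}" by (simp add: eventually_at_filter)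
      then show "\<forall>\<^sub>F s in at t within {0..}. norm (A s p - A t p) \<le> mode_lip p * \<bar>s - t\<bar>"
        by eventually_elim (use Alip[OF t] in simp)
    qed
  qed
  define G where "G = (\<lambda>p s. mode_proj p (rhs (eta_of (A s))))"
  have Gc: "continuous_on {0..} (G p)" for p
    unfolding continuous_on_def G_def
  proof
    fix t :: real assume "t \<in> {0..}"
    then have t: "t \<ge> 0" by simp
    have "\<forall>\<^sub>F s in at t within {0..}. s \<in> {0..}" by (simp add: eventually_at_filter)
    then have "\<forall>\<^sub>F s in at t within {0..}. A s \<in> l2 \<and> l2_norm (A s) \<le> exp (1/2) * 1 * l2_norm a"
      by eventually_elim (use Al A1 in simp)
    then show "((\<lambda>s. mode_proj p (rhs (eta_of (A s)))) \<longlongrightarrow> mode_proj p (rhs (eta_of (A t)))) (at t within {0..})"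
      by (rule mode_proj_rhs_tendsto[OF _ Al[OF t] Acont[OF t]])
  qed
  \<comment> \<open>The derivatives converge pointwise in time and are bounded, so the equation
    passes to the limit in integrated form; continuity of \<open>G p\<close> allows it to be
    differentiated again.\<close>
  have int_eq: "A t p = A 0 p + integral {0..t} (G p)" if t: "t \<ge> 0" for t p
  proof (cases "p = 0")
    case True
    then show ?thesis by (simp add: A00 t G_def)
  next
    case False
    \<comment> \<open>The shift by \<open>p\<close> ensures that coordinate \<open>p\<close> lies
      below the truncation for every \<open>n\<close>.\<close>
    define f where "f = (\<lambda>n s. mode_proj p (rhs (eta_of (X (r (n + p)) s))))"
    have hi: "(f n has_integral (X (r (n + p)) t p - X (r (n + p)) 0 p)) {0..t}" for n
    proof (rule fundamental_theorem_of_calculus[OF t])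
      fix s assume s: "s \<in> {0..t}"
      have "p \<in> {1..r (n + p)}" using False rp[of "n + p"] by simp
      then have "((\<lambda>s. X (r (n + p)) s p) has_real_derivative f n s) (at s within {0..})"
        unfolding f_def using s by (intro galerkin_flow_deriv[OF X(1)]) auto
      then have "((\<lambda>s. X (r (n + p)) s p) has_real_derivative f n s) (at s within {0..t})"
        by (rule has_field_derivative_subset) auto
      then show "((\<lambda>s. X (r (n + p)) s p) has_vector_derivative f n s) (at s within {0..t})"
        by (simp add: has_real_derivative_iff_has_vector_derivative)
    qed
    have "(\<lambda>n. integral {0..t} (f n)) \<longlonglongrightarrow> integral {0..t} (G p)"
    proof (rule dominated_convergence(2)[where h = "\<lambda>_. mode_lip p"])
      show "f n integrable_on {0..t}" for n using hi by (rule has_integral_integrable)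
      show "norm (f n s) \<le> mode_lip p" if "s \<in> {0..t}" for n s
        unfolding f_def using mode_proj_rhs_bound[OF Xl X1] that by simp
      show "(\<lambda>n. f n s) \<longlonglongrightarrow> G p s" if "s \<in> {0..t}" for s
        unfolding f_def G_def using LIMSEQ_ignore_initial_segment[OF Xlim[of s p], of p] that by simp
    qed (rule integrable_const_ivl)
    moreover have "(\<lambda>n. integral {0..t} (f n)) \<longlonglongrightarrow> A t p - A 0 p"
      unfolding integral_unique[OF hi]
      by (intro tendsto_diff LIMSEQ_ignore_initial_segment[of "\<lambda>n. X (r n) _ p"] lim t) simp
    ultimately show ?thesis using LIMSEQ_unique by fastforce
  qed
  have Ader: "((\<lambda>t. A t p) has_real_derivative mode_proj p (rhs (eta_of (A t)))) (at t within {0..})" if t: "t \<ge> 0" for t p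
  proof -
    have "((\<lambda>u. A 0 p + integral {0..u} (G p)) has_real_derivative 0 + G p t) (at t within {0..})"
      by (intro DERIV_add DERIV_const)
         (use indefinite_integral_deriv[OF Gc t] in \<open>simp add: has_real_derivative_iff_has_vector_derivative\<close>)
    then have "((\<lambda>u. A 0 p + integral {0..u} (G p)) has_real_derivative G p t) (at t within {0..})" by simp
    then have "((\<lambda>t. A t p) has_real_derivative G p t) (at t within {0..})"
      by (rule has_field_derivative_transform_within[where d = 1]) (simp, use t in simp, rule int_eq[symmetric], simp)
    then show ?thesis by (simp only: G_def)
  qed
  show thesis by (rule that[of A, OF A0 Al Ab At Acont Ader])
qed

lemma eta_solution_exists:
  assumes \<epsilon>: "small_radius \<epsilon>" and a: "a \<in> l2" "l2_norm a \<le> \<epsilon>"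
  shows "\<exists>A. global_solution (eta_of a) (\<lambda>t. eta_of (A t)) \<and> (\<forall>t\<ge>0. A t \<in> l2 \<and>
    l2_norm (A t) \<le> exp (1/2) * exp (- 3 / 8 * t) * l2_norm a \<and>
    (\<forall>M. tail_energy M (A t) \<le> exp (6 * t) * tail_energy M a))"
proof -
  obtain A where A: "A 0 = a" "\<And>t. t \<ge> 0 \<Longrightarrow> A t \<in> l2"
    "\<And>t. t \<ge> 0 \<Longrightarrow> l2_norm (A t) \<le> exp (1/2) * exp (- 3 / 8 * t) * l2_norm a"
    "\<And>t M. t \<ge> 0 \<Longrightarrow> tail_energy M (A t) \<le> exp (6 * t) * tail_energy M a"
    "\<And>t. t \<ge> 0 \<Longrightarrow> ((\<lambda>s. l2_norm (\<lambda>p. A s p - A t p)) \<longlongrightarrow> 0) (at t within {0..})"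
    "\<And>t p. t \<ge> 0 \<Longrightarrow> ((\<lambda>t. A t p) has_real_derivative mode_proj p (rhs (eta_of (A t)))) (at t within {0..})"
    by (rule galerkin_limit[OF assms]) blast
  have B: "l2_norm (A t) \<le> exp (1/2) * 1 * l2_norm a" if t: "t \<ge> 0" for t
    by (rule order_trans[OF A(3)[OF t]], intro mult_right_mono mult_left_mono l2_norm_nonneg a) (use t in auto)
  have "global_solution (eta_of a) (\<lambda>t. eta_of (A t))"
    unfolding solution_on_def
  proof (intro conjI ballI)
    fix t :: real assume "t \<in> {0..}"
    then have t: "t \<ge> 0" by simp
    show "eta_of (A t) \<in> HDW" by (rule eta_of_HDW(1)[OF A(2)[OF t]])
    have "((\<lambda>s. 2 * l2_norm (\<lambda>p. A s p - A t p)) \<longlongrightarrow> 0) (at t within {0..})"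
      by (intro tendsto_mult_right_zero A(5) t)
    moreover have "\<forall>\<^sub>F s in at t within {0..}. 2 * l2_norm (\<lambda>p. A s p - A t p) = HDW_norm (\<lambda>\<theta>. eta_of (A s) \<theta> - eta_of (A t) \<theta>)"
    proof -
      have "\<forall>\<^sub>F s in at t within {0..}. s \<in> {0..}" by (simp add: eventually_at_filter)
      then show ?thesis by eventually_elim (simp add: eta_of_dist A(2) t)
    qed
    ultimately show "((\<lambda>s. HDW_norm (\<lambda>\<theta>. eta_of (A s) \<theta> - eta_of (A t) \<theta>)) \<longlongrightarrow> 0) (at t within {0..})"
      by (rule Lim_transform_eventually)
    have "has_L2_time_deriv (\<lambda>t. eta_of (A t)) (rhs (eta_of (A t))) t {0..}"
      by (rule eta_L2_time_deriv[OF A(2) B A(5,6) t])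
    then show "\<exists>D. has_L2_time_deriv (\<lambda>t. eta_of (A t)) D t {0..} \<and> (AE \<theta> in lborel. D \<theta> + lin_op (eta_of (A t)) \<theta>
        = hilbert (eta_of (A t)) \<theta> * eta_of (A t) \<theta> - vel (eta_of (A t)) \<theta> * wderiv (eta_of (A t)) \<theta>)"
      by (intro exI[of _ "rhs (eta_of (A t))"] conjI) (simp_all add: rhs_def)
  qed (simp add: A(1))
  then show ?thesis by (intro exI[of _ A] conjI allI impI A)
qed

section \<open>Stability and decay\<close>

lemma small_radius_exists: "\<exists>\<epsilon>. small_radius \<epsilon>"
proof
  have k: "trilinear_const \<ge> 0" by (rule trilinear_const_nonneg)
  \<comment> \<open>Makes \<open>trilinear_const * \<epsilon>\<close> at most 1/8. Since
    \<open>sqrt 2\<close> is at most 2, the product with it is at most 1/4, below 3/8.\<close>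
  define \<epsilon> where "\<epsilon> = 1 / (8 * (trilinear_const + 1))"
  have e: "\<epsilon> > 0" "\<epsilon> \<le> 1/2" "trilinear_const * \<epsilon> \<le> 1/8"
    using k by (simp_all add: \<epsilon>_def divide_simps)
  have "sqrt 2 \<le> 2" by (rule real_le_lsqrt) auto
  then have "sqrt 2 * (trilinear_const * \<epsilon>) \<le> 2 * (1/8)"
    using e k by (intro mult_mono) auto
  then show "small_radius (1 / (8 * (trilinear_const + 1)))"
    using e unfolding small_radius_def \<epsilon>_def[symmetric] by (simp add: mult_ac)
qed

text \<open>Uniqueness identifies an arbitrary solution with the constructed one. So it stays in the
  even modes and inherits the decay and the tail bounds.\<close>

lemma solution_modes:
  assumes \<epsilon>: "small_radius \<epsilon>" and a: "a \<in> l2" "l2_norm a \<le> \<epsilon>"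
    and \<eta>: "solution_on {0..T} (eta_of a) \<eta>" and t: "t \<in> {0..T}"
  obtains b where "b \<in> l2" "\<eta> t = eta_of b" "l2_norm b \<le> exp (1/2) * exp (- 3 / 8 * t) * l2_norm a"
    "\<forall>M. tail_energy M b \<le> exp (6 * t) * tail_energy M a"
proof -
  obtain A where A: "global_solution (eta_of a) (\<lambda>t. eta_of (A t))"
    "\<forall>t\<ge>0. A t \<in> l2 \<and> l2_norm (A t) \<le> exp (1/2) * exp (- 3 / 8 * t) * l2_norm a \<and>
      (\<forall>M. tail_energy M (A t) \<le> exp (6 * t) * tail_energy M a)"
    using eta_solution_exists[OF \<epsilon> a] by (elim exE conjE) (rule that)
  have t0: "t \<ge> 0" using t by simp
  note At = A(2)[rule_format, OF t0]
  have "solution_on {0..T} (eta_of a) (\<lambda>t. eta_of (A t))" by (rule solution_on_subset[OF A(1)]) auto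
  then have eq: "\<eta> t = eta_of (A t)" by (rule solution_unique[OF \<eta> _ t])
  show thesis using At eq by (intro that[of "A t"]) simp_all
qed

lemma small_data_modes:
  assumes "\<eta>0 \<in> even_mode_data" "HDW_norm \<eta>0 \<le> 2 * \<epsilon>"
  obtains a where "a \<in> l2" "\<eta>0 = eta_of a" "l2_norm a \<le> \<epsilon>"
proof -
  obtain a where a: "a \<in> l2" "\<eta>0 = eta_of a" using even_mode_data_eta_of[OF assms(1)] by blast
  then show thesis using eta_of_HDW(2)[OF a(1)] assms(2) by (intro that[of a]) simp_all
qed

text \<open>Allows one \<open>M\<close>, chosen for \<open>a\<close>, to control the tails of all
  data close to \<open>a\<close>.\<close>

lemma tail_energy_perturb:
  assumes "a \<in> l2" "c \<in> l2"
  shows "tail_energy M c \<le> 2 * tail_energy M a + 2 * (l2_norm (\<lambda>p. c p - a p))\<^sup>2"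
proof (rule tail_energy_leI[OF assms(2)])
  fix K
  define w where "w = (\<lambda>p. cutoff_weight (real (Suc M)) (int p))"
  have w: "0 \<le> w p" "w p \<le> 1" for p
    using cutoff_weight_nonneg[of M "int p"] by (auto simp: w_def cutoff_weight_def)
  have "(\<Sum>p\<in>{1..K}. w p * (c p)\<^sup>2) \<le> (\<Sum>p\<in>{1..K}. 2 * (w p * (a p)\<^sup>2) + 2 * (c p - a p)\<^sup>2)"
  proof (rule sum_mono)
    fix p
    have "2 * (a p)\<^sup>2 + 2 * (c p - a p)\<^sup>2 - (c p)\<^sup>2 = (c p - 2 * a p)\<^sup>2"
      by (simp add: power2_eq_square algebra_simps)
    then have "(c p)\<^sup>2 \<le> 2 * (a p)\<^sup>2 + 2 * (c p - a p)\<^sup>2" using zero_le_power2[of "c p - 2 * a p"] by linarith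
    then have "w p * (c p)\<^sup>2 \<le> w p * (2 * (a p)\<^sup>2 + 2 * (c p - a p)\<^sup>2)" by (rule mult_left_mono[OF _ w(1)])
    also have "\<dots> = 2 * (w p * (a p)\<^sup>2) + w p * (2 * (c p - a p)\<^sup>2)" by (simp add: distrib_left)
    also have "w p * (2 * (c p - a p)\<^sup>2) \<le> 1 * (2 * (c p - a p)\<^sup>2)" by (intro mult_right_mono w) simp
    finally show "w p * (c p)\<^sup>2 \<le> 2 * (w p * (a p)\<^sup>2) + 2 * (c p - a p)\<^sup>2" by simp
  qed
  also have "\<dots> = 2 * (\<Sum>p\<in>{1..K}. w p * (a p)\<^sup>2) + 2 * (\<Sum>p\<in>{1..K}. (c p - a p)\<^sup>2)"
    by (simp add: sum.distrib sum_distrib_left)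
  also have "\<dots> \<le> 2 * tail_energy M a + 2 * (l2_norm (\<lambda>p. c p - a p))\<^sup>2"
    using tail_energy_partial[OF assms(1), of M K] l2_partial_sum[OF l2_diff[OF assms(2,1)], of K] unfolding w_def by linarith
  finally show "(\<Sum>p\<in>{1..K}. cutoff_weight (real (Suc M)) (int p) * (c p)\<^sup>2)
     \<le> 2 * tail_energy M a + 2 * (l2_norm (\<lambda>p. c p - a p))\<^sup>2" unfolding w_def .
qed

definition stab_const :: "real \<Rightarrow> real \<Rightarrow> real" where
  "stab_const B T = exp (2 * ((3 + 2 * embed_const + 2 * embed_const * sqrt (2 * pi)) * (1 + 2 * (sqrt (4 * pi) * B))) * T)"

text \<open>Low modes are compared through L2 stability, high modes through their tails. The tail of
  \<open>a\<close> vanishes for large \<open>M\<close>, but the factor of \<open>d\<^sup>2\<close>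
  grows with \<open>M\<close>, so \<open>M\<close> has to be fixed before \<open>d\<close>.\<close>

lemma solution_dependence:
  assumes \<epsilon>: "small_radius \<epsilon>" and a: "a \<in> l2" "l2_norm a \<le> \<epsilon>" and c: "c \<in> l2" "l2_norm c \<le> \<epsilon>"
    and \<eta>: "solution_on {0..T} (eta_of a) \<eta>" and \<xi>: "solution_on {0..T} (eta_of c) \<xi>" and t: "t \<in> {0..T}"
    and d: "d = l2_norm (\<lambda>p. c p - a p)"
  shows "(HDW_norm (\<lambda>\<theta>. \<xi> t \<theta> - \<eta> t \<theta>))\<^sup>2 \<le> 32 * exp (6 * T) * tail_energy M a
    + 4 * ((\<Sum>p<Suc M. (proj_const p)\<^sup>2) * (stab_const (2 * exp (1/2) * \<epsilon>) T * (16 * pi)) + 8 * exp (6 * T)) * d\<^sup>2"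
proof -
  have \<epsilon>0: "\<epsilon> > 0" using \<epsilon> by (simp add: small_radius_def)
  have B: "HDW_norm (\<zeta> s) \<le> 2 * exp (1/2) * \<epsilon>"
    if b: "b \<in> l2" "l2_norm b \<le> \<epsilon>" and \<zeta>: "solution_on {0..T} (eta_of b) \<zeta>" and s: "s \<in> {0..T}" for b \<zeta> s
  proof -
    obtain x where x: "x \<in> l2" "\<zeta> s = eta_of x" "l2_norm x \<le> exp (1/2) * exp (- 3 / 8 * s) * l2_norm b"
      by (rule solution_modes[OF \<epsilon> b \<zeta> s])
    have "exp (1/2) * exp (- 3 / 8 * s) * l2_norm b \<le> exp (1/2) * 1 * \<epsilon>"
      using s b l2_norm_nonneg[OF b(1)] by (intro mult_mono) auto
    then have "l2_norm x \<le> exp (1/2) * 1 * \<epsilon>" by (rule order_trans[OF x(3)])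
    then show ?thesis using x(2) eta_of_HDW(2)[OF x(1)] by simp
  qed
  obtain x where x: "x \<in> l2" "\<eta> t = eta_of x" "l2_norm x \<le> exp (1/2) * exp (- 3 / 8 * t) * l2_norm a" "\<forall>M. tail_energy M x \<le> exp (6 * t) * tail_energy M a"
    by (rule solution_modes[OF \<epsilon> a \<eta> t])
  obtain y where y: "y \<in> l2" "\<xi> t = eta_of y" "l2_norm y \<le> exp (1/2) * exp (- 3 / 8 * t) * l2_norm c" "\<forall>M. tail_energy M y \<le> exp (6 * t) * tail_energy M c"
    by (rule solution_modes[OF \<epsilon> c \<xi> t])
  have expT: "exp (6 * t) \<le> exp (6 * T)" using t by simp
  define K where "K = stab_const (2 * exp (1/2) * \<epsilon>) T"
  define U where "U = L2_norm (\<lambda>\<theta>. eta_of y \<theta> - eta_of x \<theta>)"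
  have U: "U\<^sup>2 \<le> K * (16 * pi) * d\<^sup>2"
  proof -
    have "L2_norm (\<lambda>\<theta>. eta_of c \<theta> - eta_of a \<theta>) \<le> 2 * sqrt (4 * pi) * d"
      using odd_H1_poincare[OF eta_of_odd_H1[OF l2_diff[OF c(1) a(1)]]] eta_wderiv_norm[OF l2_diff[OF c(1) a(1)]]
      unfolding eta_of_diff[OF c(1) a(1), abs_def] d by linarith
    then have "(L2_norm (\<lambda>\<theta>. eta_of c \<theta> - eta_of a \<theta>))\<^sup>2 \<le> (2 * sqrt (4 * pi) * d)\<^sup>2"
      by (rule power_mono) simp
    also have "\<dots> = 16 * pi * d\<^sup>2" by (simp add: power_mult_distrib)
    finally have 1: "(L2_norm (\<lambda>\<theta>. eta_of c \<theta> - eta_of a \<theta>))\<^sup>2 \<le> 16 * pi * d\<^sup>2" .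
    define m where "m = 2 * ((3 + 2 * embed_const + 2 * embed_const * sqrt (2 * pi)) * (1 + 2 * (sqrt (4 * pi) * (2 * exp (1/2) * \<epsilon>))))"
    have m: "m \<ge> 0" unfolding m_def using \<epsilon>0 by (intro mult_nonneg_nonneg add_nonneg_nonneg) auto
    have "U\<^sup>2 \<le> (L2_norm (\<lambda>\<theta>. eta_of c \<theta> - eta_of a \<theta>))\<^sup>2 * exp (m * t)"
      using L2_stability[OF \<xi> \<eta> t B[OF c \<xi>] B[OF a \<eta>]] unfolding U_def x(2) y(2) m_def .
    also have "\<dots> \<le> (16 * pi * d\<^sup>2) * exp (m * T)"
      using t m 1 by (intro mult_mono) (auto intro!: mult_left_mono)
    also have "\<dots> = K * (16 * pi) * d\<^sup>2" unfolding K_def stab_const_def m_def by (simp only: mult_ac)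
    finally show ?thesis .
  qed
  have comp: "(y p - x p)\<^sup>2 \<le> (proj_const p)\<^sup>2 * (K * (16 * pi) * d\<^sup>2)" for p
  proof -
    have "\<bar>y p - x p\<bar> \<le> proj_const p * U"
      using mode_proj_bound[OF L2_diff[OF eta_of_L2[OF y(1)] eta_of_L2[OF x(1)]], of p]
      unfolding mode_proj_diff[OF eta_of_L2[OF y(1)] eta_of_L2[OF x(1)]] mode_proj_eta[OF y(1)] mode_proj_eta[OF x(1)] U_def .
    then have "\<bar>y p - x p\<bar>\<^sup>2 \<le> (proj_const p * U)\<^sup>2" by (rule power_mono) simp
    also have "\<dots> = (proj_const p)\<^sup>2 * U\<^sup>2" by (rule power_mult_distrib)
    also have "\<dots> \<le> (proj_const p)\<^sup>2 * (K * (16 * pi) * d\<^sup>2)" by (intro mult_left_mono U) simp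
    finally show ?thesis by simp
  qed
  define V where "V = exp (6 * T) * (2 * tail_energy M a + 2 * d\<^sup>2)"
  have ta: "0 \<le> tail_energy M a" by (rule tail_energy_nonneg[OF a(1)])
  have "exp (6 * t) * tail_energy M a \<le> V"
    unfolding V_def using ta by (intro mult_mono expT) auto
  then have tx: "tail_energy M x \<le> V" using x(4)[rule_format, of M] by linarith
  have "exp (6 * t) * tail_energy M c \<le> V"
    unfolding V_def d using tail_energy_perturb[OF a(1) c(1)] tail_energy_nonneg[OF c(1)] by (intro mult_mono expT) auto
  then have ty: "tail_energy M y \<le> V" using y(4)[rule_format, of M] by linarith
  have "(l2_norm (\<lambda>p. y p - x p))\<^sup>2 \<le> (\<Sum>p<Suc M. (y p - x p)\<^sup>2) + 4 * V"
    by (rule l2_dist_tail[OF y(1) x(1) ty tx])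
  also have "(\<Sum>p<Suc M. (y p - x p)\<^sup>2) \<le> (\<Sum>p<Suc M. (proj_const p)\<^sup>2) * (K * (16 * pi) * d\<^sup>2)"
    unfolding sum_distrib_right by (intro sum_mono comp)
  finally have "(l2_norm (\<lambda>p. y p - x p))\<^sup>2 \<le> (\<Sum>p<Suc M. (proj_const p)\<^sup>2) * (K * (16 * pi) * d\<^sup>2) + 4 * V" by simp
  moreover have "(HDW_norm (\<lambda>\<theta>. \<xi> t \<theta> - \<eta> t \<theta>))\<^sup>2 = 4 * (l2_norm (\<lambda>p. y p - x p))\<^sup>2"
    unfolding x(2) y(2) eta_of_dist[OF y(1) x(1)] by (simp add: power_mult_distrib)
  ultimately have "(HDW_norm (\<lambda>\<theta>. \<xi> t \<theta> - \<eta> t \<theta>))\<^sup>2 \<le> 4 * ((\<Sum>p<Suc M. (proj_const p)\<^sup>2) * (K * (16 * pi) * d\<^sup>2) + 4 * V)" by (simp only: mult_le_cancel_left_pos[OF zero_less_numeral])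
  also have "4 * (P * (K * (16 * pi) * d\<^sup>2) + 4 * V) = 32 * exp (6 * T) * tail_energy M a + 4 * (P * (K * (16 * pi)) + 8 * exp (6 * T)) * d\<^sup>2" for P
    unfolding V_def by (simp add: algebra_simps)
  finally show ?thesis unfolding K_def .
qed

lemma continuous_dependence:
  assumes \<epsilon>: "small_radius \<epsilon>" and a: "a \<in> l2" "l2_norm a \<le> \<epsilon>"
    and \<eta>: "global_solution (eta_of a) \<eta>" and \<delta>: "\<delta> > 0"
  shows "\<exists>r>0. \<forall>c \<xi>. c \<in> l2 \<and> l2_norm c \<le> \<epsilon> \<and> global_solution (eta_of c) \<xi> \<and> l2_norm (\<lambda>p. c p - a p) < r \<longrightarrow>
     (\<forall>t\<in>{0..T}. HDW_norm (\<lambda>\<theta>. \<xi> t \<theta> - \<eta> t \<theta>) < \<delta>)"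
proof -
  have "(\<lambda>M. 32 * exp (6 * T) * tail_energy M a) \<longlonglongrightarrow> 0"
    by (intro tendsto_mult_right_zero tail_energy_tendsto a)
  then have "\<forall>\<^sub>F M in sequentially. 32 * exp (6 * T) * tail_energy M a < \<delta>\<^sup>2 / 2"
    by (rule order_tendstoD) (use \<delta> in simp)
  then obtain M where M: "32 * exp (6 * T) * tail_energy M a < \<delta>\<^sup>2 / 2"
    using eventually_happens'[OF sequentially_bot] by blast
  define Z where "Z = 4 * ((\<Sum>p<Suc M. (proj_const p)\<^sup>2) * (stab_const (2 * exp (1/2) * \<epsilon>) T * (16 * pi)) + 8 * exp (6 * T))"
  have Z: "Z > 0" unfolding Z_def stab_const_def
    by (intro mult_pos_pos add_nonneg_pos mult_nonneg_nonneg sum_nonneg) auto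
  \<comment> \<open>Splits the square of \<delta> evenly: one half is reserved for the tail term,
    the other equals \<open>Z * r\<^sup>2\<close>.\<close>
  define r where "r = \<delta> / sqrt (2 * Z)"
  have r: "r > 0" "Z * r\<^sup>2 = \<delta>\<^sup>2 / 2" using Z \<delta> by (simp_all add: r_def power_divide)
  show ?thesis
  proof (intro exI[of _ r] conjI r(1) allI impI ballI)
    fix c \<xi> t
    assume c: "c \<in> l2 \<and> l2_norm c \<le> \<epsilon> \<and> global_solution (eta_of c) \<xi> \<and> l2_norm (\<lambda>p. c p - a p) < r" and t: "t \<in> {0..T}"
    define d where "d = l2_norm (\<lambda>p. c p - a p)"
    have c': "c \<in> l2" "l2_norm c \<le> \<epsilon>" "d < r" using c by (auto simp: d_def)
    have s: "solution_on {0..T} (eta_of a) \<eta>" "solution_on {0..T} (eta_of c) \<xi>"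
      using c \<eta> by (auto intro: solution_on_subset)
    have "d \<ge> 0" unfolding d_def by (intro l2_norm_nonneg l2_diff a c')
    then have "d\<^sup>2 \<le> r\<^sup>2" using c' by (intro power_mono) auto
    then have "Z * d\<^sup>2 \<le> \<delta>\<^sup>2 / 2" unfolding r(2)[symmetric] using Z by (intro mult_left_mono) auto
    moreover have "(HDW_norm (\<lambda>\<theta>. \<xi> t \<theta> - \<eta> t \<theta>))\<^sup>2 \<le> 32 * exp (6 * T) * tail_energy M a + Z * d\<^sup>2"
      unfolding Z_def by (rule solution_dependence[OF \<epsilon> a c'(1,2) s t d_def])
    ultimately have "(HDW_norm (\<lambda>\<theta>. \<xi> t \<theta> - \<eta> t \<theta>))\<^sup>2 < \<delta>\<^sup>2" using M by linarith
    then show "HDW_norm (\<lambda>\<theta>. \<xi> t \<theta> - \<eta> t \<theta>) < \<delta>" by (rule power2_less_imp_less) (use \<delta> in simp)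
  qed
qed

theorem theorem1p4:
  shows "\<exists>\<epsilon>>0. \<exists>C>0.
           globally_well_posed {\<eta>0 \<in> even_mode_data. HDW_norm \<eta>0 \<le> \<epsilon>} \<and>
           (\<forall>\<eta>0\<in>even_mode_data. HDW_norm \<eta>0 \<le> \<epsilon> \<longrightarrow>
              (\<forall>\<eta>. global_solution \<eta>0 \<eta> \<longrightarrow>
                 (\<forall>t\<ge>0. HDW_norm (\<eta> t) \<le> C * exp (- 3 / 8 * t) * HDW_norm \<eta>0)))"
proof -
  obtain \<epsilon> where \<epsilon>: "small_radius \<epsilon>" using small_radius_exists by blast
  \<comment> \<open>The radius doubles because the norm of \<open>HDW\<close> is twice the l2 norm
    of the coordinates.\<close>
  have \<epsilon>0: "2 * \<epsilon> > 0" using \<epsilon> by (simp add: small_radius_def)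
  have wp: "globally_well_posed {\<eta>0 \<in> even_mode_data. HDW_norm \<eta>0 \<le> 2 * \<epsilon>}"
    unfolding globally_well_posed_def
  proof (intro conjI ballI allI impI)
    fix \<eta>0 assume "\<eta>0 \<in> {\<eta>0 \<in> even_mode_data. HDW_norm \<eta>0 \<le> 2 * \<epsilon>}"
    then have "\<eta>0 \<in> even_mode_data" "HDW_norm \<eta>0 \<le> 2 * \<epsilon>" by auto
    then obtain a where a: "a \<in> l2" "\<eta>0 = eta_of a" "l2_norm a \<le> \<epsilon>" by (rule small_data_modes)
    show "\<exists>\<eta>. global_solution \<eta>0 \<eta>"
      using eta_solution_exists[OF \<epsilon> a(1,3)] unfolding a(2) by blast
  next
    fix \<eta>0 T \<eta> \<eta>' t
    assume "solution_on {0..T} \<eta>0 \<eta> \<and> solution_on {0..T} \<eta>0 \<eta>'" and t: "t \<in> {0..T}"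
    then have "solution_on {0..T} \<eta>0 \<eta>" "solution_on {0..T} \<eta>0 \<eta>'" by auto
    then show "\<eta> t = \<eta>' t" using t by (rule solution_unique)
  next
    fix \<eta>0 \<eta> and T \<delta> :: real
    assume "\<eta>0 \<in> {\<eta>0 \<in> even_mode_data. HDW_norm \<eta>0 \<le> 2 * \<epsilon>}" and \<eta>: "global_solution \<eta>0 \<eta>" and \<delta>: "\<delta> > 0"
    then have "\<eta>0 \<in> even_mode_data" "HDW_norm \<eta>0 \<le> 2 * \<epsilon>" by auto
    then obtain a where a: "a \<in> l2" "\<eta>0 = eta_of a" "l2_norm a \<le> \<epsilon>" by (rule small_data_modes)
    obtain r where r: "r > 0" "\<forall>c \<xi>. c \<in> l2 \<and> l2_norm c \<le> \<epsilon> \<and> global_solution (eta_of c) \<xi> \<and> l2_norm (\<lambda>p. c p - a p) < r \<longrightarrow>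
       (\<forall>t\<in>{0..T}. HDW_norm (\<lambda>\<theta>. \<xi> t \<theta> - \<eta> t \<theta>) < \<delta>)"
      using continuous_dependence[OF \<epsilon> a(1,3) \<eta>[unfolded a(2)] \<delta>, of T] by (elim exE conjE) (rule that)
    show "\<exists>r>0. \<forall>\<xi>0\<in>{\<eta>0 \<in> even_mode_data. HDW_norm \<eta>0 \<le> 2 * \<epsilon>}. \<forall>\<xi>.
        global_solution \<xi>0 \<xi> \<and> HDW_norm (\<lambda>\<theta>. \<xi>0 \<theta> - \<eta>0 \<theta>) < r \<longrightarrow>
        (\<forall>t\<in>{0..T}. HDW_norm (\<lambda>\<theta>. \<xi> t \<theta> - \<eta> t \<theta>) < \<delta>)"
    proof (intro exI[of _ r] conjI r(1) ballI allI impI)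
      fix \<xi>0 \<xi> t
      assume "\<xi>0 \<in> {\<eta>0 \<in> even_mode_data. HDW_norm \<eta>0 \<le> 2 * \<epsilon>}"
        and \<xi>: "global_solution \<xi>0 \<xi> \<and> HDW_norm (\<lambda>\<theta>. \<xi>0 \<theta> - \<eta>0 \<theta>) < r" and t: "t \<in> {0..T}"
      then have "\<xi>0 \<in> even_mode_data" "HDW_norm \<xi>0 \<le> 2 * \<epsilon>" by auto
      then obtain c where c: "c \<in> l2" "\<xi>0 = eta_of c" "l2_norm c \<le> \<epsilon>" by (rule small_data_modes)
      have "2 * l2_norm (\<lambda>p. c p - a p) < r" using \<xi> unfolding a(2) c(2) eta_of_dist[OF c(1) a(1)] by simp
      moreover have "0 \<le> l2_norm (\<lambda>p. c p - a p)" by (intro l2_norm_nonneg l2_diff a c)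
      ultimately have "l2_norm (\<lambda>p. c p - a p) < r" by linarith
      then show "HDW_norm (\<lambda>\<theta>. \<xi> t \<theta> - \<eta> t \<theta>) < \<delta>"
        using c \<xi> t by (intro r(2)[rule_format, of c \<xi> t]) simp_all
    qed
  qed
  \<comment> \<open>The constant \<open>exp (1/2)\<close> is the square root of the factor that the
    second pass of Gronwall leaves on the squared norm; the normalisation factor 2 cancels.\<close>
  have decay: "HDW_norm (\<eta> t) \<le> exp (1/2) * exp (- 3 / 8 * t) * HDW_norm \<eta>0"
    if \<eta>0: "\<eta>0 \<in> even_mode_data" "HDW_norm \<eta>0 \<le> 2 * \<epsilon>" and \<eta>: "global_solution \<eta>0 \<eta>" and t: "t \<ge> 0" for \<eta>0 \<eta> t
  proof -
    obtain a where a: "a \<in> l2" "\<eta>0 = eta_of a" "l2_norm a \<le> \<epsilon>" by (rule small_data_modes[OF \<eta>0])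
    have s: "solution_on {0..t} (eta_of a) \<eta>" using \<eta> unfolding a(2) by (rule solution_on_subset) auto
    have tt: "t \<in> {0..t}" using t by simp
    obtain b where b: "b \<in> l2" "\<eta> t = eta_of b" "l2_norm b \<le> exp (1/2) * exp (- 3 / 8 * t) * l2_norm a"
      by (rule solution_modes[OF \<epsilon> a(1,3) s tt])
    show ?thesis using b(3) unfolding b(2) a(2) eta_of_HDW(2)[OF b(1)] eta_of_HDW(2)[OF a(1)] by simp
  qed
  show ?thesis
  proof (rule exI[of _ "2 * \<epsilon>"], intro conjI \<epsilon>0, rule exI[of _ "exp (1/2)"], intro conjI wp ballI impI allI)
    show "(0 :: real) < exp (1/2)" by simp
  qed (rule decay)
qed

end
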